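(* Let $b$ satisfy (b1)–(b4) and let $M>0$. Then there exists a sequence of fields $b^k\colon\Omega\times\mathbb R\to\mathbb R^N$ such that for every $k$: (c1) $b^k\in C_b(\Omega\times\mathbb R;\mathbb R^N)$ with $\|b^k\|_\infty\le\|b\|_\infty$; (c2) for every $t$, $x\mapsto b^k(x,t)$ is in $C^\infty(\Omega;\mathbb R^N)$ and $\int_\Omega|\operatorname{div}_xb^k_t|\,dx\le|\operatorname{div}_xb_t|(\Omega)+1/k$ for all $t\in[-M,M]$; (c3) the least upper bound $\sigma^k_M:=\bigvee_{t\in[-M,M]}|\operatorname{div}_xb^k_t|\mathcal L^N$ is a Radon measure with $\sigma^k_M(\Omega)\le\sigma(\Omega)+1/k$; (c4) for every $u\in BV(\Omega)\cap L^\infty(\Omega)$ with $\|u\|_\infty\le M$, $[b^k(\cdot,u),Du]_{1/2}\to[b(\cdot,u),Du]_{1/2}$ locally weakly* in the sense of measures in $\Omega$, i.e. $\langle[b^k(\cdot,u),Du]_{1/2},\varphi\rangle\to\langle[b(\cdot,u),Du]_{1/2},\varphi\rangle$ for every $\varphi\in C^1_c(\Omega)$.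
   Context: $\Omega\subseteq\mathbb R^N$ ($N\ge2$) open; $\mathcal{DM}^\infty(\Omega)$ = fields $A\in L^\infty(\Omega;\mathbb R^N)$ with distributional divergence a finite Radon measure. Assumptions on $b\colon\Omega\times\mathbb R\to\mathbb R^N$: (b1) Borel and bounded; (b2) for a.e. $x$, $t\mapsto b(x,t)$ continuous; (b3) $b_t:=b(\cdot,t)\in\mathcal{DM}^\infty(\Omega)$ for all $t$; (b4) $\sigma:=\bigvee_t|\operatorname{div}_xb_t|$ (least upper bound of measures: $\sigma(E)=\sup\sum_{t\in T}|\operatorname{div}_xb_t|(E_t)$ over countable $T$ and Borel partitions) is a finite Radon measure. $f(\cdot,t)=d\operatorname{div}_xb_t/d\sigma$, $B(x,t)=\int_0^tb(x,s)ds$, $F(x,t)=\int_0^tf(x,s)ds$. The standard external nonlinear pairing is the distribution $\langle[b(\cdot,u),Du]_{1/2},\varphi\rangle:=-\int_\Omega\tfrac12\big(F(x,u^+)+F(x,u^-)\big)\varphi\,d\sigma-\int_\Omega B(x,u(x))\cdot\nabla\varphi\,dx$, with $u^\pm$ the approximate upper/lower limits. For the smooth fields $b^k$ it is $\langle[b^k(\cdot,u),Du]_{1/2},\varphi\rangle:=-\int_\Omega\varphi(x)\int_0^{u(x)}\operatorname{div}_xb^k(x,t)\,dt\,dx-\int_\Omega\int_0^{u(x)}b^k(x,t)\cdot\nabla\varphi(x)\,dt\,dx$. *)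

theory Defs
  imports "HOL-Analysis.Analysis"
begin

(* Test functions C^1_c(Omega), extended by zero to the whole space *)
definition C1c_on :: "'a::euclidean_space set \<Rightarrow> ('a \<Rightarrow> 'b::euclidean_space) \<Rightarrow> bool" where
  "C1c_on \<Omega> \<phi> \<longleftrightarrow>
     (\<forall>x. \<phi> differentiable at x) \<and>
     (\<forall>v. continuous_on UNIV (\<lambda>x. frechet_derivative \<phi> (at x) v)) \<and>
     (\<exists>K. compact K \<and> K \<subseteq> \<Omega> \<and> (\<forall>x. x \<notin> K \<longrightarrow> \<phi> x = 0))"

definition grad :: "('a::euclidean_space \<Rightarrow> real) \<Rightarrow> 'a \<Rightarrow> 'a" where
  "grad \<phi> x = (\<Sum>i\<in>Basis. frechet_derivative \<phi> (at x) i *\<^sub>R i)"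

definition divergence :: "('a::euclidean_space \<Rightarrow> 'a) \<Rightarrow> 'a \<Rightarrow> real" where
  "divergence \<phi> x = (\<Sum>i\<in>Basis. frechet_derivative \<phi> (at x) i \<bullet> i)"

fun iter_pd :: "'a list \<Rightarrow> ('a::euclidean_space \<Rightarrow> 'b::real_normed_vector) \<Rightarrow> 'a \<Rightarrow> 'b" where
  "iter_pd [] f = f"
| "iter_pd (v # vs) f = (\<lambda>x. frechet_derivative (iter_pd vs f) (at x) v)"

definition smooth_on :: "'a::euclidean_space set \<Rightarrow> ('a \<Rightarrow> 'b::real_normed_vector) \<Rightarrow> bool" where
  "smooth_on \<Omega> f \<longleftrightarrow> (\<forall>vs. set vs \<subseteq> Basis \<longrightarrow> (\<forall>x\<in>\<Omega>. iter_pd vs f differentiable at x))"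

(* The distributional divergence of A on \<Omega> is the finite signed Radon measure mp - mn,
   given by its Jordan decomposition (mp, mn mutually singular finite Borel measures on \<Omega>),
   so that |div A| = mp + mn. *)
definition is_div_measure :: "'a::euclidean_space set \<Rightarrow> ('a \<Rightarrow> 'a) \<Rightarrow> 'a measure \<Rightarrow> 'a measure \<Rightarrow> bool" where
  "is_div_measure \<Omega> A mp mn \<longleftrightarrow>
     sets mp = sets (restrict_space borel \<Omega>) \<and> sets mn = sets (restrict_space borel \<Omega>) \<and>
     finite_measure mp \<and> finite_measure mn \<and>
     (\<exists>P \<in> sets (restrict_space borel \<Omega>). emeasure mn P = 0 \<and> emeasure mp (\<Omega> - P) = 0) \<and>
     (\<forall>\<phi>::'a \<Rightarrow> real. C1c_on \<Omega> \<phi> \<longrightarrow>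
        (LINT x:\<Omega>|lebesgue. A x \<bullet> grad \<phi> x) = - (integral\<^sup>L mp \<phi> - integral\<^sup>L mn \<phi>))"

definition DM_inf :: "'a::euclidean_space set \<Rightarrow> ('a \<Rightarrow> 'a) \<Rightarrow> 'a measure \<Rightarrow> 'a measure \<Rightarrow> bool" where
  "DM_inf \<Omega> A mp mn \<longleftrightarrow>
     A \<in> borel_measurable (lebesgue_on \<Omega>) \<and> (\<exists>C. AE x in lebesgue_on \<Omega>. norm (A x) \<le> C) \<and>
     is_div_measure \<Omega> A mp mn"

definition lub_meas :: "'a::euclidean_space set \<Rightarrow> (real \<Rightarrow> 'a set \<Rightarrow> ennreal) \<Rightarrow> real set \<Rightarrow> 'a set \<Rightarrow> ennreal" where
  "lub_meas \<Omega> \<nu> T E = (SUP (T', P) \<in> {(T', P). countable T' \<and> T' \<subseteq> T \<and>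
        (\<forall>t\<in>T'. P t \<in> sets (restrict_space borel \<Omega>)) \<and> disjoint_family_on P T' \<and>
        (\<Union>t\<in>T'. P t) = E}.
      (\<integral>\<^sup>+ t. \<nu> t (P t) \<partial>count_space T'))"

definition is_BV :: "'a::euclidean_space set \<Rightarrow> ('a \<Rightarrow> real) \<Rightarrow> bool" where
  "is_BV \<Omega> u \<longleftrightarrow> set_integrable lebesgue \<Omega> u \<and>
     (\<exists>C. \<forall>\<phi>::'a \<Rightarrow> 'a. C1c_on \<Omega> \<phi> \<and> (\<forall>x. norm (\<phi> x) \<le> 1) \<longrightarrow>
        (LINT x:\<Omega>|lebesgue. u x * divergence \<phi> x) \<le> C)"

definition density_zero :: "'a::euclidean_space set \<Rightarrow> 'a \<Rightarrow> bool" where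
  "density_zero S x \<longleftrightarrow>
     ((\<lambda>r. measure lebesgue (S \<inter> ball x r) / measure lebesgue (ball x r)) \<longlongrightarrow> 0) (at_right 0)"

definition ap_upper :: "'a::euclidean_space set \<Rightarrow> ('a \<Rightarrow> real) \<Rightarrow> 'a \<Rightarrow> real" where
  "ap_upper \<Omega> u x = Inf {t. density_zero {y\<in>\<Omega>. t < u y} x}"

definition ap_lower :: "'a::euclidean_space set \<Rightarrow> ('a \<Rightarrow> real) \<Rightarrow> 'a \<Rightarrow> real" where
  "ap_lower \<Omega> u x = Sup {t. density_zero {y\<in>\<Omega>. u y < t} x}"

definition prim_b :: "('a \<Rightarrow> real \<Rightarrow> 'a::euclidean_space) \<Rightarrow> 'a \<Rightarrow> real \<Rightarrow> 'a" where
  "prim_b b x t = interval_lebesgue_integral lborel (ereal 0) (ereal t) (\<lambda>s. b x s)"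

definition prim_f :: "('a \<Rightarrow> real \<Rightarrow> real) \<Rightarrow> 'a \<Rightarrow> real \<Rightarrow> real" where
  "prim_f f x t = interval_lebesgue_integral lborel (ereal 0) (ereal t) (\<lambda>s. f x s)"

definition pairing_half :: "'a::euclidean_space set \<Rightarrow> 'a measure \<Rightarrow> ('a \<Rightarrow> real \<Rightarrow> real) \<Rightarrow>
    ('a \<Rightarrow> real \<Rightarrow> 'a) \<Rightarrow> ('a \<Rightarrow> real) \<Rightarrow> ('a \<Rightarrow> real) \<Rightarrow> real" where
  "pairing_half \<Omega> \<sigma> f b u \<phi> =
     - (\<integral>x. (1/2) * (prim_f f x (ap_upper \<Omega> u x) + prim_f f x (ap_lower \<Omega> u x)) * \<phi> x \<partial>\<sigma>)
     - (LINT x:\<Omega>|lebesgue. prim_b b x (u x) \<bullet> grad \<phi> x)"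

definition pairing_smooth :: "'a::euclidean_space set \<Rightarrow> ('a \<Rightarrow> real \<Rightarrow> 'a) \<Rightarrow> ('a \<Rightarrow> real) \<Rightarrow> ('a \<Rightarrow> real) \<Rightarrow> real" where
  "pairing_smooth \<Omega> bk u \<phi> =
     - (LINT x:\<Omega>|lebesgue. \<phi> x * (LBINT t=0..u x. divergence (\<lambda>y. bk y t) x))
     - (LINT x:\<Omega>|lebesgue. (LBINT t=0..u x. bk x t \<bullet> grad \<phi> x))"

end

(* The fields b^k are built with a partition of unity (zeta_i) of Omega: each piece zeta_i b_t is mollified at its own
radius eps_i, and the sum is divided by 1 + delta_k to restore the sup bound. Since b is bounded and continuous in t,
the radii can be chosen such that the commutator errors (zeta_i b_t) * rho - zeta_i b_t and b_t . grad zeta_i * rho -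
b_t . grad zeta_i are small in L^1 uniformly for t in a compact interval; what remains of the divergence is
(zeta_i div b_t) * rho, whose variation is controlled by |div b_t| and by sigma.

For the pairings, write the integral from 0 to u(x) as an integral over t of the indicator of {u > t}. For fixed t the
claim becomes the convergence of the averages of 1_{u > t} against an even mollifier, integrated against div b_t. Since
b is bounded, sigma vanishes on sets of null (N-1)-dimensional content. By the coarea inequality {u > t} has locally
finite perimeter for almost all t, and outside a null set for the content such a set has density 0 or 1 or is
asymptotically a half space at each point. There the averages tend to 0, 1 or 1/2, which integrates to
(F(x, u^+) + F(x, u^-)) / 2 by Fubini and dominated convergence.

De Giorgi's blow-up is replaced by elementary estimates: where the measure |D1_E| - nu . D1_E has density 0, E is almost
monotone in all directions h with h . nu >= 0, hence almost separated from its complement by a hyperplane. The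
hyperplane need not pass through x; a comparison of scales leaves a half space or one of the two trivial densities. *)
theory Submission
  imports Defs
begin

text \<open>One sequence has to serve every u, so for (c4) the half-weight at jumps must come out of
  the kernel alone: it is even, hence averages a half space through the point to exactly 1/2. Almost
  every level t brings its own exceptional set, but the averages of 1_{u > t} decrease in t; a
  countable dense set of good levels therefore decides all levels, with a single null set. The
  measure |D1_E| is never built. It is only tested with C^1 fields supported in small balls, and the
  normal nu is a cluster point of fields that attain the perimeter up to 4^-j, since by a Vitali
  covering their excess has small density off a set of small content. That sigma ignores null
  content rests on cutoffs: compact sets of null content carry cutoffs with small gradient in L^1,
  which a bounded b cannot detect. Levels are confined to [-M, M] because the uniform choice of the
  radii integrates the modulus of continuity of b(x, .) on a compact interval. The density f is
  bounded by 1 only at each fixed t, off a null set depending on t; truncating it repairs this once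
  and for all.\<close>

abbreviation Borel :: "('a::topological_space \<Rightarrow> 'b::topological_space) set" where
 "Borel \<equiv> borel_measurable borel"

abbreviation vol :: "'a::euclidean_space set \<Rightarrow> real" where "vol \<equiv> measure lborel"

abbreviation FD :: "('a::euclidean_space \<Rightarrow> 'b::real_normed_vector) \<Rightarrow> 'a \<Rightarrow> 'a \<Rightarrow> 'b" where
 "FD f x \<equiv> frechet_derivative f (at x)"

abbreviation evol :: "'a::euclidean_space set \<Rightarrow> ennreal" where "evol \<equiv> emeasure lborel"

abbreviation ind :: "'a set \<Rightarrow> 'a \<Rightarrow> 'b::zero_neq_one" where "ind \<equiv> indicator"

abbreviation Lint :: "('a::euclidean_space \<Rightarrow> 'b::{banach, second_countable_topology}) \<Rightarrow> bool" where
 "Lint \<equiv> integrable lborel"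

abbreviation nn_lborel :: "('a::euclidean_space \<Rightarrow> ennreal) \<Rightarrow> ennreal"  (binder "NBINT " 10) where
 "nn_lborel f \<equiv> nn_integral lborel f"

lemmas Bintegral_add = Bochner_Integration.integral_add
lemmas Bintegral_diff = Bochner_Integration.integral_diff
lemmas Bintegral_sum = Bochner_Integration.integral_sum
lemmas Bintegral_cong = Bochner_Integration.integral_cong
lemmas Bintegrable_add = Bochner_Integration.integrable_add
lemmas Bintegrable_diff = Bochner_Integration.integrable_diff
lemmas Bintegrable_sum = Bochner_Integration.integrable_sum
lemmas Bintegrable_bound = Bochner_Integration.integrable_bound
lemmas Bintegral_nonneg = Bochner_Integration.integral_nonneg

section \<open>Test functions of class C^1 with compact support\<close>

lemma C1c_onI:
 assumes "\<And>x. (phi has_derivative D x) (at x)" "\<And>v. continuous_on UNIV (\<lambda>x. D x v)"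
  "compact K" "K \<subseteq> \<Omega>" "\<And>x. x \<notin> K ==> phi x = 0"
 shows "C1c_on \<Omega> phi"
proof -
 have D: "FD phi x = D x" for x
  using frechet_derivative_at[OF assms(1)] by simp
 have "\<exists>K. compact K \<and> K \<subseteq> \<Omega> \<and> (\<forall>x. x \<notin> K \<longrightarrow> phi x = 0)"
  using assms(3,4,5) by blast
 moreover have "\<forall>x. phi differentiable at x"
  using assms(1) differentiable_def by blast
 ultimately show ?thesis
  using assms(2) unfolding C1c_on_def D by blast
qed

lemma C1c_on_has_derivative:
 "C1c_on \<Omega> phi ==> (phi has_derivative FD phi x) (at x)"
 unfolding C1c_on_def using frechet_derivative_works by blast

lemma C1c_on_continuous_derivative:
 "C1c_on \<Omega> phi ==> continuous_on UNIV (\<lambda>x. FD phi x v)"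
 unfolding C1c_on_def by blast

lemma C1c_on_linear: "C1c_on \<Omega> phi ==> linear (FD phi x)"
 using C1c_on_has_derivative has_derivative_linear by blast

lemma C1c_on_continuous: "C1c_on \<Omega> phi ==> continuous_on UNIV phi"
 by (meson C1c_on_has_derivative continuous_at_imp_continuous_on has_derivative_continuous)

lemma C1c_on_mono: "C1c_on \<Omega> phi ==> \<Omega> \<subseteq> \<Omega>' ==> C1c_on \<Omega>' phi"
 unfolding C1c_on_def by blast

text \<open>The complement of \<open>K\<close> is open and \<open>phi\<close> is zero there, so the
  derivative vanishes off the same compact set.\<close>

lemma C1c_onE:
 assumes "C1c_on \<Omega> phi"
 obtains K where "compact K" "K \<subseteq> \<Omega>" "\<And>x. x \<notin> K ==> phi x = 0"
  "\<And>x v. x \<notin> K ==> FD phi x v = 0"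
proof -
 from assms obtain K where K: "compact K" "K \<subseteq> \<Omega>" "\<And>x. x \<notin> K ==> phi x = 0"
  unfolding C1c_on_def by blast
 have "FD phi x v = 0" if "x \<notin> K" for x v
 proof -
  have "(phi has_derivative (\<lambda>h. 0)) (at x)"
   by (rule has_derivative_transform_within_open[of "\<lambda>x. 0" _ _ _ "- K"])
    (use K that in \<open>auto intro: compact_imp_closed\<close>)
  from frechet_derivative_at[OF this] show ?thesis by metis
 qed
 with K that show thesis by blast
qed

lemma C1c_on_outside:
 assumes "C1c_on \<Omega> phi" "x \<notin> \<Omega>"
 shows "phi x = 0" "FD phi x v = 0"
 using C1c_onE[OF assms(1)] assms(2) by (metis subsetD)+

lemma C1c_on_zero: "C1c_on \<Omega> (\<lambda>x::'a::euclidean_space. 0 :: 'b::euclidean_space)"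
 by (rule C1c_onI[of _ "\<lambda>x h. 0" "{}"]) auto

lemma C1c_on_add:
 assumes "C1c_on \<Omega> phi" "C1c_on \<Omega> psi"
 shows "C1c_on \<Omega> (\<lambda>x. phi x + psi x)"
  "FD (\<lambda>x. phi x + psi x) x v
   = FD phi x v + FD psi x v"
proof -
 obtain K where K: "compact K" "K \<subseteq> \<Omega>" "\<And>x. x \<notin> K ==> phi x = 0" using assms(1) by (metis C1c_onE)
 obtain L where L: "compact L" "L \<subseteq> \<Omega>" "\<And>x. x \<notin> L ==> psi x = 0" using assms(2) by (metis C1c_onE)
 note d = has_derivative_add[OF C1c_on_has_derivative[OF assms(1)] C1c_on_has_derivative[OF assms(2)]]
 show "C1c_on \<Omega> (\<lambda>x. phi x + psi x)"
  by (rule C1c_onI[OF d, of "K \<union> L"])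
   (use K L in \<open>auto intro!: continuous_on_add assms[THEN C1c_on_continuous_derivative]\<close>)
 show "FD (\<lambda>x. phi x + psi x) x v
   = FD phi x v + FD psi x v"
  using frechet_derivative_at[OF d, of x] by metis
qed

lemma C1c_on_linear_image:
 assumes "C1c_on \<Omega> phi" "bounded_linear L"
 shows "C1c_on \<Omega> (\<lambda>x. L (phi x))"
  "FD (\<lambda>x. L (phi x)) x v = L (FD phi x v)"
proof -
 obtain K where K: "compact K" "K \<subseteq> \<Omega>" "\<And>x. x \<notin> K ==> phi x = 0" using assms(1) by (metis C1c_onE)
 note d = bounded_linear.has_derivative[OF assms(2) C1c_on_has_derivative[OF assms(1)]]
 show "C1c_on \<Omega> (\<lambda>x. L (phi x))"
  by (rule C1c_onI[OF d, of K])
   (use K in \<open>auto intro!: bounded_linear.continuous_on[OF assms(2)]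
     C1c_on_continuous_derivative[OF assms(1)] simp: linear_0[OF bounded_linear.linear[OF assms(2)]]\<close>)
 show "FD (\<lambda>x. L (phi x)) x v = L (FD phi x v)"
  using frechet_derivative_at[OF d, of x] by metis
qed

lemmas C1c_on_scaleR_const = C1c_on_linear_image[OF _ bounded_linear_scaleR_right]
lemmas C1c_on_vec = C1c_on_linear_image[OF _ bounded_linear_scaleR_left]

lemma C1c_on_uminus:
 assumes "C1c_on \<Omega> phi" shows "C1c_on \<Omega> (\<lambda>x. - phi x)"
 using C1c_on_scaleR_const(1)[OF assms, of "-1"] by simp

lemma C1c_on_diff:
 assumes "C1c_on \<Omega> phi" "C1c_on \<Omega> psi"
 shows "C1c_on \<Omega> (\<lambda>x. phi x - psi x)"
 using C1c_on_add(1)[OF assms(1) C1c_on_uminus[OF assms(2)]] by simp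

lemma C1c_on_sum:
 assumes "\<And>i. i \<in> I ==> C1c_on \<Omega> (phi i)"
 shows "C1c_on \<Omega> (\<lambda>x. \<Sum>i\<in>I. phi i x)"
 using assms
proof (induction I rule: infinite_finite_induct)
 case (insert i F)
 thus ?case using C1c_on_add(1)[of \<Omega> "phi i" "\<lambda>x. \<Sum>i\<in>F. phi i x"] by simp
qed (auto intro: C1c_on_zero)

lemma C1c_on_mult:
 assumes dpsi: "\<And>x. (psi has_derivative D x) (at x)" and cpsi: "\<And>v. continuous_on UNIV (\<lambda>x. D x v)"
  and phi: "C1c_on \<Omega> phi"
 shows "C1c_on \<Omega> (\<lambda>x. psi x *\<^sub>R phi x)"
  "FD (\<lambda>x. psi x *\<^sub>R phi x) x v
   = psi x *\<^sub>R FD phi x v + D x v *\<^sub>R phi x"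
proof -
 obtain K where K: "compact K" "K \<subseteq> \<Omega>" "\<And>x. x \<notin> K ==> phi x = 0" using phi by (metis C1c_onE)
 have d: "((\<lambda>x. psi x *\<^sub>R phi x) has_derivative
   (\<lambda>v. psi x *\<^sub>R FD phi x v + D x v *\<^sub>R phi x)) (at x)" for x
  by (rule has_derivative_scaleR[OF dpsi C1c_on_has_derivative[OF phi]])
 have c: "continuous_on UNIV psi"
  by (meson dpsi continuous_at_imp_continuous_on has_derivative_continuous)
 show "C1c_on \<Omega> (\<lambda>x. psi x *\<^sub>R phi x)"
  by (rule C1c_onI[OF d, of K])
   (use K in \<open>auto intro!: continuous_intros c cpsi C1c_on_continuous_derivative[OF phi] C1c_on_continuous[OF phi]\<close>)
 show "FD (\<lambda>x. psi x *\<^sub>R phi x) x v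
   = psi x *\<^sub>R FD phi x v + D x v *\<^sub>R phi x"
  using frechet_derivative_at[OF d, of x] by metis
qed

lemma C1c_on_C1c_mult:
 assumes "C1c_on \<Omega>' psi" "C1c_on \<Omega> phi"
 shows "C1c_on \<Omega> (\<lambda>x. psi x *\<^sub>R phi x)"
 by (rule C1c_on_mult(1)[OF C1c_on_has_derivative[OF assms(1)] C1c_on_continuous_derivative[OF assms(1)] assms(2)])

lemma C1c_on_affine:
 assumes "C1c_on \<Omega> phi" and c: "c \<noteq> 0"
 shows "C1c_on ((\<lambda>y. (1/c) *\<^sub>R (y - a)) ` \<Omega>) (\<lambda>x. phi (a + c *\<^sub>R x))"
  "FD (\<lambda>x. phi (a + c *\<^sub>R x)) x v = c *\<^sub>R FD phi (a + c *\<^sub>R x) v"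
proof -
 obtain K where K: "compact K" "K \<subseteq> \<Omega>" "\<And>x. x \<notin> K ==> phi x = 0" using assms by (metis C1c_onE)
 have d: "((\<lambda>x. phi (a + c *\<^sub>R x)) has_derivative (\<lambda>v. FD phi (a + c *\<^sub>R x) (c *\<^sub>R v))) (at x)" for x
 proof -
  have "((\<lambda>x. a + c *\<^sub>R x) has_derivative (\<lambda>v. c *\<^sub>R v)) (at x)"
   by (auto intro!: derivative_eq_intros)
  from has_derivative_compose[OF this C1c_on_has_derivative[OF assms(1)]] show ?thesis .
 qed
 have lin: "FD phi z (c *\<^sub>R v) = c *\<^sub>R FD phi z v" for z v
  using linear_cmul[OF C1c_on_linear[OF assms(1)]] .
 have x: "x = (1/c) *\<^sub>R (a + c *\<^sub>R x - a)" for x using c by simp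
 show "C1c_on ((\<lambda>y. (1/c) *\<^sub>R (y - a)) ` \<Omega>) (\<lambda>x. phi (a + c *\<^sub>R x))"
 proof (rule C1c_onI[OF d, of "(\<lambda>y. (1/c) *\<^sub>R (y - a)) ` K"])
  show "continuous_on UNIV (\<lambda>x. FD phi (a + c *\<^sub>R x) (c *\<^sub>R v))" for v
   by (rule continuous_on_compose2[OF C1c_on_continuous_derivative[OF assms(1)]]) (auto intro!: continuous_intros)
  show "compact ((\<lambda>y. (1/c) *\<^sub>R (y - a)) ` K)"
   by (rule compact_continuous_image) (use K in \<open>auto intro!: continuous_intros\<close>)
  show "phi (a + c *\<^sub>R x) = 0" if "x \<notin> (\<lambda>y. (1/c) *\<^sub>R (y - a)) ` K" for x
   using that x K(3) by blast
 qed (use K in auto)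
 show "FD (\<lambda>x. phi (a + c *\<^sub>R x)) x v = c *\<^sub>R FD phi (a + c *\<^sub>R x) v"
  using frechet_derivative_at[OF d, of x] lin by metis
qed

lemma C1c_on_reflect:
 assumes "C1c_on UNIV phi"
 shows "C1c_on UNIV (\<lambda>y. phi (x - y))"
  "FD (\<lambda>y. phi (x - y)) y v = - FD phi (x - y) v"
 using C1c_on_mono[OF C1c_on_affine(1)[OF assms, of "-1" x]] C1c_on_affine(2)[OF assms, of "-1" x y v]
 by auto

lemma continuous_compact_support_bounded:
 fixes f :: "'a::euclidean_space => 'b::euclidean_space"
 assumes "continuous_on UNIV f" "compact K" "\<And>x. x \<notin> K ==> f x = 0"
 shows "\<exists>C\<ge>0. \<forall>x. norm (f x) \<le> C"
proof -
 have "bounded (f ` K)"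
  by (intro compact_imp_bounded compact_continuous_image continuous_on_subset[OF assms(1)] assms(2)) auto
 then obtain C where "\<forall>x\<in>K. norm (f x) \<le> C" by (auto simp: bounded_iff)
 thus ?thesis by (intro exI[of _ "max 0 C"]) (metis assms(3) max.coboundedI2 max.cobounded1 norm_zero)
qed

lemma C1c_on_bounded:
 assumes "C1c_on \<Omega> phi" shows "\<exists>C\<ge>0. \<forall>x. norm (phi x) \<le> C"
 using C1c_onE[OF assms] continuous_compact_support_bounded[OF C1c_on_continuous[OF assms]] by metis

lemma C1c_on_derivative_bounded:
 fixes phi :: "'a::euclidean_space => 'b::euclidean_space"
 assumes "C1c_on \<Omega> phi" shows "\<exists>C\<ge>0. \<forall>x v. norm (FD phi x v) \<le> C * norm v"
proof -
 obtain K where K: "compact K" "\<And>x v. x \<notin> K ==> FD phi x v = 0"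
  using C1c_onE[OF assms] by metis
 have "\<forall>i::'a. \<exists>C\<ge>0. \<forall>x. norm (FD phi x i) \<le> C"
  using continuous_compact_support_bounded[OF C1c_on_continuous_derivative[OF assms] K(1)] K(2) by blast
 then obtain C where C: "\<And>i::'a. C i \<ge> 0" "\<And>i x. norm (FD phi x i) \<le> C i" by metis
 have "norm (FD phi x v) \<le> (\<Sum>i\<in>Basis. C i) * norm v" for x v
 proof -
  have "FD phi x v = FD phi x (\<Sum>i\<in>Basis. (v \<bullet> i) *\<^sub>R i)"
   by (simp add: euclidean_representation)
  also have "\<dots> = (\<Sum>i\<in>Basis. (v \<bullet> i) *\<^sub>R FD phi x i)"
   using C1c_on_linear[OF assms] by (simp add: linear_sum linear_cmul)
  also have "norm \<dots> \<le> (\<Sum>i\<in>Basis. norm v * C i)"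
   by (rule sum_norm_le) (auto intro!: mult_mono C simp: Basis_le_norm)
  finally show ?thesis by (simp add: sum_distrib_left mult.commute)
 qed
 thus ?thesis by (intro exI[of _ "\<Sum>i\<in>Basis. C i"]) (auto intro: sum_nonneg C)
qed

lemma C1c_on_uniform_derivative:
 fixes phi :: "'a::euclidean_space => 'b::euclidean_space"
 assumes "C1c_on \<Omega> phi" "e > 0"
 shows "\<exists>d>0. \<forall>x y v. dist x y < d \<longrightarrow>
  norm (FD phi x v - FD phi y v) \<le> e * norm v"
proof -
 obtain K where K: "compact K" "\<And>x v. x \<notin> K ==> FD phi x v = 0"
  using C1c_onE[OF assms(1)] by metis
 define e' where "e' = e / DIM('a)"
 have e': "e' > 0" using assms by (simp add: e'_def)
 have "\<exists>d>0. \<forall>x y. dist x y < d \<longrightarrow> dist (FD phi x i) (FD phi y i) < e'" for i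
 proof -
  have u: "uniformly_continuous_on (cball z 1) (\<lambda>x. FD phi x i)" for z
   by (intro compact_uniformly_continuous continuous_on_subset[OF C1c_on_continuous_derivative[OF assms(1)]]) auto
  \<comment> \<open>The margin 1 between the radii \<open>R\<close> and \<open>R + 1\<close>: two
    points closer than 1 either both lie in the larger ball or both lie outside
    \<open>K\<close>.\<close>
  obtain R where R: "K \<subseteq> cball 0 R" using K(1) by (metis bounded_iff compact_imp_bounded mem_cball_0 subsetI)
  have "uniformly_continuous_on (cball 0 (R+1)) (\<lambda>x. FD phi x i)"
   by (intro compact_uniformly_continuous continuous_on_subset[OF C1c_on_continuous_derivative[OF assms(1)]]) auto
  then obtain d where d: "d>0" "\<And>x y. x \<in> cball 0 (R+1) ==> y \<in> cball 0 (R+1) ==> dist x y < d ==>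
    dist (FD phi x i) (FD phi y i) < e'"
   unfolding uniformly_continuous_on_def using e' by metis
  have "dist (FD phi x i) (FD phi y i) < e'" if "dist x y < min d 1" for x y
  proof (cases "x \<in> cball 0 (R+1) \<and> y \<in> cball 0 (R+1)")
   case True thus ?thesis using d that by auto
  next
   case False
   hence "R + 1 < norm x \<or> R + 1 < norm y" by auto
   moreover have "norm x \<le> norm y + dist x y" "norm y \<le> norm x + dist x y"
    by (metis dist_norm norm_triangle_sub add.commute norm_minus_commute)+
   ultimately have "x \<notin> cball 0 R" "y \<notin> cball 0 R" using that by auto
   hence "x \<notin> K" "y \<notin> K" using R by auto
   thus ?thesis using K e' by simp
  qed
  thus ?thesis using d(1) by (intro exI[of _ "min d 1"]) auto
 qed
 then obtain d where d: "\<And>i. d i > 0" "\<And>i x y. dist x y < d i ==>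
   dist (FD phi x i) (FD phi y i) < e'" by metis
 define D where "D = Min (d ` (Basis::'a set))"
 have D: "D > 0" unfolding D_def using d(1) by (subst Min_gr_iff) auto
 have "norm (FD phi x v - FD phi y v) \<le> e * norm v" if "dist x y < D" for x y v
 proof -
  have r: "FD phi x v = (\<Sum>i\<in>Basis. (v \<bullet> i) *\<^sub>R FD phi x i)" for x
  proof -
   have "FD phi x v = FD phi x (\<Sum>i\<in>Basis. (v \<bullet> i) *\<^sub>R i)"
    by (simp add: euclidean_representation)
   also have "\<dots> = (\<Sum>i\<in>Basis. (v \<bullet> i) *\<^sub>R FD phi x i)"
    using C1c_on_linear[OF assms(1)] by (simp add: linear_sum linear_cmul)
   finally show ?thesis .
  qed
  have "norm (FD phi x v - FD phi y v) =
   norm (\<Sum>i\<in>Basis. (v \<bullet> i) *\<^sub>R (FD phi x i - FD phi y i))"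
   unfolding r[of x] r[of y] by (simp add: scaleR_diff_right sum_subtractf)
  also have "\<dots> \<le> (\<Sum>i\<in>(Basis::'a set). norm v * e')"
  proof (rule sum_norm_le)
   fix i :: 'a assume i: "i \<in> Basis"
   have "D \<le> d i" using i by (simp add: D_def)
   hence "dist x y < d i" using that by simp
   thus "norm ((v \<bullet> i) *\<^sub>R (FD phi x i - FD phi y i)) \<le> norm v * e'"
    using i d(2)[of x y i] by (auto intro!: mult_mono simp: Basis_le_norm dist_norm)
  qed
  also have "\<dots> = e * norm v" by (simp add: e'_def)
  finally show ?thesis .
 qed
 with D show ?thesis by blast
qed

text \<open>The mean value inequality for \<open>phi\<close> minus its linear part at x, together
  with uniform continuity of the derivative. Uniformity in x is what allows a convolution with a
  merely integrable factor to be differentiated.\<close>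

lemma C1c_on_uniform_remainder:
 assumes "C1c_on \<Omega> phi" "e > 0"
 shows "\<exists>d>0. \<forall>x y. norm (y - x) < d \<longrightarrow>
  norm (phi y - phi x - FD phi x (y - x)) \<le> e * norm (y - x)"
proof -
 obtain d where d: "d>0" "\<And>x y v. dist x y < d ==>
  norm (FD phi x v - FD phi y v) \<le> e * norm v"
  using C1c_on_uniform_derivative[OF assms] by blast
 have "norm (phi y - phi x - FD phi x (y - x)) \<le> e * norm (y - x)" if "norm (y - x) < d" for x y
 proof -
  let ?D = "\<lambda>x. FD phi x"
  let ?g = "\<lambda>z. phi z - ?D x z"
  have bl: "bounded_linear (?D x)"
   using C1c_on_has_derivative[OF assms(1)] has_derivative_bounded_linear by blast
  have "norm (?g (x + (y - x)) - ?g x) \<le> norm (y - x) * e"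
  proof (rule differentiable_bound_segment[where ?x0.0 = x and G = UNIV and f = ?g and f' = "\<lambda>z v. ?D z v - ?D x v"])
   show "(?g has_derivative (\<lambda>v. ?D z v - ?D x v)) (at z within UNIV)" for z
    by (intro has_derivative_diff C1c_on_has_derivative[OF assms(1)] bounded_linear_imp_has_derivative bl)
   fix s :: real assume s: "s \<in> {0..1}"
   have "dist (x + s *\<^sub>R (y - x)) x < d"
   proof -
    have "norm (s *\<^sub>R (y - x)) \<le> norm (y - x)" using s by (simp add: mult_left_le_one_le)
    thus ?thesis using that by (simp add: dist_norm)
   qed
   thus "onorm (\<lambda>v. ?D (x + s *\<^sub>R (y - x)) v - ?D x v) \<le> e"
    using d(2) by (intro onorm_bound) (use assms in auto)
  qed auto
  thus ?thesis by (simp add: linear_diff[OF C1c_on_linear[OF assms(1)]] algebra_simps)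
 qed
 with d(1) show ?thesis by blast
qed

lemma C1c_on_lipschitz:
 assumes "C1c_on \<Omega> phi"
 shows "\<exists>C\<ge>0. \<forall>x y. norm (phi x - phi y) \<le> C * norm (x - y)"
proof -
 obtain C where C: "C \<ge> 0" "\<And>x v. norm (FD phi x v) \<le> C * norm v"
  using C1c_on_derivative_bounded[OF assms] by blast
 have "norm (phi x - phi y) \<le> C * norm (x - y)" for x y
  by (rule differentiable_bound[of UNIV phi "\<lambda>x. FD phi x"])
   (auto intro!: onorm_bound C C1c_on_has_derivative[OF assms])
 with C show ?thesis by blast
qed

lemma integrable_continuous_compact_support:
 fixes f :: "'a::euclidean_space => 'b::euclidean_space"
 assumes "continuous_on UNIV f" "compact K" "\<And>x. x \<notin> K ==> f x = 0"
 shows "Lint f"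
proof -
 have "Lint (\<lambda>x. ind K x *\<^sub>R f x)"
  by (rule borel_integrable_compact) (use assms in \<open>auto intro: continuous_on_subset\<close>)
 moreover have "(\<lambda>x. ind K x *\<^sub>R f x) = f" using assms by (auto simp: indicator_def)
 ultimately show ?thesis by simp
qed

lemma C1c_on_integrable:
 assumes "C1c_on \<Omega> phi" shows "Lint phi"
 using C1c_onE[OF assms] integrable_continuous_compact_support[OF C1c_on_continuous[OF assms]] by metis

lemma C1c_on_derivative_integrable:
 assumes "C1c_on \<Omega> phi" shows "Lint (\<lambda>x. FD phi x v)"
 using C1c_onE[OF assms] integrable_continuous_compact_support[OF C1c_on_continuous_derivative[OF assms]] by metis

lemma C1c_on_measurable[measurable_dest]:
 assumes "C1c_on \<Omega> phi" shows "phi \<in> Borel"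
 using C1c_on_continuous[OF assms] by (rule borel_measurable_continuous_onI)

lemma inner_grad:
 assumes "C1c_on \<Omega> phi" shows "v \<bullet> grad phi x = FD phi x v"
proof -
 have "FD phi x v = FD phi x (\<Sum>i\<in>Basis. (v \<bullet> i) *\<^sub>R i)"
  by (simp add: euclidean_representation)
 also have "\<dots> = (\<Sum>i\<in>Basis. (v \<bullet> i) *\<^sub>R FD phi x i)"
  using C1c_on_linear[OF assms] by (simp add: linear_sum linear_cmul)
 finally show ?thesis by (simp add: grad_def inner_sum_right mult.commute)
qed

lemma grad_continuous:
 assumes "C1c_on \<Omega> phi" shows "continuous_on UNIV (grad phi)"
 unfolding grad_def by (intro continuous_intros C1c_on_continuous_derivative[OF assms])

lemma grad_outside:
 assumes "C1c_on \<Omega> phi" "x \<notin> \<Omega>" shows "grad phi x = 0"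
 unfolding grad_def using C1c_on_outside(2)[OF assms] by simp

lemma grad_bounded:
 assumes "C1c_on \<Omega> phi" shows "\<exists>C\<ge>0. \<forall>x. norm (grad phi x) \<le> C"
proof -
 obtain K where "compact K" "\<And>x. x \<notin> K ==> grad phi x = 0"
  using C1c_onE[OF assms] unfolding grad_def by (metis (mono_tags, lifting) scale_zero_left sum.neutral)
 thus ?thesis using continuous_compact_support_bounded[OF grad_continuous[OF assms]] by blast
qed

lemma grad_integrable:
 assumes "C1c_on \<Omega> phi" shows "Lint (grad phi)"
 unfolding grad_def by (intro Bintegrable_sum integrable_scaleR_left C1c_on_derivative_integrable[OF assms])

lemma divergence_add:
 assumes "C1c_on \<Omega> phi" "C1c_on \<Omega>' psi"
 shows "divergence (\<lambda>x. phi x + psi x) x = divergence phi x + divergence psi x"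
proof -
 have "C1c_on UNIV phi" "C1c_on UNIV psi" using assms C1c_on_mono by blast+
 thus ?thesis unfolding divergence_def by (simp add: C1c_on_add(2) inner_add_left sum.distrib)
qed

lemma divergence_scaleR:
 assumes "C1c_on \<Omega> phi" shows "divergence (\<lambda>x. c *\<^sub>R phi x) x = c * divergence phi x"
 unfolding divergence_def by (simp add: C1c_on_scaleR_const(2)[OF assms] sum_distrib_left)

lemma divergence_vec:
 assumes "C1c_on \<Omega> psi" shows "divergence (\<lambda>x. psi x *\<^sub>R v) x = FD psi x v"
proof -
 have "divergence (\<lambda>x. psi x *\<^sub>R v) x = (\<Sum>i\<in>Basis. FD psi x i * (v \<bullet> i))"
  unfolding divergence_def by (simp add: C1c_on_vec(2)[OF assms])
 also have "\<dots> = v \<bullet> grad psi x" by (simp add: grad_def inner_sum_right)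
 finally show ?thesis by (simp add: inner_grad[OF assms])
qed

lemma divergence_integrable:
 assumes "C1c_on \<Omega> phi" shows "Lint (divergence phi)"
 unfolding divergence_def
 by (intro Bintegrable_sum integrable_inner_left C1c_on_derivative_integrable[OF assms])

lemma divergence_continuous:
 assumes "C1c_on \<Omega> phi" shows "continuous_on UNIV (divergence phi)"
 unfolding divergence_def by (intro continuous_intros C1c_on_continuous_derivative[OF assms])

lemma divergence_outside:
 assumes "C1c_on \<Omega> phi" "x \<notin> \<Omega>" shows "divergence phi x = 0"
 unfolding divergence_def using C1c_on_outside(2)[OF assms] by simp


section \<open>Lebesgue integrals under scaling, reflection and translation\<close>

lemma distr_lborel_affine:
 fixes t :: "'a::euclidean_space"
 assumes "c \<noteq> 0" "F \<in> Borel"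
 shows "(NBINT x. F x) = ennreal (\<bar>c\<bar> ^ DIM('a)) * (NBINT x. F (t + c *\<^sub>R x))"
 by (subst lborel_affine[OF assms(1), of t])
  (use assms in \<open>simp add: nn_integral_density nn_integral_distr nn_integral_cmult\<close>)

lemma distr_lborel_reflect: "distr lborel borel (\<lambda>y. x - y) = (lborel :: 'a::euclidean_space measure)"
proof -
 have "lborel = density (distr lborel borel (\<lambda>y. x + (-1) *\<^sub>R y)) (\<lambda>_. ennreal (\<bar>-1\<bar>^DIM('a)))"
  by (rule lborel_affine) simp
 thus ?thesis by (simp add: density_1)
qed

lemma distr_lborel_translate: "distr lborel borel (\<lambda>y. y + h) = (lborel :: 'a::euclidean_space measure)"
 using lborel_distr_plus[of h] by (simp add: add.commute[of _ h])

lemma nn_integral_reflect: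
 fixes x :: "'a::euclidean_space"
 assumes "F \<in> Borel"
 shows "(NBINT y. F (x - y)) = (NBINT y. F y)"
 by (subst (2) distr_lborel_reflect[of x, symmetric]) (use assms in \<open>simp add: nn_integral_distr\<close>)

lemma nn_integral_translate:
 fixes h :: "'a::euclidean_space"
 assumes "F \<in> Borel"
 shows "(NBINT y. F (y + h)) = (NBINT y. F y)"
 by (subst (2) distr_lborel_translate[of h, symmetric]) (use assms in \<open>simp add: nn_integral_distr\<close>)

lemma
 fixes F :: "'a::euclidean_space => 'b::{banach, second_countable_topology}"
 assumes "F \<in> Borel"
 shows integral_reflect: "(LBINT y. F (x - y)) = (LBINT y. F y)"
  and integrable_reflect: "Lint (\<lambda>y. F (x - y)) \<longleftrightarrow> Lint F"
  and integral_translate: "(LBINT y. F (y + h)) = (LBINT y. F y)"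
  and integrable_translate: "Lint (\<lambda>y. F (y + h)) \<longleftrightarrow> Lint F"
proof -
 show "(LBINT y. F (x - y)) = (LBINT y. F y)"
  by (subst (2) distr_lborel_reflect[of x, symmetric]) (use assms in \<open>simp add: integral_distr\<close>)
 show "(LBINT y. F (y + h)) = (LBINT y. F y)"
  by (subst (2) distr_lborel_translate[of h, symmetric]) (use assms in \<open>simp add: integral_distr\<close>)
 show "Lint (\<lambda>y. F (x - y)) \<longleftrightarrow> Lint F"
  by (subst (2) distr_lborel_reflect[of x, symmetric]) (use assms in \<open>simp add: integrable_distr_eq\<close>)
 show "Lint (\<lambda>y. F (y + h)) \<longleftrightarrow> Lint F"
  by (subst (2) distr_lborel_translate[of h, symmetric]) (use assms in \<open>simp add: integrable_distr_eq\<close>)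
qed

section \<open>Convolution with a test kernel\<close>

definition convol :: "('a::euclidean_space => real) => ('a => 'b::euclidean_space) => 'a => 'b" where
 "convol K B x = (LBINT y. K (x - y) *\<^sub>R B y)"

lemma integrable_scaleR_bounded:
 fixes B :: "'a => 'b::euclidean_space"
 assumes "integrable M B" "K \<in> borel_measurable M" "\<And>y. \<bar>K y\<bar> \<le> C"
 shows "integrable M (\<lambda>y. K y *\<^sub>R B y)"
proof (rule Bintegrable_bound[of _ "\<lambda>y. C *\<^sub>R B y"])
 show "AE y in M. norm (K y *\<^sub>R B y) \<le> norm (C *\<^sub>R B y)"
  using assms(3) by (auto intro!: mult_right_mono order_trans[OF assms(3)])
qed (use assms in auto)

lemma convol_integrable:
 fixes B :: "'a::euclidean_space => 'b::euclidean_space"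
 assumes "continuous_on UNIV K" "\<And>x. \<bar>K x\<bar> \<le> C" "Lint B"
 shows "Lint (\<lambda>y. K (x - y) *\<^sub>R B y)"
proof (rule integrable_scaleR_bounded[OF assms(3)])
 have "K \<in> Borel" using assms(1) by (rule borel_measurable_continuous_onI)
 thus "(\<lambda>y. K (x - y)) \<in> borel_measurable lborel" by measurable
qed (use assms in auto)

lemma convol_C1c_integrable:
 fixes B :: "'a::euclidean_space => 'b::euclidean_space"
 assumes "C1c_on \<Omega> K" "Lint B"
 shows "Lint (\<lambda>y. K (x - y) *\<^sub>R B y)"
  "Lint (\<lambda>y. FD K (x - y) v *\<^sub>R B y)"
proof -
 obtain C where "C \<ge> 0" "\<And>x. norm (K x) \<le> C" using C1c_on_bounded[OF assms(1)] by blast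
 thus "Lint (\<lambda>y. K (x - y) *\<^sub>R B y)"
  using convol_integrable[OF C1c_on_continuous[OF assms(1)] _ assms(2)] by auto
 obtain C where "C \<ge> 0" "\<And>x v. norm (FD K x v) \<le> C * norm v"
  using C1c_on_derivative_bounded[OF assms(1)] by blast
 thus "Lint (\<lambda>y. FD K (x - y) v *\<^sub>R B y)"
  using convol_integrable[OF C1c_on_continuous_derivative[OF assms(1)] _ assms(2)] by (metis real_norm_def)
qed

lemma norm_convol_le:
 fixes B :: "'a::euclidean_space => 'b::euclidean_space"
 shows "norm (convol K B x) \<le> (LBINT y. \<bar>K (x - y)\<bar> * norm (B y))"
 unfolding convol_def using integral_norm_bound[of lborel "\<lambda>y. K (x - y) *\<^sub>R B y"] by simp

text \<open>The remainder of \<open>K\<close> is at most \<open>e' * norm (y - x)\<close> uniformly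
  in the integration variable, so integrating it against \<open>B\<close> costs only the L^1 norm of
  \<open>B\<close>.\<close>

lemma convol_has_derivative:
 assumes K: "C1c_on \<Omega> K" and B: "Lint B"
 shows "(convol K B has_derivative (\<lambda>h. convol (\<lambda>z. FD K z h) B x)) (at x)"
 unfolding has_derivative_at_alt
proof (intro conjI allI impI)
 let ?D = "\<lambda>z. FD K z"
 obtain C where C: "C \<ge> 0" "\<And>x v. norm (?D x v) \<le> C * norm v"
  using C1c_on_derivative_bounded[OF K] by blast
 note i1 = convol_C1c_integrable(1)[OF K B] and i2 = convol_C1c_integrable(2)[OF K B]
 have iB: "Lint (\<lambda>y. norm (B y))" using B by auto
 define I where "I = (LBINT y. norm (B y))"
 have I: "I \<ge> 0" unfolding I_def by simp
 show "bounded_linear (\<lambda>h. convol (\<lambda>z. ?D z h) B x)"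
 proof (rule bounded_linear_intro[where K = "C * I"])
  show "convol (\<lambda>z. ?D z (g + h)) B x = convol (\<lambda>z. ?D z g) B x + convol (\<lambda>z. ?D z h) B x" for g h
   unfolding convol_def using C1c_on_linear[OF K]
   by (simp add: linear_add scaleR_add_left Bintegral_add[OF i2 i2])
  show "convol (\<lambda>z. ?D z (r *\<^sub>R h)) B x = r *\<^sub>R convol (\<lambda>z. ?D z h) B x" for r h
   unfolding convol_def linear_cmul[OF C1c_on_linear[OF K]] real_scaleR_def scaleR_scaleR[symmetric]
   by (rule integral_scaleR_right)
  show "norm (convol (\<lambda>z. ?D z h) B x) \<le> norm h * (C * I)" for h
  proof -
   have "norm (convol (\<lambda>z. ?D z h) B x) \<le> (LBINT y. \<bar>?D (x - y) h\<bar> * norm (B y))"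
    by (rule norm_convol_le)
   also have "\<dots> \<le> (LBINT y. (C * norm h) * norm (B y))"
    using i2[of x h, THEN integrable_norm] iB C
    by (intro integral_mono) (auto intro!: mult_right_mono)
   also have "\<dots> = norm h * (C * I)" by (simp add: I_def)
   finally show ?thesis .
  qed
 qed
 fix e :: real assume e: "e > 0"
 define e' where "e' = e / (I + 1)"
 have "e' > 0" using e I by (simp add: e'_def)
 then obtain d where d: "d > 0" "\<And>x y. norm (y - x) < d ==>
  norm (K y - K x - ?D x (y - x)) \<le> e' * norm (y - x)"
  using C1c_on_uniform_remainder[OF K] by blast
 have "norm (convol K B y - convol K B x - convol (\<lambda>z. ?D z (y - x)) B x) \<le> e * norm (y - x)"
  if "norm (y - x) < d" for y
 proof -
  have eq: "convol K B y - convol K B x - convol (\<lambda>z. ?D z (y - x)) B x =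
   (LBINT z. (K (y - z) - K (x - z) - ?D (x - z) (y - x)) *\<^sub>R B z)"
   unfolding convol_def
   by (subst Bintegral_diff[symmetric, OF i1 i1],
     subst Bintegral_diff[symmetric])
    (auto intro!: Bintegrable_diff i1 i2 simp: scaleR_diff_left)
  have "norm (\<dots>) \<le> (LBINT z. norm ((K (y - z) - K (x - z) - ?D (x - z) (y - x)) *\<^sub>R B z))"
   by (rule integral_norm_bound)
  also have "\<dots> \<le> (LBINT z. (e' * norm (y - x)) * norm (B z))"
  proof (rule integral_mono)
   show "Lint (\<lambda>z. norm ((K (y - z) - K (x - z) - ?D (x - z) (y - x)) *\<^sub>R B z))"
    unfolding scaleR_diff_left by (intro integrable_norm Bintegrable_diff i1 i2)
   fix z
   show "norm ((K (y - z) - K (x - z) - ?D (x - z) (y - x)) *\<^sub>R B z) \<le> (e' * norm (y - x)) * norm (B z)"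
    using d(2)[of "y - z" "x - z"] that by (auto intro!: mult_right_mono)
  qed (use iB in auto)
  also have "\<dots> = (e' * I) * norm (y - x)" by (simp add: I_def)
  also have "\<dots> \<le> e * norm (y - x)"
   using e I by (intro mult_right_mono) (auto simp: e'_def field_simps)
  finally show ?thesis using eq by simp
 qed
 with d(1) show "\<exists>d>0. \<forall>y. norm (y - x) < d \<longrightarrow>
  norm (convol K B y - convol K B x - convol (\<lambda>z. ?D z (y - x)) B x) \<le> e * norm (y - x)" by blast
qed

lemma frechet_derivative_convol:
 assumes "C1c_on \<Omega> K" "Lint B"
 shows "FD (convol K B) x h = convol (\<lambda>z. FD K z h) B x"
 using frechet_derivative_at[OF convol_has_derivative[OF assms]] by metis

text \<open>Phrased with \<open>iter_pd\<close> to match \<open>smooth_on\<close>: every derivative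
  of a convolution passes to the kernel, so the induction in \<open>iter_pd_convol\<close> never
  touches the integrable factor.\<close>

definition smooth_kernel :: "('a::euclidean_space => real) => bool" where
 "smooth_kernel K \<longleftrightarrow> (\<forall>vs. C1c_on UNIV (iter_pd vs K))"

lemma smooth_kernel_C1c: "smooth_kernel K ==> C1c_on UNIV K"
 unfolding smooth_kernel_def by (metis iter_pd.simps(1))

lemma iter_pd_convol:
 assumes "smooth_kernel K" "Lint B"
 shows "iter_pd vs (convol K B) = convol (iter_pd vs K) B"
proof (induction vs)
 case (Cons v vs)
 have "C1c_on UNIV (iter_pd vs K)" using assms unfolding smooth_kernel_def by blast
 thus ?case by (simp add: Cons.IH frechet_derivative_convol assms(2))
qed simp

lemma iter_pd_convol_differentiable:
 assumes "smooth_kernel K" "Lint B"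
 shows "iter_pd vs (convol K B) differentiable at x"
 using convol_has_derivative[of UNIV "iter_pd vs K" B x] assms
 unfolding iter_pd_convol[OF assms] smooth_kernel_def differentiable_def by blast

lemma convol_continuous:
 assumes "C1c_on \<Omega> K" "Lint B"
 shows "continuous_on UNIV (convol K B)"
 by (meson assms convol_has_derivative continuous_at_imp_continuous_on has_derivative_continuous)

section \<open>The standard mollifier\<close>

text \<open>The functions \<open>flat k\<close> span a space closed under differentiation, which gives the
 smoothness of the standard mollifier built from \<open>flat 0\<close>.\<close>

definition flat :: "nat => real => real" where
 "flat k s = (if s > 0 then exp (- 1 / s) / s ^ k else 0)"

lemma flat_tendsto_0: "(flat k \<longlongrightarrow> 0) (at 0)"
proof -
 have "((\<lambda>x::real. x ^ k / exp x) \<longlongrightarrow> 0) at_top" by (rule tendsto_power_div_exp_0)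
 hence "((\<lambda>s::real. inverse s ^ k / exp (inverse s)) \<longlongrightarrow> 0) (at_right 0)"
  by (rule filterlim_compose) (rule filterlim_inverse_at_top_right)
 hence "(flat k \<longlongrightarrow> 0) (at_right 0)"
  by (rule Lim_transform_eventually)
   (auto simp: flat_def eventually_at_right_field exp_minus field_simps intro!: exI[of _ 1])
 moreover have "(flat k \<longlongrightarrow> 0) (at_left 0)"
  by (rule tendsto_eventually) (auto simp: flat_def eventually_at_left_field intro!: exI[of _ "-1"])
 ultimately show ?thesis by (simp add: filterlim_split_at)
qed

lemma flat_has_derivative:
 "(flat k has_real_derivative - real k * flat (k + 1) s + flat (k + 2) s) (at s)"
proof -
 consider "s > 0" | "s < 0" | "s = 0" by linarith
 thus ?thesis
 proof cases
  case 1
  have "((\<lambda>s. exp (- 1 / s) / s ^ k) has_real_derivative - real k * flat (k + 1) s + flat (k + 2) s) (at s)"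
  proof -
   have "((\<lambda>s. exp (- 1 / s)) has_real_derivative exp (- 1 / s) / (s * s)) (at s)"
    using 1 by (auto intro!: derivative_eq_intros simp: field_simps)
   from DERIV_divide[OF this DERIV_pow[of k s]] 1
   have d: "((\<lambda>s. exp (- 1 / s) / s ^ k) has_real_derivative
    (exp (- 1 / s) / (s * s) * s ^ k - exp (- 1 / s) * (real k * s ^ (k - Suc 0))) / (s ^ k * s ^ k)) (at s)"
    by simp
   show ?thesis
   proof (cases k)
    case 0
    thus ?thesis using d 1 by (simp add: flat_def power2_eq_square)
   next
    case (Suc n)
    define p where "p = s ^ n"
    have "p > 0" "s ^ (k - Suc 0) = p" "s ^ k = s * p" "s ^ (k + 1) = s * s * p" "s ^ (k + 2) = s * s * s * p"
     using 1 by (auto simp: Suc p_def)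
    hence "(exp (- 1 / s) / (s * s) * s ^ k - exp (- 1 / s) * (real k * s ^ (k - Suc 0))) / (s ^ k * s ^ k)
     = - real k * flat (k + 1) s + flat (k + 2) s"
     using 1 unfolding flat_def by (simp add: field_simps)
    with d show ?thesis by simp
   qed
  qed
  thus ?thesis
   by (rule has_field_derivative_transform_within_open[where S = "{0<..}"]) (use 1 in \<open>auto simp: flat_def\<close>)
 next
  case 2
  have "((\<lambda>s. 0) has_real_derivative - real k * flat (k + 1) s + flat (k + 2) s) (at s)"
   using 2 by (simp add: flat_def)
  thus ?thesis
   by (rule has_field_derivative_transform_within_open[where S = "{..<0}"]) (use 2 in \<open>auto simp: flat_def\<close>)
 next
  case 3
  \<comment> \<open>At 0 the difference quotient of \<open>flat k\<close> is the function
    \<open>flat (k + 1)\<close> itself, so its limit is known.\<close>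
  have "(\<lambda>h. (flat k (0 + h) - flat k 0) / h) = flat (k + 1)"
   by (auto simp: flat_def fun_eq_iff field_simps)
  hence "(flat k has_real_derivative 0) (at 0)"
   unfolding DERIV_def using flat_tendsto_0[of "k+1"] by simp
  thus ?thesis using 3 by (simp add: flat_def)
 qed
qed

text \<open>Linear forms and the functions \<open>flat k\<close> of 1 - |x|^2 / eps^2 generate an
  algebra closed under differentiation. Membership of the bump gives derivatives of every order
  without formulas for them.\<close>

inductive bump_algebra :: "real => ('a::euclidean_space => real) => bool" for eps where
 const: "bump_algebra eps (\<lambda>x. c)"
| linear: "bump_algebra eps (\<lambda>x. x \<bullet> v)"
| flat: "bump_algebra eps (\<lambda>x. flat k (1 - x \<bullet> x / eps\<^sup>2))"
| add: "bump_algebra eps f ==> bump_algebra eps g ==> bump_algebra eps (\<lambda>x. f x + g x)"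
| mult: "bump_algebra eps f ==> bump_algebra eps g ==> bump_algebra eps (\<lambda>x. f x * g x)"

lemma bump_algebra_derivative:
 assumes "bump_algebra eps f"
 shows "\<exists>D. (\<forall>x. (f has_derivative D x) (at x)) \<and> (\<forall>v. bump_algebra eps (\<lambda>x. D x v))"
 using assms
proof induction
 case (const c)
 show ?case by (intro exI[of _ "\<lambda>x v. 0"]) (auto intro: bump_algebra.const)
next
 case (linear v)
 show ?case by (intro exI[of _ "\<lambda>x h. h \<bullet> v"]) (auto intro!: bump_algebra.const derivative_eq_intros)
next
 case (flat k)
 let ?s = "\<lambda>x::'a. 1 - x \<bullet> x / eps\<^sup>2"
 let ?D = "\<lambda>x v. (- real k * flat (k + 1) (?s x) + flat (k + 2) (?s x)) * ((- 2 / eps\<^sup>2) * (x \<bullet> v))"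
 have "((\<lambda>x. flat k (?s x)) has_derivative ?D x) (at x)" for x
 proof -
  have 1: "(?s has_derivative (\<lambda>v. (- 2 / eps\<^sup>2) * (x \<bullet> v))) (at x)"
   by (cases "eps = 0") (auto intro!: derivative_eq_intros simp: inner_commute fun_eq_iff power2_eq_square power4_eq_xxxx)
  show ?thesis
   using has_derivative_compose[OF 1 flat_has_derivative[of k "?s x", unfolded has_field_derivative_def]] .
 qed
 moreover have "bump_algebra eps (\<lambda>x. ?D x v)" for v
  by (intro bump_algebra.intros)
 ultimately show ?case by (intro exI[of _ ?D]) blast
next
 case (add f g)
 then obtain D E where "\<And>x. (f has_derivative D x) (at x)" "\<And>v. bump_algebra eps (\<lambda>x. D x v)"
  "\<And>x. (g has_derivative E x) (at x)" "\<And>v. bump_algebra eps (\<lambda>x. E x v)" by blast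
 thus ?case
  by (intro exI[of _ "\<lambda>x v. D x v + E x v"]) (auto intro!: has_derivative_add bump_algebra.add)
next
 case (mult f g)
 then obtain D E where "\<And>x. (f has_derivative D x) (at x)" "\<And>v. bump_algebra eps (\<lambda>x. D x v)"
  "\<And>x. (g has_derivative E x) (at x)" "\<And>v. bump_algebra eps (\<lambda>x. E x v)" by blast
 thus ?case using mult.hyps
  by (intro exI[of _ "\<lambda>x v. f x * E x v + D x v * g x"])
   (auto intro!: has_derivative_mult bump_algebra.add bump_algebra.mult)
qed

lemma bump_algebra_C1c:
 assumes "bump_algebra eps f" "\<And>x. x \<notin> cball 0 eps ==> f x = 0"
 shows "C1c_on UNIV f" "bump_algebra eps (\<lambda>x. FD f x v)"
  "x \<notin> cball 0 eps ==> FD f x v = 0"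
proof -
 obtain D where D: "\<And>x. (f has_derivative D x) (at x)" "\<And>v. bump_algebra eps (\<lambda>x. D x v)"
  using bump_algebra_derivative[OF assms(1)] by blast
 have c: "continuous_on UNIV (\<lambda>x. D x v)" for v
  using bump_algebra_derivative[OF D(2)[of v]]
  by (meson continuous_at_imp_continuous_on has_derivative_continuous)
 have "C1c_on (cball 0 eps) f"
  by (rule C1c_onI[OF D(1) c, of "cball 0 eps"]) (use assms in auto)
 from C1c_on_mono[OF this] show "C1c_on UNIV f" by simp
 show "FD f x v = 0" if "x \<notin> cball 0 eps"
  using C1c_on_outside(2)[OF \<open>C1c_on (cball 0 eps) f\<close> that] .
 show "bump_algebra eps (\<lambda>x. FD f x v)"
  using D(2)[of v] by (simp flip: frechet_derivative_at[OF D(1)])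
qed

definition bump :: "real => 'a::euclidean_space => real" where
 "bump eps x = flat 0 (1 - x \<bullet> x / eps\<^sup>2)"

definition moll :: "real => 'a::euclidean_space => real" where
 "moll eps x = bump eps x / (LBINT y. bump eps (y::'a))"

lemma bump_nonneg: "bump eps x \<ge> 0" and bump_le_1: "bump eps x \<le> 1"
 by (auto simp: bump_def flat_def)

lemma bump_outside:
 assumes "eps > 0" "norm x \<ge> eps" shows "bump eps x = 0"
proof -
 have "x \<bullet> x \<ge> eps\<^sup>2" using assms by (simp add: dot_square_norm)
 thus ?thesis using assms by (simp add: bump_def flat_def)
qed

lemma bump_algebra_bump: "bump_algebra eps (bump eps)"
 unfolding bump_def by (rule bump_algebra.flat)

lemma bump_C1c: "eps > 0 ==> C1c_on UNIV (bump eps :: 'a::euclidean_space => real)"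
 by (rule bump_algebra_C1c(1)[OF bump_algebra_bump]) (simp add: bump_outside)

text \<open>The factor eps^N becomes the bound of order 1 / eps^N in \<open>moll_le\<close>, with a
  constant independent of eps. That bound turns densities on balls into averages against the
  mollifier.\<close>

lemma bump_integral_scale:
 assumes "eps > 0"
 shows "(LBINT y. bump eps (y::'a::euclidean_space)) = eps ^ DIM('a) * (LBINT y. bump 1 (y::'a))"
proof -
 have m[measurable]: "bump eps \<in> borel_measurable (borel :: 'a measure)" if "eps > 0" for eps :: real
  using C1c_on_measurable[OF bump_C1c[OF that]] .
 note m[OF assms, measurable] m[OF zero_less_one, measurable]
 have "(NBINT y. bump eps (y::'a)) = ennreal (\<bar>eps\<bar> ^ DIM('a)) * (NBINT y. bump eps (0 + eps *\<^sub>R y::'a))"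
  by (rule distr_lborel_affine) (use assms m in auto)
 also have "(\<lambda>y. bump eps (0 + eps *\<^sub>R y::'a)) = bump 1"
  using assms by (auto simp: bump_def fun_eq_iff power2_eq_square)
 finally have "(NBINT y. bump eps (y::'a)) = ennreal (\<bar>eps\<bar> ^ DIM('a)) * (NBINT y. bump 1 (y::'a))" .
 thus ?thesis using assms
  by (subst (1 2) integral_eq_nn_integral)
   (use assms in \<open>auto simp: bump_nonneg enn2real_mult\<close>)
qed

lemma bump_integral_pos:
 assumes "eps > 0"
 shows "(LBINT y. bump eps (y::'a::euclidean_space)) > 0"
proof -
 have i: "Lint (bump eps :: 'a => real)" using C1c_on_integrable[OF bump_C1c[OF assms]] .
 have "(LBINT y. bump eps (y::'a)) \<noteq> 0"
 proof
  assume "(LBINT y. bump eps (y::'a)) = 0"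
  hence "AE y in lborel. bump eps (y::'a) = 0"
   using integral_nonneg_eq_0_iff_AE[OF i] bump_nonneg by auto
  moreover have [measurable]: "bump eps \<in> borel_measurable (borel :: 'a measure)"
   using C1c_on_measurable[OF bump_C1c[OF assms]] .
  have "{y \<in> space lborel. \<not> bump eps (y::'a) = 0} \<in> sets lborel" by measurable
  ultimately have "{y::'a. \<not> bump eps y = 0} \<in> null_sets lborel"
   by (subst (asm) AE_iff_null) auto
  moreover have "ball 0 eps \<subseteq> {y::'a. \<not> bump eps y = 0}"
  proof
   fix y :: 'a assume "y \<in> ball 0 eps"
   hence "y \<bullet> y < eps\<^sup>2" using assms by (simp add: dot_square_norm power_strict_mono)
   thus "y \<in> {y. \<not> bump eps y = 0}" using assms by (simp add: bump_def flat_def)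
  qed
  ultimately have "ball (0::'a) eps \<in> null_sets lborel"
   using null_sets_subset[of "{y::'a. \<not> bump eps y = 0}" lborel "ball 0 eps"] by auto
  hence "evol (ball (0::'a) eps) = 0" by auto
  thus False using assms unit_ball_vol_pos[of "real DIM('a)"] by (simp add: emeasure_ball)
 qed
 moreover have "(LBINT y. bump eps (y::'a)) \<ge> 0" by (simp add: bump_nonneg)
 ultimately show ?thesis by linarith
qed

context
 fixes eps :: real assumes eps: "eps > 0"
begin

lemma smooth_kernel_moll: "smooth_kernel (moll eps :: 'a::euclidean_space => real)"
proof -
 have "bump_algebra eps (iter_pd vs (moll eps :: 'a => real)) \<and> (\<forall>x. x \<notin> cball 0 eps \<longrightarrow> iter_pd vs (moll eps) x = 0)" for vs :: "'a list"
 proof (induction vs)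
  case Nil
  have "bump_algebra eps (\<lambda>x::'a. bump eps x * (1 / (LBINT y. bump eps (y::'a))))"
   by (intro bump_algebra.mult bump_algebra_bump bump_algebra.const)
  moreover have "(\<lambda>x::'a. bump eps x * (1 / (LBINT y. bump eps (y::'a)))) = moll eps"
   by (simp add: moll_def fun_eq_iff)
  ultimately show ?case using bump_outside[OF eps, where 'a = 'a] by (simp add: moll_def)
 next
  case (Cons v vs)
  thus ?case using bump_algebra_C1c(2,3)[of eps "iter_pd vs (moll eps)"] by simp
 qed
 thus ?thesis unfolding smooth_kernel_def using bump_algebra_C1c(1) by blast
qed

lemma moll_C1c: "C1c_on UNIV (moll eps :: 'a::euclidean_space => real)"
 using smooth_kernel_moll by (rule smooth_kernel_C1c)

lemma moll_measurable[measurable]: "moll eps \<in> borel_measurable (borel :: 'a::euclidean_space measure)"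
 using moll_C1c by (rule C1c_on_measurable)

lemma moll_integrable: "Lint (moll eps :: 'a::euclidean_space => real)"
 using moll_C1c by (rule C1c_on_integrable)

lemma moll_integral: "(LBINT x. moll eps (x::'a::euclidean_space)) = 1"
 using bump_integral_pos[OF eps, where 'a = 'a] unfolding moll_def by simp

lemma moll_nonneg: "moll eps x \<ge> 0"
 using bump_integral_pos[OF eps, where 'a = 'a] by (auto simp: moll_def bump_nonneg)

lemma moll_outside: "norm x \<ge> eps ==> moll eps x = 0"
 by (simp add: moll_def bump_outside[OF eps])

lemma moll_minus: "moll eps (- x) = moll eps x"
 by (simp add: moll_def bump_def)

lemma moll_commute: "moll eps (x - y) = moll eps (y - x)"
 using moll_minus[of "x - y"] by simp

lemma moll_le: "moll eps (x::'a::euclidean_space) \<le> 1 / (eps ^ DIM('a) * (LBINT y. bump 1 (y::'a)))"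
 using bump_integral_pos[OF eps, where 'a = 'a] bump_le_1[of eps x]
 unfolding moll_def bump_integral_scale[OF eps] by (auto intro!: divide_right_mono)

lemma moll_nn_integral: "(NBINT x. ennreal (moll eps (x::'a::euclidean_space))) = 1"
 by (subst nn_integral_eq_integral[OF moll_integrable]) (simp_all add: moll_integral moll_nonneg)

lemma moll_nn_integral_reflect: "(NBINT y. ennreal (moll eps (x - y))) = 1"
 using nn_integral_reflect[of "\<lambda>y. ennreal (moll eps y)" x] moll_nn_integral by simp

lemma moll_nn_integral_shift: "(NBINT x. ennreal (moll eps (x - y))) = 1"
 using moll_nn_integral_reflect[of y] by (simp add: moll_commute[of _ y])

lemma moll_integral_reflect: "(LBINT y. moll eps (x - y)) = 1"
 using integral_reflect[of "moll eps" x] moll_integral by simp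

lemma moll_integrable_reflect: "Lint (\<lambda>y. moll eps (x - y))"
 using integrable_reflect[of "moll eps" x] moll_integrable by simp

end


section \<open>L^1 estimates for mollification, cutoffs and density of test functions\<close>

lemma norm_integral_le_nn_integral:
 fixes f :: "'a => 'b::{banach, second_countable_topology}"
 shows "ennreal (norm (integral\<^sup>L M f)) \<le> (\<integral>\<^sup>+x. ennreal (norm (f x)) \<partial>M)"
 by (cases "integrable M f") (auto intro: integral_norm_bound_ennreal simp: not_integrable_integral_eq)

lemma norm_convol_le_nn_integral:
 assumes "\<And>x. K x \<ge> 0"
 shows "ennreal (norm (convol K B x)) \<le> (NBINT y. ennreal (K (x - y)) * ennreal (norm (B y)))"
 unfolding convol_def using norm_integral_le_nn_integral[of lborel "\<lambda>y. K (x - y) *\<^sub>R B y"] assms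
 by (simp add: ennreal_mult)

lemma nn_integral_convol_moll:
 fixes w :: "'a::euclidean_space => ennreal"
 assumes "eps > 0" and [measurable]: "w \<in> Borel"
 shows "(NBINT x. NBINT y. ennreal (moll eps (x - y)) * w y) = (NBINT y. w y)"
proof -
 note moll_measurable[OF assms(1), measurable]
 have "(NBINT x. NBINT y. ennreal (moll eps (x - y)) * w y)
   = (NBINT y. NBINT x. ennreal (moll eps (x - y)) * w y)"
  by (rule lborel_pair.Fubini'[symmetric]) measurable
 also have "\<dots> = (NBINT y. w y)"
  by (subst nn_integral_multc) (auto simp: moll_nn_integral_shift[OF assms(1)])
 finally show ?thesis .
qed

lemma nn_integral_norm_convol_moll_le:
 assumes "eps > 0" and [measurable]: "B \<in> Borel"
 shows "(NBINT x. ennreal (norm (convol (moll eps) B x))) \<le> (NBINT y. ennreal (norm (B y)))"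
proof -
 have "(NBINT x. ennreal (norm (convol (moll eps) B x)))
  \<le> (NBINT x. NBINT y. ennreal (moll eps (x - y)) * ennreal (norm (B y)))"
  by (intro nn_integral_mono norm_convol_le_nn_integral moll_nonneg[OF assms(1)])
 also have "\<dots> = (NBINT y. ennreal (norm (B y)))"
  by (rule nn_integral_convol_moll[OF assms(1)]) simp
 finally show ?thesis .
qed

lemma convol_moll_integrable:
 fixes B :: "'a::euclidean_space => 'b::euclidean_space"
 assumes "eps > 0" "Lint B"
 shows "Lint (\<lambda>y. moll eps (x - y) *\<^sub>R B y)"
 using convol_C1c_integrable(1)[OF moll_C1c[OF assms(1)] assms(2)] .

lemma convol_moll_add:
 assumes "eps > 0" "Lint B" "Lint B'"
 shows "convol (moll eps) (\<lambda>y. B y + B' y) x = convol (moll eps) B x + convol (moll eps) B' x"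
  "convol (moll eps) (\<lambda>y. B y - B' y) x = convol (moll eps) B x - convol (moll eps) B' x"
 unfolding convol_def scaleR_add_right scaleR_diff_right
 by (auto intro!: Bintegral_add Bintegral_diff convol_moll_integrable assms)

lemma convol_moll_bound:
 assumes "eps > 0" "AE y in lborel. norm (B y) \<le> L" "L \<ge> 0"
 shows "norm (convol (moll eps) B x) \<le> L"
proof -
 have "ennreal (norm (convol (moll eps) B x)) \<le> (NBINT y. ennreal (moll eps (x - y)) * ennreal (norm (B y)))"
  by (rule norm_convol_le_nn_integral[OF moll_nonneg[OF assms(1)]])
 also have "\<dots> \<le> (NBINT y. ennreal (moll eps (x - y)) * ennreal L)"
  using assms(2) by (intro nn_integral_mono_AE) (auto elim!: eventually_mono intro!: mult_left_mono ennreal_leI)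
 also have "\<dots> = ennreal L"
  using moll_measurable[OF assms(1), measurable]
  by (subst nn_integral_multc) (auto simp: moll_nn_integral_reflect[OF assms(1)])
 finally show ?thesis using assms(3) by simp
qed

text \<open>The kernel has mass one and lives in the ball of radius eps; only the deviation of
  \<open>B\<close> from c in that ball counts.\<close>

lemma convol_moll_near:
 assumes eps: "eps > 0" and B: "Lint B" and near: "\<And>y. norm (x - y) < eps ==> norm (B y - c) \<le> d" "d \<ge> 0"
 shows "norm (convol (moll eps) B x - c) \<le> d"
proof -
 note i = convol_moll_integrable[OF eps B] moll_integrable_reflect[OF eps]
 have "convol (moll eps) B x - c = convol (moll eps) B x - (LBINT y. moll eps (x - y) *\<^sub>R c)"
  using integral_scaleR_left[OF i(2), of x c] by (simp add: moll_integral_reflect[OF eps])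
 also have "\<dots> = (LBINT y. moll eps (x - y) *\<^sub>R (B y - c))"
  unfolding convol_def scaleR_diff_right
  by (intro Bintegral_diff[symmetric] i integrable_scaleR_left)
 finally have "norm (convol (moll eps) B x - c) \<le> (LBINT y. norm (moll eps (x - y) *\<^sub>R (B y - c)))"
  using integral_norm_bound by metis
 also have "\<dots> \<le> (LBINT y. moll eps (x - y) * d)"
 proof (rule integral_mono')
  fix y show "norm (moll eps (x - y) *\<^sub>R (B y - c)) \<le> moll eps (x - y) * d"
   using near(1)[of y] moll_outside[OF eps, of "x - y"] moll_nonneg[OF eps, of "x - y"]
   by (cases "norm (x - y) < eps") (auto intro!: mult_left_mono)
 qed (use i near in \<open>auto simp: moll_nonneg[OF eps]\<close>)
 also have "\<dots> = d" by (simp add: moll_integral_reflect[OF eps])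
 finally show ?thesis .
qed

lemma convol_moll_outside:
 assumes "eps > 0" "\<And>y. y \<in> ball x eps ==> B y = 0"
 shows "convol (moll eps) B x = 0"
proof -
 have "moll eps (x - y) *\<^sub>R B y = 0" for y
  using assms moll_outside[OF assms(1), of "x - y"] by (cases "y \<in> ball x eps") (auto simp: dist_norm)
 thus ?thesis unfolding convol_def by (simp only: Bochner_Integration.integral_zero)
qed

lemma convol_moll_measurable:
 assumes "eps > 0" and [measurable]: "B \<in> Borel"
 shows "convol (moll eps) B \<in> Borel"
proof -
 note moll_measurable[OF assms(1), measurable]
 have "(\<lambda>x. LBINT y. moll eps (x - y) *\<^sub>R B y) \<in> borel_measurable lborel"
  by (rule lborel.borel_measurable_lebesgue_integral) measurable
 thus ?thesis unfolding convol_def[abs_def] by simp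
qed

lemma convol_moll_C1c:
 fixes B :: "'a::euclidean_space => 'b::euclidean_space"
 assumes eps: "eps > 0" and B: "Lint B" and S: "compact S" "\<And>y. y \<notin> S ==> B y = 0"
  and U: "\<And>y. y \<in> S ==> cball y eps \<subseteq> U"
 shows "C1c_on U (convol (moll eps) B)"
proof (rule C1c_onI[OF convol_has_derivative[OF moll_C1c[OF eps] B]])
 show "continuous_on UNIV (convol (\<lambda>z. FD (moll eps) z v) B)" for v
 proof -
  have "C1c_on UNIV (iter_pd [v] (moll eps))" using smooth_kernel_moll[OF eps] unfolding smooth_kernel_def by blast
  from convol_continuous[OF this B] show ?thesis by simp
 qed
 let ?K = "{x + y |x y. x \<in> S \<and> y \<in> cball 0 eps}"
 show "compact ?K" using compact_sums[OF S(1) compact_cball[of 0 eps]] by simp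
 show "?K \<subseteq> U"
 proof clarify
  fix x y :: 'a assume "x \<in> S" "y \<in> cball 0 eps"
  thus "x + y \<in> U" using U[of x] by (auto simp: subset_iff dist_norm)
 qed
 fix x assume x: "x \<notin> ?K"
 show "convol (moll eps) B x = 0"
 proof (rule convol_moll_outside[OF eps])
  fix y assume "y \<in> ball x eps"
  hence "x = y + (x - y)" "x - y \<in> cball 0 eps" by (auto simp: dist_norm norm_minus_commute)
  hence "y \<notin> S" using x by blast
  thus "B y = 0" by (rule S(2))
 qed
qed

lemma compact_Union_cball:
 fixes K :: "'a::euclidean_space set"
 assumes "compact K" shows "compact (\<Union>x\<in>K. cball x e)"
proof -
 have "(\<Union>x\<in>K. cball x e) = {x + y |x y. x \<in> K \<and> y \<in> cball 0 e}"
 proof safe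
  fix x y :: 'a assume "x \<in> K" "y \<in> cball x e"
  thus "\<exists>x' y'. y = x' + y' \<and> x' \<in> K \<and> y' \<in> cball 0 e"
   by (intro exI[of _ x] exI[of _ "y - x"]) (auto simp: dist_norm norm_minus_commute)
 next
  fix x y :: 'a assume "x \<in> K" "y \<in> cball 0 e"
  thus "x + y \<in> (\<Union>x\<in>K. cball x e)" by (auto intro!: bexI[of _ x] simp: dist_norm)
 qed
 thus ?thesis using compact_sums[OF assms compact_cball[of 0 e]] by simp
qed

lemma compact_thicken:
 fixes K :: "'a::euclidean_space set"
 assumes "compact K" "open U" "K \<subseteq> U"
 obtains e where "e > 0" "\<And>x. x \<in> K ==> cball x e \<subseteq> U"
 using compact_subset_open_imp_cball_epsilon_subset[OF assms] by (metis UN_subset_iff)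

lemma smooth_cutoff:
 fixes K :: "'a::euclidean_space set"
 assumes "compact K" "open U" "K \<subseteq> U"
 obtains eta :: "'a => real" where "C1c_on U eta" "\<And>x. 0 \<le> eta x" "\<And>x. eta x \<le> 1" "\<And>x. x \<in> K ==> eta x = 1"
proof -
 obtain e where e: "e > 0" "\<And>x. x \<in> K ==> cball x e \<subseteq> U" using compact_thicken[OF assms] by metis
 \<comment> \<open>Half of the available width thickens \<open>K\<close> to \<open>S\<close>, the
   other half is used by the mollification. At points of \<open>K\<close> the kernel sees only
   \<open>S\<close>, which gives the value 1.\<close>
 define eps where "eps = e / 2"
 have eps: "eps > 0" using e by (simp add: eps_def)
 define S where "S = (\<Union>x\<in>K. cball x eps)"
 have S: "compact S" unfolding S_def by (rule compact_Union_cball[OF assms(1)])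
 have i: "Lint (ind S :: 'a => real)"
  using S by (auto intro!: integrable_real_indicator emeasure_compact_finite borel_compact)
 have "C1c_on U (convol (moll eps) (ind S :: 'a => real))"
 proof (rule convol_moll_C1c[OF eps i S])
  fix y assume "y \<in> S"
  then obtain x where "x \<in> K" "dist x y \<le> eps" by (auto simp: S_def)
  hence "cball y eps \<subseteq> cball x e"
   by (auto simp: eps_def) (smt (verit) dist_triangle field_sum_of_halves)
  thus "cball y eps \<subseteq> U" using e(2)[OF \<open>x \<in> K\<close>] by blast
 qed simp
 moreover have "0 \<le> convol (moll eps) (ind S :: 'a => real) x" for x
  unfolding convol_def by (intro Bintegral_nonneg) (simp add: moll_nonneg[OF eps])
 moreover have "convol (moll eps) (ind S :: 'a => real) x \<le> 1" for x
  using convol_moll_bound[OF eps, of "ind S :: 'a => real" 1 x] by (auto simp: indicator_def)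
 moreover have "convol (moll eps) (ind S :: 'a => real) x = 1" if "x \<in> K" for x
 proof -
  have "norm (convol (moll eps) (ind S :: 'a => real) x - 1) \<le> 0"
   by (rule convol_moll_near[OF eps i]) (use that in \<open>auto simp: indicator_def S_def dist_norm intro!: bexI[of _ x]\<close>)
  thus ?thesis by simp
 qed
 ultimately show thesis by (rule that)
qed

lemma compact_inner_approx:
 fixes A :: "'a::euclidean_space set"
 assumes A: "A \<in> sets borel" "evol A < \<infinity>" and e: "e > 0"
 obtains K where "compact K" "K \<subseteq> A" "evol (A - K) \<le> ennreal e"
proof -
 \<comment> \<open>Lebesgue measure restricted to \<open>A\<close> is finite, hence inner regular by
   compact sets.\<close>
 let ?M = "density lborel (ind A)"
 have em: "emeasure ?M B = evol (B \<inter> A)" if "B \<in> sets borel" for B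
  using A(1) that by (simp add: emeasure_density mult.commute[of "ind A _"] indicator_inter_arith[symmetric] del: nn_integral_indicator)
   (simp add: Int_ac)
 have fin: "emeasure ?M (space ?M) \<noteq> \<infinity>"
  using em[of UNIV] A by simp
 have "emeasure ?M A = (SUP K \<in> {K. K \<subseteq> A \<and> compact K}. emeasure ?M K)"
  by (rule inner_regular) (use A fin in auto)
 hence sup: "evol A = (SUP K \<in> {K. K \<subseteq> A \<and> compact K}. emeasure ?M K)"
  using em[OF A(1)] by simp
 show thesis
 proof (cases "evol A \<le> ennreal e")
  case True
  thus thesis using that[of "{}"] by simp
 next
  case False
  hence "evol A - ennreal e < evol A"
   using A(2) e by (intro ennreal_between) (auto simp: less_top not_le dest: order.strict_trans1[OF zero_le])
  then obtain K where K: "K \<subseteq> A" "compact K" "evol A - ennreal e < emeasure ?M K"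
   unfolding sup less_SUP_iff by auto
  have b: "K \<in> sets borel" using K(1,2) by (metis borel_compact)
  have "emeasure ?M K = evol K" using em[OF b] K by (simp add: Int_absorb2)
  hence *: "evol A - ennreal e < evol K" using K by simp
  have finK: "evol K < \<infinity>" using emeasure_mono[of K A lborel] K A by (auto intro: le_less_trans)
  have "evol (A - K) = evol A - evol K"
   using K A b finK by (intro emeasure_Diff) auto
  also have "\<dots> \<le> ennreal e"
   using * A finK by (metis ennreal_minus_le_iff less_imp_le add.commute infinity_ennreal_def less_irrefl)
  finally show thesis using that K by blast
 qed
qed

lemma C1c_approx_indicator:
 fixes A :: "'a::euclidean_space set"
 assumes A: "A \<in> sets borel" "evol A < \<infinity>" and W: "open W" "A \<subseteq> W" and e: "e > 0"
 obtains psi :: "'a => real" where "C1c_on W psi" "\<And>x. 0 \<le> psi x" "\<And>x. psi x \<le> 1"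
  "(NBINT x. ennreal \<bar>ind A x - psi x\<bar>) \<le> ennreal e"
proof -
 obtain K where K: "compact K" "K \<subseteq> A" "evol (A - K) \<le> ennreal (e/2)"
  using compact_inner_approx[OF A, of "e/2"] e by auto
 have Kb: "K \<in> sets borel" using K(1,2) by (metis borel_compact)
 obtain U where U: "open U" "K \<subseteq> U" "evol (U - K) < ennreal (e/2)"
  using outer_regular_lborel[OF Kb, of "e/2"] e by auto
 obtain psi :: "'a => real" where psi: "C1c_on (U \<inter> W) psi" "\<And>x. 0 \<le> psi x" "\<And>x. psi x \<le> 1" "\<And>x. x \<in> K ==> psi x = 1"
  by (rule smooth_cutoff[OF K(1), of "U \<inter> W"]) (use U W K in auto)
 \<comment> \<open>\<open>psi\<close> is 1 on \<open>K\<close> and 0 off \<open>U\<close>, so it can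
   differ from the indicator only on the two thin sets.\<close>
 have "ennreal \<bar>ind A x - psi x\<bar> \<le> ind (A - K) x + ind (U - K) x" for x
  using psi(2,3)[of x] psi(4)[of x] C1c_on_outside(1)[OF psi(1), of x] K(2)
  by (auto simp: indicator_def abs_if split: if_splits intro: order_trans[of _ 1])
 hence "(NBINT x. ennreal \<bar>ind A x - psi x\<bar>)
  \<le> (NBINT x. ind (A - K) x + ind (U - K) x)"
  by (rule nn_integral_mono)
 also have "\<dots> = evol (A - K) + evol (U - K)"
  using A Kb borel_open[OF U(1)] by (subst nn_integral_add) auto
 also have "\<dots> \<le> ennreal (e/2) + ennreal (e/2)" using K U by (intro add_mono) auto
 also have "\<dots> = ennreal e" using e by (simp flip: ennreal_plus)
 finally show thesis using that psi C1c_on_mono[OF psi(1)] by blast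
qed

lemma C1c_dense_L1:
 fixes g :: "'a::euclidean_space => 'b::euclidean_space"
 assumes "Lint g"
 shows "\<forall>e>0. \<exists>psi. C1c_on UNIV psi \<and> (NBINT x. ennreal (norm (g x - psi x))) \<le> ennreal e"
 using assms
proof (induction rule: integrable_induct)
 case (base A c)
 show ?case
 proof (intro allI impI)
  fix e :: real assume e: "e > 0"
  define e' where "e' = e / (norm c + 1)"
  have e': "e' > 0" using e by (auto simp: e'_def intro!: divide_pos_pos add_nonneg_pos)
  obtain psi :: "'a => real" where psi: "C1c_on UNIV psi" "(NBINT x. ennreal \<bar>ind A x - psi x\<bar>) \<le> ennreal e'"
   by (rule C1c_approx_indicator[of A UNIV e']) (use base e' in auto)
  have [measurable]: "psi \<in> Borel" "A \<in> sets borel" using C1c_on_measurable[OF psi(1)] base by auto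
  have "(NBINT x. ennreal (norm (ind A x *\<^sub>R c - psi x *\<^sub>R c)))
   = (NBINT x. ennreal \<bar>ind A x - psi x\<bar> * ennreal (norm c))"
   by (simp flip: scaleR_diff_left ennreal_mult)
  also have "\<dots> = (NBINT x. ennreal \<bar>ind A x - psi x\<bar>) * ennreal (norm c)"
   by (rule nn_integral_multc) measurable
  also have "\<dots> \<le> ennreal e' * ennreal (norm c)" using psi by (intro mult_right_mono) auto
  also have "\<dots> \<le> ennreal e"
   using e e' by (subst ennreal_mult[symmetric]) (auto simp: e'_def divide_simps add_nonneg_eq_0_iff intro!: ennreal_leI)
  finally show "\<exists>psi. C1c_on UNIV psi \<and> (NBINT x. ennreal (norm (ind A x *\<^sub>R c - psi x))) \<le> ennreal e"
   using C1c_on_vec(1)[OF psi(1), of c] by blast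
 qed
next
 case (add f g)
 show ?case
 proof (intro allI impI)
  fix e :: real assume e: "e > 0"
  hence "e/2 > 0" by simp
  obtain psi psi2 where p: "C1c_on UNIV psi" "(NBINT x. ennreal (norm (f x - psi x))) \<le> ennreal (e/2)"
   "C1c_on UNIV psi2" "(NBINT x. ennreal (norm (g x - psi2 x))) \<le> ennreal (e/2)"
   using add.IH(1)[rule_format, OF \<open>e/2 > 0\<close>] add.IH(2)[rule_format, OF \<open>e/2 > 0\<close>] by blast
  note [measurable] = C1c_on_measurable[OF p(1)] C1c_on_measurable[OF p(3)]
   borel_measurable_integrable[OF add.hyps(1)] borel_measurable_integrable[OF add.hyps(2)]
  have "(NBINT x. ennreal (norm (f x + g x - (psi x + psi2 x))))
   \<le> (NBINT x. ennreal (norm (f x - psi x)) + ennreal (norm (g x - psi2 x)))"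
  proof (intro nn_integral_mono)
   fix x
   have "norm (f x + g x - (psi x + psi2 x)) \<le> norm (f x - psi x) + norm (g x - psi2 x)"
    by (rule norm_diff_triangle_ineq)
   from ennreal_leI[OF this] show "ennreal (norm (f x + g x - (psi x + psi2 x)))
    \<le> ennreal (norm (f x - psi x)) + ennreal (norm (g x - psi2 x))" by simp
  qed
  also have "\<dots> = (NBINT x. ennreal (norm (f x - psi x))) + (NBINT x. ennreal (norm (g x - psi2 x)))"
   by (rule nn_integral_add) measurable
  also have "\<dots> \<le> ennreal (e/2) + ennreal (e/2)" using p by (intro add_mono)
  also have "\<dots> = ennreal e" using e by (simp flip: ennreal_plus)
  finally show "\<exists>psi. C1c_on UNIV psi \<and> (NBINT x. ennreal (norm (f x + g x - psi x))) \<le> ennreal e"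
   using C1c_on_add(1)[OF p(1,3)] by blast
 qed
next
 case (lim f s)
 show ?case
 proof (intro allI impI)
  fix e :: real assume e: "e > 0"
  have "(\<lambda>i. NBINT x. ennreal (norm (f x - s i x))) \<longlonglongrightarrow> 0"
   using lim.hyps by (intro nn_integral_dominated_convergence_norm[where w = "\<lambda>x. 2 * norm (f x)"])
    (auto simp: integrable_iff_bounded nn_integral_cmult ennreal_mult ennreal_mult_less_top)
  hence "eventually (\<lambda>i. (NBINT x. ennreal (norm (f x - s i x))) < ennreal (e/2)) sequentially"
   using e by (intro order_tendstoD) auto
  then obtain i where i: "(NBINT x. ennreal (norm (f x - s i x))) < ennreal (e/2)"
   by (auto simp: eventually_sequentially)
  have "e/2 > 0" using e by simp
  obtain psi where p: "C1c_on UNIV psi" "(NBINT x. ennreal (norm (s i x - psi x))) \<le> ennreal (e/2)"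
   using lim.IH[of i] \<open>e/2 > 0\<close> by metis
  note [measurable] = C1c_on_measurable[OF p(1)]
   borel_measurable_integrable[OF lim.hyps(1)] borel_measurable_integrable[OF lim.hyps(4)]
  have "norm (f x - psi x) \<le> norm (f x - s i x) + norm (s i x - psi x)" for x
   using norm_triangle_ineq[of "f x - s i x" "s i x - psi x"] by simp
  hence "(NBINT x. ennreal (norm (f x - psi x)))
   \<le> (NBINT x. ennreal (norm (f x - s i x)) + ennreal (norm (s i x - psi x)))"
   by (intro nn_integral_mono) (auto simp flip: ennreal_plus intro!: ennreal_leI)
  also have "\<dots> = (NBINT x. ennreal (norm (f x - s i x))) + (NBINT x. ennreal (norm (s i x - psi x)))"
   by (rule nn_integral_add) measurable
  also have "\<dots> \<le> ennreal (e/2) + ennreal (e/2)" using p i by (intro add_mono) auto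
  also have "\<dots> = ennreal e" using e by (simp flip: ennreal_plus)
  finally show "\<exists>psi. C1c_on UNIV psi \<and> (NBINT x. ennreal (norm (f x - psi x))) \<le> ennreal e"
   using p by blast
 qed
qed

text \<open>A C^1 function approximates \<open>g\<close> in L^1; mollification does not increase the
  L^1 norm of the difference, and for the C^1 function the error is of order eps on a fixed compact
  set.\<close>

lemma convol_moll_L1:
 assumes g: "Lint g" and e: "e > 0"
 shows "\<exists>d>0. \<forall>eps. 0 < eps \<and> eps < d \<longrightarrow> (NBINT x. ennreal (norm (convol (moll eps) g x - g x))) \<le> ennreal e"
proof -
 have "e / 4 > 0" using e by simp
 then obtain psi where psi: "C1c_on UNIV psi" "(NBINT x. ennreal (norm (g x - psi x))) \<le> ennreal (e/4)"
  using C1c_dense_L1[OF g] by metis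
 have ipsi: "Lint psi" using C1c_on_integrable[OF psi(1)] .
 note [measurable] = borel_measurable_integrable[OF g] C1c_on_measurable[OF psi(1)]
 obtain K where K: "compact K" "\<And>x. x \<notin> K ==> psi x = 0" using C1c_onE[OF psi(1)] by metis
 obtain C where C: "C \<ge> 0" "\<And>x y. norm (psi x - psi y) \<le> C * norm (x - y)" using C1c_on_lipschitz[OF psi(1)] by blast
 let ?S = "\<Union>x\<in>K. cball x 1"
 have S: "compact ?S" by (rule compact_Union_cball[OF K(1)])
 define V where "V = vol ?S"
 have V: "evol ?S = ennreal V" "V \<ge> 0"
  unfolding V_def using emeasure_compact_finite[OF S] by (auto simp: emeasure_eq_ennreal_measure)
 \<comment> \<open>The 1 keeps the mollified function inside the 1-neighbourhood of
   \<open>K\<close>; the other bound makes the uniform error times the volume \<open>V\<close> at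
   most e/4.\<close>
 define d where "d = min 1 (e / (4 * (C * V + 1)))"
 have CV: "C * V \<ge> 0" using C V by simp
 hence d: "d > 0" using e by (simp add: d_def add_nonneg_pos)
 have "(NBINT x. ennreal (norm (convol (moll eps) g x - g x))) \<le> ennreal e" if eps: "0 < eps" "eps < d" for eps
 proof -
  note mm = convol_moll_measurable[OF eps(1)]
  have p: "norm (convol (moll eps) psi x - psi x) \<le> (C * eps) * ind ?S x" for x
  proof (cases "x \<in> ?S")
   case True
   have "norm (convol (moll eps) psi x - psi x) \<le> C * eps"
   proof (rule convol_moll_near[OF eps(1) ipsi])
    fix y assume "norm (x - y) < eps"
    thus "norm (psi y - psi x) \<le> C * eps" using C(2)[of y x] C(1)
     by (smt (verit) mult_left_mono norm_minus_commute)
   qed (use C eps in auto)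
   with True show ?thesis by (simp add: indicator_def)
  next
   case False
   have "y \<notin> K" if "y \<in> ball x eps" for y
    using False that eps by (auto simp: d_def dist_commute)
   hence "convol (moll eps) psi x = 0" "psi x = 0" using K(2) eps by (auto intro!: convol_moll_outside)
   thus ?thesis using C eps by simp
  qed
  have "norm (convol (moll eps) g x - g x) \<le> norm (convol (moll eps) (\<lambda>y. g y - psi y) x)
    + (C * eps) * ind ?S x + norm (g x - psi x)" for x
  proof -
   have "convol (moll eps) g x - g x = convol (moll eps) (\<lambda>y. g y - psi y) x
    + (convol (moll eps) psi x - psi x) - (g x - psi x)"
    by (simp add: convol_moll_add(2)[OF eps(1) g ipsi])
   thus ?thesis using p[of x]
    by (smt (verit) norm_triangle_ineq norm_triangle_ineq4)
  qed
  hence "ennreal (norm (convol (moll eps) g x - g x)) \<le> ennreal (norm (convol (moll eps) (\<lambda>y. g y - psi y) x))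
    + ennreal (C * eps) * ind ?S x + ennreal (norm (g x - psi x))" for x
   using C eps by (subst ennreal_indicator[symmetric], subst ennreal_mult[symmetric])
    (auto simp flip: ennreal_plus intro!: ennreal_leI)
  hence "(NBINT x. ennreal (norm (convol (moll eps) g x - g x))) \<le>
   (NBINT x. ennreal (norm (convol (moll eps) (\<lambda>y. g y - psi y) x))
    + ennreal (C * eps) * ind ?S x + ennreal (norm (g x - psi x)))"
   by (intro nn_integral_mono)
  also have "\<dots> = (NBINT x. ennreal (norm (convol (moll eps) (\<lambda>y. g y - psi y) x)))
    + ennreal (C * eps) * evol ?S + (NBINT x. ennreal (norm (g x - psi x)))"
   using mm[of "\<lambda>y. g y - psi y"] borel_compact[OF S]
   by (subst nn_integral_add, measurable)+ (simp add: nn_integral_cmult_indicator)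
  also have "\<dots> \<le> ennreal (e/4) + ennreal (C * eps) * ennreal V + ennreal (e/4)"
   using order_trans[OF nn_integral_norm_convol_moll_le[OF eps(1), of "\<lambda>y. g y - psi y"] psi(2)] psi(2) V
   by (intro add_mono) auto
  also have "\<dots> \<le> ennreal (e/4) + ennreal (e/4) + ennreal (e/4)"
  proof -
   have "C * eps * V = (C * V) * eps" by simp
   also have "\<dots> \<le> (C * V + 1) * (e / (4 * (C * V + 1)))"
    using CV eps by (intro mult_mono) (auto simp: d_def)
   also have "\<dots> = e/4" using CV by (simp add: field_simps add_nonneg_eq_0_iff)
   finally have "ennreal (C * eps) * ennreal V \<le> ennreal (e/4)"
    using C V eps by (subst ennreal_mult[symmetric]) (auto intro: ennreal_leI)
   thus ?thesis by (intro add_mono) auto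
  qed
  also have "\<dots> \<le> ennreal e" using e by (auto simp flip: ennreal_plus intro!: ennreal_leI)
  finally show ?thesis .
 qed
 with d show ?thesis by blast
qed

lemma ennreal_tendsto_0I:
 fixes f :: "nat => ennreal"
 assumes "\<And>r. r > 0 ==> \<exists>N. \<forall>n\<ge>N. f n \<le> ennreal r"
 shows "f \<longlonglongrightarrow> 0"
proof (rule order_tendstoI)
 fix a :: ennreal assume "0 < a"
 then obtain r where r: "0 < r" "ennreal r < a"
  by (metis dense ennreal_cases ennreal_less_zero_iff less_top_ennreal order_less_trans top.not_eq_extremum)
 thus "eventually (\<lambda>n. f n < a) sequentially"
  using assms[OF r(1)] by (auto simp: eventually_sequentially intro: le_less_trans)
qed auto

text \<open>The centres of a cover of the closure may lie outside \<open>Q\<close>; each ball that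
  meets \<open>Q\<close> gets a point of \<open>Q\<close> instead, and the radius dlt/2 becomes
  dlt.\<close>

lemma finite_net_in_subset:
 fixes Q :: "'a::heine_borel set"
 assumes "bounded Q" "dlt > 0"
 obtains F where "finite F" "F \<subseteq> Q" "\<And>t. t \<in> Q ==> \<exists>s\<in>F. dist t s < dlt"
proof -
 have "compact (closure Q)" using assms(1) by simp
 hence "\<exists>k. finite k \<and> closure Q \<subseteq> (\<Union>x\<in>k. ball x (dlt/2))"
  using assms(2) by (metis compact_eq_totally_bounded half_gt_zero)
 then obtain k where k: "finite k" "closure Q \<subseteq> (\<Union>x\<in>k. ball x (dlt/2))" by blast
 define p where "p x = (SOME t. t \<in> Q \<inter> ball x (dlt/2))" for x
 let ?k = "{x\<in>k. Q \<inter> ball x (dlt/2) \<noteq> {}}"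
 have p: "p x \<in> Q \<inter> ball x (dlt/2)" if "x \<in> ?k" for x
  unfolding p_def by (rule someI_ex) (use that in blast)
 show thesis
 proof (rule that[of "p ` ?k"])
  fix t assume "t \<in> Q"
  then obtain x where x: "x \<in> k" "t \<in> ball x (dlt/2)" using k closure_subset by blast
  hence "x \<in> ?k" using \<open>t \<in> Q\<close> by auto
  moreover have "dist t (p x) < dlt"
   using p[OF \<open>x \<in> ?k\<close>] x dist_triangle_half_r[of x t dlt "p x"] by (auto simp: dist_commute)
  ultimately show "\<exists>s\<in>p ` ?k. dist t s < dlt" by blast
 qed (use k p in auto)
qed

text \<open>For almost every y the modulus of continuity of \<open>g y\<close> on the compact
  interval tends to 0 and is dominated by \<open>2 * G y\<close>, so its integral tends to 0. Up to
  it, the supremum over \<open>Q\<close> reduces to a finite net, to which plain L^1 convergence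
  applies. Countability of \<open>Q\<close> keeps the suprema measurable.\<close>

lemma convol_moll_uniform_L1:
 fixes g :: "'a::euclidean_space => real => 'b::euclidean_space"
 assumes meas: "(\<lambda>p. g (fst p) (snd p)) \<in> Borel"
  and G: "Lint G" "\<And>y t. norm (g y t) \<le> G y"
  and cont: "AE y in lborel. continuous_on UNIV (g y)"
  and Q: "countable Q" "Q \<subseteq> {-M..M}" and e: "e > 0"
 shows "\<exists>d>0. \<forall>eps. 0 < eps \<and> eps < d \<longrightarrow>
  (NBINT x. (SUP t\<in>Q. ennreal (norm (convol (moll eps) (\<lambda>y. g y t) x - g x t)))) \<le> ennreal e"
proof -
 have m[measurable]: "(\<lambda>y. g y t) \<in> Borel" for t
 proof -
  have "(\<lambda>y. (\<lambda>p. g (fst p) (snd p)) (y, t)) \<in> Borel"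
   by (rule measurable_compose[OF _ meas]) (simp add: borel_prod[symmetric])
  thus ?thesis by simp
 qed
 have i: "Lint (\<lambda>y. g y t)" for t
  by (rule Bintegrable_bound[OF G(1)]) (use G(2) in \<open>auto intro: order_trans[OF _ abs_ge_self]\<close>)
 note [measurable] = borel_measurable_integrable[OF G(1)]
 have G0: "G y \<ge> 0" for y using G(2)[of y 0] norm_ge_zero order_trans by blast
 have finG: "(NBINT y. ennreal (2 * G y)) < \<infinity>"
 proof -
  have "Lint (\<lambda>y. 2 * G y)" using G by simp
  thus ?thesis using G0 by (subst nn_integral_eq_integral) auto
 qed
 \<comment> \<open>Pairs of levels at distance at most 1/(n+1); \<open>\<omega> n y\<close> is then
   the modulus of continuity of \<open>g y\<close> along \<open>Q\<close> at that step.\<close>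
 define P where "P n = {p \<in> Q \<times> Q. \<bar>fst p - snd p\<bar> \<le> 1 / real (Suc n)}" for n
 have cP: "countable (P n)" for n unfolding P_def using Q by (intro countable_subset[OF _ countable_SIGMA[of Q "\<lambda>_. Q"]]) auto
 define \<omega> where "\<omega> n y = (SUP p\<in>P n. ennreal (norm (g y (fst p) - g y (snd p))))" for n y
 have [measurable]: "\<omega> n \<in> Borel" for n
  unfolding \<omega>_def by (intro borel_measurable_SUP cP) measurable
 have \<omega>le: "\<omega> n y \<le> ennreal (2 * G y)" for n y
  unfolding \<omega>_def using G(2)
  by (intro SUP_least ennreal_leI) (smt (verit) norm_triangle_ineq4)
 have \<omega>0: "(\<lambda>n. \<omega> n y) \<longlonglongrightarrow> 0" if c: "continuous_on UNIV (g y)" for y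
 proof (rule ennreal_tendsto_0I)
  show "\<exists>N. \<forall>n\<ge>N. \<omega> n y \<le> ennreal r" if "r > 0" for r
  proof -
   have "uniformly_continuous_on {-M..M} (g y)"
    by (intro compact_uniformly_continuous continuous_on_subset[OF c]) auto
   then obtain d where d: "d > 0" "\<And>s t. s \<in> {-M..M} ==> t \<in> {-M..M} ==> dist s t < d ==> dist (g y s) (g y t) < r"
    unfolding uniformly_continuous_on_def using \<open>r > 0\<close> by metis
   obtain N where N: "1 / real (Suc N) < d" using d(1) by (metis nat_approx_posE)
   have "\<omega> n y \<le> ennreal r" if "n \<ge> N" for n
    unfolding \<omega>_def
   proof (intro SUP_least ennreal_leI)
    fix p assume p: "p \<in> P n"
    have "1 / real (Suc n) \<le> 1 / real (Suc N)" using that by (intro divide_left_mono) auto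
    hence "dist (fst p) (snd p) < d" using p N by (auto simp: P_def dist_real_def)
    thus "norm (g y (fst p) - g y (snd p)) \<le> r"
     using d(2)[of "fst p" "snd p"] p Q(2) by (force simp: P_def dist_norm)
   qed
   thus ?thesis by blast
  qed
 qed
 have "(\<lambda>n. NBINT y. \<omega> n y) \<longlonglongrightarrow> (\<integral>\<^sup>+y. 0 \<partial>(lborel::'a measure))"
  by (rule nn_integral_dominated_convergence[where w = "\<lambda>y. ennreal (2 * G y)"])
   (use \<omega>le finG cont \<omega>0 in \<open>auto elim!: eventually_mono\<close>)
 hence "eventually (\<lambda>n. (NBINT y. \<omega> n y) < ennreal (e/3)) sequentially"
  using e by (intro order_tendstoD) auto
 then obtain n where n: "(NBINT y. \<omega> n y) < ennreal (e/3)"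
  by (auto simp: eventually_sequentially)
 obtain F where F: "finite F" "F \<subseteq> Q" "\<And>t. t \<in> Q ==> \<exists>s\<in>F. dist t s < 1 / real (Suc n)"
  using finite_net_in_subset[of Q "1 / real (Suc n)"] bounded_subset[OF bounded_closed_interval Q(2)] by auto
 define e' where "e' = e / (3 * (real (card F) + 1))"
 have e': "e' > 0" using e by (auto simp: e'_def intro!: divide_pos_pos)
 have "\<exists>d>0. \<forall>eps. 0 < eps \<and> eps < d \<longrightarrow> (NBINT x. ennreal (norm (convol (moll eps) (\<lambda>y. g y s) x - g x s))) \<le> ennreal e'" for s
  using convol_moll_L1[OF i e'] .
 then obtain d where d: "\<And>s. d s > 0" "\<And>s eps. 0 < eps ==> eps < d s ==>
   (NBINT x. ennreal (norm (convol (moll eps) (\<lambda>y. g y s) x - g x s))) \<le> ennreal e'" by metis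
 define D where "D = Min (insert 1 (d ` F))"
 have D: "D > 0" "\<And>s. s \<in> F ==> D \<le> d s" unfolding D_def using F(1) d(1) by (auto simp: Min_gr_iff)
 have "(NBINT x. (SUP t\<in>Q. ennreal (norm (convol (moll eps) (\<lambda>y. g y t) x - g x t)))) \<le> ennreal e"
  if eps: "0 < eps" "eps < D" for eps
 proof -
  note moll_measurable[OF eps(1), measurable]
  let ?c = "\<lambda>x. NBINT y. ennreal (moll eps (x - y)) * \<omega> n y"
  let ?r = "\<lambda>s x. ennreal (norm (convol (moll eps) (\<lambda>y. g y s) x - g x s))"
  have [measurable]: "convol (moll eps) (\<lambda>y. g y s) \<in> Borel" for s
   by (rule convol_moll_measurable[OF eps(1)]) measurable
  have cm: "?c \<in> borel_measurable lborel" by measurable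
  \<comment> \<open>Passing from t to a net point s costs the modulus twice, once mollified and once
    pointwise; the rest is the plain error at s, bounded by the sum over the net.\<close>
  have pt: "?r t x \<le> ?c x + \<omega> n x + (\<Sum>s\<in>F. ?r s x)" if t: "t \<in> Q" for t x
  proof -
   obtain s where s: "s \<in> F" "dist t s < 1 / real (Suc n)" using F(3)[OF t] by blast
   have pP: "(t, s) \<in> P n" "(s, t) \<in> P n" using s t F(2) by (auto simp: P_def dist_real_def)
   have w: "ennreal (norm (g y t - g y s)) \<le> \<omega> n y" "ennreal (norm (g y s - g y t)) \<le> \<omega> n y" for y
    unfolding \<omega>_def
    by (rule SUP_upper2[OF pP(1)], simp, rule SUP_upper2[OF pP(2)], simp)
   have eq: "convol (moll eps) (\<lambda>y. g y t) x - g x t = convol (moll eps) (\<lambda>y. g y t - g y s) x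
    + (g x s - g x t) + (convol (moll eps) (\<lambda>y. g y s) x - g x s)"
    by (simp add: convol_moll_add(2)[OF eps(1) i i])
   have "norm (convol (moll eps) (\<lambda>y. g y t) x - g x t) \<le> norm (convol (moll eps) (\<lambda>y. g y t - g y s) x)
    + norm (g x s - g x t) + norm (convol (moll eps) (\<lambda>y. g y s) x - g x s)"
    unfolding eq using norm_triangle_ineq[of "convol (moll eps) (\<lambda>y. g y t - g y s) x + (g x s - g x t)" "convol (moll eps) (\<lambda>y. g y s) x - g x s"]
     norm_triangle_ineq[of "convol (moll eps) (\<lambda>y. g y t - g y s) x" "g x s - g x t"] by linarith
   hence "?r t x \<le> ennreal (norm (convol (moll eps) (\<lambda>y. g y t - g y s) x)) + ennreal (norm (g x s - g x t)) + ?r s x"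
    by (auto simp flip: ennreal_plus intro!: ennreal_leI)
   also have "\<dots> \<le> ?c x + \<omega> n x + (\<Sum>s\<in>F. ?r s x)"
   proof (intro add_mono)
    have "ennreal (norm (convol (moll eps) (\<lambda>y. g y t - g y s) x)) \<le>
     (NBINT y. ennreal (moll eps (x - y)) * ennreal (norm (g y t - g y s)))"
     by (rule norm_convol_le_nn_integral[OF moll_nonneg[OF eps(1)]])
    also have "\<dots> \<le> ?c x" by (intro nn_integral_mono mult_left_mono w) auto
    finally show "ennreal (norm (convol (moll eps) (\<lambda>y. g y t - g y s) x)) \<le> ?c x" .
    show "?r s x \<le> (\<Sum>s\<in>F. ?r s x)" using s F(1) by (intro member_le_sum) auto
   qed (rule w)
   finally show ?thesis .
  qed
  have "(NBINT x. (SUP t\<in>Q. ?r t x)) \<le> (NBINT x. ?c x + \<omega> n x + (\<Sum>s\<in>F. ?r s x))"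
   by (intro nn_integral_mono SUP_least pt)
  also have "\<dots> = (NBINT x. ?c x) + (NBINT x. \<omega> n x) + (\<Sum>s\<in>F. NBINT x. ?r s x)"
   using cm by (subst nn_integral_add, measurable)+ (subst nn_integral_sum, measurable)
  also have "\<dots> \<le> ennreal (e/3) + ennreal (e/3) + (\<Sum>s\<in>F. ennreal e')"
  proof (intro add_mono sum_mono)
   show "(NBINT x. ?c x) \<le> ennreal (e/3)"
    using n nn_integral_convol_moll[OF eps(1), of "\<omega> n"] by simp
   show "(NBINT x. \<omega> n x) \<le> ennreal (e/3)" using n by simp
   show "(NBINT x. ?r s x) \<le> ennreal e'" if "s \<in> F" for s
    using d(2)[of eps s] D(2)[OF that] eps by simp
  qed
  also have "\<dots> = ennreal (e/3 + e/3 + (\<Sum>s\<in>F. e'))"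
   using e e' by (subst sum_ennreal) (simp_all flip: ennreal_plus)
  also have "\<dots> \<le> ennreal e"
  proof (rule ennreal_leI)
   have "(\<Sum>s\<in>F. e') \<le> e/3" using e by (simp add: e'_def field_simps)
   thus "e/3 + e/3 + (\<Sum>s\<in>F. e') \<le> e" by simp
  qed
  finally show ?thesis .
 qed
 with D show ?thesis by blast
qed


section \<open>Hausdorff content of codimension one\<close>

text \<open>\<open>content_le A e\<close> bounds the (N - 1)-dimensional Hausdorff content of A, up to the choice of
 normalisation; \<open>hnull\<close> are the sets that are negligible for the (N - 1)-dimensional Hausdorff measure.\<close>

definition content_le :: "'a::euclidean_space set => real => bool" where
 "content_le A e \<longleftrightarrow> (\<exists>c r. (\<forall>n::nat. 0 \<le> r n) \<and> A \<subseteq> (\<Union>n. ball (c n) (r n)) \<and>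
  (\<forall>n. (\<Sum>i<n. r i ^ (DIM('a) - 1)) \<le> e))"

definition hnull :: "'a::euclidean_space set => bool" where
 "hnull A \<longleftrightarrow> (\<forall>e>0. content_le A e)"

lemma content_le_subset: "content_le A e ==> B \<subseteq> A ==> e \<le> e' ==> content_le B e'"
 unfolding content_le_def by (meson order_trans)

lemma hnull_subset: "hnull A ==> B \<subseteq> A ==> hnull B"
 unfolding hnull_def using content_le_subset by blast

lemma content_leI_countable:
 fixes A :: "'a::euclidean_space set" and c :: "'i => 'a"
 assumes "DIM('a) \<ge> 2" "countable C" "\<And>i. i \<in> C ==> 0 \<le> r i" "A \<subseteq> (\<Union>i\<in>C. ball (c i) (r i))"
  "\<And>F. finite F ==> F \<subseteq> C ==> (\<Sum>i\<in>F. r i ^ (DIM('a) - 1)) \<le> e"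
 shows "content_le A e"
proof -
 define J where "J = to_nat_on C ` C"
 \<comment> \<open>Indices outside \<open>J\<close> get radius 0: such a ball is empty, and its
   power is 0 because the exponent N - 1 is positive.\<close>
 define r' where "r' n = (if n \<in> J then r (from_nat_into C n) else 0)" for n
 have fn: "from_nat_into C n \<in> C" if "n \<in> J" for n
  by (rule from_nat_into) (use that in \<open>auto simp: J_def\<close>)
 show ?thesis unfolding content_le_def
 proof (intro exI[of _ "\<lambda>n. c (from_nat_into C n)"] exI[of _ r'] conjI allI)
  show "0 \<le> r' n" for n using fn assms(3) by (simp add: r'_def)
  show "A \<subseteq> (\<Union>n. ball (c (from_nat_into C n)) (r' n))"
  proof
   fix x assume "x \<in> A"
   then obtain i where i: "i \<in> C" "x \<in> ball (c i) (r i)" using assms(4) by blast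
   have "to_nat_on C i \<in> J" "from_nat_into C (to_nat_on C i) = i" using i assms(2) by (auto simp: J_def)
   thus "x \<in> (\<Union>n. ball (c (from_nat_into C n)) (r' n))"
    using i by (intro UN_I[of "to_nat_on C i"]) (auto simp: r'_def)
  qed
  fix n
  have inj: "inj_on (from_nat_into C) ({..<n} \<inter> J)"
   using assms(2) by (intro inj_onI) (auto simp: J_def)
  have "(\<Sum>i<n. r' i ^ (DIM('a) - 1)) = (\<Sum>i\<in>{..<n} \<inter> J. r (from_nat_into C i) ^ (DIM('a) - 1))"
   using assms(1) by (intro sum.mono_neutral_cong_right) (auto simp: r'_def)
  also have "\<dots> = (\<Sum>i\<in>from_nat_into C ` ({..<n} \<inter> J). r i ^ (DIM('a) - 1))"
   by (simp add: sum.reindex[OF inj])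
  also have "\<dots> \<le> e" by (rule assms(5)) (use fn in auto)
  finally show "(\<Sum>i<n. r' i ^ (DIM('a) - 1)) \<le> e" .
 qed
qed

lemma content_le_Union:
 fixes A :: "nat => 'a::euclidean_space set"
 assumes "DIM('a) \<ge> 2" "\<And>n. content_le (A n) (e n)" "\<And>n. (\<Sum>i<n. e i) \<le> E"
 shows "content_le (\<Union>n. A n) E"
proof -
 define P where "P n c r \<longleftrightarrow> (\<forall>m::nat. 0 \<le> r m) \<and> A n \<subseteq> (\<Union>m. ball (c m) (r m)) \<and>
  (\<forall>m. (\<Sum>i<m. r i ^ (DIM('a) - 1)) \<le> e n)" for n c r
 have "\<forall>n. \<exists>c r. P n c r"
  using assms(2) unfolding content_le_def P_def by blast
 then obtain c r where "\<And>n. P n (c n) (r n)" by metis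
 hence cr: "\<And>n m. 0 \<le> r n m" "\<And>n. A n \<subseteq> (\<Union>m. ball (c n m) (r n m))"
  "\<And>n m. (\<Sum>i<m. r n i ^ (DIM('a) - 1)) \<le> e n"
  unfolding P_def by blast+
 show ?thesis
 proof (rule content_leI_countable[OF assms(1), of "UNIV :: (nat \<times> nat) set" "\<lambda>p. r (fst p) (snd p)" _ "\<lambda>p. c (fst p) (snd p)"])
  show "(\<Union>n. A n) \<subseteq> (\<Union>p\<in>UNIV. ball (c (fst p) (snd p)) (r (fst p) (snd p)))"
   using cr(2) by fastforce
  fix F :: "(nat \<times> nat) set" assume "finite F"
  hence "finite (fst ` F)" "finite (snd ` F)" by auto
  then obtain n m where "fst ` F \<subseteq> {..<n}" "snd ` F \<subseteq> {..<m}"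
   by (meson finite_nat_bounded)
  hence F: "F \<subseteq> {..<n} \<times> {..<m}" by force
  have "(\<Sum>p\<in>F. r (fst p) (snd p) ^ (DIM('a) - 1)) \<le> (\<Sum>p\<in>{..<n} \<times> {..<m}. r (fst p) (snd p) ^ (DIM('a) - 1))"
   using F cr(1) by (intro sum_mono2) auto
  also have "\<dots> = (\<Sum>i<n. \<Sum>j<m. r i j ^ (DIM('a) - 1))"
   by (simp add: sum.cartesian_product case_prod_beta)
  also have "\<dots> \<le> (\<Sum>i<n. e i)" by (intro sum_mono cr(3))
  also have "\<dots> \<le> E" by (rule assms(3))
  finally show "(\<Sum>p\<in>F. r (fst p) (snd p) ^ (DIM('a) - 1)) \<le> E" .
 qed (use cr in auto)
qed

lemma sum_half_powers_le: "(\<Sum>i<n. c * (1/2) ^ Suc i) \<le> (c::real)" if "c \<ge> 0"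
proof -
 have "(\<Sum>i<n. c * (1/2) ^ Suc i) = c * (1 - (1/2) ^ n)"
  by (induction n) (auto simp: algebra_simps)
 also have "\<dots> \<le> c" using that by (simp add: mult_left_le)
 finally show ?thesis .
qed

lemma hnull_Union:
 fixes A :: "nat => 'a::euclidean_space set"
 assumes "DIM('a) \<ge> 2" "\<And>n. hnull (A n)"
 shows "hnull (\<Union>n. A n)"
 unfolding hnull_def
proof (intro allI impI)
 fix e :: real assume e: "e > 0"
 show "content_le (\<Union>n. A n) e"
  by (rule content_le_Union[OF assms(1), of _ "\<lambda>n. e * (1/2) ^ Suc n"])
   (use assms(2) e sum_half_powers_le in \<open>auto simp: hnull_def\<close>)
qed

lemma hnull_countable_Union:
 fixes A :: "'i => 'a::euclidean_space set"
 assumes "DIM('a) \<ge> 2" "countable I" "\<And>i. i \<in> I ==> hnull (A i)"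
 shows "hnull (\<Union>i\<in>I. A i)"
proof (cases "I = {}")
 case True
 have "content_le ({}::'a set) e" if "e > 0" for e
  by (rule content_leI_countable[OF assms(1), of "{}::nat set"]) (use that in auto)
 thus ?thesis using True by (simp add: hnull_def)
next
 case False
 hence "(\<Union>i\<in>I. A i) = (\<Union>n. A (from_nat_into I n))"
  using assms(2) by (metis UN_extend_simps(10) range_from_nat_into)
 thus ?thesis
  using hnull_Union[OF assms(1), of "\<lambda>n. A (from_nat_into I n)"] assms(3) False
  by (simp add: from_nat_into)
qed

lemma hnull_Un:
 fixes A B :: "'a::euclidean_space set"
 assumes "DIM('a) \<ge> 2" "hnull A" "hnull B" shows "hnull (A \<union> B)"
 using hnull_countable_Union[OF assms(1), of "{A, B}" "\<lambda>x. x"] assms by auto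

text \<open>Borel-Cantelli for the content: the union of all sets from index n on has content at
  most 2 c 2^-n.\<close>

lemma hnull_limsup:
 fixes A :: "nat => 'a::euclidean_space set"
 assumes "DIM('a) \<ge> 2" "\<And>n. content_le (A n) (c * (1/2) ^ n)" "c \<ge> 0"
 shows "hnull {x. \<forall>n. \<exists>m\<ge>n. x \<in> A m}"
 unfolding hnull_def
proof (intro allI impI)
 fix e :: real assume e: "e > 0"
 have "(\<lambda>n. 2 * c * (1/2) ^ n) \<longlonglongrightarrow> 2 * c * 0"
  by (intro tendsto_mult tendsto_const LIMSEQ_power_zero) auto
 hence "eventually (\<lambda>n. 2 * c * (1/2) ^ n < e) sequentially"
  using e by (intro order_tendstoD) auto
 then obtain n where n: "2 * c * (1/2) ^ n < e" by (auto simp: eventually_sequentially)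
 have "content_le (\<Union>k. A (n + k)) (2 * c * (1/2) ^ n)"
 proof (rule content_le_Union[OF assms(1,2)])
  fix m
  have "(\<Sum>i<m. c * (1/2) ^ (n + i)) = (\<Sum>i<m. (2 * c * (1/2) ^ n) * (1/2) ^ Suc i)"
   by (simp add: power_add mult.assoc)
  also have "\<dots> \<le> 2 * c * (1/2) ^ n" using assms(3) by (intro sum_half_powers_le) auto
  finally show "(\<Sum>i<m. c * (1/2) ^ (n + i)) \<le> 2 * c * (1/2) ^ n" .
 qed
 thus "content_le {x. \<forall>n. \<exists>m\<ge>n. x \<in> A m} e"
  by (rule content_le_subset) (use n in \<open>auto dest!: spec[of _ n] simp: le_iff_add\<close>)
qed

section \<open>Distributional gradients of indicators and a covering estimate\<close>

text \<open>\<open>dist_grad E\<close> is the distributional gradient of \<open>1\<^sub>E\<close>, tested against vector fields.\<close>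

definition dist_grad :: "'a::euclidean_space set => ('a => 'a) => real" where
 "dist_grad E Phi = - (LBINT x. ind E x * divergence Phi x)"

lemma dist_grad_integrable:
 assumes "E \<in> sets borel" "C1c_on \<Omega> Phi"
 shows "Lint (\<lambda>x. ind E x * divergence Phi x)"
 using integrable_mult_indicator[of E lborel "divergence Phi"] divergence_integrable[OF assms(2)] assms(1) by simp

lemma dist_grad_add:
 assumes "E \<in> sets borel" "C1c_on \<Omega> Phi" "C1c_on \<Omega>' Psi"
 shows "dist_grad E (\<lambda>x. Phi x + Psi x) = dist_grad E Phi + dist_grad E Psi"
 unfolding dist_grad_def divergence_add[OF assms(2,3)] distrib_left
 by (subst Bintegral_add) (auto intro: dist_grad_integrable assms)

lemma dist_grad_scaleR:
 assumes "C1c_on \<Omega> Phi"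
 shows "dist_grad E (\<lambda>x. c *\<^sub>R Phi x) = c * dist_grad E Phi"
proof -
 have "(LBINT x. ind E x * divergence (\<lambda>x. c *\<^sub>R Phi x) x) = (LBINT x. c * (ind E x * divergence Phi x))"
  by (simp add: divergence_scaleR[OF assms] mult.left_commute)
 thus ?thesis by (simp add: dist_grad_def)
qed

lemma dist_grad_uminus:
 assumes "C1c_on \<Omega> Phi" shows "dist_grad E (\<lambda>x. - Phi x) = - dist_grad E Phi"
 using dist_grad_scaleR[OF assms, of E "-1"] by simp

lemma dist_grad_diff:
 assumes "E \<in> sets borel" "C1c_on \<Omega> Phi" "C1c_on \<Omega>' Psi"
 shows "dist_grad E (\<lambda>x. Phi x - Psi x) = dist_grad E Phi - dist_grad E Psi"
 using dist_grad_add[OF assms(1,2) C1c_on_uminus[OF assms(3)]] dist_grad_uminus[OF assms(3)] by simp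

lemma dist_grad_zero: "dist_grad E (\<lambda>x. 0) = 0"
 unfolding dist_grad_def divergence_def by simp

lemma dist_grad_sum:
 assumes "E \<in> sets borel" "\<And>i. i \<in> I ==> C1c_on \<Omega> (Phi i)"
 shows "dist_grad E (\<lambda>x. \<Sum>i\<in>I. Phi i x) = (\<Sum>i\<in>I. dist_grad E (Phi i))"
 using assms(2)
proof (induction I rule: infinite_finite_induct)
 case (insert i F)
 hence "dist_grad E (\<lambda>x. Phi i x + (\<Sum>i\<in>F. Phi i x)) = dist_grad E (Phi i) + dist_grad E (\<lambda>x. \<Sum>i\<in>F. Phi i x)"
  by (intro dist_grad_add[OF assms(1), of \<Omega> _ \<Omega>] C1c_on_sum) auto
 thus ?case using insert by simp
qed (auto simp: dist_grad_zero)

text \<open>A pair of a vector field and a scalar bound for it. Testing \<open>dist_grad E Psi - dist_grad E (psi Phi)\<close> with such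
 pairs computes the total variation of the measure \<open>|D1\<^sub>E| - Phi \<bullet> D1\<^sub>E\<close> without constructing it.\<close>

definition test_pair :: "'a::euclidean_space set => ('a => 'a) => ('a => real) => bool" where
 "test_pair U Psi psi \<longleftrightarrow> C1c_on U Psi \<and> C1c_on U psi \<and> (\<forall>x. norm (Psi x) \<le> psi x \<and> psi x \<le> 1)"

text \<open>The supports lie in disjoint sets, so at most one \<open>psi i\<close> is nonzero at
  each point; this preserves the bound 1.\<close>

lemma test_pair_sum:
 assumes F: "finite F" "disjoint_family_on U F" "\<And>i. i \<in> F ==> U i \<subseteq> W" "\<And>i. i \<in> F ==> test_pair (U i) (Psi i) (psi i)"
 shows "test_pair W (\<lambda>x. \<Sum>i\<in>F. Psi i x) (\<lambda>x. \<Sum>i\<in>F. psi i x)"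
 unfolding test_pair_def
proof (intro conjI allI)
 have c: "C1c_on (U i) (Psi i)" "C1c_on (U i) (psi i)" "norm (Psi i x) \<le> psi i x" "psi i x \<le> 1" if "i \<in> F" for i x
  using F(4)[OF that] by (auto simp: test_pair_def)
 show "C1c_on W (\<lambda>x. \<Sum>i\<in>F. Psi i x)" "C1c_on W (\<lambda>x. \<Sum>i\<in>F. psi i x)"
  by (auto intro!: C1c_on_sum C1c_on_mono[OF c(1) F(3)] C1c_on_mono[OF c(2) F(3)])
 fix x
 show "norm (\<Sum>i\<in>F. Psi i x) \<le> (\<Sum>i\<in>F. psi i x)" using c by (intro sum_norm_le)
 show "(\<Sum>i\<in>F. psi i x) \<le> 1"
 proof (cases "\<exists>i\<in>F. x \<in> U i")
  case True
  then obtain i where i: "i \<in> F" "x \<in> U i" by blast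
  have "psi j x = 0" if "j \<in> F - {i}" for j
   using F(2) i that C1c_on_outside(1)[OF c(2), of j x] unfolding disjoint_family_on_def by blast
  hence "(\<Sum>j\<in>F. psi j x) = (\<Sum>j\<in>{i}. psi j x)" using i F(1) by (intro sum.mono_neutral_right) auto
  thus ?thesis using c(4)[OF i(1)] by simp
 next
  case False
  hence "psi j x = 0" if "j \<in> F" for j using C1c_on_outside(1)[OF c(2)] that by blast
  thus ?thesis by simp
 qed
qed

text \<open>A weak-type estimate. Vitali's lemma selects disjoint balls on which the excess is
  large. Their test pairs add up to one test pair in \<open>W\<close>, so the sum of r^(N-1) is at
  most c / kap; enlarging the balls five times covers the bad set.\<close>

lemma content_bad_points:
 fixes W :: "'a::euclidean_space set"
 assumes dim: "DIM('a) \<ge> 2" and W: "open W" and E: "E \<in> sets borel" and Phi: "C1c_on UNIV Phi"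
  and bound: "\<And>Psi psi. test_pair W Psi psi ==> dist_grad E Psi - dist_grad E (\<lambda>x. psi x *\<^sub>R Phi x) \<le> c"
  and kap: "kap > 0"
 shows "content_le {x\<in>W. \<forall>dlt>0. \<exists>r Psi psi. 0 < r \<and> r < dlt \<and> test_pair (ball x r) Psi psi \<and>
   kap * r ^ (DIM('a) - 1) < dist_grad E Psi - dist_grad E (\<lambda>x. psi x *\<^sub>R Phi x)} (5 ^ (DIM('a) - 1) * c / kap)"
  (is "content_le ?S _")
proof -
 define A where "A = ?S"
 \<comment> \<open>Radii below 1 give the uniform bound that the Vitali covering lemma asks
   for.\<close>
 define P where "P x r Psi psi \<longleftrightarrow> 0 < r \<and> r < 1 \<and> cball x r \<subseteq> W \<and> test_pair (ball x r) Psi psi \<and>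
   kap * r ^ (DIM('a) - 1) < dist_grad E Psi - dist_grad E (\<lambda>x. psi x *\<^sub>R Phi x)" for x r Psi psi
 have "\<exists>r Psi psi. P x r Psi psi" if x: "x \<in> A" for x
 proof -
  obtain d where d: "d > 0" "cball x d \<subseteq> W" using x W open_contains_cball unfolding A_def by blast
  have "min d 1 > 0" using d by simp
  then obtain r Psi psi where "0 < r" "r < min d 1" "test_pair (ball x r) Psi psi"
   "kap * r ^ (DIM('a) - 1) < dist_grad E Psi - dist_grad E (\<lambda>x. psi x *\<^sub>R Phi x)"
   using x unfolding A_def by blast
  moreover from this d have "cball x r \<subseteq> W" by auto
  ultimately show ?thesis unfolding P_def by (intro exI[of _ r] exI[of _ Psi] exI[of _ psi]) auto
 qed
 then obtain r Psi psi where "\<And>x. x \<in> A ==> P x (r x) (Psi x) (psi x)" by metis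
 hence r: "\<And>x. x \<in> A ==> 0 < r x \<and> r x \<le> 1 \<and> cball x (r x) \<subseteq> W"
  and t: "\<And>x. x \<in> A ==> test_pair (ball x (r x)) (Psi x) (psi x)"
  and big: "\<And>x. x \<in> A ==> kap * r x ^ (DIM('a) - 1) < dist_grad E (Psi x) - dist_grad E (\<lambda>y. psi x y *\<^sub>R Phi y)"
  unfolding P_def by (blast intro: less_imp_le)+
 obtain C where C: "countable C" "C \<subseteq> A"
  "pairwise (\<lambda>i j. disjnt (cball i (r i)) (cball j (r j))) C"
  "\<And>i. i \<in> A ==> \<exists>j. j \<in> C \<and> \<not> disjnt (cball i (r i)) (cball j (r j)) \<and>
            cball i (r i) \<subseteq> ball j (5 * r j)"
  using Vitali_covering_lemma_cballs_balls[of A r 1 "\<lambda>x. x"] r by blast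
 show ?thesis unfolding A_def[symmetric]
 proof (rule content_leI_countable[OF dim C(1), of "\<lambda>x. 5 * r x" _ "\<lambda>x. x"])
  show "A \<subseteq> (\<Union>i\<in>C. ball i (5 * r i))"
  proof
   fix x assume x: "x \<in> A"
   hence "x \<in> cball x (r x)" using r[OF x] by auto
   thus "x \<in> (\<Union>i\<in>C. ball i (5 * r i))" using C(4)[OF x] by blast
  qed
  show "0 \<le> 5 * r i" if "i \<in> C" for i using r C(2) that by fastforce
  fix F assume F: "finite F" "F \<subseteq> C"
  have FA: "i \<in> A" if "i \<in> F" for i using that F C(2) by blast
  have dj: "disjoint_family_on (\<lambda>x. ball x (r x)) F"
   unfolding disjoint_family_on_def
  proof (intro ballI impI)
   fix i j assume "i \<in> F" "j \<in> F" "i \<noteq> j"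
   hence "disjnt (cball i (r i)) (cball j (r j))" using C(3) F(2) by (auto simp: pairwise_def)
   thus "ball i (r i) \<inter> ball j (r j) = {}"
    using ball_subset_cball[of i "r i"] ball_subset_cball[of j "r j"] unfolding disjnt_def by blast
  qed
  have tp: "test_pair W (\<lambda>x. \<Sum>i\<in>F. Psi i x) (\<lambda>x. \<Sum>i\<in>F. psi i x)"
   by (rule test_pair_sum[OF F(1) dj]) (use r t FA ball_subset_cball in blast)+
  have c: "C1c_on W (Psi i)" "C1c_on W (\<lambda>x. psi i x *\<^sub>R Phi x)" if "i \<in> F" for i
  proof -
   have c1: "C1c_on (ball i (r i)) (Psi i)" "C1c_on (ball i (r i)) (psi i)" "ball i (r i) \<subseteq> W"
    using t[OF FA[OF that]] r[OF FA[OF that]] ball_subset_cball[of i "r i"] by (auto simp: test_pair_def)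
   show "C1c_on W (Psi i)" using C1c_on_mono[OF c1(1,3)] .
   have "C1c_on UNIV (\<lambda>x. psi i x *\<^sub>R Phi x)" by (rule C1c_on_C1c_mult[OF c1(2) Phi])
   obtain K where K: "compact K" "K \<subseteq> ball i (r i)" "\<And>x. x \<notin> K ==> psi i x = 0"
    using C1c_onE[OF c1(2)] by metis
   show "C1c_on W (\<lambda>x. psi i x *\<^sub>R Phi x)"
    using \<open>C1c_on UNIV (\<lambda>x. psi i x *\<^sub>R Phi x)\<close> K c1(3) unfolding C1c_on_def
    by (intro conjI exI[of _ K]) auto
  qed
  have "kap * (\<Sum>i\<in>F. r i ^ (DIM('a) - 1)) \<le> (\<Sum>i\<in>F. dist_grad E (Psi i) - dist_grad E (\<lambda>y. psi i y *\<^sub>R Phi y))"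
   unfolding sum_distrib_left by (intro sum_mono less_imp_le big FA)
  also have "\<dots> = dist_grad E (\<lambda>x. \<Sum>i\<in>F. Psi i x) - dist_grad E (\<lambda>x. \<Sum>i\<in>F. psi i x *\<^sub>R Phi x)"
   by (simp add: sum_subtractf dist_grad_sum[OF E c(1)] dist_grad_sum[OF E c(2)])
  also have "\<dots> \<le> c" using bound[OF tp] by (simp add: scaleR_left.sum)
  finally have "(\<Sum>i\<in>F. r i ^ (DIM('a) - 1)) \<le> c / kap" using kap by (simp add: field_simps)
  hence "5 ^ (DIM('a) - 1) * (\<Sum>i\<in>F. r i ^ (DIM('a) - 1)) \<le> 5 ^ (DIM('a) - 1) * (c / kap)"
   by (intro mult_left_mono) auto
  thus "(\<Sum>i\<in>F. (5 * r i) ^ (DIM('a) - 1)) \<le> 5 ^ (DIM('a) - 1) * c / kap"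
   by (simp add: power_mult_distrib sum_distrib_left)
 qed
qed


section \<open>Sets of finite perimeter: regular points and almost monotonicity\<close>

lemma emeasure_subset_ball_finite:
 assumes "A \<subseteq> ball x r" shows "evol A < \<infinity>"
proof -
 have "evol A \<le> evol (ball x r)" by (rule emeasure_mono[OF assms]) simp
 thus ?thesis using emeasure_lborel_ball_finite[of x r] by (rule le_less_trans)
qed

lemma fmeasurable_subset_ball:
 shows "A \<in> sets borel ==> A \<subseteq> ball x r ==> A \<in> fmeasurable lborel"
 using emeasure_subset_ball_finite by (intro fmeasurableI) auto

text \<open>The perimeter is bounded only inside the open set \<open>W\<close>, while finite volume
  of \<open>E\<close> makes its indicator integrable, so that it can be convolved.\<close>

locale finite_perimeter =
 fixes E W :: "'a::euclidean_space set" and V :: real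
 assumes dim: "DIM('a) \<ge> 2" and W: "open W" and E: "E \<in> sets borel" and finE: "evol E < \<infinity>"
  and per: "\<And>Phi. C1c_on W Phi ==> (\<And>x. norm (Phi x) \<le> 1) ==> dist_grad E Phi \<le> V"
begin

text \<open>\<open>K\<close> bounds the density of the perimeter measure at x, and \<open>nu\<close> is the (approximate) normal there, in the
 sense that the measure \<open>|D1\<^sub>E| - nu \<bullet> D1\<^sub>E\<close> has density 0. If \<open>norm nu < 1\<close> this forces \<open>|D1\<^sub>E|\<close> to
 have density 0, so no case distinction is needed.\<close>

definition regular_at :: "'a => 'a => real => bool" where
 "regular_at x nu K \<longleftrightarrow> norm nu \<le> 1 \<and> K \<ge> 0 \<and>
  (\<exists>dlt>0. \<forall>r. 0 < r \<and> r < dlt \<longrightarrow> (\<forall>Psi psi. test_pair (ball x r) Psi psi \<longrightarrow> dist_grad E Psi \<le> K * r ^ (DIM('a) - 1))) \<and>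
  (\<forall>e>0. \<exists>dlt>0. \<forall>r. 0 < r \<and> r < dlt \<longrightarrow> (\<forall>Psi psi. test_pair (ball x r) Psi psi \<longrightarrow>
    dist_grad E Psi - dist_grad E (\<lambda>y. psi y *\<^sub>R nu) \<le> e * r ^ (DIM('a) - 1)))"

text \<open>The zero field turns \<open>content_bad_points\<close> into a bound for the perimeter
  density; the resulting content is of order V / k and tends to 0.\<close>

lemma hnull_unbounded_density:
 "hnull {x\<in>W. \<forall>k::nat. \<forall>dlt>0. \<exists>r Psi psi. 0 < r \<and> r < dlt \<and> test_pair (ball x r) Psi psi \<and>
   real (Suc k) * r ^ (DIM('a) - 1) < dist_grad E Psi}" (is "hnull ?A")
 unfolding hnull_def
proof (intro allI impI)
 fix e :: real assume e: "e > 0"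
 obtain k :: nat where k: "5 ^ (DIM('a) - 1) * V / e < real k" using reals_Archimedean2 by blast
 have "content_le {x\<in>W. \<forall>dlt>0. \<exists>r Psi psi. 0 < r \<and> r < dlt \<and> test_pair (ball x r) Psi psi \<and>
   real (Suc k) * r ^ (DIM('a) - 1) < dist_grad E Psi - dist_grad E (\<lambda>x. psi x *\<^sub>R (\<lambda>_. 0) x)} (5 ^ (DIM('a) - 1) * V / real (Suc k))"
 proof (rule content_bad_points[OF dim W E C1c_on_zero])
  fix Psi psi assume "test_pair W Psi psi"
  hence "dist_grad E Psi \<le> V" by (intro per) (auto simp: test_pair_def intro: order_trans)
  thus "dist_grad E Psi - dist_grad E (\<lambda>x. psi x *\<^sub>R (\<lambda>_. 0) x) \<le> V" by (simp add: dist_grad_zero)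
 qed simp
 thus "content_le ?A e"
 proof (rule content_le_subset)
  show "5 ^ (DIM('a) - 1) * V / real (Suc k) \<le> e" using k e by (simp add: field_simps)
 qed (simp add: dist_grad_zero, blast)
qed

text \<open>A field with almost maximal \<open>dist_grad\<close> cannot be improved locally:
  \<open>Psi + (1 - psi) *\<^sub>R Phi\<close> is a competitor because norm Psi \<le> psi, and its
  gain is exactly the excess to be bounded.\<close>

lemma almost_maximal_field:
 assumes "eta > 0"
 obtains Phi where "C1c_on W Phi" "\<And>x. norm (Phi x) \<le> 1"
  "\<And>Psi psi. test_pair W Psi psi ==> dist_grad E Psi - dist_grad E (\<lambda>x. psi x *\<^sub>R Phi x) \<le> eta"
proof -
 let ?S = "dist_grad E ` {Phi. C1c_on W Phi \<and> (\<forall>x. norm (Phi x) \<le> 1)}"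
 have bdd: "bdd_above ?S" using per by (auto intro!: bdd_aboveI[of _ V])
 have ne: "?S \<noteq> {}" using C1c_on_zero by (auto intro!: exI[of _ "\<lambda>x. 0"])
 obtain Phi where Phi: "C1c_on W Phi" "\<And>x. norm (Phi x) \<le> 1" "Sup ?S - eta < dist_grad E Phi"
  using less_cSup_iff[OF ne bdd, of "Sup ?S - eta"] assms by auto
 show thesis
 proof (rule that[OF Phi(1,2)])
  fix Psi psi assume t: "test_pair W Psi psi"
  hence c: "C1c_on W Psi" "C1c_on W psi" and b: "\<And>x. norm (Psi x) \<le> psi x" "\<And>x. psi x \<le> 1"
   by (auto simp: test_pair_def)
  have c3: "C1c_on W (\<lambda>x. psi x *\<^sub>R Phi x)" by (rule C1c_on_C1c_mult[OF c(2) Phi(1)])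
  let ?T = "\<lambda>x. Psi x + (Phi x - psi x *\<^sub>R Phi x)"
  have "C1c_on W ?T" by (intro C1c_on_add C1c_on_diff c c3 Phi(1))
  moreover have "norm (?T x) \<le> 1" for x
  proof -
   have p: "0 \<le> psi x" using b(1)[of x] norm_ge_zero order_trans by blast
   have "norm (?T x) = norm (Psi x + (1 - psi x) *\<^sub>R Phi x)" by (simp add: algebra_simps)
   also have "\<dots> \<le> norm (Psi x) + (1 - psi x) * norm (Phi x)"
    using norm_triangle_ineq[of "Psi x" "(1 - psi x) *\<^sub>R Phi x"] b(2)[of x] by simp
   also have "\<dots> \<le> psi x + (1 - psi x) * 1" using b[of x] Phi(2)[of x] p by (intro add_mono mult_left_mono) auto
   finally show ?thesis by simp
  qed
  ultimately have "dist_grad E ?T \<le> Sup ?S" by (intro cSup_upper bdd) auto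
  moreover have "dist_grad E ?T = dist_grad E Psi + (dist_grad E Phi - dist_grad E (\<lambda>x. psi x *\<^sub>R Phi x))"
   using dist_grad_add[OF E c(1) C1c_on_diff[OF Phi(1) c3]] dist_grad_diff[OF E Phi(1) c3] by simp
  ultimately show "dist_grad E Psi - dist_grad E (\<lambda>x. psi x *\<^sub>R Phi x) \<le> eta" using Phi(3) by simp
 qed
qed

text \<open>\<open>nu\<close> is a cluster point of \<open>Phi j x\<close>. Off the limsup of the
  bad sets, the excess over \<open>Phi j\<close> has density at most 2^-j at x for all large j;
  continuity of \<open>Phi j\<close> and the density bound then replace \<open>Phi j\<close> by
  \<open>nu\<close> near x.\<close>

lemma hnull_not_regular: "\<exists>N. hnull N \<and> (\<forall>x\<in>W - N. \<exists>nu K. regular_at x nu K)"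
proof -
 have "\<exists>Phi. C1c_on W Phi \<and> (\<forall>x. norm (Phi x) \<le> 1) \<and> (\<forall>Psi psi. test_pair W Psi psi \<longrightarrow>
   dist_grad E Psi - dist_grad E (\<lambda>x. psi x *\<^sub>R Phi x) \<le> (1/4) ^ j)" for j :: nat
  using almost_maximal_field[of "(1/4) ^ j"] by (metis zero_less_divide_1_iff zero_less_numeral zero_less_power)
 then obtain Phi where Phi: "\<And>j::nat. C1c_on W (Phi j)" "\<And>j x. norm (Phi j x) \<le> 1"
  "\<And>j Psi psi. test_pair W Psi psi ==> dist_grad E Psi - dist_grad E (\<lambda>x. psi x *\<^sub>R Phi j x) \<le> (1/4) ^ j" by metis
 \<comment> \<open>The total excess of \<open>Phi j\<close> is at most 4^-j. With the threshold 2^-j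
   the bad sets have contents of order 2^-j, which are summable, and the threshold itself still
   tends to 0.\<close>
 define A where "A j = {x\<in>W. \<forall>dlt>0. \<exists>r Psi psi. 0 < r \<and> r < dlt \<and> test_pair (ball x r) Psi psi \<and>
   (1/2) ^ j * r ^ (DIM('a) - 1) < dist_grad E Psi - dist_grad E (\<lambda>x. psi x *\<^sub>R Phi j x)}" for j
 have cA: "content_le (A j) (5 ^ (DIM('a) - 1) * (1/2) ^ j)" for j
 proof -
  have "content_le (A j) (5 ^ (DIM('a) - 1) * (1/4) ^ j / (1/2) ^ j)"
   unfolding A_def
   by (rule content_bad_points[OF dim W E C1c_on_mono[OF Phi(1)] Phi(3)]) auto
  also have "(5 ^ (DIM('a) - 1) * (1/4) ^ j / (1/2) ^ j :: real) = 5 ^ (DIM('a) - 1) * (1/2) ^ j"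
   by (simp add: power_divide power_mult_distrib[symmetric] field_simps)
  finally show ?thesis .
 qed
 define N1 where "N1 = {x. \<forall>n. \<exists>m\<ge>n. x \<in> A m}"
 define N2 where "N2 = {x\<in>W. \<forall>k::nat. \<forall>dlt>0. \<exists>r Psi psi. 0 < r \<and> r < dlt \<and> test_pair (ball x r) Psi psi \<and>
   real (Suc k) * r ^ (DIM('a) - 1) < dist_grad E Psi}"
 have "hnull (N1 \<union> N2)"
  unfolding N1_def N2_def
  by (intro hnull_Un[OF dim] hnull_limsup[OF dim cA] hnull_unbounded_density) simp
 moreover have "\<exists>nu K. regular_at x nu K" if x: "x \<in> W - (N1 \<union> N2)" for x
 proof -
  obtain k :: nat and dlt1 where "dlt1 > 0" and ndlt1: "\<not> (\<exists>r Psi psi. 0 < r \<and> r < dlt1 \<and> test_pair (ball x r) Psi psi \<and>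
    real (Suc k) * r ^ (DIM('a) - 1) < dist_grad E Psi)"
   using x unfolding N2_def by blast
  hence dlt1: "dlt1 > 0" "\<And>r Psi psi. 0 < r ==> r < dlt1 ==> test_pair (ball x r) Psi psi ==>
    dist_grad E Psi \<le> real (Suc k) * r ^ (DIM('a) - 1)"
   by (auto simp only: not_less[symmetric])
  define K where "K = real (Suc k)"
  have K: "K \<ge> 0" by (simp add: K_def)
  obtain n where n: "\<And>j. j \<ge> n ==> x \<notin> A j" using x unfolding N1_def by blast
  have dlt2: "\<exists>dlt>0. \<forall>r Psi psi. 0 < r \<and> r < dlt \<and> test_pair (ball x r) Psi psi \<longrightarrow>
   dist_grad E Psi - dist_grad E (\<lambda>x. psi x *\<^sub>R Phi j x) \<le> (1/2) ^ j * r ^ (DIM('a) - 1)" if "j \<ge> n" for j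
   using n[OF that] x unfolding A_def by (simp only: not_less[symmetric]) blast
  have "compact (cball (0::'a) 1)" by simp
  moreover have "\<forall>j. Phi j x \<in> cball 0 1" using Phi(2) by simp
  ultimately obtain nu s where nu: "nu \<in> cball 0 1" "strict_mono (s :: nat => nat)" "((\<lambda>j. Phi j x) \<circ> s) \<longlonglongrightarrow> nu"
   unfolding compact_def by (metis (no_types, lifting))
  have "\<exists>dlt>0. \<forall>r. 0 < r \<and> r < dlt \<longrightarrow> (\<forall>Psi psi. test_pair (ball x r) Psi psi \<longrightarrow>
    dist_grad E Psi - dist_grad E (\<lambda>y. psi y *\<^sub>R nu) \<le> e * r ^ (DIM('a) - 1))" if e: "e > 0" for e
  proof -
   \<comment> \<open>\<open>tau\<close> is the allowed distance between \<open>Phi j\<close> and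
     \<open>nu\<close>; the density bound \<open>K\<close> turns it into an error
     \<open>tau * K\<close>, at most e/2.\<close>
   define tau where "tau = e / (2 * (K + 1))"
   have tau: "tau > 0" "tau * K \<le> e/2" using e K by (auto simp: tau_def field_simps)
   have "eventually (\<lambda>j. dist (Phi (s j) x) nu < tau/2) sequentially"
    using tendstoD[OF nu(3), of "tau/2"] tau by simp
   moreover have "(\<lambda>j. (1/2::real) ^ s j) \<longlonglongrightarrow> 0"
    using LIMSEQ_subseq_LIMSEQ[OF LIMSEQ_power_zero[of "1/2::real"] nu(2)] by (simp add: o_def)
   hence "eventually (\<lambda>j. (1/2::real) ^ s j < e/2) sequentially" using e by (intro order_tendstoD) auto
   moreover have "eventually (\<lambda>j. s j \<ge> n) sequentially"
    using filterlim_subseq[OF nu(2)] by (auto simp: filterlim_at_top)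
   ultimately have "eventually (\<lambda>j. dist (Phi (s j) x) nu < tau/2 \<and> (1/2::real) ^ s j < e/2 \<and> s j \<ge> n) sequentially"
    by eventually_elim auto
   then obtain j0 where "dist (Phi (s j0) x) nu < tau/2 \<and> (1/2::real) ^ s j0 < e/2 \<and> s j0 \<ge> n"
    by (auto simp: eventually_sequentially)
   then obtain j where j: "dist (Phi j x) nu < tau/2" "(1/2::real) ^ j < e/2" "j \<ge> n" by blast
   obtain d where d: "d > 0" "\<And>y. dist y x < d ==> dist (Phi j y) (Phi j x) < tau/2"
    using C1c_on_continuous[OF Phi(1)[of j]] tau unfolding continuous_on_iff by (metis UNIV_I half_gt_zero)
   obtain dlt2 where dlt2: "dlt2 > 0" "\<And>r Psi psi. 0 < r ==> r < dlt2 ==> test_pair (ball x r) Psi psi ==>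
     dist_grad E Psi - dist_grad E (\<lambda>x. psi x *\<^sub>R Phi j x) \<le> (1/2) ^ j * r ^ (DIM('a) - 1)"
    using dlt2[OF j(3)] by blast
   define dlt where "dlt = min (min dlt1 dlt2) d"
   have "dist_grad E Psi - dist_grad E (\<lambda>y. psi y *\<^sub>R nu) \<le> e * r ^ (DIM('a) - 1)"
    if r: "0 < r" "r < dlt" and t: "test_pair (ball x r) Psi psi" for r Psi psi
   proof -
    have c: "C1c_on (ball x r) psi" and b: "\<And>y. 0 \<le> psi y" "\<And>y. psi y \<le> 1"
     using t by (auto simp: test_pair_def intro: order_trans[OF norm_ge_zero])
    have r': "r < dlt1" "r < dlt2" "r < d" using r by (auto simp: dlt_def)
    have i1: "C1c_on UNIV (\<lambda>y. psi y *\<^sub>R Phi j y)" by (rule C1c_on_C1c_mult[OF c C1c_on_mono[OF Phi(1)]]) simp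
    have i2: "C1c_on (ball x r) (\<lambda>y. psi y *\<^sub>R nu)" by (rule C1c_on_vec(1)[OF c])
    let ?D = "\<lambda>y. psi y *\<^sub>R Phi j y - psi y *\<^sub>R nu"
    have "C1c_on UNIV ?D" by (rule C1c_on_diff[OF i1 C1c_on_mono[OF i2]]) simp
    obtain L where L: "compact L" "L \<subseteq> ball x r" "\<And>y. y \<notin> L ==> psi y = 0" using C1c_onE[OF c] by metis
    have i3: "C1c_on (ball x r) ?D"
     using \<open>C1c_on UNIV ?D\<close> L unfolding C1c_on_def by (intro conjI exI[of _ L]) auto
    \<comment> \<open>Rescaled by 1/tau, the difference of the two fields is itself dominated by
      \<open>psi\<close>, hence part of a test pair to which the density bound applies.\<close>
    have "norm ((1/tau) *\<^sub>R ?D y) \<le> psi y" for y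
    proof (cases "y \<in> ball x r")
     case True
     hence "dist (Phi j y) (Phi j x) < tau/2" using d(2)[of y] r' by (simp add: dist_commute)
     with j(1) have "dist (Phi j y) nu < tau" using dist_triangle_half_l[of "Phi j y" "Phi j x" tau nu] by (simp add: dist_commute)
     hence "norm (psi y *\<^sub>R (Phi j y - nu)) \<le> psi y * tau"
      using b(1)[of y] by (auto simp: dist_norm intro!: mult_left_mono)
     thus ?thesis using tau by (simp add: scaleR_diff_right[symmetric] divide_le_eq)
    next
     case False
     thus ?thesis using C1c_on_outside(1)[OF c False] by simp
    qed
    hence "test_pair (ball x r) (\<lambda>y. (1/tau) *\<^sub>R ?D y) psi"
     unfolding test_pair_def using b c C1c_on_scaleR_const(1)[OF i3] by blast
    from dlt1(2)[OF r(1) r'(1) this]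
    have "dist_grad E ?D \<le> (tau * K) * r ^ (DIM('a) - 1)"
     using tau(1) by (simp add: dist_grad_scaleR[OF i3] K_def divide_le_eq mult_ac)
    also have "\<dots> \<le> e/2 * r ^ (DIM('a) - 1)" using tau r by (intro mult_right_mono) auto
    finally have 1: "dist_grad E (\<lambda>y. psi y *\<^sub>R Phi j y) - dist_grad E (\<lambda>y. psi y *\<^sub>R nu) \<le> e/2 * r ^ (DIM('a) - 1)"
     using dist_grad_diff[OF E i1 i2] by simp
    have "dist_grad E Psi - dist_grad E (\<lambda>y. psi y *\<^sub>R Phi j y) \<le> (1/2) ^ j * r ^ (DIM('a) - 1)"
     by (rule dlt2(2)[OF r(1) r'(2) t])
    also have "\<dots> \<le> e/2 * r ^ (DIM('a) - 1)" using j r by (intro mult_right_mono) auto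
    finally show ?thesis using 1 by (simp add: field_simps)
   qed
   moreover have "dlt > 0" using dlt1 dlt2 d by (simp add: dlt_def)
   ultimately show ?thesis by blast
  qed
  hence "regular_at x nu K"
   unfolding regular_at_def using nu(1) K dlt1 by (auto simp: K_def)
  thus ?thesis by blast
 qed
 ultimately show ?thesis by blast
qed

text \<open>By the mean value theorem, the difference quotient of \<open>1\<^sub>E\<close> in direction \<open>h\<close> is the derivative of \<open>1\<^sub>E\<close> tested
 with a translate. Comparing \<open>-h\<close> with \<open>nu - tau h\<close>, whose norm is at most \<open>1 + tau\<^sup>2 |h|\<^sup>2 / 2\<close> when \<open>h \<bullet> nu \<ge> 0\<close>,
 shows that \<open>E\<close> is almost monotone in all such directions.\<close>

lemma translation_difference:
 assumes psi: "C1c_on (ball x r) psi"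
 obtains s where "0 < s" "s < 1"
  "(LBINT y. psi y * (ind E y - ind E (y + h))) = dist_grad E (\<lambda>y. psi (y - s *\<^sub>R h) *\<^sub>R (- h))"
proof -
 let ?B = "ind E :: 'a => real"
 have iB: "Lint ?B" using E finE by (intro integrable_real_indicator) auto
 \<comment> \<open>The reflected kernel turns the integral of \<open>psi (y - s *\<^sub>R h)\<close>
   over \<open>E\<close> into a convolution at the point \<open>s *\<^sub>R h\<close>, whose
   derivative is known.\<close>
 define k where "k w = psi (0 - w)" for w
 have k: "C1c_on UNIV k" "FD k w v = - FD psi (- w) v" for w v
  unfolding k_def using C1c_on_reflect[OF C1c_on_mono[OF psi], of 0] by auto
 define F where "F s = convol k ?B (s *\<^sub>R h)" for s
 have Feq: "F s = (LBINT y. psi (y - s *\<^sub>R h) * ind E y)" for s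
  by (simp add: F_def convol_def k_def)
 define F' where "F' s = - (LBINT y. FD psi (y - s *\<^sub>R h) h * ind E y)" for s
 have "(F has_real_derivative F' s) (at s)" for s
 proof -
  have "((\<lambda>s. s *\<^sub>R h) has_derivative (\<lambda>t. t *\<^sub>R h)) (at s)" by (auto intro!: derivative_eq_intros)
  from has_derivative_compose[OF this convol_has_derivative[OF k(1) iB]]
  have "(F has_derivative (\<lambda>t. convol (\<lambda>z. FD k z (t *\<^sub>R h)) ?B (s *\<^sub>R h))) (at s)"
   unfolding F_def .
  moreover have "convol (\<lambda>z. FD k z (t *\<^sub>R h)) ?B (s *\<^sub>R h) = F' s * t" for t
  proof -
   have "FD k (s *\<^sub>R h - y) (t *\<^sub>R h) * ?B y
    = t * (- (FD psi (y - s *\<^sub>R h) h * ?B y))" for y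
    by (simp add: linear_cmul[OF C1c_on_linear[OF psi], simplified] k(2))
   thus ?thesis unfolding convol_def F'_def by (simp add: mult.commute)
  qed
  ultimately show ?thesis unfolding has_field_derivative_def by simp
 qed
 from MVT2[of 0 1 F F', OF _ this] obtain s where s: "0 < s" "s < 1" "F 1 - F 0 = F' s" by auto
 have iF: "Lint (\<lambda>y. psi (y - s *\<^sub>R h) * ind E y)" for s
  using convol_C1c_integrable(1)[OF k(1) iB, of "s *\<^sub>R h"] by (simp add: k_def)
 have F1: "F 1 = (LBINT y. psi y * ind E (y + h))"
 proof -
  have [measurable]: "psi \<in> Borel" "E \<in> sets borel" using C1c_on_measurable[OF psi] E by auto
  have "(LBINT y. (\<lambda>y. psi (y - h) * ind E y) (y + h)) = (LBINT y. psi (y - h) * ind E y)"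
   by (rule integral_translate) measurable
  thus ?thesis unfolding Feq by simp
 qed
 have iF1: "Lint (\<lambda>y. psi y * ind E (y + h))"
 proof -
  have [measurable]: "psi \<in> Borel" "E \<in> sets borel" using C1c_on_measurable[OF psi] E by auto
  have "Lint (\<lambda>y. (\<lambda>y. psi (y - h) * ind E y) (y + h)) = Lint (\<lambda>y. psi (y - h) * ind E y)"
   by (rule integrable_translate) measurable
  thus ?thesis using iF[of 1] by simp
 qed
 have "(LBINT y. psi y * (ind E y - ind E (y + h))) = F 0 - F 1"
  unfolding F1 using iF1 iF[of 0] by (simp add: right_diff_distrib Feq Bintegral_diff)
 also have "\<dots> = - F' s" using s by simp
 also have "\<dots> = dist_grad E (\<lambda>y. psi (y - s *\<^sub>R h) *\<^sub>R (- h))"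
 proof -
  have a: "C1c_on UNIV (\<lambda>y. psi (y - s *\<^sub>R h))" "FD (\<lambda>y. psi (y - s *\<^sub>R h)) y v = FD psi (y - s *\<^sub>R h) v" for y v
   using C1c_on_mono[OF C1c_on_affine(1)[OF psi, of 1 "- s *\<^sub>R h"]] C1c_on_affine(2)[OF psi, of 1 "- s *\<^sub>R h" y v]
   by auto
  have "divergence (\<lambda>y. psi (y - s *\<^sub>R h) *\<^sub>R (- h)) y = - FD psi (y - s *\<^sub>R h) h" for y
   by (simp only: divergence_vec[OF a(1)] a(2) linear_neg[OF C1c_on_linear[OF psi]])
  thus ?thesis unfolding dist_grad_def F'_def by (simp add: mult.commute)
 qed
 finally show thesis using that s by blast
qed

lemma translation_difference_set_borel: "{y\<in>ball x r. y \<in> E \<and> y + h \<notin> E} \<in> sets borel"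
proof -
 note E[measurable]
 have "{y\<in>space borel. y \<in> E \<and> y + h \<notin> E} \<in> sets borel" by measurable
 hence "ball x r \<inter> {y\<in>space borel. y \<in> E \<and> y + h \<notin> E} \<in> sets borel" by auto
 also have "ball x r \<inter> {y\<in>space borel. y \<in> E \<and> y + h \<notin> E} = {y\<in>ball x r. y \<in> E \<and> y + h \<notin> E}" by auto
 finally show ?thesis .
qed

lemma almost_monotone:
 assumes reg: "regular_at x nu K" and e: "e > 0"
 shows "\<exists>dlt>0. \<forall>r h. 0 < r \<and> r < dlt \<and> norm h \<le> 2 * r \<and> h \<bullet> nu \<ge> 0 \<longrightarrow>
  evol {y\<in>ball x r. y \<in> E \<and> y + h \<notin> E} \<le> ennreal (e * r ^ DIM('a))"
proof -
 let ?N = "DIM('a) - 1"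
 \<comment> \<open>Translating a test function supported in the ball of radius r by at most 2r
   leaves it in the ball of radius 3r; \<open>c\<close> is the resulting factor in r^(N-1).\<close>
 define c where "c = (3::real) ^ ?N"
 have c: "c > 0" by (simp add: c_def)
 have nu: "norm nu \<le> 1" and K: "K \<ge> 0" using reg by (auto simp: regular_at_def)
 \<comment> \<open>Two error terms share \<open>e\<close>: one of order \<open>tau0 * K\<close>,
   made small by \<open>tau0\<close>, and one of order \<open>eta / tau0\<close>, made small by
   \<open>eta\<close> afterwards.\<close>
 define tau0 where "tau0 = e / (4 * c * (K + 1))"
 have tau0: "tau0 > 0" using e c K by (simp add: tau0_def)
 have tau0K: "c * (2 * tau0 * K) \<le> e/2"
 proof -
  define k where "k = K + 1"
  have "k > 0" using K by (simp add: k_def)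
  hence "c * (2 * tau0 * K) = (e/2) * (K / (K + 1))"
   using c unfolding tau0_def k_def[symmetric] by (simp add: field_simps)
  also have "\<dots> \<le> (e/2) * 1" using e K by (intro mult_left_mono) auto
  finally show ?thesis by simp
 qed
 define eta where "eta = e * tau0 / (2 * c * (1 + 2 * tau0\<^sup>2))"
 have tau2: "1 + 2 * tau0\<^sup>2 > 0" by (simp add: add_pos_nonneg)
 have eta: "eta > 0" using e c tau0 tau2 by (simp add: eta_def)
 have etae: "c * ((1 + 2 * tau0\<^sup>2) * eta / tau0) = e/2"
 proof -
  define q where "q = 1 + 2 * tau0\<^sup>2"
  show ?thesis using c tau0 tau2 unfolding eta_def q_def[symmetric] by (simp add: field_simps)
 qed
 from reg obtain d1 where "d1 > 0" and
  d1': "\<forall>r. 0 < r \<and> r < d1 \<longrightarrow> (\<forall>Psi psi. test_pair (ball x r) Psi psi \<longrightarrow> dist_grad E Psi \<le> K * r ^ ?N)"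
  unfolding regular_at_def by (elim conjE exE) simp
 have d1: "d1 > 0" "\<And>r Psi psi. 0 < r ==> r < d1 ==> test_pair (ball x r) Psi psi ==> dist_grad E Psi \<le> K * r ^ ?N"
  using \<open>d1 > 0\<close> d1' by blast+
 have "\<exists>d2>0. \<forall>r. 0 < r \<and> r < d2 \<longrightarrow> (\<forall>Psi psi. test_pair (ball x r) Psi psi \<longrightarrow>
    dist_grad E Psi - dist_grad E (\<lambda>y. psi y *\<^sub>R nu) \<le> eta * r ^ ?N)"
  using reg eta unfolding regular_at_def by (elim conjE) simp
 then obtain d2 where d2: "d2 > 0" "\<And>r Psi psi. 0 < r ==> r < d2 ==> test_pair (ball x r) Psi psi ==>
   dist_grad E Psi - dist_grad E (\<lambda>y. psi y *\<^sub>R nu) \<le> eta * r ^ ?N"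
  by blast
 define dlt where "dlt = min d1 d2 / 3"
 have "evol {y\<in>ball x r. y \<in> E \<and> y + h \<notin> E} \<le> ennreal (e * r ^ DIM('a))"
  if r: "0 < r" "r < dlt" and h: "norm h \<le> 2 * r" "h \<bullet> nu \<ge> 0" for r h
 proof -
  define R where "R = 3 * r"
  have R: "0 < R" "R < d1" "R < d2" using r by (auto simp: R_def dlt_def)
  \<comment> \<open>Dividing by r makes \<open>tau * norm h\<close> at most \<open>2 * tau0\<close>
    at every scale.\<close>
  define tau where "tau = tau0 / r"
  have tau: "tau > 0" using tau0 r by (simp add: tau_def)
  \<comment> \<open>An upper bound for the norm of \<open>nu - tau *\<^sub>R h\<close>, since h . nu
    \<ge> 0 and sqrt (1 + q) \<le> 1 + q/2; dividing by it gives the vector \<open>v\<close> of norm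
    at most 1.\<close>
  define m where "m = 1 + tau\<^sup>2 * (norm h)\<^sup>2 / 2"
  have m: "m \<ge> 1" by (simp add: m_def)
  have th: "tau * norm h \<le> 2 * tau0" using h r tau0 by (simp add: tau_def field_simps)
  have th2: "tau\<^sup>2 * (norm h)\<^sup>2 \<le> 4 * tau0\<^sup>2"
  proof -
   have "(tau * norm h)\<^sup>2 \<le> (2 * tau0)\<^sup>2" using th tau by (intro power_mono) auto
   thus ?thesis by (simp add: power_mult_distrib)
  qed
  have mle: "m \<le> 1 + 2 * tau0\<^sup>2" using th2 by (simp add: m_def)
  define v where "v = (1/m) *\<^sub>R (nu - tau *\<^sub>R h)"
  have v: "norm v \<le> 1"
  proof -
   have sq: "1 + q \<le> (1 + q / 2)\<^sup>2" for q :: real by (simp add: power2_eq_square field_simps)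
   have "(norm (nu - tau *\<^sub>R h))\<^sup>2 = (nu - tau *\<^sub>R h) \<bullet> (nu - tau *\<^sub>R h)" by (rule power2_norm_eq_inner)
   also have "\<dots> = nu \<bullet> nu - 2 * (tau * (h \<bullet> nu)) + tau * tau * (h \<bullet> h)"
    by (simp only: inner_diff_left inner_diff_right inner_scaleR_left inner_scaleR_right inner_commute[of nu h])
     (simp only: algebra_simps)
   also have "\<dots> = (norm nu)\<^sup>2 - 2 * (tau * (h \<bullet> nu)) + (tau * norm h)\<^sup>2"
    by (simp add: power2_norm_eq_inner[symmetric] power_mult_distrib power2_eq_square)
   also have "\<dots> \<le> 1 + tau\<^sup>2 * (norm h)\<^sup>2"
    using power_le_one[OF norm_ge_zero nu, of 2] mult_nonneg_nonneg[OF less_imp_le[OF tau] h(2)]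
    by (simp add: power_mult_distrib)
   also have "\<dots> \<le> m\<^sup>2" unfolding m_def by (rule sq)
   finally have "norm (nu - tau *\<^sub>R h) \<le> m" by (rule power2_le_imp_le) (use m in simp)
   thus ?thesis using m by (simp add: v_def divide_le_eq)
  qed
  have B: "(LBINT y. psi y * (ind E y - ind E (y + h))) \<le> e * r ^ DIM('a)"
   if psi: "C1c_on (ball x r) psi" "\<And>y. 0 \<le> psi y" "\<And>y. psi y \<le> 1" for psi
  proof -
   obtain s where s: "0 < s" "s < 1"
    "(LBINT y. psi y * (ind E y - ind E (y + h))) = dist_grad E (\<lambda>y. psi (y - s *\<^sub>R h) *\<^sub>R (- h))"
    using translation_difference[OF psi(1)] by blast
   define psis where "psis y = psi (y - s *\<^sub>R h)" for y
   have cs: "C1c_on (ball x R) psis"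
   proof -
    have "C1c_on ((\<lambda>y. (1 / 1) *\<^sub>R (y - - s *\<^sub>R h)) ` ball x r) (\<lambda>y. psi (- s *\<^sub>R h + 1 *\<^sub>R y))"
     by (rule C1c_on_affine(1)[OF psi(1)]) simp
    hence "C1c_on ((\<lambda>y. y + s *\<^sub>R h) ` ball x r) psis" by (simp add: psis_def[abs_def])
    moreover have "(\<lambda>y. y + s *\<^sub>R h) ` ball x r \<subseteq> ball x R"
    proof clarify
     fix y assume "y \<in> ball x r"
     moreover have "norm (s *\<^sub>R h) \<le> 2 * r" using s h by (simp add: mult_le_one order_trans[OF mult_left_le_one_le])
     moreover have "dist x (y + s *\<^sub>R h) \<le> dist x y + norm (s *\<^sub>R h)"
      by (metis add_diff_cancel_left' dist_norm dist_triangle norm_minus_commute)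
     ultimately show "y + s *\<^sub>R h \<in> ball x R" by (simp add: R_def)
    qed
    ultimately show ?thesis by (rule C1c_on_mono)
   qed
   have tp: "test_pair (ball x R) (\<lambda>y. psis y *\<^sub>R w) psis" if "norm w \<le> 1" for w
    unfolding test_pair_def using C1c_on_vec(1)[OF cs] cs psi that by (auto simp: psis_def mult_left_le)
   define L where "L w = dist_grad E (\<lambda>y. psis y *\<^sub>R w)" for w
   have Ladd: "L (a *\<^sub>R w + b *\<^sub>R z) = a * L w + b * L z" for a b w z
   proof -
    have "L (a *\<^sub>R w + b *\<^sub>R z) = dist_grad E (\<lambda>y. a *\<^sub>R (psis y *\<^sub>R w) + b *\<^sub>R (psis y *\<^sub>R z))"
     unfolding L_def by (simp add: scaleR_add_right mult.commute)
    also have "\<dots> = dist_grad E (\<lambda>y. a *\<^sub>R (psis y *\<^sub>R w)) + dist_grad E (\<lambda>y. b *\<^sub>R (psis y *\<^sub>R z))"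
     by (intro dist_grad_add[OF E, of "ball x R" _ "ball x R"] C1c_on_scaleR_const(1) C1c_on_vec(1)[OF cs])
    finally show ?thesis unfolding L_def dist_grad_scaleR[OF C1c_on_vec(1)[OF cs]] .
   qed
   have 1: "L v - L nu \<le> eta * R ^ ?N" using d2(2)[OF R(1,3) tp[OF v]] by (simp add: L_def)
   have 2: "L nu \<le> K * R ^ ?N" using d1(2)[OF R(1,2) tp[OF nu]] by (simp add: L_def)
   have Lv: "L v = (L nu - tau * L h) / m"
    using Ladd[of "1/m" nu "- tau / m" h] m by (simp add: v_def scaleR_diff_right field_simps)
   have Lh: "L (- h) = - L h" using Ladd[of "-1" h 0 0] by simp
   \<comment> \<open>The definition of \<open>v\<close> solved for -h: the first term is controlled
     by the small excess over \<open>nu\<close>, the second by the density bound, with a factor m -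
     1 quadratic in \<open>tau0\<close>.\<close>
   have "tau * L (- h) = m * (L v - L nu) + (m - 1) * L nu"
    using m by (simp add: Lh Lv field_simps)
   also have "\<dots> \<le> m * (eta * R ^ ?N) + (m - 1) * (K * R ^ ?N)"
    using 1 2 m by (intro add_mono mult_left_mono) auto
   also have "\<dots> \<le> (1 + 2 * tau0\<^sup>2) * (eta * R ^ ?N) + (2 * tau0\<^sup>2) * (K * R ^ ?N)"
    using mle eta K R by (intro add_mono mult_right_mono) auto
   also have "\<dots> = tau0 * R ^ ?N * ((1 + 2 * tau0\<^sup>2) * eta / tau0 + 2 * tau0 * K)"
    using tau0 by (simp add: field_simps power2_eq_square)
   finally have "tau0 * L (- h) \<le> tau0 * (r * R ^ ?N * ((1 + 2 * tau0\<^sup>2) * eta / tau0 + 2 * tau0 * K))"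
    using r by (simp add: tau_def field_simps)
   hence "L (- h) \<le> r * R ^ ?N * ((1 + 2 * tau0\<^sup>2) * eta / tau0 + 2 * tau0 * K)"
    using tau0 by (simp only: mult_le_cancel_left_pos)
   also have "\<dots> = r * r ^ ?N * (c * ((1 + 2 * tau0\<^sup>2) * eta / tau0) + c * (2 * tau0 * K))"
    by (simp add: R_def power_mult_distrib c_def algebra_simps)
   also have "\<dots> \<le> r * r ^ ?N * e"
    unfolding etae using tau0K r by (intro mult_left_mono) (linarith, simp)
   also have "\<dots> = e * r ^ DIM('a)" using dim by (simp add: power_eq_if[of r "DIM('a)"])
   finally show ?thesis using s(3) by (simp add: L_def psis_def)
  qed
  define A where "A = {y\<in>ball x r. y \<in> E \<and> y + h \<notin> E}"
  note E[measurable]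
  have A[measurable]: "A \<in> sets borel" unfolding A_def by (rule translation_difference_set_borel)
  have Afin: "evol A < \<infinity>"
   by (rule emeasure_subset_ball_finite[of _ x r]) (auto simp: A_def)
  have iA: "Lint (ind A :: 'a => real)" using A Afin by (intro integrable_real_indicator) auto
  have "vol A \<le> e * r ^ DIM('a)"
  proof (rule field_le_epsilon)
   fix e' :: real assume e': "e' > 0"
   obtain psi :: "'a => real" where psi: "C1c_on (ball x r) psi" "\<And>x. 0 \<le> psi x" "\<And>x. psi x \<le> 1"
    "(NBINT y. ennreal \<bar>ind A y - psi y\<bar>) \<le> ennreal e'"
    by (rule C1c_approx_indicator[OF A Afin open_ball[of x r] _ e']) (auto simp: A_def)
   have ipsi: "Lint psi" using C1c_on_integrable[OF psi(1)] .
   note [measurable] = borel_measurable_integrable[OF ipsi]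
   let ?g = "\<lambda>y. ind E y - ind E (y + h) :: real"
   have g: "\<bar>?g y\<bar> \<le> 1" for y by (auto simp: indicator_def)
   have [measurable]: "?g \<in> Borel" by measurable
   have ig: "Lint (\<lambda>y. f y * ?g y)" if "Lint f" for f :: "'a => real"
   proof -
    have "Lint (\<lambda>y. ?g y *\<^sub>R f y)"
     by (rule integrable_scaleR_bounded[OF that _ g]) measurable
    thus ?thesis by (simp add: mult.commute)
   qed
   have "vol A = (LBINT y. ind A y * ?g y)"
   proof -
    have "(\<lambda>y. ind A y * ?g y) = (ind A :: 'a => real)"
     by (auto simp: A_def indicator_def fun_eq_iff)
    thus ?thesis using A by simp
   qed
   also have "\<dots> = (LBINT y. psi y * ?g y + (ind A y - psi y) * ?g y)"
    by (intro Bintegral_cong) (auto simp: algebra_simps)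
   also have "\<dots> = (LBINT y. psi y * ?g y) + (LBINT y. (ind A y - psi y) * ?g y)"
    by (intro Bintegral_add ig ipsi Bintegrable_diff iA)
   also have "(LBINT y. (ind A y - psi y) * ?g y) \<le> e'"
   proof -
    have "ennreal (norm (LBINT y. (ind A y - psi y) * ?g y)) \<le>
     (NBINT y. ennreal (norm ((ind A y - psi y) * ?g y)))" by (rule norm_integral_le_nn_integral)
    also have "\<dots> \<le> (NBINT y. ennreal \<bar>ind A y - psi y\<bar>)"
     using g by (intro nn_integral_mono ennreal_leI) (simp add: abs_mult mult_left_le)
    also have "\<dots> \<le> ennreal e'" by (rule psi(4))
    finally show ?thesis using e' by simp
   qed
   finally show "vol A \<le> e * r ^ DIM('a) + e'" using B[OF psi(1-3)] by linarith
  qed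
  thus ?thesis using Afin unfolding A_def[symmetric]
   by (simp add: emeasure_eq_ennreal_measure less_top ennreal_leI)
 qed
 moreover have "dlt > 0" using d1 d2 by (simp add: dlt_def)
 ultimately show ?thesis by blast
qed

end

section \<open>Separation by a hyperplane at small scales\<close>

text \<open>An inversion is a point of \<open>E\<close> together with a point outside it that lies
  at least as high in direction \<open>nu\<close>. Measuring only rectangles X, Y made of such pairs
  avoids the product measure.\<close>

definition inversions_le :: "'a::euclidean_space set => 'a => 'a set => real => bool" where
 "inversions_le E nu U c \<longleftrightarrow> (\<forall>X Y. X \<in> sets borel \<longrightarrow> Y \<in> sets borel \<longrightarrow> X \<subseteq> U \<inter> E \<longrightarrow> Y \<subseteq> U - E \<longrightarrow>
  (\<forall>y\<in>X. \<forall>z\<in>Y. y \<bullet> nu \<le> z \<bullet> nu) \<longrightarrow> vol X * vol Y \<le> c)"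

lemma inversions_leD:
 assumes "inversions_le E nu U c" "X \<in> sets borel" "Y \<in> sets borel" "X \<subseteq> U \<inter> E" "Y \<subseteq> U - E"
  "\<And>y z. y \<in> X ==> z \<in> Y ==> y \<bullet> nu \<le> z \<bullet> nu"
 shows "vol X * vol Y \<le> c"
 using assms unfolding inversions_le_def by simp

text \<open>Inside small balls, \<open>E\<close> and its complement are almost separated by a hyperplane orthogonal to \<open>nu\<close>.\<close>

definition separated_at :: "'a::euclidean_space set => 'a => 'a => bool" where
 "separated_at E x nu \<longleftrightarrow> norm nu = 1 \<and> (\<forall>e>0. \<exists>dlt>0. \<forall>r. 0 < r \<and> r < dlt \<longrightarrow>
  inversions_le E nu (ball x r) (e * (r ^ DIM('a))\<^sup>2))"

text \<open>By Tonelli the product of the volumes of \<open>X\<close> and \<open>Y\<close> is the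
  integral over h of the volume of the y in \<open>X\<close> with y + h in \<open>Y\<close>. Only h
  with h . \<mu> \<ge> 0 and norm at most 2r contribute, and for these
  \<open>almost_monotone\<close> applies.\<close>

lemma (in finite_perimeter) regular_imp_separated:
 assumes reg: "regular_at x nu K"
 shows "\<exists>\<mu>. separated_at E x \<mu>"
proof -
 \<comment> \<open>\<open>nu\<close> may be short or zero. Only its direction matters for the
   condition h . nu \<ge> 0, and for \<open>nu = 0\<close> every h satisfies it, so any unit vector
   serves.\<close>
 define \<mu> where "\<mu> = (if nu = 0 then (SOME i. i \<in> Basis) else (1 / norm nu) *\<^sub>R nu)"
 have "norm (SOME i. i \<in> (Basis :: 'a set)) = 1" by (rule norm_Basis[OF SOME_Basis])
 hence n\<mu>: "norm \<mu> = 1" by (simp add: \<mu>_def)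
 have \<mu>nu: "h \<bullet> \<mu> \<ge> 0 ==> h \<bullet> nu \<ge> 0" for h by (auto simp: \<mu>_def zero_le_divide_iff split: if_splits)
 have "separated_at E x \<mu>" unfolding separated_at_def
 proof (intro conjI n\<mu> allI impI)
  fix e :: real assume e: "e > 0"
  let ?v = "unit_ball_vol (real DIM('a))"
  have v: "?v > 0" by simp
  \<comment> \<open>Compensates the volume of the ball of radius 2r in which the shifts h
    lie.\<close>
  define e0 where "e0 = e / (?v * 2 ^ DIM('a))"
  have e0: "e0 > 0" using e v by (simp add: e0_def)
  obtain dlt where dlt: "dlt > 0" "\<And>r h. 0 < r ==> r < dlt ==> norm h \<le> 2 * r ==> h \<bullet> nu \<ge> 0 ==>
    evol {y\<in>ball x r. y \<in> E \<and> y + h \<notin> E} \<le> ennreal (e0 * r ^ DIM('a))"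
   using almost_monotone[OF reg e0] by blast
  have *: "vol X * vol Y \<le> e * (r ^ DIM('a))\<^sup>2"
   if r: "0 < r" "r < dlt" and [measurable]: "X \<in> sets borel" "Y \<in> sets borel"
    and XY: "X \<subseteq> ball x r \<inter> E" "Y \<subseteq> ball x r - E" "\<And>y z. y \<in> X ==> z \<in> Y ==> y \<bullet> \<mu> \<le> z \<bullet> \<mu>" for r X Y
  proof -
   have Xf: "evol X < \<infinity>" by (rule emeasure_subset_ball_finite[of _ x r]) (use XY(1) in auto)
   have Yf: "evol Y < \<infinity>" by (rule emeasure_subset_ball_finite[of _ x r]) (use XY(2) in auto)
   note E[measurable]
   have shift: "(NBINT h. ind Y (y + h)) = evol Y" for y
    using nn_integral_translate[of "ind Y :: 'a => ennreal" y] by (simp add: add.commute)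
   have "evol X * evol Y = (NBINT y. ind X y * evol Y)"
    by (simp add: nn_integral_multc)
   also have "\<dots> = (NBINT y. NBINT h. ind X y * ind Y (y + h))"
    by (simp add: nn_integral_cmult shift)
   also have "\<dots> = (NBINT h. NBINT y. ind X y * ind Y (y + h))"
    by (rule lborel_pair.Fubini') measurable
   also have "\<dots> \<le> (NBINT h. ennreal (e0 * r ^ DIM('a)) * ind (cball (0::'a) (2 * r)) h)"
   proof (intro nn_integral_mono)
    fix h :: 'a
    show "(NBINT y. ind X y * ind Y (y + h)) \<le> ennreal (e0 * r ^ DIM('a)) * ind (cball 0 (2 * r)) h"
    proof (cases "\<exists>y. y \<in> X \<and> y + h \<in> Y")
     case False
     hence z: "ind X y * ind Y (y + h) = (0 :: ennreal)" for y by (auto simp: indicator_def)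
     show ?thesis unfolding z by simp
    next
     case True
     then obtain y where y: "y \<in> X" "y + h \<in> Y" by blast
     have "h \<bullet> \<mu> \<ge> 0" using XY(3)[OF y] by (simp add: inner_add_left)
     hence hnu: "h \<bullet> nu \<ge> 0" by (rule \<mu>nu)
     have "dist x y < r" "dist x (y + h) < r" using y XY(1,2) by auto
     hence h: "norm h \<le> 2 * r" using dist_triangle2[of y "y + h" x] by (simp add: dist_norm norm_minus_commute)
     note translation_difference_set_borel[measurable]
     have "(NBINT y. ind X y * ind Y (y + h)) \<le> (NBINT y. ind {y\<in>ball x r. y \<in> E \<and> y + h \<notin> E} y)"
      using XY by (intro nn_integral_mono) (auto simp: indicator_def)
     also have "\<dots> \<le> ennreal (e0 * r ^ DIM('a))" using dlt(2)[OF r h hnu] by simp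
     finally show ?thesis using h by (simp add: indicator_def)
    qed
   qed
   also have "\<dots> = ennreal (e0 * r ^ DIM('a)) * ennreal (?v * (2 * r) ^ DIM('a))"
    using r by (simp add: nn_integral_cmult_indicator emeasure_cball)
   also have "\<dots> = ennreal (e * (r ^ DIM('a))\<^sup>2)"
    using r e v unfolding e0_def
    by (subst ennreal_mult[symmetric]) (auto simp: power_mult_distrib power2_eq_square less_imp_neq[OF v, symmetric])
   finally have "ennreal (vol X * vol Y) \<le> ennreal (e * (r ^ DIM('a))\<^sup>2)"
    using Xf Yf by (simp add: emeasure_eq_ennreal_measure less_top ennreal_mult)
   thus ?thesis using e by simp
  qed
  show "\<exists>dlt>0. \<forall>r. 0 < r \<and> r < dlt \<longrightarrow> inversions_le E \<mu> (ball x r) (e * (r ^ DIM('a))\<^sup>2)"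
   unfolding inversions_le_def
   by (intro exI[of _ dlt] conjI allI impI dlt(1), elim conjE, rule *; blast)
 qed
 thus ?thesis by blast
qed


section \<open>Densities at a separated point\<close>

text \<open>The epsilon form of \<open>density_zero\<close> with r^N in place of the volume of the
  ball; for Borel sets the two agree, see \<open>density_zero_iff_null_density\<close>.\<close>

definition null_density :: "'a::euclidean_space set => 'a => bool" where
 "null_density S x \<longleftrightarrow> (\<forall>e>0. \<exists>dlt>0. \<forall>r. 0 < r \<and> r < dlt \<longrightarrow>
  vol (S \<inter> ball x r) \<le> e * r ^ DIM('a))"

lemma measure_Int_ball_mono:
 assumes "S \<inter> ball x r \<subseteq> T \<inter> ball y r'" "S \<in> sets borel" "T \<in> sets borel"
 shows "vol (S \<inter> ball x r) \<le> vol (T \<inter> ball y r')"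
 by (rule measure_mono_fmeasurable[OF assms(1)]) (use assms in \<open>auto intro: fmeasurable_subset_ball[of _ y r']\<close>)

lemma null_density_mono:
 assumes "null_density S x" "T \<subseteq> S" "S \<in> sets borel" "T \<in> sets borel"
 shows "null_density T x"
 unfolding null_density_def
proof (intro allI impI)
 fix e :: real assume "e > 0"
 then obtain dlt where dlt: "dlt > 0" "\<And>r. 0 < r ==> r < dlt ==> vol (S \<inter> ball x r) \<le> e * r ^ DIM('a)"
  using assms(1) unfolding null_density_def by blast
 have "vol (T \<inter> ball x r) \<le> e * r ^ DIM('a)" if "0 < r" "r < dlt" for r
  using measure_Int_ball_mono[of T x r S x r] dlt(2)[OF that] assms by fastforce
 with dlt(1) show "\<exists>dlt>0. \<forall>r. 0 < r \<and> r < dlt \<longrightarrow> vol (T \<inter> ball x r) \<le> e * r ^ DIM('a)" by blast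
qed

lemma null_density_Un:
 fixes x :: "'a::euclidean_space"
 assumes "null_density S x" "null_density T x" "S \<in> sets borel" "T \<in> sets borel"
 shows "null_density (S \<union> T) x"
 unfolding null_density_def
proof (intro allI impI)
 fix e :: real assume "e > 0"
 hence "e/2 > 0" by simp
 obtain dlt1 where dlt1: "dlt1 > 0" "\<And>r. 0 < r ==> r < dlt1 ==> vol (S \<inter> ball x r) \<le> e/2 * r ^ DIM('a)"
  using assms(1) \<open>e/2 > 0\<close> unfolding null_density_def by blast
 obtain dlt2 where dlt2: "dlt2 > 0" "\<And>r. 0 < r ==> r < dlt2 ==> vol (T \<inter> ball x r) \<le> e/2 * r ^ DIM('a)"
  using assms(2) \<open>e/2 > 0\<close> unfolding null_density_def by blast
 have "vol ((S \<union> T) \<inter> ball x r) \<le> e * r ^ DIM('a)" if "0 < r" "r < min dlt1 dlt2" for r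
 proof -
  have "vol ((S \<union> T) \<inter> ball x r) \<le> vol (S \<inter> ball x r) + vol (T \<inter> ball x r)"
   unfolding Int_Un_distrib2 using assms by (intro measure_Un_le) auto
  thus ?thesis using dlt1(2)[of r] dlt2(2)[of r] that by simp
 qed
 thus "\<exists>dlt>0. \<forall>r. 0 < r \<and> r < dlt \<longrightarrow> vol ((S \<union> T) \<inter> ball x r) \<le> e * r ^ DIM('a)"
  using dlt1(1) dlt2(1) by (intro exI[of _ "min dlt1 dlt2"]) auto
qed

definition half_space :: "'a::euclidean_space => 'a => 'a set" where
 "half_space x nu = {y. y \<bullet> nu > x \<bullet> nu}"

lemma half_space_borel[measurable]: "half_space x nu \<in> sets borel"
 unfolding half_space_def inner_commute[of _ nu] by (intro borel_open open_halfspace_gt)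

lemma half_space_plane_null:
 assumes "norm nu = 1" shows "{y. y \<bullet> nu = c} \<in> null_sets lborel"
proof -
 have "negligible {y. nu \<bullet> y = c}" using assms by (intro negligible_hyperplane) auto
 moreover have "{y. nu \<bullet> y = c} \<in> sets borel" by (intro borel_closed closed_hyperplane)
 ultimately show ?thesis
  by (simp add: inner_commute[of _ nu] negligible_iff_null_sets null_sets_completion_iff)
qed

text \<open>Reflection at x exchanges the two half balls.\<close>

lemma nn_integral_half_space:
 assumes nu: "norm nu = 1" and [measurable]: "F \<in> Borel" and sym: "\<And>y. F (2 *\<^sub>R x - y) = F y"
 shows "2 * (NBINT y. F y * ind (half_space x nu) y) = (NBINT y. F y)"
proof -
 have refl: "(NBINT y. F y * ind (half_space x nu) y) = (NBINT y. F y * ind {y. y \<bullet> nu < x \<bullet> nu} y)"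
 proof -
  have "(NBINT y. F y * ind (half_space x nu) y)
    = (NBINT y. F (2 *\<^sub>R x - y) * ind (half_space x nu) (2 *\<^sub>R x - y))"
   by (rule nn_integral_reflect[of "\<lambda>y. F y * ind (half_space x nu) y", symmetric]) measurable
  also have "\<dots> = (NBINT y. F y * ind {y. y \<bullet> nu < x \<bullet> nu} y)"
   unfolding sym by (intro nn_integral_cong) (auto simp: indicator_def half_space_def inner_diff_left)
  finally show ?thesis .
 qed
 have m: "{y. y \<bullet> nu < x \<bullet> nu} \<in> sets borel"
  unfolding inner_commute[of _ nu] by (intro borel_open open_halfspace_lt)
 have "2 * (NBINT y. F y * ind (half_space x nu) y)
  = (NBINT y. F y * ind (half_space x nu) y) + (NBINT y. F y * ind {y. y \<bullet> nu < x \<bullet> nu} y)"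
  unfolding refl[symmetric] by (simp add: mult_2)
 also have "\<dots> = (NBINT y. F y * ind (half_space x nu) y + F y * ind {y. y \<bullet> nu < x \<bullet> nu} y)"
  using m by (intro nn_integral_add[symmetric]) auto
 also have "\<dots> = (NBINT y. F y)"
 proof (rule nn_integral_cong_AE)
  show "AE y in lborel. F y * ind (half_space x nu) y + F y * ind {y. y \<bullet> nu < x \<bullet> nu} y = F y"
   using AE_not_in[OF half_space_plane_null[OF nu, of "x \<bullet> nu"]]
   by eventually_elim (auto simp: indicator_def half_space_def)
 qed
 finally show ?thesis .
qed

lemma measure_half_ball:
 fixes x :: "'a::euclidean_space"
 assumes "norm nu = 1" "r \<ge> 0"
 shows "vol (half_space x nu \<inter> ball x r) = unit_ball_vol (real DIM('a)) / 2 * r ^ DIM('a)"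
proof -
 have [measurable]: "ball x r \<in> sets borel" by simp
 have "2 * (NBINT y. ind (ball x r) y * ind (half_space x nu) y) = (NBINT y. ind (ball x r) y)"
  by (rule nn_integral_half_space[OF assms(1)])
   (auto simp: indicator_def dist_norm algebra_simps scaleR_2 norm_minus_commute)
 also have "(NBINT y. ind (ball x r) y * ind (half_space x nu) y) = evol (half_space x nu \<inter> ball x r)"
  by (subst indicator_inter_arith[symmetric]) (simp add: Int_commute)
 finally have "2 * evol (half_space x nu \<inter> ball x r) = ennreal (unit_ball_vol (real DIM('a)) * r ^ DIM('a))"
  using assms(2) by (simp add: emeasure_ball)
 hence "enn2real (2 * evol (half_space x nu \<inter> ball x r)) = unit_ball_vol (real DIM('a)) * r ^ DIM('a)"
  using assms(2) by simp
 thus ?thesis by (simp add: enn2real_mult measure_def)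
qed

lemma measure_scale:
 fixes x :: "'a::euclidean_space"
 assumes "r > 0" "A \<in> sets borel"
 shows "vol A = r ^ DIM('a) * vol {z. x + r *\<^sub>R z \<in> A}"
proof -
 note assms(2)[measurable]
 have m: "{z. x + r *\<^sub>R z \<in> A} \<in> sets borel"
 proof -
  have "{z\<in>space borel. x + r *\<^sub>R z \<in> A} \<in> sets borel" by measurable
  thus ?thesis by simp
 qed
 have "(NBINT y. ind A y) = ennreal (\<bar>r\<bar> ^ DIM('a)) * (NBINT z. ind A (x + r *\<^sub>R z))"
  by (rule distr_lborel_affine) (use assms in auto)
 also have "(\<lambda>z. ind A (x + r *\<^sub>R z)) = (ind {z. x + r *\<^sub>R z \<in> A} :: 'a => ennreal)"
  by (auto simp: indicator_def)
 finally have "evol A = ennreal (r ^ DIM('a)) * evol {z. x + r *\<^sub>R z \<in> A}"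
  using assms m by simp
 thus ?thesis using assms by (simp add: measure_def enn2real_mult)
qed

text \<open>Scaling reduces the claim to the unit ball at 0, where slabs of height 1/(n+1) decrease
  to the empty set. One \<open>kap\<close> therefore serves all centres and radii.\<close>

lemma thin_slab:
 fixes nu :: "'a::euclidean_space"
 assumes nu: "norm nu = 1" and a: "a > 0"
 shows "\<exists>kap. 0 < kap \<and> kap < 1 \<and> (\<forall>x r. r > 0 \<longrightarrow>
  vol ({y. x \<bullet> nu < y \<bullet> nu \<and> y \<bullet> nu < x \<bullet> nu + kap * r} \<inter> ball x r) \<le> a * r ^ DIM('a))"
proof -
 define S where "S n = {z::'a. 0 < z \<bullet> nu \<and> z \<bullet> nu < 1 / real (Suc n)} \<inter> ball 0 1" for n
 have S: "S n \<in> sets borel" for n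
  unfolding S_def inner_commute[of _ nu]
  by (auto intro!: sets.Int borel_open open_Collect_conj open_Collect_less continuous_intros)
 have fin: "evol (S n) \<noteq> \<infinity>" for n
  using emeasure_subset_ball_finite[of "S n" 0 1] by (auto simp: S_def)
 have dec: "decseq S" unfolding decseq_def S_def
 proof (intro allI impI subsetI)
  fix m n :: nat and z :: 'a assume "m \<le> n" and z: "z \<in> {z. 0 < z \<bullet> nu \<and> z \<bullet> nu < 1 / real (Suc n)} \<inter> ball 0 1"
  hence "1 / real (Suc n) \<le> 1 / real (Suc m)" by (intro divide_left_mono) auto
  thus "z \<in> {z. 0 < z \<bullet> nu \<and> z \<bullet> nu < 1 / real (Suc m)} \<inter> ball 0 1" using z by auto
 qed
 have "(\<Inter>n. S n) = {}"
 proof -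
  have False if "\<forall>n. z \<in> S n" for z
  proof -
   have "0 < z \<bullet> nu" using that by (auto simp: S_def)
   then obtain n where "1 / real (Suc n) < z \<bullet> nu" by (metis nat_approx_posE)
   moreover have "z \<bullet> nu < 1 / real (Suc n)" using that by (auto simp: S_def)
   ultimately show False by simp
  qed
  thus ?thesis by blast
 qed
 hence "(\<lambda>n. vol (S n)) \<longlonglongrightarrow> 0"
  using Lim_measure_decseq[OF _ dec fin] S by (auto simp: image_subset_iff)
 hence "eventually (\<lambda>n. vol (S n) < a) sequentially" using a by (intro order_tendstoD) auto
 hence "eventually (\<lambda>n. vol (S n) < a \<and> n \<ge> 1) sequentially"
  using eventually_ge_at_top[of 1] by eventually_elim auto
 then obtain n where n: "vol (S n) < a" "n \<ge> 1" by (auto simp: eventually_sequentially)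
 have "vol ({y. x \<bullet> nu < y \<bullet> nu \<and> y \<bullet> nu < x \<bullet> nu + 1 / real (Suc n) * r} \<inter> ball x r) \<le> a * r ^ DIM('a)"
  if r: "r > 0" for x r
 proof -
  let ?A = "{y. x \<bullet> nu < y \<bullet> nu \<and> y \<bullet> nu < x \<bullet> nu + 1 / real (Suc n) * r} \<inter> ball x r"
  have "?A \<in> sets borel"
   by (auto intro!: sets.Int borel_open open_Collect_conj open_Collect_less continuous_intros)
  from measure_scale[OF r this, of x]
  have "vol ?A = r ^ DIM('a) * vol {z. x + r *\<^sub>R z \<in> ?A}" .
  also have "{z. x + r *\<^sub>R z \<in> ?A} = S n"
   using r by (auto simp: S_def inner_add_left dist_norm zero_less_mult_iff pos_less_divide_eq mult.commute[of r])
  finally show ?thesis using n r by (simp add: mult.commute mult_left_mono)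
 qed
 thus ?thesis using n by (intro exI[of _ "1 / real (Suc n)"]) auto
qed

lemma separated_atD:
 fixes x :: "'a::euclidean_space"
 assumes "separated_at E x nu" "e > 0"
 obtains dlt where "dlt > 0" "\<And>r. 0 < r ==> r < dlt ==> inversions_le E nu (ball x r) (e * (r ^ DIM('a))\<^sup>2)"
 using assms unfolding separated_at_def by blast

lemma inversions_le_compl:
 assumes "inversions_le E nu U c" shows "inversions_le (- E) (- nu) U c"
 unfolding inversions_le_def
proof (intro allI impI)
 fix X Y :: "'a set"
 assume b: "X \<in> sets borel" "Y \<in> sets borel" "X \<subseteq> U \<inter> - E" "Y \<subseteq> U - - E" "\<forall>y\<in>X. \<forall>z\<in>Y. y \<bullet> - nu \<le> z \<bullet> - nu"
 have "vol Y * vol X \<le> c"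
  by (rule inversions_leD[OF assms b(2,1)]) (use b(3,4,5) in auto)
 thus "vol X * vol Y \<le> c" by (simp add: mult.commute)
qed

lemma separated_at_compl: "separated_at E x nu ==> separated_at (- E) x (- nu)"
 unfolding separated_at_def using inversions_le_compl by (metis norm_minus_cancel)

text \<open>If the part of the complement of \<open>E\<close> in the upper half ball of radius r is not negligible, then, by separation,
 \<open>E\<close> is negligible in the upper half balls of radius between \<open>kap\<^sup>2 r\<close> and \<open>kap r\<close>. Hence the same situation recurs at
 radius \<open>kap r\<close>, and \<open>E\<close> is negligible in all smaller upper half balls.\<close>

lemma half_space_dichotomy:
 fixes x :: "'a::euclidean_space"
 assumes sep: "separated_at E x nu" and E[measurable]: "E \<in> sets borel"
 shows "null_density (half_space x nu - E) x \<or> null_density (half_space x nu \<inter> E) x"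
proof (rule disjCI)
 assume "\<not> null_density (half_space x nu \<inter> E) x"
 show "null_density (half_space x nu - E) x"
 proof (rule ccontr)
  assume "\<not> null_density (half_space x nu - E) x"
  let ?N = "DIM('a)"
  let ?H = "half_space x nu"
  define v where "v = unit_ball_vol (real ?N) / 2"
  have v: "v > 0" by (simp add: v_def)
  have nu: "norm nu = 1" using sep by (simp add: separated_at_def)
  obtain a0 where a0: "a0 > 0" "\<And>dlt. dlt > 0 ==> \<exists>r. 0 < r \<and> r < dlt \<and> a0 * r ^ ?N < vol ((?H - E) \<inter> ball x r)"
   using \<open>\<not> null_density (half_space x nu - E) x\<close> unfolding null_density_def by (auto simp: not_le)
  \<comment> \<open>The cap v/2, also imposed on \<open>e\<close> below, ensures a + e \<le> v: if
    \<open>E\<close> occupies at most e r^N of the upper half ball, its complement occupies at least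
    a r^N.\<close>
  define a where "a = min a0 (v/2)"
  have a: "a > 0" "a \<le> v/2" using a0 v by (auto simp: a_def)
  have abad: "\<exists>r. 0 < r \<and> r < dlt \<and> a * r ^ ?N < vol ((?H - E) \<inter> ball x r)" if dlt: "dlt > 0" for dlt
  proof -
   obtain r where r: "0 < r" "r < dlt" "a0 * r ^ ?N < vol ((?H - E) \<inter> ball x r)" using a0(2)[OF dlt] by blast
   have "a * r ^ ?N \<le> a0 * r ^ ?N" using r by (intro mult_right_mono) (auto simp: a_def)
   thus ?thesis using r le_less_trans by blast
  qed
  obtain kap where kap: "0 < kap" "kap < 1" "\<And>r. r > 0 ==>
    vol ({y. x \<bullet> nu < y \<bullet> nu \<and> y \<bullet> nu < x \<bullet> nu + kap * r} \<inter> ball x r) \<le> a/2 * r ^ ?N"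
   using thin_slab[OF nu, of "a/2"] a by auto
  have split: "vol (?H \<inter> E \<inter> ball x r) + vol ((?H - E) \<inter> ball x r) = v * r ^ ?N" if "r \<ge> 0" for r
  proof -
   have f: "A \<in> fmeasurable lborel" if "A \<in> sets borel" "A \<subseteq> ball x r" for A
    using that by (rule fmeasurable_subset_ball)
   have "vol (?H \<inter> E \<inter> ball x r \<union> (?H - E) \<inter> ball x r) =
    vol (?H \<inter> E \<inter> ball x r) + vol ((?H - E) \<inter> ball x r)"
    by (intro measure_Un_AE f) auto
   moreover have "?H \<inter> E \<inter> ball x r \<union> (?H - E) \<inter> ball x r = ?H \<inter> ball x r" by blast
   ultimately show ?thesis using measure_half_ball[OF nu that, of x] by (simp add: v_def)
  qed
  have "null_density (?H \<inter> E) x"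
   unfolding null_density_def
  proof (intro allI impI)
   fix e0 :: real assume e0: "e0 > 0"
   define e where "e = min e0 (v/2)"
   have e: "e > 0" "e \<le> e0" "e \<le> v/2" using e0 v by (auto simp: e_def)
   \<comment> \<open>Chosen so that division by the lower bound a/2 r^N for the volume of
     \<open>Y\<close> leaves e (kap^2 r)^N, the bound at the smallest radius of the step.\<close>
   define e1 where "e1 = (a/2) * (e * (kap\<^sup>2) ^ ?N)"
   have e1: "e1 > 0" using a e kap by (simp add: e1_def)
   obtain dlt where dlt: "dlt > 0" "\<And>r. 0 < r ==> r < dlt ==> inversions_le E nu (ball x r) (e1 * (r ^ ?N)\<^sup>2)"
    using separated_atD[OF sep e1] by blast
   have step: "vol (?H \<inter> E \<inter> ball x r') \<le> e * r' ^ ?N"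
    if r: "0 < r" "r < dlt" "a * r ^ ?N \<le> vol ((?H - E) \<inter> ball x r)" and r': "kap\<^sup>2 * r \<le> r'" "r' \<le> kap * r" for r r'
   proof -
    define S where "S = {y. x \<bullet> nu < y \<bullet> nu \<and> y \<bullet> nu < x \<bullet> nu + kap * r}"
    have Sb: "S \<in> sets borel" unfolding S_def
     by (auto intro!: borel_open open_Collect_conj open_Collect_less continuous_intros)
    \<comment> \<open>A slab of height kap r is cut off. It has volume at most a/2 r^N, and what
      remains is no lower than any point of the ball of radius kap r, in which \<open>X\<close>
      lies.\<close>
    define Y where "Y = ((?H - E) \<inter> ball x r) - S"
    define X where "X = ?H \<inter> E \<inter> ball x (kap * r)"
    have XYb: "X \<in> sets borel" "Y \<in> sets borel" using Sb by (auto simp: X_def Y_def)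
    have "vol ((?H - E) \<inter> ball x r) \<le> vol Y + vol (S \<inter> ball x r)"
    proof -
     have "vol ((?H - E) \<inter> ball x r) \<le> vol (Y \<union> (S \<inter> ball x r))"
     proof (rule measure_mono_fmeasurable)
      show "(?H - E) \<inter> ball x r \<subseteq> Y \<union> (S \<inter> ball x r)" unfolding Y_def by blast
      have sub: "Y \<union> (S \<inter> ball x r) \<subseteq> ball x r" unfolding Y_def by blast
      have "Y \<union> (S \<inter> ball x r) \<in> sets borel"
       by (intro sets.Un sets.Int XYb Sb borel_open open_ball)
      thus "Y \<union> (S \<inter> ball x r) \<in> fmeasurable lborel" by (rule fmeasurable_subset_ball[OF _ sub])
     qed auto
     also have "\<dots> \<le> vol Y + vol (S \<inter> ball x r)"
      using XYb Sb by (intro measure_Un_le) auto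
     finally show ?thesis .
    qed
    hence Y: "a/2 * r ^ ?N \<le> vol Y" using r(3) kap(3)[OF r(1)] unfolding S_def by simp
    have "vol X * vol Y \<le> e1 * (r ^ ?N)\<^sup>2"
    proof (rule inversions_leD[OF dlt(2)[OF r(1,2)] XYb])
     have "kap * r \<le> r" using kap r by simp
     thus "X \<subseteq> ball x r \<inter> E" by (auto simp: X_def)
     show "Y \<subseteq> ball x r - E" by (auto simp: Y_def)
     fix y z assume y: "y \<in> X" and z: "z \<in> Y"
     have z': "x \<bullet> nu + kap * r \<le> z \<bullet> nu" using z unfolding Y_def S_def half_space_def by auto
     have "(y - x) \<bullet> nu \<le> norm (y - x) * norm nu" by (rule norm_cauchy_schwarz)
     also have "\<dots> \<le> kap * r" using y nu by (auto simp: X_def dist_norm norm_minus_commute)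
     finally show "y \<bullet> nu \<le> z \<bullet> nu" using z' by (simp add: inner_diff_left)
    qed
    hence "vol X * (a/2 * r ^ ?N) \<le> (a/2 * r ^ ?N) * (e * (kap\<^sup>2) ^ ?N * r ^ ?N)"
     using mult_left_mono[OF Y, of "vol X"] by (simp add: e1_def power2_eq_square mult_ac)
    hence "vol X \<le> e * (kap\<^sup>2) ^ ?N * r ^ ?N"
     using a r by (simp add: mult.commute[of "vol X"])
    also have "\<dots> = e * (kap\<^sup>2 * r) ^ ?N" by (simp add: power_mult_distrib)
    also have "\<dots> \<le> e * r' ^ ?N" using e r r' kap by (intro mult_left_mono power_mono) auto
    finally have "vol X \<le> e * r' ^ ?N" .
    moreover have "vol (?H \<inter> E \<inter> ball x r') \<le> vol X"
     unfolding X_def by (rule measure_Int_ball_mono) (use r' in auto)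
    ultimately show ?thesis by simp
   qed
   obtain r0 where r0: "0 < r0" "r0 < dlt" "a * r0 ^ ?N < vol ((?H - E) \<inter> ball x r0)" using abad[OF dlt(1)] by blast
   have small: "kap ^ n * r0 \<le> r0" "kap ^ n * r0 > 0" for n using kap r0 by (auto simp: power_le_one mult_le_cancel_right1)
   have rec: "kap ^ (n + 2) * r0 \<le> r' ==> r' \<le> kap ^ (n + 1) * r0 ==> vol (?H \<inter> E \<inter> ball x r') \<le> e * r' ^ ?N" for n r'
   proof (induction n arbitrary: r')
    case 0
    thus ?case using step[OF r0(1,2) less_imp_le[OF r0(3)], of r'] by (simp add: power2_eq_square)
   next
    case (Suc n)
    let ?r = "kap ^ (n + 1) * r0"
    have "kap ^ (n + 2) * r0 \<le> ?r" using kap r0 by simp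
    hence 1: "vol (?H \<inter> E \<inter> ball x ?r) \<le> e * ?r ^ ?N" by (intro Suc.IH) auto
    have rp: "0 < ?r" "?r < dlt" by (rule small(2), rule le_less_trans[OF small(1) r0(2)])
    have "(a + e) * ?r ^ ?N \<le> v * ?r ^ ?N" using a e rp by (intro mult_right_mono) auto
    hence "a * ?r ^ ?N \<le> vol ((?H - E) \<inter> ball x ?r)"
     using 1 split[of ?r] rp by (simp add: distrib_right)
    thus ?case using Suc.prems by (intro step[OF rp]) (auto simp: power2_eq_square mult_ac)
   qed
   have "vol (?H \<inter> E \<inter> ball x r') \<le> e0 * r' ^ ?N" if r': "0 < r'" "r' < kap * r0" for r'
   proof -
    have "(\<lambda>n. kap ^ n * r0) \<longlonglongrightarrow> 0 * r0" using kap by (intro tendsto_mult LIMSEQ_power_zero tendsto_const) auto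
    hence "eventually (\<lambda>n. kap ^ n * r0 < r') sequentially" using r' by (intro order_tendstoD) auto
    hence ex: "\<exists>n. kap ^ n * r0 < r'" by (auto simp: eventually_sequentially)
    \<comment> \<open>r' lies between two consecutive terms of the sequence kap^n r0; m is at least
      2 because r' is below kap r0, which matches the index shift in \<open>rec\<close>.\<close>
    define m where "m = (LEAST n. kap ^ n * r0 < r')"
    have m: "kap ^ m * r0 < r'" unfolding m_def by (rule LeastI_ex[OF ex])
    have m2: "m \<ge> 2"
    proof (rule ccontr)
     assume "\<not> m \<ge> 2"
     hence "m = 0 \<or> m = 1" by auto
     moreover have "kap * r0 \<le> r0" using kap r0 by simp
     ultimately show False using m r' by auto
    qed
    then obtain n where n: "m = n + 2" by (metis le_add_diff_inverse2)
    have "\<not> kap ^ (n + 1) * r0 < r'" using not_less_Least[of "n+1" "\<lambda>n. kap ^ n * r0 < r'"] n by (simp add: m_def)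
    hence "vol (?H \<inter> E \<inter> ball x r') \<le> e * r' ^ ?N" using m n by (intro rec[of n]) auto
    also have "\<dots> \<le> e0 * r' ^ ?N" using e r' by (intro mult_right_mono) auto
    finally show ?thesis .
   qed
   thus "\<exists>dlt>0. \<forall>r. 0 < r \<and> r < dlt \<longrightarrow> vol (?H \<inter> E \<inter> ball x r) \<le> e0 * r ^ ?N"
    using kap r0 by (intro exI[of _ "kap * r0"]) auto
  qed
  thus False using \<open>\<not> null_density (half_space x nu \<inter> E) x\<close> by blast
 qed
qed

lemma null_density_cong_plane:
 assumes "norm nu = 1" "null_density S x" "S \<in> sets borel" "T \<in> sets borel" "T \<subseteq> S \<union> {y. y \<bullet> nu = c}"
 shows "null_density T x"
proof -
 have P: "{y. y \<bullet> nu = c} \<in> null_sets lborel" by (rule half_space_plane_null[OF assms(1)])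
 have "null_density {y. y \<bullet> nu = c} x"
  unfolding null_density_def
 proof (intro allI impI exI[of _ "1::real"] conjI)
  fix e r :: real assume "e > 0" "0 < r \<and> r < 1"
  moreover have "{y. y \<bullet> nu = c} \<inter> ball x r \<in> null_sets lborel"
   using null_set_Int2[OF P, of "ball x r"] by simp
  hence "vol ({y. y \<bullet> nu = c} \<inter> ball x r) = 0" by (auto simp: measure_def)
  ultimately show "vol ({y. y \<bullet> nu = c} \<inter> ball x r) \<le> e * r ^ DIM('a)" by simp
 qed auto
 hence "null_density (S \<union> {y. y \<bullet> nu = c}) x"
  using assms P by (intro null_density_Un) (auto dest: null_setsD2)
 thus ?thesis by (rule null_density_mono) (use assms P in \<open>auto dest: null_setsD2\<close>)
qed

text \<open>Of the four combinations of the two dichotomies, three are the claimed alternatives up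
  to a null hyperplane. In the fourth, \<open>E\<close> fills much of the lower half ball and misses
  much of the upper one; these parts form inversions of product at least v^2/4 r^(2N), against the
  bound v^2/8 r^(2N).\<close>

lemma separated_trichotomy:
 fixes x :: "'a::euclidean_space"
 assumes sep: "separated_at E x nu" and E[measurable]: "E \<in> sets borel"
 shows "null_density E x \<or> null_density (- E) x \<or> null_density ((half_space x nu - E) \<union> (E - half_space x nu)) x"
proof -
 let ?H = "half_space x nu" and ?L = "half_space x (- nu)"
 have nu: "norm nu = 1" using sep by (simp add: separated_at_def)
 have up: "null_density (?H - E) x \<or> null_density (?H \<inter> E) x"
  by (rule half_space_dichotomy[OF sep E])
 have lo: "null_density (?L \<inter> E) x \<or> null_density (?L - E) x"
  using half_space_dichotomy[OF separated_at_compl[OF sep]] by (simp add: Diff_eq)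
 have HL: "y \<in> ?H \<or> y \<in> ?L \<or> y \<bullet> nu = x \<bullet> nu" for y by (auto simp: half_space_def)
 consider "null_density (?H - E) x" "null_density (?L \<inter> E) x"
  | "null_density (?H \<inter> E) x" "null_density (?L \<inter> E) x"
  | "null_density (?H - E) x" "null_density (?L - E) x"
  | "null_density (?H \<inter> E) x" "null_density (?L - E) x" using up lo by blast
 thus ?thesis
 proof cases
  case 1
  have "null_density ((?H - E) \<union> (E - ?H)) x"
   by (rule null_density_cong_plane[OF nu null_density_Un[OF 1], of _ "x \<bullet> nu"]) (use HL in auto)
  thus ?thesis by blast
 next
  case 2
  have "null_density E x"
   by (rule null_density_cong_plane[OF nu null_density_Un[OF 2], of _ "x \<bullet> nu"]) (use HL in auto)
  thus ?thesis by blast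
 next
  case 3
  have "null_density (- E) x"
   by (rule null_density_cong_plane[OF nu null_density_Un[OF 3], of _ "x \<bullet> nu"]) (use HL in auto)
  thus ?thesis by blast
 next
  case 4
  let ?N = "DIM('a)"
  define v where "v = unit_ball_vol (real ?N) / 2"
  have v: "v > 0" by (simp add: v_def)
  have v2: "v/2 > 0" and v8: "v\<^sup>2/8 > 0" using v by auto
  obtain dlt1 where dlt1: "dlt1 > 0" "\<And>r. 0 < r ==> r < dlt1 ==> vol (?H \<inter> E \<inter> ball x r) \<le> v/2 * r ^ ?N"
   using 4(1) v2 unfolding null_density_def by blast
  obtain dlt2 where dlt2: "dlt2 > 0" "\<And>r. 0 < r ==> r < dlt2 ==> vol ((?L - E) \<inter> ball x r) \<le> v/2 * r ^ ?N"
   using 4(2) v2 unfolding null_density_def by blast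
  obtain dlt where dlt: "dlt > 0" "\<And>r. 0 < r ==> r < dlt ==> inversions_le E nu (ball x r) (v\<^sup>2/8 * (r ^ ?N)\<^sup>2)"
   using separated_atD[OF sep v8] by blast
  define r where "r = min (min dlt1 dlt2) dlt / 2"
  have r: "0 < r" "r < dlt1" "r < dlt2" "r < dlt" using dlt1 dlt2 dlt by (auto simp: r_def)
  define X where "X = ?L \<inter> E \<inter> ball x r"
  define Y where "Y = (?H - E) \<inter> ball x r"
  have f: "A \<in> fmeasurable lborel" if "A \<in> sets borel" "A \<subseteq> ball x r" for A
    using that by (rule fmeasurable_subset_ball)
  have "vol (X \<union> (?L - E) \<inter> ball x r) = vol X + vol ((?L - E) \<inter> ball x r)"
   unfolding X_def by (intro measure_Un_AE f) auto
  moreover have "X \<union> (?L - E) \<inter> ball x r = ?L \<inter> ball x r" by (auto simp: X_def)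
  ultimately have Xm: "v/2 * r ^ ?N \<le> vol X"
   using measure_half_ball[of "- nu" r x] nu r dlt2(2)[of r] by (simp add: v_def)
  have "vol (?H \<inter> E \<inter> ball x r \<union> Y) = vol (?H \<inter> E \<inter> ball x r) + vol Y"
   unfolding Y_def by (intro measure_Un_AE f) auto
  moreover have "?H \<inter> E \<inter> ball x r \<union> Y = ?H \<inter> ball x r" by (auto simp: Y_def)
  ultimately have Ym: "v/2 * r ^ ?N \<le> vol Y"
   using measure_half_ball[OF nu, of r x] r dlt1(2)[of r] by (simp add: v_def)
  have "(v/2 * r ^ ?N) * (v/2 * r ^ ?N) \<le> vol X * vol Y"
   using Xm Ym v r by (intro mult_mono) auto
  also have "\<dots> \<le> v\<^sup>2/8 * (r ^ ?N)\<^sup>2"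
   by (rule inversions_leD[OF dlt(2)[OF r(1,4)]]) (auto simp: X_def Y_def half_space_def)
  finally have "v\<^sup>2/4 * (r ^ ?N)\<^sup>2 \<le> v\<^sup>2/8 * (r ^ ?N)\<^sup>2" by (simp add: power2_eq_square mult_ac)
  thus ?thesis using v r by simp
 qed
qed

lemma moll_null_density:
 fixes x :: "'a::euclidean_space"
 assumes nd: "null_density S x" and [measurable]: "S \<in> sets borel" and e: "e > 0"
 shows "\<exists>dlt>0. \<forall>eps. 0 < eps \<and> eps < dlt \<longrightarrow> (NBINT y. ennreal (moll eps (x - y)) * ind S y) \<le> ennreal e"
proof -
 define C where "C = (LBINT y. bump 1 (y::'a))"
 have C: "C > 0" unfolding C_def by (rule bump_integral_pos) simp
 have "e * C > 0" using e C by simp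
 then obtain dlt where dlt: "dlt > 0" "\<And>r. 0 < r ==> r < dlt ==> vol (S \<inter> ball x r) \<le> e * C * r ^ DIM('a)"
  using nd unfolding null_density_def by blast
 have "(NBINT y. ennreal (moll eps (x - y)) * ind S y) \<le> ennreal e" if eps: "0 < eps" "eps < dlt" for eps
 proof -
  have "(NBINT y. ennreal (moll eps (x - y)) * ind S y)
   \<le> (NBINT y. ennreal (1 / (eps ^ DIM('a) * C)) * ind (S \<inter> ball x eps) y)"
  proof (intro nn_integral_mono)
   fix y
   show "ennreal (moll eps (x - y)) * ind S y \<le> ennreal (1 / (eps ^ DIM('a) * C)) * ind (S \<inter> ball x eps) y"
    using moll_le[OF eps(1), of "x - y"] moll_outside[OF eps(1), of "x - y"]
    by (cases "norm (x - y) < eps") (auto simp: indicator_def C_def dist_norm intro!: ennreal_leI)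
  qed
  also have "\<dots> = ennreal (1 / (eps ^ DIM('a) * C)) * evol (S \<inter> ball x eps)"
   by (rule nn_integral_cmult_indicator) auto
  also have "evol (S \<inter> ball x eps) = ennreal (vol (S \<inter> ball x eps))"
   using emeasure_subset_ball_finite[of "S \<inter> ball x eps" x eps] by (intro emeasure_eq_ennreal_measure) auto
  also have "\<dots> \<le> ennreal (e * C * eps ^ DIM('a))" by (intro ennreal_leI dlt(2)[OF eps])
  also have "ennreal (1 / (eps ^ DIM('a) * C)) * \<dots> = ennreal e"
   using C eps e by (subst ennreal_mult[symmetric]) auto
  finally show ?thesis by (simp add: mult_left_mono)
 qed
 with dlt(1) show ?thesis by blast
qed


section \<open>Averages of sets against the mollifier\<close>

definition moll_avg :: "real => 'a::euclidean_space set => 'a => real" where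
 "moll_avg eps E x = (LBINT y. moll eps (x - y) * ind E y)"

lemma moll_avg_nn_integral:
 assumes "eps > 0" "E \<in> sets borel"
 shows "ennreal (moll_avg eps E x) = (NBINT y. ennreal (moll eps (x - y)) * ind E y)"
proof -
 have "Lint (\<lambda>y. ind E y *\<^sub>R moll eps (x - y))"
  using assms by (intro integrable_mult_indicator moll_integrable_reflect) auto
 hence "(NBINT y. ennreal (moll eps (x - y) * ind E y)) = ennreal (moll_avg eps E x)"
  unfolding moll_avg_def
  by (intro nn_integral_eq_integral) (auto simp: mult.commute moll_nonneg[OF assms(1)])
 thus ?thesis by (simp add: ennreal_mult moll_nonneg[OF assms(1)] ennreal_indicator)
qed

lemma moll_avg_nonneg: "eps > 0 ==> moll_avg eps E x \<ge> 0"
 unfolding moll_avg_def by (intro Bintegral_nonneg) (simp add: moll_nonneg)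

lemma moll_avg_le_add:
 assumes "eps > 0" "E \<in> sets borel" "F \<in> sets borel" "G \<in> sets borel" "E \<subseteq> F \<union> G"
 shows "moll_avg eps E x \<le> moll_avg eps F x + moll_avg eps G x"
proof -
 note moll_measurable[OF assms(1), measurable] assms(2-4)[measurable]
 have "ennreal (moll_avg eps E x) \<le> (NBINT y. ennreal (moll eps (x - y)) * ind F y + ennreal (moll eps (x - y)) * ind G y)"
  unfolding moll_avg_nn_integral[OF assms(1,2)] using assms(5)
  by (intro nn_integral_mono) (auto simp: indicator_def)
 also have "\<dots> = ennreal (moll_avg eps F x) + ennreal (moll_avg eps G x)"
  unfolding moll_avg_nn_integral[OF assms(1,3)] moll_avg_nn_integral[OF assms(1,4)]
  by (rule nn_integral_add) measurable
 also have "\<dots> = ennreal (moll_avg eps F x + moll_avg eps G x)"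
  by (intro ennreal_plus[symmetric] moll_avg_nonneg assms(1))
 finally show ?thesis
  by (subst (asm) ennreal_le_iff) (auto intro!: add_nonneg_nonneg moll_avg_nonneg assms(1))
qed

lemma moll_avg_empty: "moll_avg eps {} x = 0"
 by (simp add: moll_avg_def)

lemma moll_avg_mono:
 assumes "eps > 0" "E \<in> sets borel" "F \<in> sets borel" "E \<subseteq> F"
 shows "moll_avg eps E x \<le> moll_avg eps F x"
 using moll_avg_le_add[OF assms(1-3), of "{}" x] assms(4) by (simp add: moll_avg_empty)

lemma moll_avg_compl:
 assumes "eps > 0" "E \<in> sets borel"
 shows "moll_avg eps (- E) x = 1 - moll_avg eps E x"
proof -
 have i: "Lint (\<lambda>y. moll eps (x - y) * ind E y)"
  using integrable_mult_indicator[of E lborel, OF _ moll_integrable_reflect[OF assms(1)]] assms(2) by (simp add: mult.commute)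
 have "moll_avg eps (- E) x = (LBINT y. moll eps (x - y) - moll eps (x - y) * ind E y)"
  unfolding moll_avg_def by (intro Bintegral_cong) (auto simp: indicator_def)
 also have "\<dots> = 1 - moll_avg eps E x"
  unfolding moll_avg_def by (subst Bintegral_diff[OF moll_integrable_reflect[OF assms(1)] i])
   (simp add: moll_integral_reflect[OF assms(1)])
 finally show ?thesis .
qed

lemma moll_avg_half_space:
 assumes "eps > 0" "norm nu = 1"
 shows "moll_avg eps (half_space x nu) x = 1/2"
proof -
 note moll_measurable[OF assms(1), measurable]
 have "2 * ennreal (moll_avg eps (half_space x nu) x) = (NBINT y. ennreal (moll eps (x - y)))"
  unfolding moll_avg_nn_integral[OF assms(1) half_space_borel]
  using moll_commute[OF assms(1), of x]
  by (intro nn_integral_half_space[OF assms(2)]) (auto simp: scaleR_2 algebra_simps)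
 from arg_cong[OF this, of enn2real] show ?thesis
  by (simp add: enn2real_mult moll_nn_integral_reflect[OF assms(1)] moll_avg_nonneg[OF assms(1)])
qed

lemma moll_avg_null_density:
 assumes "null_density S x" "S \<in> sets borel"
 shows "((\<lambda>eps. moll_avg eps S x) \<longlongrightarrow> 0) (at_right 0)"
proof (rule tendstoI)
 fix e :: real assume "e > 0"
 hence "e/2 > 0" by simp
 obtain dlt where dlt: "dlt > 0" "\<And>eps. 0 < eps ==> eps < dlt ==>
   (NBINT y. ennreal (moll eps (x - y)) * ind S y) \<le> ennreal (e/2)"
  using moll_null_density[OF assms \<open>e/2 > 0\<close>] by blast
 have "dist (moll_avg eps S x) 0 < e" if "0 < eps" "eps < dlt" for eps
  using dlt(2)[OF that] moll_avg_nonneg[OF that(1), of S x] \<open>e > 0\<close>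
  by (simp flip: moll_avg_nn_integral[OF that(1) assms(2)])
 thus "eventually (\<lambda>eps. dist (moll_avg eps S x) 0 < e) (at_right 0)"
  using dlt(1) by (auto simp: eventually_at_right_field)
qed

text \<open>In the third alternative \<open>E\<close> differs from the half space through x by a set
  of null density, and the even kernel gives that half space exactly 1/2.\<close>

lemma separated_moll_avg:
 assumes sep: "separated_at E x nu" and E: "E \<in> sets borel"
 shows "null_density E x \<or> null_density (- E) x \<or> ((\<lambda>eps. moll_avg eps E x) \<longlongrightarrow> 1/2) (at_right 0)"
proof -
 let ?H = "half_space x nu" and ?D = "(half_space x nu - E) \<union> (E - half_space x nu)"
 have nu: "norm nu = 1" using sep by (simp add: separated_at_def)
 have D: "?D \<in> sets borel" using E by auto
 have "((\<lambda>eps. moll_avg eps E x) \<longlongrightarrow> 1/2) (at_right 0)" if nd: "null_density ?D x"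
 proof (rule tendstoI)
  fix e :: real assume "e > 0"
  have "eventually (\<lambda>eps. moll_avg eps ?D x < e \<and> eps > 0) (at_right 0)"
   using order_tendstoD(2)[OF moll_avg_null_density[OF nd D] \<open>e > 0\<close>] eventually_at_right_less
   by (rule eventually_conj)
  thus "eventually (\<lambda>eps. dist (moll_avg eps E x) (1/2) < e) (at_right 0)"
  proof eventually_elim
   case (elim eps)
   have "moll_avg eps E x \<le> moll_avg eps ?H x + moll_avg eps ?D x" "moll_avg eps ?H x \<le> moll_avg eps E x + moll_avg eps ?D x"
    using E D elim by (auto intro!: moll_avg_le_add)
   thus ?case using elim moll_avg_half_space[of eps nu x] nu by (auto simp: dist_real_def)
  qed
 qed
 thus ?thesis using separated_trichotomy[OF sep E] by blast
qed

text \<open>A weak form of the structure theorem of De Giorgi and Federer: at the jump points only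
  the limit 1/2 of the averages is kept, not the blow-up.\<close>

lemma (in finite_perimeter) fine_structure:
 "\<exists>N. hnull N \<and> (\<forall>x\<in>W - N. null_density E x \<or> null_density (- E) x \<or>
  ((\<lambda>eps. moll_avg eps E x) \<longlongrightarrow> 1/2) (at_right 0))"
 using hnull_not_regular regular_imp_separated separated_moll_avg[OF _ E] by blast

section \<open>Coarea inequality for functions of bounded variation\<close>

text \<open>Translation invariance: the integral of phi (x + s h) - phi x is 0, and it equals s
  times the integral of the derivative up to an error of order e s.\<close>

lemma integral_frechet_derivative_zero:
 fixes phi :: "'a::euclidean_space => real"
 assumes "C1c_on \<Omega> phi" shows "(LBINT x. FD phi x h) = 0"
proof (cases "h = 0")
 case True
 thus ?thesis by (simp add: linear_0[OF C1c_on_linear[OF assms]])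
next
 case False
 let ?D = "\<lambda>x. FD phi x h"
 obtain K where K: "compact K" "\<And>x. x \<notin> K ==> phi x = 0" "\<And>x v. x \<notin> K ==> FD phi x v = 0"
  using C1c_onE[OF assms] by metis
 \<comment> \<open>Contains the supports of \<open>phi\<close> and of its translates by s h with s
   \<le> 1, so one volume bounds every error.\<close>
 let ?S = "\<Union>x\<in>K. cball x (norm h)"
 have S: "compact ?S" by (rule compact_Union_cball[OF K(1)])
 define v where "v = vol ?S"
 have [measurable]: "phi \<in> Borel" using C1c_on_measurable[OF assms] .
 have iphi: "Lint phi" and iD: "Lint ?D"
  using C1c_on_integrable[OF assms] C1c_on_derivative_integrable[OF assms] by auto
 have iS: "Lint (ind ?S :: 'a => real)"
  using S by (auto intro!: integrable_real_indicator emeasure_compact_finite borel_compact)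
 have "\<bar>LBINT x. ?D x\<bar> \<le> e * (norm h * v)" if e: "e > 0" for e
 proof -
  obtain d where d: "d > 0" "\<And>x y. norm (y - x) < d ==>
   norm (phi y - phi x - FD phi x (y - x)) \<le> e * norm (y - x)"
   using C1c_on_uniform_remainder[OF assms e] by blast
  define s where "s = min 1 (d / (2 * norm h))"
  have s: "0 < s" "s \<le> 1" "s * norm h < d"
   using d False by (auto simp: s_def min_def field_simps)
  have pt: "\<bar>phi (x + s *\<^sub>R h) - phi x - s * ?D x\<bar> \<le> (e * s * norm h) * ind ?S x" for x
  proof (cases "x \<in> ?S")
   case True
   have "\<bar>phi (x + s *\<^sub>R h) - phi x - FD phi x (s *\<^sub>R h)\<bar> \<le> e * norm (s *\<^sub>R h)"
    using d(2)[of "x + s *\<^sub>R h" x] s by simp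
   thus ?thesis using True s by (simp add: linear_cmul[OF C1c_on_linear[OF assms], simplified])
  next
   case False
   have "x \<notin> K" using False by (auto intro: bexI[of _ x])
   moreover have "x + s *\<^sub>R h \<notin> K"
    using False s mult_right_mono[OF s(2) norm_ge_zero[of h]]
    by (auto simp: dist_norm dest!: bspec[of _ _ "x + s *\<^sub>R h"])
   ultimately show ?thesis using K False by simp
  qed
  have it: "Lint (\<lambda>x. phi (x + s *\<^sub>R h))" using iphi by (subst integrable_translate) auto
  have "s * (LBINT x. ?D x) = - (LBINT x. phi (x + s *\<^sub>R h) - phi x - s * ?D x)"
   using it iphi iD integral_translate[of phi "s *\<^sub>R h"] by simp
  also have "\<bar>\<dots>\<bar> \<le> (LBINT x. (e * s * norm h) * ind ?S x)"
   unfolding abs_minus_cancel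
   by (rule integral_abs_bound[THEN order_trans], rule integral_mono) (use it iphi iD iS pt in auto)
  also have "\<dots> = (e * s * norm h) * v"
   using borel_compact[OF S] by (simp add: v_def)
  finally have "s * \<bar>LBINT x. ?D x\<bar> \<le> s * (e * (norm h * v))"
   using s by (simp add: abs_mult mult_ac)
  thus ?thesis using s by simp
 qed
 hence "\<bar>LBINT x. ?D x\<bar> \<le> 0 + e" if "e > 0" for e
 proof -
  have "norm h * v + 1 > 0" by (simp add: v_def add_nonneg_pos)
  hence "e / (norm h * v + 1) > 0" using \<open>e > 0\<close> by simp
  hence "\<bar>LBINT x. ?D x\<bar> \<le> e / (norm h * v + 1) * (norm h * v)" by fact
  also have "\<dots> \<le> e" using \<open>norm h * v + 1 > 0\<close> \<open>e > 0\<close> by (simp add: divide_le_eq mult_left_mono)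
  finally show ?thesis by simp
 qed
 hence "\<bar>LBINT x. ?D x\<bar> \<le> 0" by (rule field_le_epsilon)
 thus ?thesis by simp
qed

lemma integral_divergence_zero:
 assumes "C1c_on \<Omega> Phi" shows "(LBINT x. divergence Phi x) = 0"
proof -
 have "FD Phi x i \<bullet> i = FD (\<lambda>x. Phi x \<bullet> i) x i" for x i
  using C1c_on_linear_image(2)[OF assms bounded_linear_inner_left, of i x i] by simp
 moreover have "C1c_on \<Omega> (\<lambda>x. Phi x \<bullet> i)" for i
  by (rule C1c_on_linear_image(1)[OF assms bounded_linear_inner_left])
 ultimately show ?thesis
  unfolding divergence_def
  by (subst Bintegral_sum)
   (auto simp: integral_frechet_derivative_zero[of \<Omega>] intro: C1c_on_derivative_integrable[of \<Omega>])
qed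

lemma Fubini_convolution:
 fixes p q :: "'a::euclidean_space => real"
 assumes "Lint p" "Lint q" "continuous_on UNIV k" "\<And>z. \<bar>k z\<bar> \<le> C"
 shows "(LBINT x. p x * (LBINT y. k (x - y) * q y)) = (LBINT y. q y * (LBINT x. k (x - y) * p x))"
proof -
 have C: "C \<ge> 0" using assms(4)[of 0] by simp
 note [measurable] = borel_measurable_integrable[OF assms(1)] borel_measurable_integrable[OF assms(2)]
  borel_measurable_continuous_onI[OF assms(3)]
 have iq: "Lint (\<lambda>y. k (x - y) * q y)" for x
  using convol_integrable[OF assms(3,4,2)] by simp
 let ?f = "\<lambda>(x, y). p x * (k (x - y) * q y)"
 have "integrable (lborel \<Otimes>\<^sub>M lborel) ?f"
 proof (rule lborel_pair.Fubini_integrable)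
  have "Lint (\<lambda>x. \<bar>p x\<bar> * (C * (LBINT y. \<bar>q y\<bar>)))" using assms(1) by auto
  thus "Lint (\<lambda>x. LBINT y. norm (?f (x, y)))"
  proof (rule Bintegrable_bound)
   show "AE x in lborel. norm (LBINT y. norm (?f (x, y))) \<le> norm (\<bar>p x\<bar> * (C * (LBINT y. \<bar>q y\<bar>)))"
   proof (rule AE_I2)
    fix x
    have "(LBINT y. \<bar>p x * (k (x - y) * q y)\<bar>) \<le> (LBINT y. \<bar>p x\<bar> * (C * \<bar>q y\<bar>))"
     by (rule integral_mono) (use integrable_abs[OF iq[of x]] assms(2,4) C in \<open>auto simp: abs_mult intro!: mult_left_mono mult_right_mono\<close>)
    thus "norm (LBINT y. norm (?f (x, y))) \<le> norm (\<bar>p x\<bar> * (C * (LBINT y. \<bar>q y\<bar>)))"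
     using C by (simp add: abs_mult)
   qed
  qed measurable
 qed (use iq in auto)
 from lborel_pair.Fubini_integral[OF this]
 have "(LBINT y. LBINT x. p x * (k (x - y) * q y)) = (LBINT x. LBINT y. p x * (k (x - y) * q y))" .
 moreover have "(LBINT x. p x * (k (x - y) * q y)) = q y * (LBINT x. k (x - y) * p x)" for y
  by (simp only: integral_mult_right_zero[symmetric] mult_ac)
 ultimately show ?thesis by simp
qed

lemma grad_convol_continuous:
 fixes u :: "'a::euclidean_space => real"
 assumes "eps > 0" "Lint u"
 shows "continuous_on UNIV (\<lambda>x. FD (convol (moll eps) u) x v)"
  "continuous_on UNIV (grad (convol (moll eps) u))"
proof -
 have *: "continuous_on UNIV (\<lambda>x. FD (convol (moll eps) u) x v)" for v
 proof -
  have "C1c_on UNIV (iter_pd [v] (moll eps :: 'a => real))"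
   using smooth_kernel_moll[OF assms(1)] unfolding smooth_kernel_def by blast
  from convol_continuous[OF this assms(2)] show ?thesis
   by (simp add: frechet_derivative_convol[OF moll_C1c[OF assms(1)] assms(2)])
 qed
 show "continuous_on UNIV (\<lambda>x. FD (convol (moll eps) u) x v)" by (rule *)
 show "continuous_on UNIV (grad (convol (moll eps) u))" unfolding grad_def by (intro continuous_intros *)
qed

text \<open>Duality: the normalised gradient on \<open>K\<close> is the test field, and the
  mollifier moves from u onto it. The mollified field is of class C^1, still of norm at most 1, and
  supported in Omega because the closed eps-balls about \<open>K\<close> are.\<close>

lemma mollified_variation:
 fixes u :: "'a::euclidean_space => real"
 assumes eps: "eps > 0" and u: "Lint u" and K: "compact K" "\<And>y. y \<in> K ==> cball y eps \<subseteq> \<Omega>"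
  and bound: "\<And>Phi. C1c_on \<Omega> Phi ==> (\<And>x. norm (Phi x) \<le> 1) ==> (LBINT x. u x * divergence Phi x) \<le> C"
 shows "(NBINT x. ind K x * ennreal (norm (grad (convol (moll eps) u) x))) \<le> ennreal C"
proof -
 let ?w = "convol (moll eps) u"
 let ?D = "\<lambda>i (z::'a). FD (moll eps) z i :: real"
 note mC = moll_C1c[OF eps, where 'a = 'a]
 have Kb[measurable]: "K \<in> sets borel" using borel_compact[OF K(1)] .
 have gm[measurable]: "grad ?w \<in> Borel"
  by (rule borel_measurable_continuous_onI[OF grad_convol_continuous(2)[OF eps u]])
 have ig: "Lint (\<lambda>x. ind K x *\<^sub>R grad ?w x)"
  by (rule borel_integrable_compact[OF K(1) continuous_on_subset[OF grad_convol_continuous(2)[OF eps u]]]) auto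
 have iK: "Lint (ind K :: 'a => real)"
  using Kb emeasure_compact_finite[OF K(1)] by (intro integrable_real_indicator) auto
 define Phi where "Phi x = ind K x *\<^sub>R sgn (grad ?w x)" for x
 have Phim[measurable]: "Phi \<in> Borel" unfolding Phi_def[abs_def] sgn_div_norm by measurable
 have Phi1: "norm (Phi x) \<le> 1" for x by (simp add: Phi_def norm_sgn indicator_def)
 have iPhi: "Lint Phi"
  by (rule Bintegrable_bound[OF iK]) (use Phi1 in \<open>auto simp: Phi_def norm_sgn\<close>)
 have iPhii: "Lint (\<lambda>x. Phi x \<bullet> i)" for i using iPhi by simp
 let ?Psi = "convol (moll eps) Phi"
 have Psi: "C1c_on \<Omega> ?Psi" by (rule convol_moll_C1c[OF eps iPhi K(1) _ K(2)]) (auto simp: Phi_def)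
 have Psi1: "norm (?Psi x) \<le> 1" for x using convol_moll_bound[OF eps, of Phi 1 x] Phi1 by simp
 have iD: "Lint (\<lambda>x. ?D i (y - x) *\<^sub>R Phi x)" for y i
  by (rule convol_C1c_integrable(2)[OF mC iPhi])
 obtain B where "\<forall>z i. norm (?D i z) \<le> B * norm i" using C1c_on_derivative_bounded[OF mC] by metis
 hence B: "\<bar>?D i z\<bar> \<le> B * norm i" for z i by simp
 \<comment> \<open>The derivative of an even kernel is odd; this sign is compensated by the factor
   -1 of the test field below.\<close>
 have odd: "?D i (x - y) = - ?D i (y - x)" for i x y
 proof -
  have "(\<lambda>z. moll eps (0 - z)) = (moll eps :: 'a => real)" by (simp add: moll_minus[OF eps])
  with C1c_on_reflect(2)[OF mC, of 0 "x - y" i] show ?thesis by simp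
 qed
 have divPsi: "divergence ?Psi y = - (\<Sum>i\<in>Basis. LBINT x. ?D i (x - y) * (Phi x \<bullet> i))" for y
 proof -
  have "divergence ?Psi y = (\<Sum>i\<in>Basis. (LBINT x. ?D i (y - x) *\<^sub>R Phi x) \<bullet> i)"
   unfolding divergence_def frechet_derivative_convol[OF mC iPhi] convol_def ..
  also have "\<dots> = (\<Sum>i\<in>Basis. LBINT x. - (?D i (x - y) * (Phi x \<bullet> i)))"
  proof (rule sum.cong[OF refl])
   fix i :: 'a assume "i \<in> Basis"
   show "(LBINT x. ?D i (y - x) *\<^sub>R Phi x) \<bullet> i = (LBINT x. - (?D i (x - y) * (Phi x \<bullet> i)))"
    using integral_inner_left[OF iD, of y i i] by (simp add: odd[of y])
  qed
  finally show ?thesis by (simp add: sum_negf)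
 qed
 have iB: "Lint (\<lambda>y. u y * (LBINT x. ?D i (x - y) * (Phi x \<bullet> i)))" for i
 proof -
  have c: "continuous_on UNIV (\<lambda>y. LBINT x. ?D i (x - y) * (Phi x \<bullet> i))"
  proof -
   have "(\<lambda>y. LBINT x. ?D i (x - y) * (Phi x \<bullet> i)) = (\<lambda>y. - FD (convol (moll eps) (\<lambda>x. Phi x \<bullet> i)) y i)"
   proof (rule ext)
    fix y show "(LBINT x. ?D i (x - y) * (Phi x \<bullet> i)) = - FD (convol (moll eps) (\<lambda>x. Phi x \<bullet> i)) y i"
     by (simp add: frechet_derivative_convol[OF mC iPhii] convol_def odd[of y])
   qed
   thus ?thesis
    using continuous_on_minus[OF grad_convol_continuous(1)[OF eps iPhii, of i i]] by (simp only:)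
  qed
  have "\<bar>LBINT x. ?D i (x - y) * (Phi x \<bullet> i)\<bar> \<le> B * norm i * (LBINT x. \<bar>Phi x \<bullet> i\<bar>)" for y
  proof -
   have "Lint (\<lambda>x. ?D i (y - x) * (Phi x \<bullet> i))" using convol_C1c_integrable(2)[OF mC iPhii] by simp
   hence I: "Lint (\<lambda>x. ?D i (x - y) * (Phi x \<bullet> i))" by (simp add: odd[of _ y])
   hence "\<bar>LBINT x. ?D i (x - y) * (Phi x \<bullet> i)\<bar> \<le> (LBINT x. (B * norm i) * \<bar>Phi x \<bullet> i\<bar>)"
    using B iPhii integrable_abs[OF I] by (intro order_trans[OF integral_abs_bound] integral_mono) (auto simp: abs_mult intro!: mult_right_mono)
   thus ?thesis by simp
  qed
  from integrable_scaleR_bounded[OF u _ this] borel_measurable_continuous_onI[OF c]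
  show ?thesis by (simp add: mult.commute)
 qed
 have "(LBINT x. ind K x * norm (grad ?w x)) = (LBINT x. Phi x \<bullet> grad ?w x)"
 proof -
  have "sgn v \<bullet> v = norm v" for v :: 'a
   by (cases "v = 0") (auto simp: sgn_div_norm power2_norm_eq_inner[symmetric] power2_eq_square)
  thus ?thesis by (simp add: Phi_def)
 qed
 also have "\<dots> = (LBINT x. (\<Sum>i\<in>Basis. (Phi x \<bullet> i) * (LBINT y. ?D i (x - y) * u y)))"
  unfolding grad_def frechet_derivative_convol[OF mC u] convol_def by (simp add: inner_sum_right mult.commute)
 also have "\<dots> = (\<Sum>i\<in>Basis. LBINT x. (Phi x \<bullet> i) * (LBINT y. ?D i (x - y) * u y))"
 proof (rule Bintegral_sum)
  fix i :: 'a assume i: "i \<in> Basis"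
  have "Lint (\<lambda>x. (ind K x *\<^sub>R grad ?w x) \<bullet> (sgn (grad ?w x) \<bullet> i) *\<^sub>R i)"
  proof -
   have "Lint (\<lambda>x. (sgn (grad ?w x) \<bullet> i) *\<^sub>R (ind K x *\<^sub>R grad ?w x))"
   proof (rule integrable_scaleR_bounded[OF ig])
    show "(\<lambda>x. sgn (grad ?w x) \<bullet> i) \<in> borel_measurable lborel" unfolding sgn_div_norm by measurable
    show "\<bar>sgn (grad ?w x) \<bullet> i\<bar> \<le> 1" for x
     using Basis_le_norm[OF i, of "sgn (grad ?w x)"] by (simp add: norm_sgn split: if_splits)
   qed
   from integrable_inner_left[OF this, of i] show ?thesis by (simp add: mult_ac)
  qed
  moreover have "(ind K x *\<^sub>R grad ?w x) \<bullet> (sgn (grad ?w x) \<bullet> i) *\<^sub>R i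
   = (Phi x \<bullet> i) * (LBINT y. ?D i (x - y) * u y)" for x
   using i by (simp add: Phi_def grad_def inner_sum_left_Basis frechet_derivative_convol[OF mC u] convol_def)
  ultimately show "Lint (\<lambda>x. (Phi x \<bullet> i) * (LBINT y. ?D i (x - y) * u y))" by simp
 qed
 also have "\<dots> = (\<Sum>i\<in>Basis. LBINT y. u y * (LBINT x. ?D i (x - y) * (Phi x \<bullet> i)))"
  by (intro sum.cong refl Fubini_convolution[OF iPhii u C1c_on_continuous_derivative[OF mC] B])
 also have "\<dots> = (LBINT y. (\<Sum>i\<in>Basis. u y * (LBINT x. ?D i (x - y) * (Phi x \<bullet> i))))"
  by (rule Bintegral_sum[symmetric]) (rule iB)
 also have "\<dots> = (LBINT y. u y * divergence (\<lambda>x. (-1) *\<^sub>R ?Psi x) y)"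
  unfolding divergence_scaleR[OF Psi] divPsi by (simp add: sum_distrib_left sum_negf)
 also have "\<dots> \<le> C" by (rule bound[OF C1c_on_scaleR_const(1)[OF Psi]]) (use Psi1 in simp)
 finally have *: "(LBINT x. ind K x * norm (grad ?w x)) \<le> C" .
 have "(NBINT x. ind K x * ennreal (norm (grad ?w x))) = (NBINT x. ennreal (ind K x * norm (grad ?w x)))"
  by (intro nn_integral_cong) (auto simp: indicator_def)
 also have "\<dots> = ennreal (LBINT x. ind K x * norm (grad ?w x))"
  using integrable_norm[OF ig] by (intro nn_integral_eq_integral) auto
 also have "\<dots> \<le> ennreal C" using * by (rule ennreal_leI)
 finally show ?thesis .
qed

text \<open>The C^1 quadratic spline with knots 0, 1/2 and 1 that rises from 0 to 1, written with
  truncated powers so that one derivative formula covers all pieces.\<close>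

definition smooth_step :: "real => real" where
 "smooth_step s = 2 * ((max 0 s)\<^sup>2 - 2 * (max 0 (s - 1/2))\<^sup>2 + (max 0 (s - 1))\<^sup>2)"

definition smooth_step' :: "real => real" where
 "smooth_step' s = 4 * (max 0 s - 2 * max 0 (s - 1/2) + max 0 (s - 1))"

lemma max_power2_has_derivative: "((\<lambda>s::real. (max 0 s)\<^sup>2) has_real_derivative 2 * max 0 s) (at s)"
proof -
 consider "s > 0" | "s < 0" | "s = 0" by linarith
 thus ?thesis
 proof cases
  case 1
  have "((\<lambda>s::real. s\<^sup>2) has_real_derivative 2 * max 0 s) (at s)"
   using 1 by (auto intro!: derivative_eq_intros)
  thus ?thesis
   by (rule has_field_derivative_transform_within_open[where S = "{0<..}"]) (use 1 in auto)
 next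
  case 2
  have "((\<lambda>s::real. 0) has_real_derivative 2 * max 0 s) (at s)" using 2 by auto
  thus ?thesis
   by (rule has_field_derivative_transform_within_open[where S = "{..<0}"]) (use 2 in auto)
 next
  case 3
  have "((\<lambda>h::real. max 0 h) \<longlongrightarrow> max 0 0) (at 0)" by (intro tendsto_intros)
  moreover have "(\<lambda>h::real. ((max 0 (0 + h))\<^sup>2 - (max 0 0)\<^sup>2) / h) = (\<lambda>h. max 0 h)"
   by (auto simp: fun_eq_iff max_def power2_eq_square)
  ultimately show ?thesis using 3 by (simp add: DERIV_def)
 qed
qed

lemma smooth_step_has_derivative: "(smooth_step has_real_derivative smooth_step' s) (at s)"
proof -
 have d: "((\<lambda>s::real. (max 0 (s - c))\<^sup>2) has_real_derivative 2 * max 0 (s - c)) (at s)" for c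
 proof -
  have "((\<lambda>s. s - c) has_real_derivative 1) (at s)" by (auto intro!: derivative_eq_intros)
  from DERIV_chain2[OF max_power2_has_derivative this] show ?thesis by simp
 qed
 have "(smooth_step has_real_derivative 2 * (2 * max 0 s - 2 * (2 * max 0 (s - 1/2)) + 2 * max 0 (s - 1))) (at s)"
  unfolding smooth_step_def[abs_def] by (intro DERIV_cmult DERIV_add DERIV_diff d max_power2_has_derivative)
 thus ?thesis by (simp add: smooth_step'_def algebra_simps)
qed

lemma smooth_step_simps: "s \<le> 0 ==> smooth_step s = 0" "s \<ge> 1 ==> smooth_step s = 1"
 by (auto simp: smooth_step_def max_def power2_eq_square algebra_simps)

lemma smooth_step'_bounds:
 "0 \<le> smooth_step' s" "smooth_step' s \<le> 2" "s < 0 \<or> s > 1 ==> smooth_step' s = 0"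
 by (auto simp: smooth_step'_def max_def)

lemma smooth_step_range: "0 \<le> smooth_step s" "smooth_step s \<le> 1"
proof -
 have mono: "smooth_step a \<le> smooth_step b" if "a \<le> b" for a b
  by (rule DERIV_nonneg_imp_nondecreasing[OF that]) (use smooth_step_has_derivative smooth_step'_bounds(1) in blast)
 show "0 \<le> smooth_step s" using mono[of "min 0 s" s] smooth_step_simps(1)[of "min 0 s"] by simp
 show "smooth_step s \<le> 1" using mono[of s "max 1 s"] smooth_step_simps(2)[of "max 1 s"] by simp
qed

lemma smooth_step'_continuous: "continuous_on UNIV smooth_step'"
 unfolding smooth_step'_def[abs_def] by (intro continuous_intros)

text \<open>Integration by parts and the chain rule, for a smooth approximation w of u.\<close>

lemma step_variation_le:
 assumes w: "\<And>x. (w has_derivative FD w x) (at x)"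
  "\<And>v. continuous_on UNIV (\<lambda>x. FD w x v)"
  and Phi: "C1c_on K Phi" "\<And>x. norm (Phi x) \<le> 1" and n: "n \<ge> 0" and K: "K \<in> sets borel"
 shows "ennreal (- (LBINT x. smooth_step (n * (w x - t)) * divergence Phi x))
  \<le> (NBINT x. ind K x * ennreal (norm (grad w x)) * ennreal (n * smooth_step' (n * (w x - t))))"
proof -
 let ?v = "\<lambda>x. smooth_step (n * (w x - t))"
 let ?v' = "\<lambda>x h. n * smooth_step' (n * (w x - t)) * FD w x h"
 have cw: "continuous_on UNIV w" by (meson w(1) continuous_at_imp_continuous_on has_derivative_continuous)
 have d: "(?v has_derivative ?v' x) (at x)" for x
 proof -
  have "((\<lambda>x. n * (w x - t)) has_derivative (\<lambda>h. n * FD w x h)) (at x)"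
   using w(1)[of x] by (auto intro!: derivative_eq_intros)
  from has_derivative_compose[OF this smooth_step_has_derivative[unfolded has_field_derivative_def]]
  show ?thesis by (simp add: mult_ac)
 qed
 have cs: "continuous_on UNIV (\<lambda>x. smooth_step' (n * (w x - t)))"
  by (rule continuous_on_compose2[OF smooth_step'_continuous]) (auto intro!: continuous_intros cw)
 have c: "continuous_on UNIV (\<lambda>x. ?v' x h)" for h
  by (intro continuous_intros cs w(2))
 note vPhi = C1c_on_mult[OF d c Phi(1)]
 have lin: "linear (FD w x)" for x using w(1) has_derivative_linear by blast
 have div: "divergence (\<lambda>x. ?v x *\<^sub>R Phi x) x = ?v x * divergence Phi x
   + n * smooth_step' (n * (w x - t)) * (Phi x \<bullet> grad w x)" for x
 proof -
  have "divergence (\<lambda>x. ?v x *\<^sub>R Phi x) x = ?v x * divergence Phi x + (\<Sum>i\<in>Basis. ?v' x i * (Phi x \<bullet> i))"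
   unfolding divergence_def vPhi(2) by (simp add: inner_add_left sum.distrib sum_distrib_left)
  also have "(\<Sum>i\<in>Basis. ?v' x i * (Phi x \<bullet> i)) = n * smooth_step' (n * (w x - t)) * (Phi x \<bullet> grad w x)"
   by (simp add: grad_def inner_sum_right sum_distrib_left mult.assoc)
  finally show ?thesis .
 qed
 have bv: "\<bar>?v x\<bar> \<le> 1" for x using smooth_step_range by (simp add: abs_le_iff order_trans[of _ 0])
 have cv: "continuous_on UNIV ?v" by (intro continuous_at_imp_continuous_on ballI has_derivative_continuous[OF d])
 have i1: "Lint (\<lambda>x. ?v x * divergence Phi x)"
  using integrable_scaleR_bounded[OF divergence_integrable[OF Phi(1)], of ?v 1] bv
   borel_measurable_continuous_onI[OF cv] by simp
 have i2: "Lint (divergence (\<lambda>x. ?v x *\<^sub>R Phi x))" by (rule divergence_integrable[OF vPhi(1)])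
 have i3: "Lint (\<lambda>x. n * smooth_step' (n * (w x - t)) * (Phi x \<bullet> grad w x))"
  using Bintegrable_diff[OF i2 i1] by (simp add: div)
 have "- (LBINT x. ?v x * divergence Phi x) = (LBINT x. n * smooth_step' (n * (w x - t)) * (Phi x \<bullet> grad w x))"
  using integral_divergence_zero[OF vPhi(1)] Bintegral_add[OF i1 i3] by (simp add: div)
 also have "ennreal \<dots> \<le> (NBINT x. ennreal (norm (n * smooth_step' (n * (w x - t)) * (Phi x \<bullet> grad w x))))"
  using norm_integral_le_nn_integral[of lborel "\<lambda>x. n * smooth_step' (n * (w x - t)) * (Phi x \<bullet> grad w x)"]
  by (rule order_trans[rotated]) (auto intro!: ennreal_leI)
 also have "\<dots> \<le> (NBINT x. ind K x * ennreal (norm (grad w x)) * ennreal (n * smooth_step' (n * (w x - t))))"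
 proof (rule nn_integral_mono)
  fix x
  have "norm (n * smooth_step' (n * (w x - t)) * (Phi x \<bullet> grad w x)) \<le> ind K x * norm (grad w x) * (n * smooth_step' (n * (w x - t)))"
  proof (cases "x \<in> K")
   case True
   have "\<bar>Phi x \<bullet> grad w x\<bar> \<le> 1 * norm (grad w x)"
    using Phi(2)[of x] by (intro order_trans[OF Cauchy_Schwarz_ineq2] mult_right_mono) auto
   hence "(n * smooth_step' (n * (w x - t))) * \<bar>Phi x \<bullet> grad w x\<bar> \<le> (n * smooth_step' (n * (w x - t))) * norm (grad w x)"
    using n smooth_step'_bounds(1) by (intro mult_left_mono) auto
   thus ?thesis using True n smooth_step'_bounds(1) by (simp add: abs_mult mult_ac)
  next
   case False
   thus ?thesis using C1c_on_outside(1)[OF Phi(1)] by simp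
  qed
  thus "ennreal (norm (n * smooth_step' (n * (w x - t)) * (Phi x \<bullet> grad w x)))
   \<le> ind K x * ennreal (norm (grad w x)) * ennreal (n * smooth_step' (n * (w x - t)))"
   using n smooth_step'_bounds(1) by (cases "x \<in> K") (auto simp: simp flip: ennreal_mult intro!: ennreal_leI)
 qed
 finally show ?thesis .
qed

lemma nn_integral_step':
 assumes "n > 0"
 shows "(NBINT t. ennreal (n * smooth_step' (n * (a - t)))) \<le> 2"
proof -
 have "(NBINT t. ennreal (n * smooth_step' (n * (a - t)))) \<le> (NBINT t. ennreal (2 * n) * ind {a - 1/n..a} t)"
 proof (rule nn_integral_mono)
  fix t
  have "smooth_step' (n * (a - t)) = 0" if "t \<notin> {a - 1/n..a}"
   using that assms by (intro smooth_step'_bounds(3)) (auto simp: not_le field_simps mult_less_0_iff)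
  thus "ennreal (n * smooth_step' (n * (a - t))) \<le> ennreal (2 * n) * ind {a - 1/n..a} t"
   using smooth_step'_bounds(2)[of "n * (a - t)"] assms by (cases "t \<in> {a - 1/n..a}") (auto intro!: ennreal_leI)
 qed
 also have "\<dots> = ennreal (2 * n) * ennreal (1/n)" using assms by (simp add: nn_integral_cmult_indicator)
 also have "\<dots> = 2" using assms by (subst ennreal_mult[symmetric]) auto
 finally show ?thesis .
qed

text \<open>Coarea inequality up to a factor 2. The derivative of a step is concentrated near the
  level, so the variations of the steps of mollified u integrate over t to at most 2 C. By Fatou
  their liminf is finite for almost every t, and by lower semicontinuity it bounds
  \<open>dist_grad\<close> of the superlevel set.\<close>

lemma superlevel_sets_finite_perimeter:
 fixes u :: "'a::euclidean_space => real"
 assumes u: "Lint u" and \<Omega>: "open \<Omega>" and K: "compact K" "K \<subseteq> \<Omega>"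
  and bound: "\<And>Phi. C1c_on \<Omega> Phi ==> (\<And>x. norm (Phi x) \<le> 1) ==> (LBINT x. u x * divergence Phi x) \<le> C"
 shows "AE t in lborel. \<exists>V. \<forall>Phi. C1c_on K Phi \<and> (\<forall>x. norm (Phi x) \<le> 1) \<longrightarrow> dist_grad {x. t < u x} Phi \<le> V"
proof -
 have um[measurable]: "u \<in> Borel" using borel_measurable_integrable[OF u] by simp
 have Kb[measurable]: "K \<in> sets borel" using borel_compact[OF K(1)] .
 obtain eps0 where eps0: "eps0 > 0" "\<And>x. x \<in> K ==> cball x eps0 \<subseteq> \<Omega>" using compact_thicken[OF K(1) \<Omega> K(2)] by metis
 have "\<exists>d>0. d \<le> eps0 \<and> (NBINT x. ennreal (norm (convol (moll d) u x - u x))) \<le> ennreal (1 / real (Suc k))" for k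
 proof -
  obtain d where d: "d > 0" "\<And>eps. 0 < eps ==> eps < d ==> (NBINT x. ennreal (norm (convol (moll eps) u x - u x))) \<le> ennreal (1 / real (Suc k))"
   using convol_moll_L1[OF u, of "1 / real (Suc k)"] by auto
  thus ?thesis using eps0(1) by (intro exI[of _ "min (d/2) eps0"]) auto
 qed
 then obtain d where d: "\<And>k. d k > 0" "\<And>k. d k \<le> eps0"
  "\<And>k. (NBINT x. ennreal (norm (convol (moll (d k)) u x - u x))) \<le> ennreal (1 / real (Suc k))" by metis
 have wi: "Lint (\<lambda>x. convol (moll (d k)) u x - u x)" for k
 proof (rule integrableI_bounded)
  show "(\<lambda>x. convol (moll (d k)) u x - u x) \<in> borel_measurable lborel"
   using convol_moll_measurable[OF d(1) um] um by simp
  show "(NBINT x. ennreal (norm (convol (moll (d k)) u x - u x))) < \<infinity>"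
   using d(3)[of k] by (rule le_less_trans) simp
 qed
 have "(\<lambda>k. LBINT x. norm (convol (moll (d k)) u x - u x)) \<longlonglongrightarrow> 0"
 proof (rule tendsto_sandwich[OF _ _ tendsto_const LIMSEQ_inverse_real_of_nat], goal_cases)
  case 1 thus ?case by simp
 next
  case 2
  have "(LBINT x. norm (convol (moll (d k)) u x - u x)) \<le> inverse (real (Suc k))" for k
   using d(3)[of k] nn_integral_eq_integral[OF integrable_norm[OF wi[of k]]] by (simp add: inverse_eq_divide)
  thus ?case by simp
 qed
 then obtain r where r: "strict_mono (r :: nat => nat)" "AE x in lborel. (\<lambda>k. convol (moll (d (r k))) u x - u x) \<longlonglongrightarrow> 0"
  using tendsto_L1_AE_subseq[of lborel "\<lambda>k x. convol (moll (d k)) u x - u x", OF wi] by blast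
 define w where "w k = convol (moll (d (r k))) u" for k
 have wlim: "AE x in lborel. (\<lambda>k. w k x) \<longlonglongrightarrow> u x"
  using r(2) unfolding w_def by eventually_elim (simp add: LIM_zero_iff)
 have wd: "(w k has_derivative FD (w k) x) (at x)" for k x
  unfolding w_def using convol_has_derivative[OF moll_C1c[OF d(1)] u] frechet_derivative_works differentiable_def by blast
 note wc = grad_convol_continuous[OF d(1) u, of "r k" for k, folded w_def]
 have [measurable]: "w k \<in> Borel" "grad (w k) \<in> Borel" for k
  unfolding w_def by (auto intro!: convol_moll_measurable d(1) borel_measurable_continuous_onI[OF grad_convol_continuous(2)] u)
 have [measurable]: "smooth_step' \<in> Borel"
  using smooth_step'_continuous by (rule borel_measurable_continuous_onI)
 \<comment> \<open>Bounds the variation on \<open>K\<close> of the step function of width 1/(k+1) at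
   level t, by \<open>step_variation_le\<close>.\<close>
 define G where "G k t = (NBINT x. ind K x * ennreal (norm (grad (w k) x)) * ennreal (real (Suc k) * smooth_step' (real (Suc k) * (w k x - t))))" for k t
 have [measurable]: "G k \<in> Borel" for k
 proof -
  have "G k \<in> borel_measurable lborel" unfolding G_def by measurable
  thus ?thesis by simp
 qed
 have "(NBINT t. G k t) \<le> 2 * ennreal C" for k
 proof -
  have "(NBINT t. G k t) = (NBINT x. NBINT t. ind K x * ennreal (norm (grad (w k) x)) * ennreal (real (Suc k) * smooth_step' (real (Suc k) * (w k x - t))))"
   unfolding G_def by (rule lborel_pair.Fubini') measurable
  also have "\<dots> \<le> (NBINT x. (ind K x * ennreal (norm (grad (w k) x))) * 2)"
   by (intro nn_integral_mono, subst nn_integral_cmult) (auto intro!: mult_left_mono nn_integral_step')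
  also have "\<dots> = (NBINT x. ind K x * ennreal (norm (grad (w k) x))) * 2"
   by (rule nn_integral_multc) measurable
  also have "\<dots> \<le> ennreal C * 2"
   unfolding w_def
   by (intro mult_right_mono mollified_variation[OF d(1) u K(1) order_trans[OF subset_cball[OF d(2)] eps0(2)] bound]) auto
  finally show ?thesis by (simp add: mult.commute)
 qed
 hence "liminf (\<lambda>k. NBINT t. G k t) \<le> 2 * ennreal C"
  by (intro Liminf_le) (auto simp: eventually_sequentially)
 hence "(NBINT t. liminf (\<lambda>k. G k t)) \<le> 2 * ennreal C"
  by (rule order_trans[rotated]) (rule nn_integral_liminf, measurable)
 hence "(NBINT t. liminf (\<lambda>k. G k t)) \<noteq> \<infinity>" by (auto simp: ennreal_mult_eq_top_iff top_unique)
 hence fin: "AE t in lborel. liminf (\<lambda>k. G k t) \<noteq> \<infinity>"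
  by (intro nn_integral_PInf_AE) measurable
 \<comment> \<open>By Fubini almost every level set of u is a null set; for such t the steps
   converge to the indicator almost everywhere.\<close>
 have nul: "AE t in lborel. AE x in lborel. u x \<noteq> t"
 proof -
  have "AE t in lborel. u x \<noteq> t" for x
   using AE_lborel_singleton[of "u x"] by eventually_elim auto
  hence "AE x in lborel. AE t in lborel. u x \<noteq> t" by simp
  moreover have "{p \<in> space (lborel \<Otimes>\<^sub>M lborel). u (fst p) \<noteq> snd p} \<in> sets (lborel \<Otimes>\<^sub>M lborel)" by measurable
  ultimately show ?thesis
   by (subst (asm) lborel_pair.AE_commute) (simp_all add: case_prod_beta')
 qed
 show ?thesis using fin nul
 proof eventually_elim
  case (elim t)
  show ?case
  proof (intro exI[of _ "enn2real (liminf (\<lambda>k. G k t))"] allI impI, elim conjE)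
   fix Phi :: "'a => 'a" assume Phi: "C1c_on K Phi" "\<forall>x. norm (Phi x) \<le> 1"
   let ?a = "\<lambda>k. - (LBINT x. smooth_step (real (Suc k) * (w k x - t)) * divergence Phi x)"
   have [measurable]: "divergence Phi \<in> Borel"
    using divergence_continuous[OF Phi(1)] by (rule borel_measurable_continuous_onI)
   have [measurable]: "smooth_step \<in> Borel"
    by (intro borel_measurable_continuous_onI) (meson smooth_step_has_derivative DERIV_isCont continuous_at_imp_continuous_on)
   have "(\<lambda>k. LBINT x. smooth_step (real (Suc k) * (w k x - t)) * divergence Phi x) \<longlonglongrightarrow>
    (LBINT x. ind {x. t < u x} x * divergence Phi x)"
   proof (rule integral_dominated_convergence[where w = "\<lambda>x. norm (divergence Phi x)"])
    show "AE x in lborel. (\<lambda>k. smooth_step (real (Suc k) * (w k x - t)) * divergence Phi x) \<longlonglongrightarrow> ind {x. t < u x} x * divergence Phi x"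
     using wlim elim(2)
    proof eventually_elim
     case (elim x)
     have "(\<lambda>k. smooth_step (real (Suc k) * (w k x - t))) \<longlonglongrightarrow> ind {x. t < u x} x"
     proof (cases "t < u x")
      case True
      have "(\<lambda>k. w k x - t - inverse (real (Suc k))) \<longlonglongrightarrow> u x - t - 0"
       by (intro tendsto_intros elim LIMSEQ_inverse_real_of_nat)
      hence "eventually (\<lambda>k. w k x - t - inverse (real (Suc k)) > 0) sequentially"
       using True by (intro order_tendstoD(1)) auto
      hence "eventually (\<lambda>k. smooth_step (real (Suc k) * (w k x - t)) = 1) sequentially"
       by eventually_elim (auto intro!: smooth_step_simps(2) simp: inverse_eq_divide divide_less_eq field_simps)
      thus ?thesis using True by (simp add: tendsto_eventually)
     next
      case False
      hence "u x < t" using elim(2) by simp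
      hence "eventually (\<lambda>k. w k x < t) sequentially" using elim(1) by (intro order_tendstoD(2))
      hence "eventually (\<lambda>k. smooth_step (real (Suc k) * (w k x - t)) = 0) sequentially"
       by eventually_elim (auto intro!: smooth_step_simps(1) mult_nonneg_nonpos)
      thus ?thesis using False by (simp add: tendsto_eventually)
     qed
     thus ?case by (intro tendsto_mult tendsto_const)
    qed
    show "AE x in lborel. norm (smooth_step (real (Suc k) * (w k x - t)) * divergence Phi x) \<le> norm (divergence Phi x)" for k
     using smooth_step_range by (auto simp: abs_mult mult_left_le_one_le)
   qed (use divergence_integrable[OF Phi(1)] in auto)
   hence "?a \<longlonglongrightarrow> dist_grad {x. t < u x} Phi" unfolding dist_grad_def by (rule tendsto_minus)
   hence "(\<lambda>k. ennreal (?a k)) \<longlonglongrightarrow> ennreal (dist_grad {x. t < u x} Phi)" by (rule tendsto_ennrealI)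
   hence "ennreal (dist_grad {x. t < u x} Phi) = liminf (\<lambda>k. ennreal (?a k))"
    by (intro lim_imp_Liminf[symmetric]) auto
   also have "\<dots> \<le> liminf (\<lambda>k. G k t)"
    unfolding G_def using Phi
    by (intro Liminf_mono always_eventually allI step_variation_le[OF wd wc(1)]) auto
   finally show "dist_grad {x. t < u x} Phi \<le> enn2real (liminf (\<lambda>k. G k t))"
    using elim(1) by (cases "liminf (\<lambda>k. G k t)") auto
  qed
 qed
qed


section \<open>Divergence measures do not charge null sets of the content\<close>

text \<open>The covering balls in \<open>content_le\<close> are open, so a countable intersection of
  covers is a Borel hull.\<close>

lemma hnull_Borel_hull:
 fixes Z :: "'a::euclidean_space set"
 assumes "hnull Z" obtains G where "G \<in> sets borel" "hnull G" "Z \<subseteq> G"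
proof -
 have "\<exists>U. open U \<and> Z \<subseteq> U \<and> content_le U (1 / real (Suc n))" for n
 proof -
  have "content_le Z (1 / real (Suc n))" using assms unfolding hnull_def by auto
  then obtain c r where cr: "\<forall>n::nat. 0 \<le> r n" "Z \<subseteq> (\<Union>n. ball (c n) (r n))"
   "\<forall>m. (\<Sum>i<m. r i ^ (DIM('a) - 1)) \<le> 1 / real (Suc n)" unfolding content_le_def by blast
  show ?thesis
   by (rule exI[of _ "\<Union>n. ball (c n) (r n)"]) (use cr in \<open>auto simp: content_le_def\<close>)
 qed
 then obtain U where U: "\<And>n. open (U n)" "\<And>n. Z \<subseteq> U n" "\<And>n. content_le (U n) (1 / real (Suc n))" by metis
 show thesis
 proof (rule that[of "\<Inter>n. U n"])
  show "(\<Inter>n. U n) \<in> sets borel" using U(1) by auto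
  show "hnull (\<Inter>n. U n)" unfolding hnull_def
  proof (intro allI impI)
   fix e :: real assume "e > 0"
   then obtain n where "1 / real (Suc n) < e" by (metis nat_approx_posE)
   thus "content_le (\<Inter>n. U n) e" using content_le_subset[OF U(3)[of n]] by (meson INT_lower UNIV_I less_imp_le)
  qed
 qed (use U in auto)
qed

lemma emeasure_eq_0_if_compact:
 fixes M :: "'a::euclidean_space measure"
 assumes "sets M = sets borel" "finite_measure M" "A \<in> sets borel"
  "\<And>K. K \<subseteq> A ==> compact K ==> emeasure M K = 0"
 shows "emeasure M A = 0"
proof -
 have "emeasure M A = (SUP K \<in> {K. K \<subseteq> A \<and> compact K}. emeasure M K)"
  using finite_measure.finite_emeasure_space[OF assms(2)] by (intro inner_regular assms(1,3)) auto
 also have "\<dots> \<le> 0" by (rule SUP_least) (use assms(4) in auto)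
 finally show ?thesis by simp
qed

lemma cutoff_union:
 fixes eta :: "'i => 'a::euclidean_space => real"
 assumes "finite F" "\<And>i. i \<in> F ==> C1c_on U (eta i)" "\<And>i x. i \<in> F ==> 0 \<le> eta i x" "\<And>i x. i \<in> F ==> eta i x \<le> 1"
 shows "\<exists>th. C1c_on U th \<and> (\<forall>x. 0 \<le> th x \<and> th x \<le> 1) \<and> (\<forall>i\<in>F. \<forall>x. eta i x = 1 \<longrightarrow> th x = 1) \<and>
  (\<forall>x. norm (grad th x) \<le> (\<Sum>i\<in>F. norm (grad (eta i) x)))"
 using assms
proof (induction F rule: finite_induct)
 case empty
 have "grad (\<lambda>x. 0 :: real) x = 0" for x :: 'a unfolding grad_def by simp
 thus ?case by (intro exI[of _ "\<lambda>x. 0"]) (auto intro: C1c_on_zero)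
next
 case (insert i F)
 then obtain th where th: "C1c_on U th" "\<And>x. 0 \<le> th x" "\<And>x. th x \<le> 1" "\<And>j x. j \<in> F ==> eta j x = 1 ==> th x = 1"
  "\<And>x. norm (grad th x) \<le> (\<Sum>i\<in>F. norm (grad (eta i) x))" by auto
 have eta: "C1c_on U (eta i)" "\<And>x. 0 \<le> eta i x" "\<And>x. eta i x \<le> 1" using insert by auto
 \<comment> \<open>Equals 1 - (1 - th)(1 - eta i): it is 1 as soon as one of the two cutoffs is, and
   in its gradient both old gradients get coefficients in [0, 1].\<close>
 let ?th = "\<lambda>x. (th x + eta i x) + (-1) *\<^sub>R (th x *\<^sub>R eta i x)"
 note p = C1c_on_mult[OF C1c_on_has_derivative[OF th(1)] C1c_on_continuous_derivative[OF th(1)] eta(1)]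
 note c = C1c_on_add[OF C1c_on_add(1)[OF th(1) eta(1)] C1c_on_scaleR_const(1)[OF p(1), of "-1"]]
 have g: "grad ?th x = (1 - eta i x) *\<^sub>R grad th x + (1 - th x) *\<^sub>R grad (eta i) x" for x
 proof -
  have "FD ?th x v = (1 - eta i x) * FD th x v + (1 - th x) * FD (eta i) x v" for v
   unfolding c(2) C1c_on_add(2)[OF th(1) eta(1)] C1c_on_scaleR_const(2)[OF p(1)] p(2) by (simp add: algebra_simps)
  thus ?thesis unfolding grad_def by (simp only: scaleR_add_left sum.distrib scaleR_sum_right scaleR_scaleR)
 qed
 have "norm (grad ?th x) \<le> (\<Sum>i\<in>insert i F. norm (grad (eta i) x))" for x
 proof -
  have "norm (grad ?th x) \<le> (1 - eta i x) * norm (grad th x) + (1 - th x) * norm (grad (eta i) x)"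
   unfolding g using norm_triangle_ineq[of "(1 - eta i x) *\<^sub>R grad th x" "(1 - th x) *\<^sub>R grad (eta i) x"] eta(3)[of x] th(3)[of x] by simp
  also have "\<dots> \<le> 1 * norm (grad th x) + 1 * norm (grad (eta i) x)"
   using eta(2)[of x] th(2)[of x] by (intro add_mono mult_right_mono) auto
  also have "\<dots> \<le> (\<Sum>i\<in>insert i F. norm (grad (eta i) x))" using th(5)[of x] insert.hyps by simp
  finally show ?thesis .
 qed
 moreover have "0 \<le> ?th x \<and> ?th x \<le> 1" for x
 proof -
  have "?th x = 1 - (1 - th x) * (1 - eta i x)" by (simp add: algebra_simps)
  moreover have "0 \<le> (1 - th x) * (1 - eta i x)" "(1 - th x) * (1 - eta i x) \<le> 1"
   using th(2,3)[of x] eta(2,3)[of x] by (auto intro: mult_le_one)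
  ultimately show ?thesis by simp
 qed
 moreover have "?th x = 1" if "j \<in> insert i F" "eta j x = 1" for j x
  using that th(4)[of j x] by auto
 ultimately show ?case using c(1) by (intro exI[of _ ?th]) blast
qed

text \<open>A bump scaled to radius r has gradient of order 1/r on a volume of order r^N. The L^1
  norm of its gradient is thus of order r^(N-1), the quantity summed by the content.\<close>

lemma hnull_cutoff:
 fixes K U :: "'a::euclidean_space set"
 assumes dim: "DIM('a) \<ge> 2" and K: "compact K" "hnull K" and U: "open U" "K \<subseteq> U" and e: "e > 0"
 obtains th :: "'a => real" where "C1c_on U th" "\<And>x. 0 \<le> th x" "\<And>x. th x \<le> 1" "\<And>x. x \<in> K ==> th x = 1"
  "(NBINT x. ennreal (norm (grad th x))) \<le> ennreal e"
proof -
 let ?N = "DIM('a)"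
 obtain \<rho> where \<rho>: "\<rho> > 0" "\<And>x. x \<in> K ==> cball x \<rho> \<subseteq> U" using compact_thicken[OF K(1) U] by metis
 obtain \<beta> :: "'a => real" where \<beta>: "C1c_on (ball 0 2) \<beta>" "\<And>x. 0 \<le> \<beta> x" "\<And>x. \<beta> x \<le> 1" "\<And>x. x \<in> cball 0 1 ==> \<beta> x = 1"
  by (rule smooth_cutoff[of "cball (0::'a) 1" "ball 0 2"]) auto
 obtain C where C: "C \<ge> 0" "\<And>x. norm (grad \<beta> x) \<le> C" using grad_bounded[OF \<beta>(1)] by blast
 let ?v = "unit_ball_vol (real ?N)"
 define c where "c = C * ?v * 2 ^ ?N"
 have c: "c \<ge> 0" using C by (simp add: c_def)
 \<comment> \<open>The first bound makes the sum of the gradient norms at most \<open>e\<close>; the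
   second forces every radius to be at most \<rho>/4, so that the doubled balls stay in
   \<open>U\<close>.\<close>
 define e' where "e' = min (e / (c + 1)) ((\<rho>/4) ^ (?N - 1))"
 have e': "e' > 0" using e c \<rho> by (simp add: e'_def)
 have "content_le K e'" using K(2) e' unfolding hnull_def by blast
 then obtain a r where ar: "\<And>n::nat. 0 \<le> r n" "K \<subseteq> (\<Union>n. ball (a n) (r n))"
  "\<And>m. (\<Sum>i<m. r i ^ (?N - 1)) \<le> e'" unfolding content_le_def by blast
 obtain F where F: "finite F" "K \<subseteq> (\<Union>n\<in>F. ball (a n) (r n))"
  using compactE_image[OF K(1), of UNIV "\<lambda>n. ball (a n) (r n)"] ar(2) by auto
 \<comment> \<open>Balls that miss \<open>K\<close> are dropped; the others are nonempty, so their
   radii are positive and the scaling is defined, and they stay close to \<open>K\<close>.\<close>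
 define G where "G = {n\<in>F. K \<inter> ball (a n) (r n) \<noteq> {}}"
 have "finite G" using F(1) by (simp add: G_def)
 moreover have "K \<subseteq> (\<Union>n\<in>G. ball (a n) (r n))" unfolding G_def using F(2) by blast
 ultimately have G: "finite G" "K \<subseteq> (\<Union>n\<in>G. ball (a n) (r n))" .
 have rpos: "r n > 0" if "n \<in> G" for n using that by (auto simp: G_def intro: le_less_trans[OF zero_le_dist])
 have rs: "r n \<le> \<rho>/4" for n
 proof -
  have "r n ^ (?N - 1) \<le> (\<Sum>i<Suc n. r i ^ (?N - 1))" using ar(1) by (intro member_le_sum) auto
  also have "\<dots> \<le> (\<rho>/4) ^ (?N - 1)" using ar(3)[of "Suc n"] by (simp add: e'_def)
  finally show ?thesis using \<rho> dim by (subst (asm) power_mono_iff) (use ar(1) in auto)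
 qed
 define eta where "eta n x = \<beta> ((- (1 / r n)) *\<^sub>R a n + (1 / r n) *\<^sub>R x)" for n x
 have etac: "C1c_on U (eta n)" and etas: "C1c_on (ball (a n) (2 * r n)) (eta n)"
  and etag: "norm (grad (eta n) x) \<le> C / r n" if n: "n \<in> G" for n x
 proof -
  have rp: "r n > 0" using rpos[OF n] .
  note af = C1c_on_affine[OF \<beta>(1), of "1 / r n" "(- (1 / r n)) *\<^sub>R a n"]
  have "(\<lambda>y. (1 / (1 / r n)) *\<^sub>R (y - - (1 / r n) *\<^sub>R a n)) ` ball 0 2 \<subseteq> ball (a n) (2 * r n)"
  proof clarify
   fix y :: 'a assume "y \<in> ball 0 2"
   hence "norm (r n *\<^sub>R y) < 2 * r n" using rp by simp
   moreover have "(1 / (1 / r n)) *\<^sub>R (y - - (1 / r n) *\<^sub>R a n) = a n + r n *\<^sub>R y" using rp by (simp add: algebra_simps)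
   ultimately show "(1 / (1 / r n)) *\<^sub>R (y - - (1 / r n) *\<^sub>R a n) \<in> ball (a n) (2 * r n)" by (simp add: dist_norm)
  qed
  thus s: "C1c_on (ball (a n) (2 * r n)) (eta n)"
   unfolding eta_def[abs_def] using af(1) rp by (intro C1c_on_mono[OF af(1)]) auto
  have "ball (a n) (2 * r n) \<subseteq> U"
  proof
   fix y assume y: "y \<in> ball (a n) (2 * r n)"
   obtain x where x: "x \<in> K" "x \<in> ball (a n) (r n)" using n by (auto simp: G_def)
   have "dist x y \<le> dist (a n) x + dist (a n) y" by (metis dist_commute dist_triangle)
   also have "\<dots> \<le> \<rho>" using x y rs[of n] \<rho>(1) by auto
   finally show "y \<in> U" using \<rho>(2)[OF x(1)] by auto
  qed
  thus "C1c_on U (eta n)" using C1c_on_mono[OF s] by blast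
  have "grad (eta n) x = (1 / r n) *\<^sub>R grad \<beta> ((- (1 / r n)) *\<^sub>R a n + (1 / r n) *\<^sub>R x)"
   unfolding grad_def eta_def[abs_def] using rp by (subst af(2)) (auto simp: scaleR_sum_right)
  thus "norm (grad (eta n) x) \<le> C / r n" using C(2) rp by (simp add: divide_right_mono)
 qed
 have etar: "0 \<le> eta n x" "eta n x \<le> 1" for n x using \<beta> by (auto simp: eta_def)
 obtain th where th: "C1c_on U th" "\<And>x. 0 \<le> th x" "\<And>x. th x \<le> 1" "\<And>n x. n \<in> G ==> eta n x = 1 ==> th x = 1"
  "\<And>x. norm (grad th x) \<le> (\<Sum>n\<in>G. norm (grad (eta n) x))"
  using cutoff_union[OF G(1) etac etar, of id] by auto
 show thesis
 proof (rule that[OF th(1-3)])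
  fix x assume "x \<in> K"
  then obtain n where n: "n \<in> G" "x \<in> ball (a n) (r n)" using G by blast
  have "norm ((- (1 / r n)) *\<^sub>R a n + (1 / r n) *\<^sub>R x) = norm (x - a n) / r n"
   using rpos[OF n(1)] by (simp flip: scaleR_diff_right add: add.commute[of "- _"])
  also have "\<dots> \<le> 1" using n rpos[OF n(1)] by (auto simp: dist_norm norm_minus_commute)
  finally have "eta n x = 1" unfolding eta_def by (intro \<beta>(4)) simp
  thus "th x = 1" using th(4) n by blast
 next
  have "(NBINT x. ennreal (norm (grad th x))) \<le> (NBINT x. (\<Sum>n\<in>G. ennreal (C / r n) * ind (ball (a n) (2 * r n)) x))"
  proof (rule nn_integral_mono)
   fix x
   have "norm (grad th x) \<le> (\<Sum>n\<in>G. (C / r n) * ind (ball (a n) (2 * r n)) x)"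
   proof (rule order_trans[OF th(5)], rule sum_mono)
    fix n assume n: "n \<in> G"
    show "norm (grad (eta n) x) \<le> (C / r n) * ind (ball (a n) (2 * r n)) x"
     using etag[OF n, of x] grad_outside[OF etas[OF n], of x] by (cases "x \<in> ball (a n) (2 * r n)") auto
   qed
   hence "ennreal (norm (grad th x)) \<le> ennreal (\<Sum>n\<in>G. (C / r n) * ind (ball (a n) (2 * r n)) x)" by (rule ennreal_leI)
   also have "\<dots> = (\<Sum>n\<in>G. ennreal (C / r n) * ind (ball (a n) (2 * r n)) x)"
    by (subst sum_ennreal[symmetric]) (auto intro!: sum.cong divide_nonneg_pos C(1) rpos simp: indicator_def)
   finally show "ennreal (norm (grad th x)) \<le> (\<Sum>n\<in>G. ennreal (C / r n) * ind (ball (a n) (2 * r n)) x)" .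
  qed
  also have "\<dots> = (\<Sum>n\<in>G. ennreal (C / r n) * evol (ball (a n) (2 * r n)))"
   by (subst nn_integral_sum) (auto simp: nn_integral_cmult_indicator intro!: borel_measurable_times_ennreal borel_measurable_indicator)
  also have "\<dots> = (\<Sum>n\<in>G. ennreal (c * r n ^ (?N - 1)))"
  proof (rule sum.cong[OF refl])
   fix n assume n: "n \<in> G"
   have "C / r n * (?v * (2 * r n) ^ ?N) = c * r n ^ (?N - 1)"
    using rpos[OF n] dim by (simp add: c_def power_mult_distrib power_eq_if[of "r n" ?N])
   thus "ennreal (C / r n) * evol (ball (a n) (2 * r n)) = ennreal (c * r n ^ (?N - 1))"
    using rpos[OF n] C by (simp add: emeasure_ball flip: ennreal_mult)
  qed
  also have "\<dots> = ennreal (c * (\<Sum>n\<in>G. r n ^ (?N - 1)))"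
   using c ar(1) by (subst sum_ennreal) (auto simp: sum_distrib_left)
  also have "\<dots> \<le> ennreal e"
  proof (rule ennreal_leI)
   obtain m where "G \<subseteq> {..<m}" using G(1) finite_nat_bounded by blast
   hence "(\<Sum>n\<in>G. r n ^ (?N - 1)) \<le> (\<Sum>n<m. r n ^ (?N - 1))" using ar(1) by (intro sum_mono2) auto
   also have "\<dots> \<le> e / (c + 1)" using ar(3)[of m] by (simp add: e'_def)
   finally have "c * (\<Sum>n\<in>G. r n ^ (?N - 1)) \<le> c * (e / (c + 1))" using c by (intro mult_left_mono)
   also have "\<dots> \<le> e" using c e by (simp add: divide_le_eq mult_left_mono)
   finally show "c * (\<Sum>n\<in>G. r n ^ (?N - 1)) \<le> e" .
  qed
  finally show "(NBINT x. ennreal (norm (grad th x))) \<le> ennreal e" .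
 qed
qed

text \<open>The data of the theorem, extended by zero to the whole space. The properties of \<open>sig\<close> as a least upper bound are
 only used through the last two assumptions.\<close>

locale field_family =
 fixes \<Omega> :: "'a::euclidean_space set" and b :: "'a => real => 'a" and B :: real
  and mp mn :: "real => 'a measure" and sig :: "'a measure" and f :: "'a => real => real"
 assumes dim: "DIM('a) \<ge> 2" and open_\<Omega>: "open \<Omega>"
  and b_borel[measurable]: "(\<lambda>p. b (fst p) (snd p)) \<in> Borel"
  and b_le: "\<And>x t. norm (b x t) \<le> B" and b_outside: "\<And>x t. x \<notin> \<Omega> ==> b x t = 0"
  and b_cont: "AE x in lborel. continuous_on UNIV (b x)"
  and mp_sets[measurable_cong]: "\<And>t. sets (mp t) = sets borel" and mn_sets[measurable_cong]: "\<And>t. sets (mn t) = sets borel"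
  and mp_fin: "\<And>t. finite_measure (mp t)" and mn_fin: "\<And>t. finite_measure (mn t)"
  and hahn: "\<And>t. \<exists>P\<in>sets borel. emeasure (mn t) P = 0 \<and> emeasure (mp t) (- P) = 0"
  and mpn_outside: "\<And>t. emeasure (mp t) (- \<Omega>) = 0" "\<And>t. emeasure (mn t) (- \<Omega>) = 0"
  and div_b: "\<And>t phi. C1c_on \<Omega> phi ==> (LBINT x. b x t \<bullet> grad phi x) = - (integral\<^sup>L (mp t) phi - integral\<^sup>L (mn t) phi)"
  and sig_sets[measurable_cong]: "sets sig = sets borel" and sig_fin: "finite_measure sig"
  and f_borel[measurable]: "(\<lambda>p. f (fst p) (snd p)) \<in> Borel"
  and f_int: "\<And>t. integrable sig (\<lambda>x. f x t)"
  and f_dens: "\<And>t E. E \<in> sets borel ==> measure (mp t) E - measure (mn t) E = (\<integral>x. ind E x * f x t \<partial>sig)"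
  and sig_ge: "\<And>t E. E \<in> sets borel ==> emeasure (mp t) E + emeasure (mn t) E \<le> emeasure sig E"
  and sig_null: "\<And>E. E \<in> sets borel ==> (\<And>t. emeasure (mp t) E = 0 \<and> emeasure (mn t) E = 0) ==> emeasure sig E = 0"
begin

lemma B_nonneg: "B \<ge> 0"
 using b_le[of 0 0] norm_ge_zero order_trans by blast

lemma b_measurable[measurable]: "(\<lambda>x. b x t) \<in> Borel"
proof -
 have "(\<lambda>x. (\<lambda>p. b (fst p) (snd p)) (x, t)) \<in> Borel"
  by (rule measurable_compose[OF _ b_borel]) (simp add: borel_prod[symmetric])
 thus ?thesis by simp
qed

text \<open>The divergence is tested with cutoffs equal to 1 on \<open>K\<close> whose supports
  shrink to \<open>K\<close> and whose gradients tend to 0 in L^1. The integral against the bounded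
  field tends to 0, the measure side to the difference of the masses of \<open>K\<close>.\<close>

lemma compact_hnull_divergence:
 assumes K: "compact K" "hnull K" "K \<subseteq> \<Omega>"
 shows "measure (mp t) K = measure (mn t) K"
proof -
 interpret mp: finite_measure "mp t" by (rule mp_fin)
 interpret mn: finite_measure "mn t" by (rule mn_fin)
 have Kb[measurable]: "K \<in> sets borel" using borel_compact[OF K(1)] .
 have op: "open (\<Omega> \<inter> (\<Union>x\<in>K. ball x (1 / real (Suc n))))" for n using open_\<Omega> by auto
 have KU: "K \<subseteq> \<Omega> \<inter> (\<Union>x\<in>K. ball x (1 / real (Suc n)))" for n using K(3) by auto
 have "\<exists>th :: 'a => real. C1c_on (\<Omega> \<inter> (\<Union>x\<in>K. ball x (1 / real (Suc n)))) th \<and> (\<forall>x. 0 \<le> th x \<and> th x \<le> 1) \<and> (\<forall>x\<in>K. th x = 1) \<and>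
  (NBINT x. ennreal (norm (grad th x))) \<le> ennreal (1 / real (Suc n))" for n
  by (rule hnull_cutoff[OF dim K(1,2) op KU, of "1 / real (Suc n)" n]) auto
 then obtain th :: "nat => 'a => real" where th: "\<And>n. C1c_on (\<Omega> \<inter> (\<Union>x\<in>K. ball x (1 / real (Suc n)))) (th n)"
  "\<And>n x. 0 \<le> th n x \<and> th n x \<le> 1" "\<And>n x. x \<in> K ==> th n x = 1"
  "\<And>n. (NBINT x. ennreal (norm (grad (th n) x))) \<le> ennreal (1 / real (Suc n))" by metis
 have [measurable]: "th n \<in> Borel" for n using C1c_on_measurable[OF th(1)] .
 have lim: "(\<lambda>n. th n x) \<longlonglongrightarrow> ind K x" for x
 proof (cases "x \<in> K")
  case True thus ?thesis by (simp add: th(3))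
 next
  case False
  then obtain e where e: "e > 0" "ball x e \<inter> K = {}"
   using compact_imp_closed[OF K(1)] by (metis Compl_iff open_Compl openE disjoint_eq_subset_Compl)
  obtain m where m: "1 / real (Suc m) < e" using e(1) by (metis nat_approx_posE)
  have "th n x = 0" if "n \<ge> m" for n
  proof (rule C1c_on_outside(1)[OF th(1)])
   have "1 / real (Suc n) \<le> 1 / real (Suc m)" using that by (intro divide_left_mono) auto
   hence "x \<notin> ball y (1 / real (Suc n))" if "y \<in> K" for y
    using e(2) m that by (metis IntI dist_commute empty_iff le_less_trans less_imp_le mem_ball order.strict_trans2)
   thus "x \<notin> \<Omega> \<inter> (\<Union>x\<in>K. ball x (1 / real (Suc n)))" by blast
  qed
  hence "eventually (\<lambda>n. th n x = 0) sequentially" unfolding eventually_sequentially by blast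
  thus ?thesis using False by (simp add: tendsto_eventually)
 qed
 have "(\<lambda>n. integral\<^sup>L (mp t) (th n)) \<longlonglongrightarrow> integral\<^sup>L (mp t) (ind K)"
  by (rule integral_dominated_convergence[where w = "\<lambda>x. 1"]) (use th(2) lim in auto)
 moreover have "(\<lambda>n. integral\<^sup>L (mn t) (th n)) \<longlonglongrightarrow> integral\<^sup>L (mn t) (ind K)"
  by (rule integral_dominated_convergence[where w = "\<lambda>x. 1"]) (use th(2) lim in auto)
 ultimately have 1: "(\<lambda>n. integral\<^sup>L (mp t) (th n) - integral\<^sup>L (mn t) (th n)) \<longlonglongrightarrow> measure (mp t) K - measure (mn t) K"
  using Kb by (auto intro!: tendsto_diff simp: mp_sets mn_sets)
 have "norm (integral\<^sup>L (mp t) (th n) - integral\<^sup>L (mn t) (th n)) \<le> B * (1 / real (Suc n))" for n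
 proof -
  have [measurable]: "grad (th n) \<in> Borel" using grad_continuous[OF th(1)] by (rule borel_measurable_continuous_onI)
  have "integral\<^sup>L (mp t) (th n) - integral\<^sup>L (mn t) (th n) = - (LBINT x. b x t \<bullet> grad (th n) x)"
   using div_b[OF C1c_on_mono[OF th(1)], of n t] by simp
  also have "ennreal (norm \<dots>) \<le> (NBINT x. ennreal (norm (b x t \<bullet> grad (th n) x)))"
   unfolding norm_minus_cancel by (rule norm_integral_le_nn_integral)
  also have "\<dots> \<le> (NBINT x. ennreal B * ennreal (norm (grad (th n) x)))"
   using B_nonneg
   by (intro nn_integral_mono) (auto simp flip: ennreal_mult intro!: ennreal_leI order_trans[OF Cauchy_Schwarz_ineq2] mult_right_mono b_le)
  also have "\<dots> = ennreal B * (NBINT x. ennreal (norm (grad (th n) x)))" by (rule nn_integral_cmult) measurable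
  also have "\<dots> \<le> ennreal B * ennreal (1 / real (Suc n))" by (intro mult_left_mono th(4)) auto
  also have "\<dots> = ennreal (B * (1 / real (Suc n)))" using B_nonneg by (subst ennreal_mult[symmetric]) auto
  finally show ?thesis using B_nonneg by (subst (asm) ennreal_le_iff) auto
 qed
 moreover have "(\<lambda>n. B * (1 / real (Suc n))) \<longlonglongrightarrow> 0"
  using tendsto_mult[OF tendsto_const[of B] LIMSEQ_inverse_real_of_nat] by (simp add: inverse_eq_divide)
 ultimately have "(\<lambda>n. integral\<^sup>L (mp t) (th n) - integral\<^sup>L (mn t) (th n)) \<longlonglongrightarrow> 0"
  by (rule Lim_null_comparison[OF always_eventually[OF allI]])
 from LIMSEQ_unique[OF 1 this] show ?thesis by simp
qed

text \<open>Both parts agree on compact null sets. On compact subsets of the Hahn set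
  \<open>P\<close> the negative part is 0, hence so is the positive one, and conversely off
  \<open>P\<close>. Inner regularity extends this to Borel sets.\<close>

lemma hnull_divergence:
 assumes G[measurable]: "G \<in> sets borel" and "hnull G"
 shows "emeasure (mp t) G = 0" "emeasure (mn t) G = 0"
proof -
 interpret mp: finite_measure "mp t" by (rule mp_fin)
 interpret mn: finite_measure "mn t" by (rule mn_fin)
 obtain P where P[measurable]: "P \<in> sets borel" and P0: "emeasure (mn t) P = 0" "emeasure (mp t) (- P) = 0"
  using hahn[of t] by blast
 have [measurable]: "\<Omega> \<in> sets borel" using open_\<Omega> by simp
 have sub: "emeasure \<mu> A = 0" if "sets \<mu> = sets borel" "A \<subseteq> A'" "A' \<in> sets borel" "emeasure \<mu> A' = 0" for \<mu> :: "'a measure" and A A'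
  using emeasure_mono[of A A' \<mu>] that by auto
 have "emeasure (mp t) (G \<inter> P \<inter> \<Omega>) = 0"
 proof (rule emeasure_eq_0_if_compact[OF mp_sets mp_fin])
  fix K assume K: "K \<subseteq> G \<inter> P \<inter> \<Omega>" "compact K"
  have "measure (mp t) K = measure (mn t) K"
   using K by (intro compact_hnull_divergence hnull_subset[OF assms(2)]) auto
  also have "emeasure (mn t) K = 0" by (rule sub[OF mn_sets _ P P0(1)]) (use K in auto)
  hence "measure (mn t) K = 0" by (simp add: measure_def)
  finally show "emeasure (mp t) K = 0" by (simp add: mp.emeasure_eq_measure)
 qed auto
 moreover have "G \<subseteq> (G \<inter> P \<inter> \<Omega>) \<union> (- P) \<union> (- \<Omega>)" by auto
 ultimately show "emeasure (mp t) G = 0"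
  using P0(2) mpn_outside(1)[of t] by (intro sub[OF mp_sets, of G "(G \<inter> P \<inter> \<Omega>) \<union> (- P) \<union> (- \<Omega>)"])
   (auto intro!: emeasure_Un_null_set[THEN trans] simp: null_sets_def mp_sets)
 have "emeasure (mn t) (G \<inter> - P \<inter> \<Omega>) = 0"
 proof (rule emeasure_eq_0_if_compact[OF mn_sets mn_fin])
  fix K assume K: "K \<subseteq> G \<inter> - P \<inter> \<Omega>" "compact K"
  have "measure (mn t) K = measure (mp t) K"
   using K by (intro compact_hnull_divergence[symmetric] hnull_subset[OF assms(2)]) auto
  also have "emeasure (mp t) K = 0" by (rule sub[OF mp_sets _ _ P0(2)]) (use K in auto)
  hence "measure (mp t) K = 0" by (simp add: measure_def)
  finally show "emeasure (mn t) K = 0" by (simp add: mn.emeasure_eq_measure)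
 qed auto
 moreover have "G \<subseteq> (G \<inter> - P \<inter> \<Omega>) \<union> P \<union> (- \<Omega>)" by auto
 ultimately show "emeasure (mn t) G = 0"
  using P0(1) mpn_outside(2)[of t] by (intro sub[OF mn_sets, of G "(G \<inter> - P \<inter> \<Omega>) \<union> P \<union> (- \<Omega>)"])
   (auto intro!: emeasure_Un_null_set[THEN trans] simp: null_sets_def mn_sets)
qed

lemma hnull_AE_sig:
 assumes "hnull Z" shows "AE x in sig. x \<notin> Z"
proof -
 obtain G where G: "G \<in> sets borel" "hnull G" "Z \<subseteq> G" using hnull_Borel_hull[OF assms] by blast
 have "emeasure sig G = 0" using G hnull_divergence by (intro sig_null) auto
 hence "G \<in> null_sets sig" using G by (simp add: null_sets_def sig_sets)
 from AE_not_in[OF this] show ?thesis by eventually_elim (use G(3) in blast)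
qed

text \<open>\<open>f_dens\<close> is the identity for indicators; uniformly bounded simple functions
  carry it over to bounded Borel functions.\<close>

lemma integral_divergence_measure:
 fixes phi :: "'a => real"
 assumes [measurable]: "phi \<in> Borel" and bd: "\<And>x. \<bar>phi x\<bar> \<le> c"
 shows "integral\<^sup>L (mp t) phi - integral\<^sup>L (mn t) phi = (\<integral>x. phi x * f x t \<partial>sig)"
proof -
 interpret mp: finite_measure "mp t" by (rule mp_fin)
 interpret mn: finite_measure "mn t" by (rule mn_fin)
 interpret s: finite_measure sig by (rule sig_fin)
 have fi: "integrable sig (\<lambda>x. g x * f x t)" if "g \<in> borel_measurable sig" "\<And>x. \<bar>g x\<bar> \<le> c" for g :: "'a => real" and c
  using integrable_scaleR_bounded[OF f_int that(1) that(2)] by simp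
 from borel_measurable_implies_sequence_metric[OF assms(1), of 0] obtain s where s':
  "\<forall>i. simple_function borel (s i)" "\<forall>x\<in>space borel. (\<lambda>i. s i x) \<longlonglongrightarrow> phi x"
  "\<forall>i. \<forall>x\<in>space borel. dist (s i x) 0 \<le> 2 * dist (phi x) 0" by blast
 hence s: "\<And>i. simple_function borel (s i)" "\<And>x. (\<lambda>i. s i x) \<longlonglongrightarrow> phi x" "\<And>i x. norm (s i x) \<le> 2 * norm (phi x)"
  by simp_all
 have sm[measurable]: "s i \<in> Borel" for i using borel_measurable_simple_function[OF s(1)] .
 have sb: "\<bar>s i x\<bar> \<le> 2 * c" for i x using s(3)[of i x] bd[of x] by simp
 have eq: "integral\<^sup>L (mp t) (s i) - integral\<^sup>L (mn t) (s i) = (\<integral>x. s i x * f x t \<partial>sig)" for i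
 proof -
  have fr: "finite (range (s i))" using simple_functionD(1)[OF s(1)[of i]] by simp
  have rep: "s i = (\<lambda>x. \<Sum>y\<in>range (s i). y * ind (s i -` {y}) x)"
  proof
   fix x
   have "(\<Sum>y\<in>range (s i). y * ind (s i -` {y}) x) = (\<Sum>y\<in>{s i x}. y * ind (s i -` {y}) x)"
    using fr by (intro sum.mono_neutral_right) (auto simp: indicator_def)
   thus "s i x = (\<Sum>y\<in>range (s i). y * ind (s i -` {y}) x)" by simp
  qed
  have vb: "s i -` {y} \<in> sets borel" for y using measurable_sets[OF sm[of i], of "{y}"] by simp
  have m: "integral\<^sup>L \<mu> (s i) = (\<Sum>y\<in>range (s i). y * measure \<mu> (s i -` {y}))"
   if "finite_measure \<mu>" "sets \<mu> = sets borel" for \<mu> :: "'a measure"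
  proof -
   have "integral\<^sup>L \<mu> (s i) = (\<integral>x. (\<Sum>y\<in>range (s i). y * ind (s i -` {y}) x) \<partial>\<mu>)" using rep by simp
   also have "\<dots> = (\<Sum>y\<in>range (s i). \<integral>x. y * ind (s i -` {y}) x \<partial>\<mu>)"
    using vb that finite_measure.emeasure_finite[OF that(1)]
    by (intro Bintegral_sum integrable_mult_right integrable_real_indicator) (auto simp: less_top[symmetric])
   finally show ?thesis using vb that sets_eq_imp_space_eq[OF that(2)] by simp
  qed
  have "(\<integral>x. s i x * f x t \<partial>sig) = (\<integral>x. (\<Sum>y\<in>range (s i). y * (ind (s i -` {y}) x * f x t)) \<partial>sig)"
   by (subst rep) (simp add: sum_distrib_right mult.assoc)
  also have "\<dots> = (\<Sum>y\<in>range (s i). \<integral>x. y * (ind (s i -` {y}) x * f x t) \<partial>sig)"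
   using vb by (intro Bintegral_sum integrable_mult_right fi[of _ 1]) (auto simp: sig_sets cong: measurable_cong_sets)
  also have "\<dots> = (\<Sum>y\<in>range (s i). y * (measure (mp t) (s i -` {y}) - measure (mn t) (s i -` {y})))"
   using f_dens[OF vb] by simp
  finally show ?thesis using m[OF mp_fin mp_sets] m[OF mn_fin mn_sets] by (simp add: right_diff_distrib sum_subtractf)
 qed
 have l1: "(\<lambda>i. integral\<^sup>L (mp t) (s i)) \<longlonglongrightarrow> integral\<^sup>L (mp t) phi"
  by (rule integral_dominated_convergence[where w = "\<lambda>x. 2 * c"]) (use s(2) sb in auto)
 have l2: "(\<lambda>i. integral\<^sup>L (mn t) (s i)) \<longlonglongrightarrow> integral\<^sup>L (mn t) phi"
  by (rule integral_dominated_convergence[where w = "\<lambda>x. 2 * c"]) (use s(2) sb in auto)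
 have l3: "(\<lambda>i. \<integral>x. s i x * f x t \<partial>sig) \<longlonglongrightarrow> (\<integral>x. phi x * f x t \<partial>sig)"
 proof (rule integral_dominated_convergence[where w = "\<lambda>x. 2 * c * \<bar>f x t\<bar>"])
  show "AE x in sig. norm (s i x * f x t) \<le> 2 * c * \<bar>f x t\<bar>" for i
   using sb by (auto simp: abs_mult intro!: mult_right_mono)
  show "AE x in sig. (\<lambda>i. s i x * f x t) \<longlonglongrightarrow> phi x * f x t" using s(2) by (auto intro!: tendsto_mult)
  show "integrable sig (\<lambda>x. 2 * c * \<bar>f x t\<bar>)" using f_int by auto
  show "(\<lambda>x. phi x * f x t) \<in> borel_measurable sig" "\<And>i. (\<lambda>x. s i x * f x t) \<in> borel_measurable sig"
   using borel_measurable_integrable[OF f_int] by measurable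
 qed
 show ?thesis by (rule LIMSEQ_unique[OF tendsto_diff[OF l1 l2]]) (use l3 in \<open>simp add: eq\<close>)
qed

text \<open>Since mp t + mn t \<le> sig, the integral of the density over any E is at most sig E in
  absolute value, so the sets where f > 1 and where -f > 1 are null. They depend on t.\<close>

lemma f_le_1: "AE x in sig. \<bar>f x t\<bar> \<le> 1"
proof -
 interpret mp: finite_measure "mp t" by (rule mp_fin)
 interpret mn: finite_measure "mn t" by (rule mn_fin)
 interpret s: finite_measure sig by (rule sig_fin)
 have fm[measurable]: "(\<lambda>x. f x t) \<in> Borel"
  using borel_measurable_integrable[OF f_int[of t]] by (simp cong: measurable_cong_sets add: sig_sets)
 have le: "\<bar>\<integral>x. ind E x * f x t \<partial>sig\<bar> \<le> measure sig E" if "E \<in> sets borel" for E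
 proof -
  have "measure (mp t) E + measure (mn t) E \<le> measure sig E"
   using sig_ge[OF that, of t]
   by (simp add: mp.emeasure_eq_measure mn.emeasure_eq_measure s.emeasure_eq_measure flip: ennreal_plus)
  thus ?thesis unfolding f_dens[OF that, symmetric]
   using measure_nonneg[of "mp t" E] measure_nonneg[of "mn t" E] by linarith
 qed
 have z: "emeasure sig E = 0" if E: "E \<in> sets borel" and gt: "\<And>x. x \<in> E ==> 1 < g x" and g: "g = (\<lambda>x. f x t) \<or> g = (\<lambda>x. - f x t)" for E g
 proof -
  note E[measurable]
  have ig: "integrable sig (\<lambda>x. ind E x * (g x - 1))"
  proof -
   have "integrable sig (\<lambda>x. g x - 1)" using g f_int by auto
   from integrable_mult_indicator[OF _ this, of E] show ?thesis by (simp add: sig_sets)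
  qed
  have iE: "integrable sig (\<lambda>x. ind E x * g x)" 
   using integrable_mult_indicator[of E sig g] g f_int by (auto simp: sig_sets)
  have "(\<integral>x. ind E x * (g x - 1) \<partial>sig) = (\<integral>x. ind E x * g x \<partial>sig) - (\<integral>x. ind E x \<partial>sig)"
   unfolding right_diff_distrib mult_1_right
   by (intro Bintegral_diff iE integrable_real_indicator) (auto simp: sig_sets s.emeasure_eq_measure)
  also have "\<dots> \<le> 0" using le[OF E] g by (auto simp: sig_sets)
  finally have "(\<integral>x. ind E x * (g x - 1) \<partial>sig) = 0"
   using gt by (intro antisym Bintegral_nonneg) (auto simp: indicator_def intro: less_imp_le)
  hence "AE x in sig. ind E x * (g x - 1) = 0"
   using gt by (subst (asm) integral_nonneg_eq_0_iff_AE[OF ig]) (auto simp: indicator_def intro: less_imp_le)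
  hence "AE x in sig. x \<notin> E"
  proof eventually_elim
   case (elim x) thus ?case using gt[of x] by (cases "x \<in> E") auto
  qed
  thus ?thesis using E by (subst (asm) AE_iff_null) (auto simp: sig_sets sets_eq_imp_space_eq[OF sig_sets] null_sets_def)
 qed
 have "{x \<in> space borel. 1 < f x t} \<in> sets borel" "{x \<in> space borel. 1 < - f x t} \<in> sets borel" by measurable
 hence m: "{x. 1 < f x t} \<in> sets borel" "{x. 1 < - f x t} \<in> sets borel" by simp_all
 have "emeasure sig {x. 1 < f x t} = 0" by (rule z[OF m(1), of "\<lambda>x. f x t"]) simp_all
 moreover have "emeasure sig {x. 1 < - f x t} = 0" by (rule z[OF m(2), of "\<lambda>x. - f x t"]) simp_all
 ultimately have "{x. 1 < f x t} \<in> null_sets sig" "{x. 1 < - f x t} \<in> null_sets sig"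
  using m unfolding null_sets_def sig_sets by simp_all
 from this[THEN AE_not_in] show ?thesis by eventually_elim auto
qed

end


section \<open>Partition of unity and choice of the radii\<close>

lemma smooth_partition_of_unity:
 fixes \<Omega> :: "'a::euclidean_space set"
 assumes "open \<Omega>"
 obtains C :: "nat => 'a set" and zeta :: "nat => 'a => real" where
  "\<And>n. compact (C n)" "\<And>n. C n \<subseteq> interior (C (Suc n))" "(\<Union>n. C n) = \<Omega>"
  "\<And>i. C1c_on (interior (C (Suc i))) (zeta i)" "\<And>i x. 0 \<le> zeta i x" "\<And>i x. x \<in> C i ==> zeta (Suc i) x = 0"
  "\<And>n x. x \<in> C n ==> (\<Sum>i<Suc n. zeta i x) = 1" "\<And>n x. (\<Sum>i<n. zeta i x) \<le> 1"
proof -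
 obtain C where C: "\<And>n. compact (C n)" "\<And>n. C n \<subseteq> \<Omega>" "\<And>n. C n \<subseteq> interior (C (Suc n))" "(\<Union>n. C n) = \<Omega>"
  using open_Union_compact_subsets[OF assms] by metis
 have "\<exists>eta :: 'a => real. C1c_on (interior (C (Suc n))) eta \<and> (\<forall>x. 0 \<le> eta x \<and> eta x \<le> 1) \<and> (\<forall>x\<in>C n. eta x = 1)" for n
  by (rule smooth_cutoff[OF C(1) open_interior C(3)]) blast
 then obtain eta :: "nat => 'a => real" where eta: "\<And>n. C1c_on (interior (C (Suc n))) (eta n)"
  "\<And>n x. 0 \<le> eta n x" "\<And>n x. eta n x \<le> 1" "\<And>n x. x \<in> C n ==> eta n x = 1" by metis
 have Csub: "C n \<subseteq> C (Suc n)" for n using C(3)[of n] interior_subset by blast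
 \<comment> \<open>Differences of successive cutoffs telescope to \<open>eta n\<close>. They are
   nonnegative because \<open>eta (Suc j)\<close> is 1 on the support of
   \<open>eta j\<close>.\<close>
 define zeta where "zeta i = (case i of 0 => eta 0 | Suc j => (\<lambda>x. eta (Suc j) x - eta j x))" for i
 have sum: "(\<Sum>i<Suc n. zeta i x) = eta n x" for n x
  by (induction n) (auto simp: zeta_def)
 have le: "eta j x \<le> eta (Suc j) x" for j x
  using C1c_on_outside(1)[OF eta(1), of x j] eta(2)[of "Suc j" x] eta(3)[of j x] eta(4)[of x "Suc j"] interior_subset[of "C (Suc j)"]
  by (cases "x \<in> interior (C (Suc j))") auto
 show thesis
 proof (rule that[OF C(1) C(3) C(4)])
  show "C1c_on (interior (C (Suc i))) (zeta i)" for i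
  proof (cases i)
   case 0 thus ?thesis using eta(1)[of 0] by (simp add: zeta_def)
  next
   case (Suc j)
   have "C1c_on (interior (C (Suc (Suc j)))) (eta j)"
    by (rule C1c_on_mono[OF eta(1)[of j] interior_mono[OF Csub]])
   with Suc show ?thesis using C1c_on_diff[OF eta(1)[of "Suc j"]] by (simp add: zeta_def)
  qed
  show "0 \<le> zeta i x" for i x using le eta(2) by (cases i) (auto simp: zeta_def)
  show "zeta (Suc i) x = 0" if "x \<in> C i" for i x
   using eta(4)[OF that] eta(4)[of x "Suc i"] that Csub by (auto simp: zeta_def)
  show "(\<Sum>i<Suc n. zeta i x) = 1" if "x \<in> C n" for n x using sum eta(4)[OF that] by simp
  show "(\<Sum>i<n. zeta i x) \<le> 1" for n x using sum eta(3) by (cases n) auto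
 qed
qed

text \<open>As a function of y this is the test function that converts a derivative falling on the
  mollifier into the divergence of b and a term with the gradient of \<open>zeta\<close>.\<close>

lemma C1c_on_mollified_test:
 fixes zeta :: "'a::euclidean_space => real"
 assumes "eps > 0" "C1c_on U zeta"
 shows "C1c_on U (\<lambda>y. moll eps (x - y) * zeta y)"
  "v \<bullet> grad (\<lambda>y. moll eps (x - y) * zeta y) y = moll eps (x - y) * (v \<bullet> grad zeta y) - zeta y * FD (moll eps) (x - y) v"
proof -
 note r = C1c_on_reflect[OF moll_C1c[OF assms(1), where 'a = 'a], of x]
 note p = C1c_on_mult[OF C1c_on_has_derivative[OF r(1)] C1c_on_continuous_derivative[OF r(1)] assms(2)]
 show c: "C1c_on U (\<lambda>y. moll eps (x - y) * zeta y)" using p(1) by simp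
 show "v \<bullet> grad (\<lambda>y. moll eps (x - y) * zeta y) y = moll eps (x - y) * (v \<bullet> grad zeta y) - zeta y * FD (moll eps) (x - y) v"
  unfolding inner_grad[OF c] inner_grad[OF assms(2)] using p(2)[of y v] by (simp add: r(2))
qed

lemma iter_pd_cong_open:
 assumes "open U" "\<And>x. x \<in> U ==> f x = g x" "x \<in> U"
 shows "iter_pd vs f x = iter_pd vs g x"
 using assms(3)
proof (induction vs arbitrary: x)
 case Nil thus ?case using assms(2) by simp
next
 case (Cons v vs)
 have "(iter_pd vs f has_derivative D) (at x) \<longleftrightarrow> (iter_pd vs g has_derivative D) (at x)" for D
  using Cons assms(1) has_derivative_transform_within_open[of "iter_pd vs f" D x UNIV U "iter_pd vs g"]
   has_derivative_transform_within_open[of "iter_pd vs g" D x UNIV U "iter_pd vs f"] by auto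
 thus ?case by (simp add: frechet_derivative_def)
qed

lemma iter_pd_differentiable_cong_open:
 assumes "open U" "\<And>x. x \<in> U ==> f x = g x" "x \<in> U" "iter_pd vs g differentiable at x"
 shows "iter_pd vs f differentiable at x"
proof -
 obtain D where "(iter_pd vs g has_derivative D) (at x)" using assms(4) by (auto simp: differentiable_def)
 hence "(iter_pd vs f has_derivative D) (at x)"
  by (rule has_derivative_transform_within_open[OF _ assms(1,3)]) (use iter_pd_cong_open[OF assms(1,2)] in simp)
 thus ?thesis by (auto simp: differentiable_def)
qed

lemma iter_pd_sum_scaleR:
 fixes T :: "'i => 'a::euclidean_space => 'b::euclidean_space"
 assumes "\<And>i vs x. i \<in> I ==> iter_pd vs (T i) differentiable at x"
 shows "iter_pd vs (\<lambda>x. c *\<^sub>R (\<Sum>i\<in>I. T i x)) = (\<lambda>x. c *\<^sub>R (\<Sum>i\<in>I. iter_pd vs (T i) x))"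
proof (induction vs)
 case (Cons v vs)
 have D: "((\<lambda>x. c *\<^sub>R (\<Sum>i\<in>I. iter_pd vs (T i) x)) has_derivative
   (\<lambda>h. c *\<^sub>R (\<Sum>i\<in>I. FD (iter_pd vs (T i)) x h))) (at x)" for x
  using assms by (intro has_derivative_scaleR_right has_derivative_sum) (simp add: frechet_derivative_works[symmetric])
 show ?case unfolding iter_pd.simps Cons.IH frechet_derivative_at[OF D, symmetric] ..
qed simp

locale partitioned_family = field_family \<Omega> b B mp mn sig f
 for \<Omega> :: "'a::euclidean_space set" and b B mp mn sig f +
 fixes C :: "nat => 'a set" and zeta :: "nat => 'a => real" and M :: real
 assumes C_compact: "\<And>n. compact (C n)" and C_interior: "\<And>n. C n \<subseteq> interior (C (Suc n))" and C_Union: "(\<Union>n. C n) = \<Omega>"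
  and zeta_C1c: "\<And>i. C1c_on (interior (C (Suc i))) (zeta i)" and zeta_nonneg: "\<And>i x. 0 \<le> zeta i x"
  and zeta_vanish: "\<And>i x. x \<in> C i ==> zeta (Suc i) x = 0"
  and zeta_sum: "\<And>n x. x \<in> C n ==> (\<Sum>i<Suc n. zeta i x) = 1" and zeta_sum_le: "\<And>n x. (\<Sum>i<n. zeta i x) \<le> 1"
  and M_pos: "M > 0"
begin

lemma C_mono: "n \<le> m ==> C n \<subseteq> C m"
 by (rule lift_Suc_mono_le) (use C_interior interior_subset in blast)+

lemma C_subset: "C n \<subseteq> \<Omega>"
 using C_Union by blast

lemma in_interior_C: assumes "x \<in> \<Omega>" obtains m where "x \<in> interior (C m)"
proof -
 obtain n where "x \<in> C n" using assms C_Union by blast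
 thus thesis using that C_interior by blast
qed

lemma zeta_C1c_\<Omega>: "C1c_on \<Omega> (zeta i)"
 by (rule C1c_on_mono[OF zeta_C1c]) (use interior_subset C_subset in blast)

lemma zeta_le_1: "zeta i x \<le> 1"
proof -
 have "zeta i x \<le> (\<Sum>j<Suc i. zeta j x)" by (rule member_le_sum) (use zeta_nonneg in auto)
 thus ?thesis using zeta_sum_le[where n = "Suc i" and x = x] by linarith
qed

lemma zeta_measurable[measurable]: "zeta i \<in> Borel"
 by (rule C1c_on_measurable[OF zeta_C1c])

lemma grad_zeta_measurable[measurable]: "grad (zeta i) \<in> Borel"
 by (rule borel_measurable_continuous_onI[OF grad_continuous[OF zeta_C1c]])

lemma zeta_b_integrable: "Lint (\<lambda>y. zeta i y *\<^sub>R b y t)"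
proof -
 have "Lint (\<lambda>y. B * zeta i y)" using C1c_on_integrable[OF zeta_C1c] by simp
 thus ?thesis
  by (rule Bintegrable_bound)
   (use b_le zeta_nonneg B_nonneg in \<open>auto simp: mult.commute[of B] abs_mult intro!: mult_left_mono\<close>)
qed

lemma b_grad_zeta_integrable: "Lint (\<lambda>y. b y t \<bullet> grad (zeta i) y)"
proof -
 have "Lint (\<lambda>y. B * norm (grad (zeta i) y))" using grad_integrable[OF zeta_C1c] by simp
 thus ?thesis
  by (rule Bintegrable_bound)
   (use B_nonneg in \<open>auto intro!: order_trans[OF Cauchy_Schwarz_ineq2] mult_right_mono b_le\<close>)
qed

text \<open>A countable dense set of levels keeps suprema over t measurable; by continuity in t they
  dominate every level in [-M, M], see \<open>Q_SUP\<close>.\<close>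

definition Q :: "real set" where "Q = {-M..M} \<inter> \<rat>"

lemma Q_countable: "countable Q" and Q_subset: "Q \<subseteq> {-M..M}"
 unfolding Q_def using countable_rat by auto

lemma Q_dense: assumes t: "t \<in> {-M..M}" obtains q where "\<And>n. q n \<in> Q" "q \<longlonglongrightarrow> t"
proof -
 have "t \<in> closure Q"
  unfolding closure_approachable
 proof (intro allI impI)
  fix e :: real assume e: "e > 0"
  have "max (- M) (t - e) < min M (t + e)" using t e M_pos by auto
  then obtain r where "r \<in> \<rat>" "max (- M) (t - e) < r" "r < min M (t + e)" using Rats_dense_in_real by blast
  thus "\<exists>y\<in>Q. dist y t < e" by (intro bexI[of _ r]) (auto simp: Q_def dist_real_def)
 qed
 thus thesis using that closure_sequential by blast
qed

lemma Q_SUP: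
 assumes t: "t \<in> {-M..M}" and g: "\<And>q. q \<longlonglongrightarrow> t ==> (\<lambda>n. g (q n)) \<longlonglongrightarrow> g t"
 shows "ennreal (norm (g t)) \<le> (SUP q\<in>Q. ennreal (norm (g q)))"
proof -
 obtain q where q: "\<And>n. q n \<in> Q" "q \<longlonglongrightarrow> t" using Q_dense[OF t] by blast
 have "(\<lambda>n. ennreal (norm (g (q n)))) \<longlonglongrightarrow> ennreal (norm (g t))" by (intro tendsto_ennrealI tendsto_norm g q(2))
 thus ?thesis by (rule LIMSEQ_le_const2) (auto intro!: SUP_upper q(1))
qed

text \<open>\<open>dlt\<close> is the accuracy of the approximation, \<open>eps i\<close> the radius at which the i-th piece is mollified.\<close>

definition admissible :: "real => (nat => real) => bool" where
 "admissible dlt eps \<longleftrightarrow> (\<forall>i. 0 < eps i \<and> eps i \<le> dlt \<and> (\<forall>x\<in>C i. cball x (eps (Suc (Suc i))) \<subseteq> C (Suc i)) \<and>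
  (\<forall>x. convol (moll (eps i)) (zeta i) x \<le> zeta i x + dlt * (1/2) ^ Suc i) \<and>
  (NBINT x. (SUP t\<in>Q. ennreal (norm (convol (moll (eps i)) (\<lambda>y. zeta i y *\<^sub>R b y t) x - zeta i x *\<^sub>R b x t)))) \<le> ennreal (dlt * (1/2) ^ Suc i) \<and>
  (NBINT x. (SUP t\<in>Q. ennreal (norm (convol (moll (eps i)) (\<lambda>y. b y t \<bullet> grad (zeta i) y) x - b x t \<bullet> grad (zeta i) x)))) \<le> ennreal (dlt * (1/2) ^ Suc i))"

lemma ex_admissible:
 assumes dlt: "dlt > 0" shows "\<exists>eps. admissible dlt eps"
proof -
 define P where "P i e \<longleftrightarrow> 0 < e \<and> e \<le> dlt \<and> (\<forall>j. i = Suc (Suc j) \<longrightarrow> (\<forall>x\<in>C j. cball x e \<subseteq> C (Suc j))) \<and>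
  (\<forall>x. convol (moll e) (zeta i) x \<le> zeta i x + dlt * (1/2) ^ Suc i) \<and>
  (NBINT x. (SUP t\<in>Q. ennreal (norm (convol (moll e) (\<lambda>y. zeta i y *\<^sub>R b y t) x - zeta i x *\<^sub>R b x t)))) \<le> ennreal (dlt * (1/2) ^ Suc i) \<and>
  (NBINT x. (SUP t\<in>Q. ennreal (norm (convol (moll e) (\<lambda>y. b y t \<bullet> grad (zeta i) y) x - b x t \<bullet> grad (zeta i) x)))) \<le> ennreal (dlt * (1/2) ^ Suc i)"
  for i e
 have "\<exists>e. P i e" for i
 proof -
  define d where "d = dlt * (1/2) ^ Suc i"
  have d: "d > 0" using dlt by (simp add: d_def)
  \<comment> \<open>The shift by two: \<open>zeta (Suc (Suc j))\<close> vanishes on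
    \<open>C (Suc j)\<close>, so its mollification vanishes on \<open>C j\<close> if the balls about
    points of \<open>C j\<close> stay in \<open>C (Suc j)\<close>.\<close>
  have "\<exists>e1>0. \<forall>j. i = Suc (Suc j) \<longrightarrow> (\<forall>x\<in>C j. cball x e1 \<subseteq> C (Suc j))"
  proof (cases "\<exists>j. i = Suc (Suc j)")
   case True
   then obtain j where j: "i = Suc (Suc j)" by blast
   obtain e where "e > 0" "\<And>x. x \<in> C j ==> cball x e \<subseteq> interior (C (Suc j))"
    using compact_thicken[OF C_compact open_interior C_interior] by metis
   thus ?thesis using j interior_subset by (intro exI[of _ e]) blast
  qed (auto intro: exI[of _ 1])
  then obtain e1 where e1: "e1 > 0" "\<And>j x. i = Suc (Suc j) ==> x \<in> C j ==> cball x e1 \<subseteq> C (Suc j)" by blast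
  obtain L where L: "L \<ge> 0" "\<And>x y. norm (zeta i x - zeta i y) \<le> L * norm (x - y)" using C1c_on_lipschitz[OF zeta_C1c] by blast
  have cont1: "AE y in lborel. continuous_on UNIV (\<lambda>t. zeta i y *\<^sub>R b y t)"
   using b_cont by eventually_elim (intro continuous_intros)
  have cont2: "AE y in lborel. continuous_on UNIV (\<lambda>t. b y t \<bullet> grad (zeta i) y)"
   using b_cont by eventually_elim (intro continuous_intros)
  have m1: "(\<lambda>p. zeta i (fst p) *\<^sub>R b (fst p) (snd p)) \<in> Borel"
   using b_borel unfolding borel_prod[symmetric] by measurable
  have m2: "(\<lambda>p. b (fst p) (snd p) \<bullet> grad (zeta i) (fst p)) \<in> Borel"
   using b_borel unfolding borel_prod[symmetric] by measurable
  have G1: "Lint (\<lambda>y. B * zeta i y)" "\<And>y t. norm (zeta i y *\<^sub>R b y t) \<le> B * zeta i y"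
   using C1c_on_integrable[OF zeta_C1c] b_le zeta_nonneg by (auto simp: mult.commute[of B] intro!: mult_left_mono)
  have G2: "Lint (\<lambda>y. B * norm (grad (zeta i) y))" "\<And>y t. norm (b y t \<bullet> grad (zeta i) y) \<le> B * norm (grad (zeta i) y)"
   using grad_integrable[OF zeta_C1c] by (auto intro!: order_trans[OF Cauchy_Schwarz_ineq2] mult_right_mono b_le)
  obtain e2 where e2: "e2 > 0" "\<And>eps. 0 < eps ==> eps < e2 ==>
    (NBINT x. (SUP t\<in>Q. ennreal (norm (convol (moll eps) (\<lambda>y. zeta i y *\<^sub>R b y t) x - zeta i x *\<^sub>R b x t)))) \<le> ennreal d"
   using convol_moll_uniform_L1[of "\<lambda>y t. zeta i y *\<^sub>R b y t", OF m1 G1 cont1 Q_countable Q_subset d] by blast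
  obtain e3 where e3: "e3 > 0" "\<And>eps. 0 < eps ==> eps < e3 ==>
    (NBINT x. (SUP t\<in>Q. ennreal (norm (convol (moll eps) (\<lambda>y. b y t \<bullet> grad (zeta i) y) x - b x t \<bullet> grad (zeta i) x)))) \<le> ennreal d"
   using convol_moll_uniform_L1[of "\<lambda>y t. b y t \<bullet> grad (zeta i) y", OF m2 G2 cont2 Q_countable Q_subset d] by blast
  \<comment> \<open>The last entry bounds the oscillation of \<open>zeta i\<close> on balls of
    radius e by d; the halves give strict inequality against \<open>e2\<close> and
    \<open>e3\<close>.\<close>
  define e where "e = min (min (min e1 (e2/2)) (min (e3/2) dlt)) (d / (L + 1))"
  have e: "0 < e" "e \<le> e1" "e < e2" "e < e3" "e \<le> dlt" "e \<le> d / (L + 1)"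
   using e1(1) e2(1) e3(1) dlt d L(1) by (auto simp: e_def)
  have "convol (moll e) (zeta i) x \<le> zeta i x + d" for x
  proof -
   have "norm (convol (moll e) (zeta i) x - zeta i x) \<le> L * e"
   proof (rule convol_moll_near[OF e(1) C1c_on_integrable[OF zeta_C1c]])
    fix y assume "norm (x - y) < e"
    thus "norm (zeta i y - zeta i x) \<le> L * e"
     using L(2)[of y x] L(1) by (smt (verit) mult_left_mono norm_minus_commute)
   qed (use L e in auto)
   also have "L * e \<le> L * (d / (L + 1))" using L e by (intro mult_left_mono)
   also have "\<dots> \<le> d" using L d by (simp add: divide_le_eq mult_left_mono)
   finally show ?thesis by simp
  qed
  thus ?thesis using e(1,5) e2(2)[OF e(1,3)] e3(2)[OF e(1,4)] e1(2) subset_cball[OF e(2)]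
   unfolding d_def P_def by (intro exI[of _ e] conjI) blast+
 qed
 then obtain eps where "\<And>i. P i (eps i)" by metis
 thus ?thesis unfolding admissible_def P_def by (intro exI[of _ eps]) blast
qed

end


section \<open>The mollified fields and their divergence\<close>

locale mollified_family = partitioned_family \<Omega> b B mp mn sig f C zeta M
 for \<Omega> :: "'a::euclidean_space set" and b B mp mn sig f C zeta M +
 fixes dlt :: real and eps :: "nat => real"
 assumes dlt: "dlt > 0" and adm: "admissible dlt eps"
begin

lemma eps_pos: "eps i > 0" and eps_le: "eps i \<le> dlt" and eps_C: "x \<in> C i ==> cball x (eps (Suc (Suc i))) \<subseteq> C (Suc i)"
 and eps_zeta: "convol (moll (eps i)) (zeta i) x \<le> zeta i x + dlt * (1/2) ^ Suc i"
 using adm unfolding admissible_def by blast+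

lemmas moll_eps_measurable[measurable] = moll_measurable[OF eps_pos]

definition T :: "nat => real => 'a => 'a" where
 "T i t = convol (moll (eps i)) (\<lambda>y. zeta i y *\<^sub>R b y t)"

definition bk :: "'a => real => 'a" where
 "bk x t = (1 / (1 + dlt)) *\<^sub>R (\<Sum>i. T i t x)"

text \<open>The mollification of zeta_i div b_t, written as an integral against \<open>sig\<close>
  with density \<open>f\<close>, which makes it jointly measurable in x and t.\<close>

definition div_part :: "nat => real => 'a => real" where
 "div_part i t x = (\<integral>y. (moll (eps i) (x - y) * zeta i y) * f y t \<partial>sig)"

definition err :: "nat => real => 'a => real" where
 "err i t x = convol (moll (eps i)) (\<lambda>y. b y t \<bullet> grad (zeta i) y) x - b x t \<bullet> grad (zeta i) x"

text \<open>Makes the series in \<open>bk\<close> locally finite: on \<open>C m\<close> only the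
  pieces with i < m + 2 are felt, even after mollification.\<close>

lemma zeta_near_0: assumes "x \<in> C m" "i \<ge> Suc (Suc m)" "y \<in> ball x (eps i)" shows "zeta i y = 0"
proof -
 obtain j where j: "i = Suc (Suc j)" "m \<le> j" using assms(2) by (metis Suc_le_D Suc_le_mono)
 have "x \<in> C j" using C_mono[OF j(2)] assms(1) by blast
 from eps_C[OF this] have "y \<in> C (Suc j)" using assms(3) j(1) by auto
 thus ?thesis using zeta_vanish j(1) by blast
qed

lemma T_eq_0: "x \<in> C m ==> i \<ge> Suc (Suc m) ==> T i t x = 0"
 unfolding T_def by (rule convol_moll_outside[OF eps_pos]) (simp add: zeta_near_0)

lemma bk_eq: "x \<in> C m ==> n \<ge> Suc (Suc m) ==> bk x t = (1 / (1 + dlt)) *\<^sub>R (\<Sum>i<n. T i t x)"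
 unfolding bk_def by (subst suminf_finite[of "{..<n}"]) (auto intro!: T_eq_0[of x m])

lemma T_has_derivative: "(T i t has_derivative (\<lambda>h. convol (\<lambda>z. FD (moll (eps i)) z h) (\<lambda>y. zeta i y *\<^sub>R b y t) x)) (at x)"
 unfolding T_def by (rule convol_has_derivative[OF moll_C1c[OF eps_pos] zeta_b_integrable])

lemma bk_smooth: "smooth_on \<Omega> (\<lambda>x. bk x t)"
 unfolding smooth_on_def
proof (intro allI impI ballI)
 fix vs :: "'a list" and x assume "x \<in> \<Omega>"
 then obtain m where m: "x \<in> interior (C m)" by (rule in_interior_C)
 have d: "iter_pd vs (T i t) differentiable at x" for i vs x
  unfolding T_def by (rule iter_pd_convol_differentiable[OF smooth_kernel_moll[OF eps_pos] zeta_b_integrable])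
 have D: "iter_pd vs (\<lambda>x. (1 / (1 + dlt)) *\<^sub>R (\<Sum>i<Suc (Suc m). T i t x)) differentiable at x"
  unfolding iter_pd_sum_scaleR[OF d] using d by (intro derivative_intros) auto
 show "iter_pd vs (\<lambda>x. bk x t) differentiable at x"
  by (rule iter_pd_differentiable_cong_open[OF open_interior bk_eq[OF _ order_refl] m D]) (use interior_subset in blast)
qed

lemma convolution_jointly_continuous:
 fixes g :: "'a => real => 'c::euclidean_space"
 assumes "continuous_on UNIV k" "\<And>z. \<bar>k z\<bar> \<le> c" and gi: "\<And>t. Lint (\<lambda>y. g y t)"
  and G: "Lint G" "\<And>y t. norm (g y t) \<le> G y" and cont: "AE y in lborel. continuous_on UNIV (g y)"
  and lim: "x \<longlonglongrightarrow> x0" "t \<longlonglongrightarrow> t0"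
 shows "(\<lambda>n. convol k (\<lambda>y. g y (t n)) (x n)) \<longlonglongrightarrow> convol k (\<lambda>y. g y t0) x0"
 unfolding convol_def
proof (rule integral_dominated_convergence[where w = "\<lambda>y. c * G y"])
 have [measurable]: "k \<in> Borel" using borel_measurable_continuous_onI[OF assms(1)] .
 have [measurable]: "(\<lambda>y. g y t) \<in> Borel" for t using borel_measurable_integrable[OF gi] by simp
 show "(\<lambda>y. k (x0 - y) *\<^sub>R g y t0) \<in> borel_measurable lborel" "\<And>n. (\<lambda>y. k (x n - y) *\<^sub>R g y (t n)) \<in> borel_measurable lborel"
  by measurable
 show "AE y in lborel. (\<lambda>n. k (x n - y) *\<^sub>R g y (t n)) \<longlonglongrightarrow> k (x0 - y) *\<^sub>R g y t0"
  using cont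
 proof eventually_elim
  case (elim y)
  have "isCont k (x0 - y)" "isCont (g y) t0" using assms(1) elim by (auto simp: continuous_on_eq_continuous_at)
  thus ?case
   by (intro tendsto_scaleR isCont_tendsto_compose[of _ k] isCont_tendsto_compose[of _ "g y"] tendsto_diff tendsto_const lim)
 qed
 have c: "c \<ge> 0" using assms(2)[of 0] by simp
 show "AE y in lborel. norm (k (x n - y) *\<^sub>R g y (t n)) \<le> c * G y" for n
  using assms(2) G(2) c by (auto intro!: mult_mono)
qed (use G in auto)

lemma zeta_b_dominated:
 "Lint (\<lambda>y. B * zeta i y)" "norm (zeta i y *\<^sub>R b y t) \<le> B * zeta i y"
 "AE y in lborel. continuous_on UNIV (\<lambda>t. zeta i y *\<^sub>R b y t)"
proof -
 show "Lint (\<lambda>y. B * zeta i y)" using C1c_on_integrable[OF zeta_C1c] by simp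
 show "norm (zeta i y *\<^sub>R b y t) \<le> B * zeta i y" using b_le zeta_nonneg by (simp add: mult.commute[of B] mult_left_mono)
 show "AE y in lborel. continuous_on UNIV (\<lambda>t. zeta i y *\<^sub>R b y t)" using b_cont by eventually_elim (intro continuous_intros)
qed

lemma bounded_C1c: assumes "C1c_on U (k :: 'a => real)" obtains c where "\<And>z. \<bar>k z\<bar> \<le> c"
 using C1c_on_bounded[OF assms] by (metis real_norm_def)

lemma bk_continuous: "continuous_on (\<Omega> \<times> UNIV) (\<lambda>p. bk (fst p) (snd p))"
proof -
 have "\<exists>c. \<forall>z::'a. \<bar>moll (eps i) z\<bar> \<le> c" for i using bounded_C1c[OF moll_C1c[OF eps_pos]] by metis
 then obtain c where c: "\<And>i z. \<bar>moll (eps i) (z :: 'a)\<bar> \<le> c i" by metis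
 have "continuous_on UNIV (\<lambda>p. T i (snd p) (fst p))" for i
  unfolding continuous_on_sequentially T_def o_def
  by (intro allI ballI impI convolution_jointly_continuous[OF C1c_on_continuous[OF moll_C1c[OF eps_pos]] c zeta_b_integrable zeta_b_dominated] tendsto_fst tendsto_snd) auto
 hence T: "isCont (\<lambda>p. T i (snd p) (fst p)) p" for i p using continuous_on_eq_continuous_at open_UNIV by blast
 have "continuous (at p) (\<lambda>p. bk (fst p) (snd p))" if p: "p \<in> \<Omega> \<times> UNIV" for p
 proof -
  obtain m where m: "fst p \<in> interior (C m)" using p in_interior_C by (metis mem_Times_iff)
  have "isCont (\<lambda>p. (1 / (1 + dlt)) *\<^sub>R (\<Sum>i<Suc (Suc m). T i (snd p) (fst p))) p"
   by (intro continuous_intros T)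
  moreover have "eventually (\<lambda>p. bk (fst p) (snd p) = (1 / (1 + dlt)) *\<^sub>R (\<Sum>i<Suc (Suc m). T i (snd p) (fst p))) (nhds p)"
   unfolding eventually_nhds
   by (rule exI[of _ "interior (C m) \<times> UNIV"])
    (use m interior_subset in \<open>auto intro!: open_Times bk_eq[of _ m] simp: mem_Times_iff simp del: sum.lessThan_Suc\<close>)
  ultimately show ?thesis by (simp only: isCont_cong)
 qed
 thus ?thesis by (simp add: continuous_at_imp_continuous_on)
qed

text \<open>The i-th mollified cutoff exceeds \<open>zeta i\<close> by at most dlt 2^-(i+1), so
  together they stay below 1 + dlt; this is the origin of the normalising factor. An almost
  everywhere bound for b at the given t suffices.\<close>

lemma norm_bk_le:
 assumes L: "AE y in lborel. y \<in> \<Omega> \<longrightarrow> norm (b y t) \<le> L" "L \<ge> 0" and x: "x \<in> \<Omega>"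
 shows "norm (bk x t) \<le> L"
proof -
 obtain m where m: "x \<in> C m" using x C_Union by blast
 have Ti: "norm (T i t x) \<le> L * convol (moll (eps i)) (zeta i) x" for i
 proof -
  have "norm (T i t x) \<le> (LBINT y. \<bar>moll (eps i) (x - y)\<bar> * norm (zeta i y *\<^sub>R b y t))"
   unfolding T_def by (rule norm_convol_le)
  also have "\<dots> \<le> (LBINT y. L * (moll (eps i) (x - y) *\<^sub>R zeta i y))"
  proof (rule integral_mono_AE')
   show "Lint (\<lambda>y. L * (moll (eps i) (x - y) *\<^sub>R zeta i y))"
    using convol_moll_integrable[OF eps_pos C1c_on_integrable[OF zeta_C1c]] by simp
   show "AE y in lborel. \<bar>moll (eps i) (x - y)\<bar> * norm (zeta i y *\<^sub>R b y t) \<le> L * (moll (eps i) (x - y) *\<^sub>R zeta i y)"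
    using L(1)
   proof eventually_elim
    case (elim y)
    have "zeta i y * norm (b y t) \<le> zeta i y * L"
     using elim zeta_nonneg C1c_on_outside(1)[OF zeta_C1c_\<Omega>] by (cases "y \<in> \<Omega>") (auto intro: mult_left_mono)
    hence "moll (eps i) (x - y) * (zeta i y * norm (b y t)) \<le> moll (eps i) (x - y) * (zeta i y * L)"
     by (rule mult_left_mono) (rule moll_nonneg[OF eps_pos])
    thus ?case by (simp add: moll_nonneg[OF eps_pos] zeta_nonneg mult_ac)
   qed
   show "AE y in lborel. 0 \<le> L * (moll (eps i) (x - y) *\<^sub>R zeta i y)" using L(2) by (simp add: moll_nonneg[OF eps_pos] zeta_nonneg)
  qed
  also have "\<dots> = L * convol (moll (eps i)) (zeta i) x" by (simp add: convol_def)
  finally show ?thesis .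
 qed
 have "norm (\<Sum>i<Suc (Suc m). T i t x) \<le> (\<Sum>i<Suc (Suc m). L * (zeta i x + dlt * (1/2) ^ Suc i))"
  by (rule sum_norm_le, rule order_trans[OF Ti], rule mult_left_mono[OF eps_zeta L(2)])
 also have "\<dots> = L * ((\<Sum>i<Suc (Suc m). zeta i x) + (\<Sum>i<Suc (Suc m). dlt * (1/2) ^ Suc i))"
  by (simp only: sum_distrib_left[symmetric] sum.distrib)
 also have "\<dots> \<le> L * (1 + dlt)"
  by (rule mult_left_mono[OF add_mono[OF zeta_sum_le sum_half_powers_le] L(2)]) (use dlt in simp)
 finally show ?thesis
  using dlt m by (subst bk_eq[OF m order_refl]) (simp add: divide_le_eq mult.commute)
qed

text \<open>The derivative falls on the kernel. Adding and subtracting the derivative of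
  \<open>zeta i\<close> completes it to the gradient of a test function of y, to which the
  divergence formula for b applies.\<close>

lemma divergence_T: "divergence (T i t) x = div_part i t x + convol (moll (eps i)) (\<lambda>y. b y t \<bullet> grad (zeta i) y) x"
proof -
 let ?m = "moll (eps i) :: 'a => real"
 let ?phi = "\<lambda>y. ?m (x - y) * zeta i y"
 note mC = moll_C1c[OF eps_pos, where 'a = 'a]
 note phi = C1c_on_mollified_test[OF eps_pos[of i] zeta_C1c_\<Omega>[of i], where x = x]
 have i1: "Lint (\<lambda>y. FD ?m (x - y) j *\<^sub>R (zeta i y *\<^sub>R b y t))" for j
  by (rule convol_C1c_integrable(2)[OF mC zeta_b_integrable])
 have "divergence (T i t) x = (\<Sum>j\<in>Basis. (LBINT y. FD ?m (x - y) j *\<^sub>R (zeta i y *\<^sub>R b y t)) \<bullet> j)"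
  unfolding divergence_def frechet_derivative_at[OF T_has_derivative, symmetric] convol_def ..
 also have "\<dots> = (\<Sum>j\<in>Basis. LBINT y. (FD ?m (x - y) j *\<^sub>R (zeta i y *\<^sub>R b y t)) \<bullet> j)"
  by (intro sum.cong refl integral_inner_left[symmetric] i1)
 also have "\<dots> = (LBINT y. (\<Sum>j\<in>Basis. (FD ?m (x - y) j *\<^sub>R (zeta i y *\<^sub>R b y t)) \<bullet> j))"
  by (intro Bintegral_sum[symmetric] integrable_inner_left i1)
 also have "\<dots> = (LBINT y. zeta i y * FD ?m (x - y) (b y t))"
 proof (intro Bintegral_cong refl)
  fix y
  have "FD ?m (x - y) (b y t) = (\<Sum>j\<in>Basis. FD ?m (x - y) j * (b y t \<bullet> j))"
   unfolding inner_grad[OF mC, symmetric, where v = "b y t"] by (simp add: grad_def inner_sum_right)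
  thus "(\<Sum>j\<in>Basis. (FD ?m (x - y) j *\<^sub>R (zeta i y *\<^sub>R b y t)) \<bullet> j) = zeta i y * FD ?m (x - y) (b y t)"
   by (simp add: sum_distrib_left mult_ac)
 qed
 finally have 1: "divergence (T i t) x = (LBINT y. zeta i y * FD ?m (x - y) (b y t))" .
 have ig: "Lint (\<lambda>y. b y t \<bullet> grad ?phi y)"
 proof (rule Bintegrable_bound[of _ "\<lambda>y. B * norm (grad ?phi y)"])
  have [measurable]: "grad ?phi \<in> Borel" using grad_continuous[OF phi(1)] by (rule borel_measurable_continuous_onI)
  show "(\<lambda>y. b y t \<bullet> grad ?phi y) \<in> borel_measurable lborel" by measurable
  show "Lint (\<lambda>y. B * norm (grad ?phi y))" using grad_integrable[OF phi(1)] by simp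
 qed (use B_nonneg in \<open>auto intro!: order_trans[OF Cauchy_Schwarz_ineq2] mult_right_mono b_le\<close>)
 have ic: "Lint (\<lambda>y. ?m (x - y) * (b y t \<bullet> grad (zeta i) y))"
  using convol_moll_integrable[OF eps_pos b_grad_zeta_integrable] by simp
 have "zeta i y * FD ?m (x - y) (b y t) = ?m (x - y) * (b y t \<bullet> grad (zeta i) y) - b y t \<bullet> grad ?phi y" for y
  using phi(2) by simp
 hence "divergence (T i t) x = convol ?m (\<lambda>y. b y t \<bullet> grad (zeta i) y) x - (LBINT y. b y t \<bullet> grad ?phi y)"
  unfolding 1 convol_def by (simp add: Bintegral_diff[OF ic ig])
 also have "(LBINT y. b y t \<bullet> grad ?phi y) = - div_part i t x"
 proof -
  obtain c where "\<And>y. \<bar>?phi y\<bar> \<le> c" using bounded_C1c[OF phi(1)] by blast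
  thus ?thesis unfolding div_part_def
   using integral_divergence_measure[of ?phi c t] C1c_on_measurable[OF phi(1)] by (simp add: div_b[OF phi(1)])
 qed
 finally show ?thesis by simp
qed

lemma divergence_bk_sum:
 assumes x: "x \<in> interior (C m)"
 shows "divergence (\<lambda>x. bk x t) x = (1 / (1 + dlt)) * (\<Sum>i<Suc (Suc m). divergence (T i t) x)"
proof -
 define n where "n = Suc (Suc m)"
 let ?D = "\<lambda>i h. convol (\<lambda>z. FD (moll (eps i)) z h) (\<lambda>y. zeta i y *\<^sub>R b y t) x"
 have "((\<lambda>x. (1 / (1 + dlt)) *\<^sub>R (\<Sum>i<n. T i t x)) has_derivative (\<lambda>h. (1 / (1 + dlt)) *\<^sub>R (\<Sum>i<n. ?D i h))) (at x)"
  by (intro has_derivative_scaleR_right has_derivative_sum T_has_derivative)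
 hence D: "((\<lambda>x. bk x t) has_derivative (\<lambda>h. (1 / (1 + dlt)) *\<^sub>R (\<Sum>i<n. ?D i h))) (at x)"
  by (rule has_derivative_transform_within_open[OF _ open_interior x]) (rule bk_eq[OF subsetD[OF interior_subset], symmetric], auto simp: n_def)
 show ?thesis
  unfolding divergence_def frechet_derivative_at[OF T_has_derivative, symmetric] frechet_derivative_at[OF D, symmetric] n_def[symmetric]
  by (simp add: inner_sum_left sum.swap[of _ Basis] flip: sum_divide_distrib)
qed

text \<open>Near x the cutoffs sum to 1, so their gradients sum to 0 and the terms b . grad (zeta i)
  can be subtracted freely. Only the commutators \<open>err\<close> remain beside the mollified
  divergence.\<close>

lemma divergence_bk:
 assumes x: "x \<in> interior (C m)"
 shows "divergence (\<lambda>x. bk x t) x = (1 / (1 + dlt)) * (\<Sum>i<Suc (Suc m). div_part i t x + err i t x)"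
proof -
 let ?n = "Suc (Suc m)"
 have "divergence (\<lambda>x. bk x t) x = (1 / (1 + dlt)) * (\<Sum>i<?n. divergence (T i t) x)" by (rule divergence_bk_sum[OF x])
 also have "(\<Sum>i<?n. divergence (T i t) x) = (\<Sum>i<?n. div_part i t x + err i t x) + b x t \<bullet> (\<Sum>i<?n. grad (zeta i) x)"
  by (simp only: divergence_T err_def inner_sum_right sum.distrib[symmetric]) (intro sum.cong, simp_all)
 also have "(\<Sum>i<?n. grad (zeta i) x) = 0"
 proof -
  have "((\<lambda>x. \<Sum>i<?n. zeta i x) has_derivative (\<lambda>h. \<Sum>i<?n. FD (zeta i) x h)) (at x)"
   by (intro has_derivative_sum C1c_on_has_derivative[OF zeta_C1c])
  moreover have "((\<lambda>x. \<Sum>i<?n. zeta i x) has_derivative (\<lambda>h. 0)) (at x)"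
  proof (rule has_derivative_transform_within_open[OF _ open_interior x])
   fix y assume "y \<in> interior (C m)"
   hence "y \<in> C (Suc m)" using interior_subset C_mono[of m "Suc m"] by auto
   thus "1 = (\<Sum>i<?n. zeta i y)" by (rule zeta_sum[symmetric])
  qed (rule has_derivative_const)
  ultimately have "(\<Sum>i<?n. FD (zeta i) x h) = 0" for h
   using has_derivative_unique by metis
  thus ?thesis unfolding grad_def by (subst sum.swap) (simp flip: scaleR_sum_left)
 qed
 finally show ?thesis by simp
qed

lemma div_part_eq: "div_part i t x = (\<integral>y. moll (eps i) (x - y) * zeta i y \<partial>mp t) - (\<integral>y. moll (eps i) (x - y) * zeta i y \<partial>mn t)"
proof -
 obtain c where "\<And>y. \<bar>moll (eps i) (x - y) * zeta i y\<bar> \<le> c"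
  using bounded_C1c[OF C1c_on_mollified_test(1)[OF eps_pos zeta_C1c]] by blast
 thus ?thesis unfolding div_part_def by (intro integral_divergence_measure[symmetric]) measurable
qed

lemma divergence_bk_le:
 assumes x: "x \<in> \<Omega>" and d: "\<And>i. ennreal \<bar>div_part i t x\<bar> \<le> d i" and e: "\<And>i. ennreal \<bar>err i t x\<bar> \<le> e i"
 shows "ennreal \<bar>divergence (\<lambda>x. bk x t) x\<bar> \<le> (\<Sum>i. d i + e i)"
proof -
 obtain m where m: "x \<in> interior (C m)" using x by (rule in_interior_C)
 let ?n = "Suc (Suc m)"
 have "\<bar>divergence (\<lambda>x. bk x t) x\<bar> \<le> 1 * \<bar>\<Sum>i<?n. div_part i t x + err i t x\<bar>"
  unfolding divergence_bk[OF m] abs_mult using dlt by (intro mult_right_mono) auto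
 also have "\<dots> \<le> (\<Sum>i<?n. \<bar>div_part i t x\<bar> + \<bar>err i t x\<bar>)"
  unfolding mult_1 by (rule order_trans[OF sum_abs], rule sum_mono, rule abs_triangle_ineq)
 finally have "ennreal \<bar>divergence (\<lambda>x. bk x t) x\<bar> \<le> (\<Sum>i<?n. ennreal (\<bar>div_part i t x\<bar> + \<bar>err i t x\<bar>))"
  by (subst sum_ennreal) (auto intro: ennreal_leI)
 also have "\<dots> \<le> (\<Sum>i<?n. d i + e i)" by (intro sum_mono) (auto intro: add_mono d e)
 also have "\<dots> \<le> (\<Sum>i. d i + e i)" by (intro sum_le_suminf) auto
 finally show ?thesis .
qed

text \<open>Integrating in x removes the mollification because the kernel has mass one; what remains
  is the sum of the cutoffs, at most 1. Applied to \<open>mp t\<close> and \<open>mn t\<close> for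
  (c2), and to \<open>sig\<close> for (c3).\<close>

lemma nn_integral_mollified_zeta:
 assumes \<mu>[measurable_cong]: "sets \<mu> = sets borel" and fin: "finite_measure \<mu>"
 shows "(\<Sum>i. NBINT x. \<integral>\<^sup>+y. ennreal (moll (eps i) (x - y) * zeta i y) \<partial>\<mu>) \<le> emeasure \<mu> UNIV"
proof -
 interpret \<mu>: finite_measure \<mu> by (rule fin)
 interpret P: pair_sigma_finite \<mu> lborel ..
 have "(NBINT x. \<integral>\<^sup>+y. ennreal (moll (eps i) (x - y) * zeta i y) \<partial>\<mu>) = (\<integral>\<^sup>+y. ennreal (zeta i y) \<partial>\<mu>)" for i
 proof -
  have "(NBINT x. \<integral>\<^sup>+y. ennreal (moll (eps i) (x - y) * zeta i y) \<partial>\<mu>) = (\<integral>\<^sup>+y. (NBINT x. ennreal (moll (eps i) (x - y) * zeta i y)) \<partial>\<mu>)"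
   by (rule P.Fubini') measurable
  also have "\<dots> = (\<integral>\<^sup>+y. ennreal (zeta i y) \<partial>\<mu>)"
   by (simp add: ennreal_mult moll_nonneg[OF eps_pos] zeta_nonneg nn_integral_multc moll_nn_integral_shift[OF eps_pos])
  finally show ?thesis .
 qed
 hence "(\<Sum>i. NBINT x. \<integral>\<^sup>+y. ennreal (moll (eps i) (x - y) * zeta i y) \<partial>\<mu>) = (\<Sum>i. \<integral>\<^sup>+y. ennreal (zeta i y) \<partial>\<mu>)" by simp
 also have "\<dots> = (\<integral>\<^sup>+y. (\<Sum>i. ennreal (zeta i y)) \<partial>\<mu>)" by (rule nn_integral_suminf[symmetric]) measurable
 also have "\<dots> \<le> (\<integral>\<^sup>+y. 1 \<partial>\<mu>)"
 proof (rule nn_integral_mono)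
  fix y show "(\<Sum>i. ennreal (zeta i y)) \<le> 1"
   unfolding suminf_eq_SUP using zeta_sum_le[where x = y] zeta_nonneg
   by (intro SUP_least) (simp add: sum_ennreal ennreal_le_1)
 qed
 finally show ?thesis using sets_eq_imp_space_eq[OF \<mu>] by simp
qed

lemma suminf_half_powers: "(\<Sum>i. ennreal (dlt * (1/2) ^ Suc i)) \<le> ennreal dlt"
 unfolding suminf_eq_SUP using dlt sum_half_powers_le[of dlt] by (intro SUP_least) (simp add: sum_ennreal ennreal_leI del: power_Suc)

lemma err_measurable[measurable]: "err i t \<in> Borel"
proof -
 have "(\<lambda>y. b y t \<bullet> grad (zeta i) y) \<in> Borel" by measurable
 note convol_moll_measurable[OF eps_pos this, measurable]
 show ?thesis unfolding err_def[abs_def] by measurable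
qed

lemma nn_integral_err_Sup: "(NBINT x. (SUP t\<in>Q. ennreal \<bar>err i t x\<bar>)) \<le> ennreal (dlt * (1/2) ^ Suc i)"
 using adm unfolding admissible_def err_def real_norm_def by blast

text \<open>Admissibility bounds the supremum over \<open>Q\<close>; continuity in t of both terms
  of \<open>err\<close>, for almost every x, extends the bound to all levels.\<close>

lemma nn_integral_err_le: 
 assumes t: "t \<in> {-M..M}" shows "(NBINT x. ennreal \<bar>err i t x\<bar>) \<le> ennreal (dlt * (1/2) ^ Suc i)"
proof -
 obtain c where c: "\<And>z. \<bar>moll (eps i) (z :: 'a)\<bar> \<le> c" using bounded_C1c[OF moll_C1c[OF eps_pos]] by metis
 have "AE x in lborel. ennreal \<bar>err i t x\<bar> \<le> (SUP t\<in>Q. ennreal \<bar>err i t x\<bar>)"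
  using b_cont
 proof eventually_elim
  case (elim x)
  have "ennreal (norm (err i t x)) \<le> (SUP t\<in>Q. ennreal (norm (err i t x)))"
  proof (rule Q_SUP[OF t])
   fix q assume q: "q \<longlonglongrightarrow> t"
   have "(\<lambda>n. convol (moll (eps i)) (\<lambda>y. b y (q n) \<bullet> grad (zeta i) y) x) \<longlonglongrightarrow> convol (moll (eps i)) (\<lambda>y. b y t \<bullet> grad (zeta i) y) x"
   proof (rule convolution_jointly_continuous[OF C1c_on_continuous[OF moll_C1c[OF eps_pos]] c b_grad_zeta_integrable, where G = "\<lambda>y. B * norm (grad (zeta i) y)"])
    show "AE y in lborel. continuous_on UNIV (\<lambda>t. b y t \<bullet> grad (zeta i) y)" using b_cont by eventually_elim (intro continuous_intros)
   qed (use grad_integrable[OF zeta_C1c] q in \<open>auto intro!: order_trans[OF Cauchy_Schwarz_ineq2] mult_right_mono b_le\<close>)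
   moreover have "(\<lambda>n. b x (q n)) \<longlonglongrightarrow> b x t"
    using elim q by (auto simp: continuous_on_eq_continuous_at intro: isCont_tendsto_compose)
   ultimately show "(\<lambda>n. err i (q n) x) \<longlonglongrightarrow> err i t x" unfolding err_def by (intro tendsto_intros)
  qed
  thus ?case by simp
 qed
 hence "(NBINT x. ennreal \<bar>err i t x\<bar>) \<le> (NBINT x. (SUP t\<in>Q. ennreal \<bar>err i t x\<bar>))" by (rule nn_integral_mono_AE)
 thus ?thesis using nn_integral_err_Sup order_trans by blast
qed

lemma divergence_bk_L1:
 assumes t: "t \<in> {-M..M}"
 shows "(NBINT x. ennreal \<bar>divergence (\<lambda>x. bk x t) x\<bar> * ind \<Omega> x) \<le> emeasure (mp t) UNIV + emeasure (mn t) UNIV + ennreal dlt"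
proof -
 interpret mp: finite_measure "mp t" by (rule mp_fin)
 interpret mn: finite_measure "mn t" by (rule mn_fin)
 let ?d = "\<lambda>\<mu> i x. \<integral>\<^sup>+y. ennreal (moll (eps i) (x - y) * zeta i y) \<partial>\<mu>"
 have m[measurable]: "?d (mp t) i \<in> borel_measurable lborel" "?d (mn t) i \<in> borel_measurable lborel" for i
  by measurable
 have b: "ennreal \<bar>div_part i t x\<bar> \<le> ?d (mp t) i x + ?d (mn t) i x" for i x
 proof -
  have n: "ennreal \<bar>\<integral>y. moll (eps i) (x - y) * zeta i y \<partial>\<mu>\<bar> \<le> ?d \<mu> i x" for \<mu>
   using norm_integral_le_nn_integral[of \<mu> "\<lambda>y. moll (eps i) (x - y) * zeta i y"]
   by (simp add: moll_nonneg[OF eps_pos] zeta_nonneg abs_mult)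
  have "ennreal \<bar>div_part i t x\<bar> \<le> ennreal \<bar>\<integral>y. moll (eps i) (x - y) * zeta i y \<partial>mp t\<bar> + ennreal \<bar>\<integral>y. moll (eps i) (x - y) * zeta i y \<partial>mn t\<bar>"
   unfolding div_part_eq by (subst ennreal_plus[symmetric]) (auto intro!: ennreal_leI abs_triangle_ineq4 simp del: ennreal_plus)
  thus ?thesis using add_mono[OF n n] order_trans by blast
 qed
 have "(NBINT x. ennreal \<bar>divergence (\<lambda>x. bk x t) x\<bar> * ind \<Omega> x)
  \<le> (NBINT x. (\<Sum>i. (?d (mp t) i x + ?d (mn t) i x) + ennreal \<bar>err i t x\<bar>))"
  using divergence_bk_le[OF _ b order_refl] by (intro nn_integral_mono) (simp split: split_indicator)
 also have "\<dots> = (\<Sum>i. ((NBINT x. ?d (mp t) i x) + (NBINT x. ?d (mn t) i x)) + (NBINT x. ennreal \<bar>err i t x\<bar>))"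
  by (subst nn_integral_suminf) (simp_all add: nn_integral_add)
 also have "\<dots> = ((\<Sum>i. NBINT x. ?d (mp t) i x) + (\<Sum>i. NBINT x. ?d (mn t) i x)) + (\<Sum>i. NBINT x. ennreal \<bar>err i t x\<bar>)"
  by (simp add: suminf_add)
 also have "\<dots> \<le> emeasure (mp t) UNIV + emeasure (mn t) UNIV + ennreal dlt"
  by (intro add_mono nn_integral_mollified_zeta mp_sets mn_sets mp_fin mn_fin
    order_trans[OF suminf_le[OF nn_integral_err_le[OF t]] suminf_half_powers]) auto
 finally show ?thesis .
qed

text \<open>The bound is free of t because |f| \<le> 1; hence it survives the supremum over all
  levels in (c3).\<close>

lemma div_part_le_sig: "ennreal \<bar>div_part i t x\<bar> \<le> (\<integral>\<^sup>+y. ennreal (moll (eps i) (x - y) * zeta i y) \<partial>sig)"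
proof -
 have "ennreal \<bar>div_part i t x\<bar> \<le> (\<integral>\<^sup>+y. ennreal (norm ((moll (eps i) (x - y) * zeta i y) * f y t)) \<partial>sig)"
  unfolding div_part_def using norm_integral_le_nn_integral[of sig "\<lambda>y. (moll (eps i) (x - y) * zeta i y) * f y t"] by simp
 also have "\<dots> \<le> (\<integral>\<^sup>+y. ennreal (moll (eps i) (x - y) * zeta i y) \<partial>sig)"
  using f_le_1[of t]
  by (intro nn_integral_mono_AE, eventually_elim)
   (auto simp: abs_mult moll_nonneg[OF eps_pos] zeta_nonneg mult_left_le intro!: ennreal_leI)
 finally show ?thesis .
qed

lemma divergence_bk_Sup:
 "(NBINT x. (SUP t\<in>Q. ennreal \<bar>divergence (\<lambda>x. bk x t) x\<bar>) * ind \<Omega> x) \<le> emeasure sig UNIV + ennreal dlt"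
proof -
 interpret s: finite_measure sig by (rule sig_fin)
 let ?d = "\<lambda>i x. \<integral>\<^sup>+y. ennreal (moll (eps i) (x - y) * zeta i y) \<partial>sig"
 let ?e = "\<lambda>i x. SUP t\<in>Q. ennreal \<bar>err i t x\<bar>"
 have [measurable]: "?d i \<in> borel_measurable lborel" for i by measurable
 have [measurable]: "?e i \<in> borel_measurable lborel" for i by (rule borel_measurable_SUP[OF Q_countable]) measurable
 have "(NBINT x. (SUP t\<in>Q. ennreal \<bar>divergence (\<lambda>x. bk x t) x\<bar>) * ind \<Omega> x)
  \<le> (NBINT x. (\<Sum>i. ?d i x + ?e i x))"
 proof (intro nn_integral_mono)
  fix x
  have "ennreal \<bar>divergence (\<lambda>x. bk x t) x\<bar> \<le> (\<Sum>i. ?d i x + ?e i x)" if "x \<in> \<Omega>" "t \<in> Q" for t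
   by (rule divergence_bk_le[OF that(1) div_part_le_sig]) (rule SUP_upper[OF that(2)])
  thus "(SUP t\<in>Q. ennreal \<bar>divergence (\<lambda>x. bk x t) x\<bar>) * ind \<Omega> x \<le> (\<Sum>i. ?d i x + ?e i x)"
   by (cases "x \<in> \<Omega>") (auto intro: SUP_least)
 qed
 also have "\<dots> = (\<Sum>i. NBINT x. ?d i x) + (\<Sum>i. NBINT x. ?e i x)"
  by (subst nn_integral_suminf) (simp_all add: nn_integral_add suminf_add)
 also have "\<dots> \<le> emeasure sig UNIV + ennreal dlt"
  by (intro add_mono nn_integral_mollified_zeta sig_sets sig_fin
    order_trans[OF suminf_le[OF nn_integral_err_Sup] suminf_half_powers]) auto
 finally show ?thesis .
qed

lemma divergence_bk_tendsto:
 assumes x: "x \<in> \<Omega>" and q: "q \<longlonglongrightarrow> t"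
 shows "(\<lambda>n. divergence (\<lambda>x. bk x (q n)) x) \<longlonglongrightarrow> divergence (\<lambda>x. bk x t) x"
proof -
 obtain m where m: "x \<in> interior (C m)" using x by (rule in_interior_C)
 have "(\<lambda>n. divergence (T i (q n)) x) \<longlonglongrightarrow> divergence (T i t) x" for i
  unfolding divergence_def frechet_derivative_at[OF T_has_derivative, symmetric]
 proof (intro tendsto_sum tendsto_inner tendsto_const)
  fix j :: 'a
  obtain c where "\<forall>z v. norm (FD (moll (eps i)) (z :: 'a) v :: real) \<le> c * norm v"
   using C1c_on_derivative_bounded[OF moll_C1c[OF eps_pos]] by metis
  hence c: "\<bar>FD (moll (eps i)) (z :: 'a) j\<bar> \<le> c * norm j" for z by simp
  show "(\<lambda>n. convol (\<lambda>z. FD (moll (eps i)) z j) (\<lambda>y. zeta i y *\<^sub>R b y (q n)) x)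
   \<longlonglongrightarrow> convol (\<lambda>z. FD (moll (eps i)) z j) (\<lambda>y. zeta i y *\<^sub>R b y t) x"
   by (rule convolution_jointly_continuous[OF C1c_on_continuous_derivative[OF moll_C1c[OF eps_pos]] c zeta_b_integrable zeta_b_dominated tendsto_const q])
 qed
 thus ?thesis unfolding divergence_bk_sum[OF m] by (intro tendsto_intros)
qed

end


section \<open>Least upper bound of absolutely continuous measures\<close>

text \<open>Partitioning E by the index that attains the largest of finitely many densities yields
  their pointwise maximum, and monotone convergence along an enumeration of \<open>Q\<close> yields
  the supremum. Conversely this supremum dominates each density on its piece.\<close>

lemma lub_meas_density:
 fixes h :: "real => 'a::euclidean_space => ennreal"
 assumes \<Omega>[measurable]: "\<Omega> \<in> sets borel" and Q: "countable Q" "Q \<subseteq> S" "Q \<noteq> {}"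
  and h[measurable]: "\<And>t. (\<lambda>x. h t x * ind \<Omega> x) \<in> Borel"
  and dense: "\<And>t x. t \<in> S ==> x \<in> \<Omega> ==> h t x \<le> (SUP q\<in>Q. h q x)"
  and E: "E \<in> sets (restrict_space borel \<Omega>)"
 shows "emeasure (restrict_space (density lborel (\<lambda>x. SUP q\<in>Q. h q x * ind \<Omega> x)) \<Omega>) E
  = lub_meas \<Omega> (\<lambda>t E. \<integral>\<^sup>+x\<in>E. h t x \<partial>lebesgue) S E"
proof -
 define H where "H = (\<lambda>x. SUP q\<in>Q. h q x * ind \<Omega> x)"
 define D where "D = density lborel H"
 have Hm[measurable]: "H \<in> Borel"
  unfolding H_def by (rule borel_measurable_SUP[OF Q(1)]) (rule h)
 have set: "A \<in> sets (restrict_space borel \<Omega>) \<longleftrightarrow> A \<in> sets borel \<and> A \<subseteq> \<Omega>" for A :: "'a set"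
  using \<Omega> by (subst sets_restrict_space_iff) auto
 have Eb[measurable]: "E \<in> sets borel" and E\<Omega>: "E \<subseteq> \<Omega>" using E set by auto
 have D: "emeasure D A = (NBINT x. H x * ind A x)" if "A \<in> sets borel" for A
  unfolding D_def using that by (subst emeasure_density) auto
 have hi: "h t x * ind A x = h t x * ind \<Omega> x * ind A x" if "A \<subseteq> \<Omega>" for t x A
  using that by (auto simp: indicator_def)
 have "emeasure (restrict_space D \<Omega>) E = emeasure D E"
  using E\<Omega> by (intro emeasure_restrict_space) (auto simp: D_def)
 also have "\<dots> = lub_meas \<Omega> (\<lambda>t E. \<integral>\<^sup>+x\<in>E. h t x \<partial>lebesgue) S E"
 proof (rule antisym)
  show "lub_meas \<Omega> (\<lambda>t E. \<integral>\<^sup>+x\<in>E. h t x \<partial>lebesgue) S E \<le> emeasure D E"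
   unfolding lub_meas_def
  proof (rule SUP_least, clarify)
   fix T' P assume T': "countable T'" "T' \<subseteq> S" and P: "\<forall>t\<in>T'. P t \<in> sets (restrict_space borel \<Omega>)" "disjoint_family_on P T'"
    and PE: "E = (\<Union>t\<in>T'. P t)"
   have "(\<integral>\<^sup>+x\<in>P t. h t x \<partial>lebesgue) \<le> emeasure D (P t)" if "t \<in> T'" for t
   proof -
    have Pt: "P t \<in> sets borel" "P t \<subseteq> \<Omega>" using P(1) that set by auto
    have "h t x \<le> H x" if "x \<in> P t" for x
    proof -
     have x: "x \<in> \<Omega>" using Pt(2) that by blast
     hence "H x = (SUP q\<in>Q. h q x)" by (simp add: H_def)
     with dense[of t x] x \<open>t \<in> T'\<close> T'(2) show ?thesis by auto
    qed
    thus ?thesis unfolding nn_integral_completion D[OF Pt(1)]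
     by (intro nn_integral_mono) (auto split: split_indicator)
   qed
   hence "(\<integral>\<^sup>+t. (\<integral>\<^sup>+x\<in>P t. h t x \<partial>lebesgue) \<partial>count_space T') \<le> (\<integral>\<^sup>+t. emeasure D (P t) \<partial>count_space T')"
    by (intro nn_integral_mono) auto
   also have "\<dots> = emeasure D (\<Union>t\<in>T'. P t)"
    using P T'(1) set by (intro emeasure_UN_countable[symmetric]) (auto simp: D_def)
   finally show "(\<integral>\<^sup>+t. (\<integral>\<^sup>+x\<in>P t. h t x \<partial>lebesgue) \<partial>count_space T') \<le> emeasure D (\<Union>t\<in>T'. P t)" .
  qed
  define q where "q = from_nat_into Q"
  have q: "range q = Q" using Q unfolding q_def by (simp add: range_from_nat_into)
  define Hn where "Hn n x = (SUP t\<in>q ` {..n}. h t x * ind \<Omega> x)" for n x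
  have Hnm[measurable]: "Hn n \<in> Borel" for n
   unfolding Hn_def[abs_def] by (rule borel_measurable_SUP) (auto intro: h)
  have HHn: "H x = (SUP n. Hn n x)" for x
  proof (rule antisym)
   show "H x \<le> (SUP n. Hn n x)"
    unfolding H_def q[symmetric]
   proof (rule SUP_least, clarify)
    fix k
    have "h (q k) x * ind \<Omega> x \<le> Hn k x" unfolding Hn_def by (rule SUP_upper) auto
    thus "h (q k) x * ind \<Omega> x \<le> (SUP n. Hn n x)" by (rule SUP_upper2[OF UNIV_I])
   qed
   show "(SUP n. Hn n x) \<le> H x"
    unfolding H_def Hn_def q[symmetric] by (intro SUP_least SUP_subset_mono) auto
  qed
  have "incseq (\<lambda>n x. Hn n x * ind E x)"
   unfolding incseq_def le_fun_def Hn_def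
   by (intro allI impI mult_right_mono SUP_subset_mono) auto
  hence "emeasure D E = (SUP n. NBINT x. Hn n x * ind E x)"
   unfolding D[OF Eb] HHn SUP_mult_right_ennreal by (intro nn_integral_monotone_convergence_SUP) auto
  also have "\<dots> \<le> lub_meas \<Omega> (\<lambda>t E. \<integral>\<^sup>+x\<in>E. h t x \<partial>lebesgue) S E"
  proof (rule SUP_least)
   fix n
   define R where "R = q ` {..n}"
   have R: "finite R" "R \<noteq> {}" "R \<subseteq> Q" using q by (auto simp: R_def)
   \<comment> \<open>The set where t attains the maximum, ties going to the smallest index, which
     makes the pieces disjoint.\<close>
   define P where "P t = {x\<in>E. h t x * ind \<Omega> x = Hn n x \<and> (\<forall>s\<in>R. s < t \<longrightarrow> h s x * ind \<Omega> x < Hn n x)}" for t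
   have [measurable]: "P t \<in> sets borel" for t
   proof -
    have "Measurable.pred borel (\<lambda>x. x \<in> E \<and> h t x * ind \<Omega> x = Hn n x \<and> (\<forall>s\<in>R. s < t \<longrightarrow> h s x * ind \<Omega> x < Hn n x))"
     using R(1) by measurable
    thus ?thesis unfolding P_def by (simp add: pred_def Int_def)
   qed
   have disj: "disjoint_family_on P R"
    unfolding disjoint_family_on_def P_def by (auto simp: neq_iff)
   have Un: "(\<Union>t\<in>R. P t) = E"
   proof
    show "E \<subseteq> (\<Union>t\<in>R. P t)"
    proof
     fix x assume x: "x \<in> E"
     have "Hn n x = Max ((\<lambda>t. h t x * ind \<Omega> x) ` R)"
      unfolding Hn_def R_def[symmetric] using R by (intro Max_Sup[symmetric]) auto
     hence "Hn n x \<in> (\<lambda>t. h t x * ind \<Omega> x) ` R" using Max_in[of "(\<lambda>t. h t x * ind \<Omega> x) ` R"] R by simp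
     then obtain t0 where t0: "t0 \<in> R" "h t0 x * ind \<Omega> x = Hn n x" by auto
     define A where "A = {t\<in>R. h t x * ind \<Omega> x = Hn n x}"
     have A: "finite A" "A \<noteq> {}" using R t0 by (auto simp: A_def)
     have "x \<in> P (Min A)" 
     proof -
      have "Min A \<in> A" using Min_in[OF A] .
      moreover have "h s x * ind \<Omega> x < Hn n x" if "s \<in> R" "s < Min A" for s
      proof -
       have "s \<notin> A" using that(2) Min_le[OF A(1)] by (meson not_le)
       hence "h s x * ind \<Omega> x \<noteq> Hn n x" using that(1) by (simp add: A_def)
       moreover have "h s x * ind \<Omega> x \<le> Hn n x" using that(1) unfolding Hn_def R_def by (rule SUP_upper)
       ultimately show ?thesis by simp
      qed
      ultimately show ?thesis using x by (simp add: P_def A_def)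
     qed
     moreover have "Min A \<in> R" using Min_in[OF A] by (simp add: A_def)
     ultimately show "x \<in> (\<Union>t\<in>R. P t)" by blast
    qed
   qed (auto simp: P_def)
   have "(NBINT x. Hn n x * ind E x) = (NBINT x. Hn n x * (\<Sum>t\<in>R. ind (P t) x))"
    using R(1) disj unfolding Un[symmetric] by (simp add: indicator_UN_disjoint)
   also have "\<dots> = (\<Sum>t\<in>R. NBINT x. Hn n x * ind (P t) x)"
    by (simp add: sum_distrib_left nn_integral_sum)
   also have "\<dots> = (\<Sum>t\<in>R. \<integral>\<^sup>+x\<in>P t. h t x \<partial>lebesgue)"
    unfolding nn_integral_completion using E\<Omega>
    by (intro sum.cong refl nn_integral_cong) (auto simp: P_def split: split_indicator)
   also have "\<dots> = (\<integral>\<^sup>+t. (\<integral>\<^sup>+x\<in>P t. h t x \<partial>lebesgue) \<partial>count_space R)"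
    using R(1) by (simp add: nn_integral_count_space_finite)
   also have "\<dots> \<le> lub_meas \<Omega> (\<lambda>t E. \<integral>\<^sup>+x\<in>E. h t x \<partial>lebesgue) S E"
    unfolding lub_meas_def
    by (rule SUP_upper2[of "(R, P)"]) (use R Q(2) disj Un set E\<Omega> in \<open>auto intro: countable_finite simp: P_def\<close>)
   finally show "(NBINT x. Hn n x * ind E x) \<le> lub_meas \<Omega> (\<lambda>t E. \<integral>\<^sup>+x\<in>E. h t x \<partial>lebesgue) S E" .
  qed
  finally show "emeasure D E \<le> lub_meas \<Omega> (\<lambda>t E. \<integral>\<^sup>+x\<in>E. h t x \<partial>lebesgue) S E" .
 qed
 finally show ?thesis by (simp add: D_def H_def)
qed

section \<open>Slicing by levels and the error terms\<close>

text \<open>\<open>orient t w\<close> is the kernel of the oriented integral from \<open>0\<close> to \<open>w\<close>.\<close>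

definition orient :: "real => real => real" where
 "orient t w = (if t < w then 1 else 0) - (if t < 0 then 1 else 0)"

lemma orient_measurable[measurable]:
 assumes [measurable]: "g \<in> borel_measurable N" "h \<in> borel_measurable N"
 shows "(\<lambda>x. orient (g x) (h x)) \<in> borel_measurable N"
 unfolding orient_def by measurable

lemma abs_orient_le: "\<bar>w\<bar> \<le> M ==> \<bar>orient t w\<bar> \<le> ind {-M..M} t"
 by (auto simp: orient_def indicator_def)

lemma interval_integral_eq_orient:
 fixes g :: "real => 'b::euclidean_space"
 assumes [measurable]: "g \<in> Borel"
 shows "interval_lebesgue_integral lborel (ereal 0) (ereal w) g = (LBINT t. orient t w *\<^sub>R g t)"
proof (cases "0 \<le> w")
 case True
 have "(LBINT t. ind {0<..<w} t *\<^sub>R g t) = (LBINT t. orient t w *\<^sub>R g t)"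
  by (rule integral_cong_AE, measurable, rule AE_mp[OF AE_lborel_singleton[of 0]])
   (use True in \<open>auto simp: orient_def indicator_def\<close>)
 thus ?thesis using True by (simp add: interval_lebesgue_integral_def set_lebesgue_integral_def)
next
 case False
 have "(LBINT t. ind {w<..<0} t *\<^sub>R g t) = (LBINT t. - (orient t w *\<^sub>R g t))"
  by (rule integral_cong_AE, measurable, rule AE_mp[OF AE_lborel_singleton[of w]])
   (use False in \<open>auto simp: orient_def indicator_def\<close>)
 thus ?thesis using False
  by (simp add: interval_lebesgue_integral_def set_lebesgue_integral_def)
qed

context
 fixes u :: "'a::euclidean_space => real" and M :: real and K :: "'a set"
 assumes u[measurable]: "u \<in> Borel" and u_le: "\<And>x. \<bar>u x\<bar> \<le> M"
  and K[measurable]: "K \<in> sets borel" and Kfin: "evol K < \<infinity>"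
begin

lemma slice_integrable:
 assumes G[measurable]: "(\<lambda>p. G (fst p) (snd p)) \<in> borel_measurable (borel \<Otimes>\<^sub>M borel)"
  and c: "\<And>x t. \<bar>G x t\<bar> \<le> c" and z: "\<And>x t. x \<notin> K ==> G x t = 0"
 shows "Lint (\<lambda>t. orient t (u x) * G x t)"
  "integrable (lborel \<Otimes>\<^sub>M lborel) (\<lambda>(x, t). orient t (u x) * G x t)"
  "Lint (\<lambda>x. LBINT t. orient t (u x) * G x t)"
proof -
 have m[measurable]: "(\<lambda>t. G x t) \<in> Borel" for x
  using measurable_compose[OF measurable_Pair1' G, of x] by simp
 have m2[measurable]: "(\<lambda>p. G (fst p) (snd p)) \<in> borel_measurable (lborel \<Otimes>\<^sub>M lborel)" using G
  by (simp only: measurable_cong_sets[OF sets_pair_measure_cong[OF sets_lborel sets_lborel] refl])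
 have b: "\<bar>orient t (u x) * G x t\<bar> \<le> c" for x t
 proof -
  have "\<bar>orient t (u x)\<bar> \<le> 1" by (auto simp: orient_def)
  thus ?thesis using mult_mono[OF _ c, of "\<bar>orient t (u x)\<bar>" 1 x t] by (simp add: abs_mult)
 qed
 have z': "t \<notin> {-M..M} ==> orient t (u x) = 0" for t x
  using abs_orient_le[OF u_le, of t x] by (auto simp: indicator_def)
 show "Lint (\<lambda>t. orient t (u x) * G x t)"
 proof (rule integrableI_bounded_set[where A = "{-M..M}" and B = c])
  show "AE t in lborel. t \<notin> {-M..M} \<longrightarrow> orient t (u x) * G x t = 0"
   by (intro AE_I2 impI) (simp add: z' del: atLeastAtMost_iff)
  show "AE t in lborel. t \<in> {-M..M} \<longrightarrow> norm (orient t (u x) * G x t) \<le> c"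
   by (intro AE_I2 impI) (simp only: real_norm_def b)
  have "G x \<in> borel_measurable lborel" using m[of x] by simp
  thus "(\<lambda>t. orient t (u x) * G x t) \<in> borel_measurable lborel"
   by (intro borel_measurable_times orient_measurable) auto
 qed (auto simp: emeasure_lborel_Icc_eq)
 show i: "integrable (lborel \<Otimes>\<^sub>M lborel) (\<lambda>(x, t). orient t (u x) * G x t)"
 proof (rule integrableI_bounded_set[where A = "K \<times> {-M..M}" and B = c])
  show "K \<times> {-M..M} \<in> sets (lborel \<Otimes>\<^sub>M lborel)" by auto
  show "(\<lambda>(x, t). orient t (u x) * G x t) \<in> borel_measurable (lborel \<Otimes>\<^sub>M lborel)" by (simp add: split_beta)
  show "emeasure (lborel \<Otimes>\<^sub>M lborel) (K \<times> {-M..M}) < \<infinity>"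
   using Kfin by (subst lborel.emeasure_pair_measure_Times) (auto simp: ennreal_mult_less_top emeasure_lborel_Icc_eq)
  show "AE p in lborel \<Otimes>\<^sub>M lborel. p \<notin> K \<times> {-M..M} \<longrightarrow> (case p of (x, t) => orient t (u x) * G x t) = 0"
   using z z' by (intro AE_I2) (fastforce simp del: atLeastAtMost_iff)
  show "AE p in lborel \<Otimes>\<^sub>M lborel. p \<in> K \<times> {-M..M} \<longrightarrow> norm (case p of (x, t) => orient t (u x) * G x t) \<le> c"
   using b by (intro AE_I2) (simp add: split_beta)
 qed
 from lborel_pair.integrable_fst'[OF this] show "Lint (\<lambda>x. LBINT t. orient t (u x) * G x t)" by simp
qed

text \<open>Exchanging the integrals leaves an L^1 norm in x at each level; 2M is the length of the
  interval of levels on which \<open>orient\<close> can be nonzero.\<close>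

lemma slice_bound:
 assumes G[measurable]: "(\<lambda>p. G (fst p) (snd p)) \<in> borel_measurable (borel \<Otimes>\<^sub>M borel)"
  and e: "\<And>t. t \<in> {-M..M} ==> (NBINT x. ennreal \<bar>G x t\<bar>) \<le> ennreal e" "e \<ge> 0"
 shows "\<bar>LBINT x. LBINT t. orient t (u x) * G x t\<bar> \<le> 2 * M * e"
proof -
 have M: "M \<ge> 0" using u_le[of undefined] by simp
 have m2[measurable]: "(\<lambda>p. G (fst p) (snd p)) \<in> borel_measurable (lborel \<Otimes>\<^sub>M lborel)" using G
  by (simp only: measurable_cong_sets[OF sets_pair_measure_cong[OF sets_lborel sets_lborel] refl])
 have "ennreal (norm (LBINT x. LBINT t. orient t (u x) * G x t)) \<le> (NBINT x. ennreal (norm (LBINT t. orient t (u x) * G x t)))"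
  by (rule norm_integral_le_nn_integral)
 also have "\<dots> \<le> (NBINT x. NBINT t. ind {-M..M} t * ennreal \<bar>G x t\<bar>)"
 proof (intro nn_integral_mono order_trans[OF norm_integral_le_nn_integral])
  fix x t
  have "\<bar>orient t (u x)\<bar> * \<bar>G x t\<bar> \<le> ind {-M..M} t * \<bar>G x t\<bar>" by (intro mult_right_mono abs_orient_le u_le) simp
  hence "ennreal (norm (orient t (u x) * G x t)) \<le> ennreal (ind {-M..M} t * \<bar>G x t\<bar>)"
   by (intro ennreal_leI) (simp add: abs_mult)
  thus "ennreal (norm (orient t (u x) * G x t)) \<le> ind {-M..M} t * ennreal \<bar>G x t\<bar>"
   by (simp add: ennreal_mult' ennreal_indicator)
 qed
 also have "\<dots> = (NBINT t. NBINT x. ind {-M..M} t * ennreal \<bar>G x t\<bar>)"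
  by (rule lborel_pair.Fubini'[symmetric]) (simp add: split_beta)
 also have "\<dots> = (NBINT t. ind {-M..M} t * (NBINT x. ennreal \<bar>G x t\<bar>))"
  by (intro nn_integral_cong) (auto split: split_indicator)
 also have "\<dots> \<le> (NBINT t. ennreal e * ind {-M..M} t)"
  using e by (intro nn_integral_mono) (auto split: split_indicator)
 also have "\<dots> = ennreal e * ennreal (2 * M)"
  using M by (subst nn_integral_cmult_indicator) (auto simp: emeasure_lborel_Icc_eq)
 also have "\<dots> = ennreal (2 * M * e)" using M e(2) by (subst ennreal_mult[symmetric]) (auto simp: mult.commute)
 finally show ?thesis using M e(2) by (subst (asm) ennreal_le_iff) auto
qed

end

context field_family
begin

lemma f_measurable_comp[measurable]:
 assumes [measurable]: "g \<in> borel_measurable N" "h \<in> borel_measurable N"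
 shows "(\<lambda>x. f (g x) (h x)) \<in> borel_measurable N"
 using measurable_compose[OF _ f_borel, of "\<lambda>x. (g x, h x)" N] by (simp add: borel_measurable_Pair)

lemma b_measurable_comp[measurable]:
 assumes [measurable]: "g \<in> borel_measurable N" "h \<in> borel_measurable N"
 shows "(\<lambda>x. b (g x) (h x)) \<in> borel_measurable N"
 using measurable_compose[OF _ b_borel, of "\<lambda>x. (g x, h x)" N] by (simp add: borel_measurable_Pair)

end

context mollified_family
begin

declare moll_measurable[measurable del]

lemma div_part_measurable[measurable]: "(\<lambda>p. div_part i (snd p) (fst p)) \<in> borel_measurable (borel \<Otimes>\<^sub>M borel)"
proof -
 interpret s: finite_measure sig by (rule sig_fin)
 have "(\<lambda>(p, y). (moll (eps i) (fst p - y) * zeta i y) * f y (snd p)) \<in> borel_measurable ((borel \<Otimes>\<^sub>M borel) \<Otimes>\<^sub>M borel)"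
  by measurable
 hence "(\<lambda>(p, y). (moll (eps i) (fst p - y) * zeta i y) * f y (snd p)) \<in> borel_measurable ((borel \<Otimes>\<^sub>M borel) \<Otimes>\<^sub>M sig)"
  by (simp add: measurable_cong_sets[OF sets_pair_measure_cong[OF refl sig_sets] refl])
 thus ?thesis unfolding div_part_def by (rule s.borel_measurable_lebesgue_integral)
qed

lemma div_part_measurable_comp[measurable]:
 assumes [measurable]: "g \<in> borel_measurable N" "h \<in> borel_measurable N"
 shows "(\<lambda>x. div_part i (h x) (g x)) \<in> borel_measurable N"
 using measurable_compose[OF _ div_part_measurable, of "\<lambda>x. (g x, h x)" N i] by simp

lemma convol_measurable_comp:
 fixes w :: "'a => real => 'c::euclidean_space"
 assumes [measurable]: "g \<in> borel_measurable N" "h \<in> borel_measurable N" "(\<lambda>p. w (fst p) (snd p)) \<in> borel_measurable (borel \<Otimes>\<^sub>M borel)"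
 shows "(\<lambda>x. convol (moll (eps i)) (\<lambda>y. w y (h x)) (g x)) \<in> borel_measurable N"
proof -
 have "(\<lambda>(p, y). moll (eps i) (fst p - y) *\<^sub>R w y (snd p)) \<in> borel_measurable ((borel \<Otimes>\<^sub>M borel) \<Otimes>\<^sub>M lborel)"
 proof -
  have [measurable]: "(\<lambda>q. w (snd q) (snd (fst q))) \<in> borel_measurable ((borel \<Otimes>\<^sub>M borel) \<Otimes>\<^sub>M lborel)"
   using measurable_compose[OF _ assms(3), of "\<lambda>q. (snd q, snd (fst q))" "(borel \<Otimes>\<^sub>M borel) \<Otimes>\<^sub>M lborel"] by simp
  show ?thesis by measurable
 qed
 hence "(\<lambda>p. convol (moll (eps i)) (\<lambda>y. w y (snd p)) (fst p)) \<in> borel_measurable (borel \<Otimes>\<^sub>M borel)"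
  unfolding convol_def by (rule lborel.borel_measurable_lebesgue_integral)
 from measurable_compose[OF _ this, of "\<lambda>x. (g x, h x)" N] show ?thesis by simp
qed

lemma err_measurable_comp[measurable]:
 assumes [measurable]: "g \<in> borel_measurable N" "h \<in> borel_measurable N"
 shows "(\<lambda>x. err i (h x) (g x)) \<in> borel_measurable N"
 unfolding err_def
 by (rule borel_measurable_diff[OF convol_measurable_comp[OF assms]]) measurable

lemma T_measurable_comp[measurable]:
 assumes [measurable]: "g \<in> borel_measurable N" "h \<in> borel_measurable N"
 shows "(\<lambda>x. T i (h x) (g x)) \<in> borel_measurable N"
 unfolding T_def by (rule convol_measurable_comp[OF assms]) measurable

text \<open>The formula for the divergence has a number of terms that varies with x; on Omega its
  partial sums are eventually constant, which gives measurability.\<close>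

lemma divergence_bk_measurable:
 "(\<lambda>x. ind \<Omega> x * divergence (\<lambda>y. bk y t) x) \<in> Borel"
proof (rule borel_measurable_LIMSEQ_real)
 have [measurable]: "\<Omega> \<in> sets borel" using open_\<Omega> by simp
 let ?S = "\<lambda>n x. ind \<Omega> x * ((1 / (1 + dlt)) * (\<Sum>i<Suc (Suc n). div_part i t x + err i t x))"
 show "?S n \<in> Borel" for n by measurable
 show "(\<lambda>n. ?S n x) \<longlonglongrightarrow> ind \<Omega> x * divergence (\<lambda>y. bk y t) x" for x
 proof (cases "x \<in> \<Omega>")
  case True
  then obtain m where m: "x \<in> interior (C m)" by (rule in_interior_C)
  have "?S n x = ind \<Omega> x * divergence (\<lambda>y. bk y t) x" if "n \<ge> m" for n
   using divergence_bk[OF subsetD[OF interior_mono[OF C_mono[OF that]] m], of t] by simp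
  thus ?thesis by (intro tendsto_eventually) (auto simp: eventually_sequentially)
 qed simp
qed

lemma ex_lub_meas_divergence_bk:
 "\<exists>\<rho>. sets \<rho> = sets (restrict_space borel \<Omega>) \<and>
  (\<forall>E\<in>sets \<rho>. emeasure \<rho> E =
    lub_meas \<Omega> (\<lambda>t E. \<integral>\<^sup>+x\<in>E. ennreal \<bar>divergence (\<lambda>y. bk y t) x\<bar> \<partial>lebesgue) {-M..M} E) \<and>
  emeasure \<rho> \<Omega> \<le> emeasure sig UNIV + ennreal dlt"
proof -
 have \<Omega>[measurable]: "\<Omega> \<in> sets borel" using open_\<Omega> by simp
 let ?h = "\<lambda>t x. ennreal \<bar>divergence (\<lambda>y. bk y t) x\<bar>"
 define \<rho> where "\<rho> = restrict_space (density lborel (\<lambda>x. SUP q\<in>Q. ?h q x * ind \<Omega> x)) \<Omega>"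
 have sets: "sets \<rho> = sets (restrict_space borel \<Omega>)"
  unfolding \<rho>_def by (intro sets_restrict_space_cong) simp
 have hm[measurable]: "(\<lambda>x. ?h t x * ind \<Omega> x) \<in> Borel" for t
 proof -
  have "(\<lambda>x. ennreal \<bar>ind \<Omega> x * divergence (\<lambda>y. bk y t) x\<bar>) \<in> Borel"
   using divergence_bk_measurable[of t] by measurable
  thus ?thesis by (rule measurable_cong[THEN iffD1, rotated]) (simp split: split_indicator)
 qed
 have Q0: "Q \<noteq> {}" using Q_dense[of 0] M_pos by (metis atLeastAtMost_iff empty_iff less_imp_le neg_le_0_iff_le)
 have "emeasure \<rho> E = lub_meas \<Omega> (\<lambda>t E. \<integral>\<^sup>+x\<in>E. ?h t x \<partial>lebesgue) {-M..M} E" if "E \<in> sets (restrict_space borel \<Omega>)" for E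
  unfolding \<rho>_def
 proof (rule lub_meas_density[OF \<Omega> Q_countable Q_subset Q0 hm _ that])
  fix t x assume "t \<in> {-M..M}" "x \<in> \<Omega>"
  thus "?h t x \<le> (SUP q\<in>Q. ?h q x)"
   using Q_SUP[of t "\<lambda>t. divergence (\<lambda>y. bk y t) x"] divergence_bk_tendsto[of x] by simp
 qed
 moreover have "emeasure \<rho> \<Omega> = (NBINT x. (SUP q\<in>Q. ?h q x) * ind \<Omega> x)"
 proof -
  have "(\<lambda>x. SUP q\<in>Q. ?h q x * ind \<Omega> x) \<in> Borel" by (rule borel_measurable_SUP[OF Q_countable]) (rule hm)
  thus ?thesis unfolding \<rho>_def using \<Omega>
   by (subst emeasure_restrict_space) (auto simp: emeasure_density intro!: nn_integral_cong split: split_indicator)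
 qed
 ultimately show ?thesis using sets divergence_bk_Sup by (intro exI[of _ \<rho>]) auto
qed

lemma nn_integral_gap_le:
 assumes t: "t \<in> {-M..M}"
 shows "(NBINT x. ennreal (norm (T i t x - zeta i x *\<^sub>R b x t))) \<le> ennreal (dlt * (1/2) ^ Suc i)"
proof -
 obtain c where c: "\<And>z. \<bar>moll (eps i) (z :: 'a)\<bar> \<le> c" using bounded_C1c[OF moll_C1c[OF eps_pos]] by metis
 have "AE x in lborel. ennreal (norm (T i t x - zeta i x *\<^sub>R b x t)) \<le> (SUP q\<in>Q. ennreal (norm (T i q x - zeta i x *\<^sub>R b x q)))"
  using b_cont
 proof eventually_elim
  case (elim x)
  show ?case
  proof (rule Q_SUP[OF t])
   fix q assume q: "q \<longlonglongrightarrow> t"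
   have "(\<lambda>n. T i (q n) x) \<longlonglongrightarrow> T i t x" unfolding T_def
    by (rule convolution_jointly_continuous[OF C1c_on_continuous[OF moll_C1c[OF eps_pos]] c zeta_b_integrable zeta_b_dominated tendsto_const q])
   moreover have "(\<lambda>n. b x (q n)) \<longlonglongrightarrow> b x t"
    using elim q by (auto simp: continuous_on_eq_continuous_at intro: isCont_tendsto_compose)
   ultimately show "(\<lambda>n. T i (q n) x - zeta i x *\<^sub>R b x (q n)) \<longlonglongrightarrow> T i t x - zeta i x *\<^sub>R b x t" by (intro tendsto_intros)
  qed
 qed
 hence "(NBINT x. ennreal (norm (T i t x - zeta i x *\<^sub>R b x t)))
  \<le> (NBINT x. (SUP q\<in>Q. ennreal (norm (T i q x - zeta i x *\<^sub>R b x q))))" by (rule nn_integral_mono_AE)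
 also have "\<dots> \<le> ennreal (dlt * (1/2) ^ Suc i)" using adm unfolding admissible_def T_def by blast
 finally show ?thesis .
qed

lemma div_part_bounded: obtains c where "\<And>t x. \<bar>div_part i t x\<bar> \<le> c"
proof -
 interpret s: finite_measure sig by (rule sig_fin)
 obtain c where c: "\<And>z. \<bar>moll (eps i) (z :: 'a)\<bar> \<le> c" using bounded_C1c[OF moll_C1c[OF eps_pos]] by metis
 have c0: "c \<ge> 0" using c[of 0] by simp
 have "\<bar>div_part i t x\<bar> \<le> c * measure sig UNIV" for t x
 proof -
  have "ennreal \<bar>div_part i t x\<bar> \<le> (\<integral>\<^sup>+y. ennreal (moll (eps i) (x - y) * zeta i y) \<partial>sig)" by (rule div_part_le_sig)
  also have "\<dots> \<le> (\<integral>\<^sup>+y. ennreal c \<partial>sig)"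
  proof (intro nn_integral_mono ennreal_leI)
   fix y show "moll (eps i) (x - y) * zeta i y \<le> c"
    using mult_mono[OF c[of "x - y"] zeta_le_1[of i y]] c0 zeta_nonneg[of i y] by (simp add: moll_nonneg[OF eps_pos])
  qed
  also have "\<dots> = ennreal (c * measure sig UNIV)"
   using c0 sets_eq_imp_space_eq[OF sig_sets] by (simp add: s.emeasure_eq_measure ennreal_mult)
  finally show ?thesis using c0 by (subst (asm) ennreal_le_iff) auto
 qed
 thus thesis by (rule that)
qed

lemma err_bounded: obtains c where "\<And>t x. \<bar>err i t x\<bar> \<le> c"
proof -
 obtain L where L: "\<And>x. norm (grad (zeta i) x) \<le> L" using grad_bounded[OF zeta_C1c] by blast
 have bd: "\<bar>b y t \<bullet> grad (zeta i) y\<bar> \<le> B * L" for y t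
  by (rule order_trans[OF Cauchy_Schwarz_ineq2]) (intro mult_mono b_le L B_nonneg norm_ge_zero)
 have BL: "B * L \<ge> 0" using bd[of undefined undefined] by linarith
 have "\<bar>err i t x\<bar> \<le> B * L + B * L" for t x
 proof -
  have "norm (convol (moll (eps i)) (\<lambda>y. b y t \<bullet> grad (zeta i) y) x) \<le> B * L"
   by (rule convol_moll_bound[OF eps_pos _ BL]) (use bd in auto)
  thus ?thesis unfolding err_def using bd[of x t] by (smt (verit) real_norm_def)
 qed
 thus thesis by (rule that)
qed

text \<open>The support of \<open>phi\<close> in \<open>C m\<close> leaves finitely many pieces. At
  each level the terms \<open>err\<close> are at most dlt 2^-(i+1) in L^1, so they add up to a
  multiple of dlt and only the terms \<open>div_part\<close> survive.\<close>

lemma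
 fixes phi u :: "'a => real"
 assumes u[measurable]: "u \<in> Borel" and u_le: "\<And>x. \<bar>u x\<bar> \<le> M"
  and phi: "C1c_on (interior (C m)) phi" "\<And>x. \<bar>phi x\<bar> \<le> c"
 shows main_term_error: "\<bar>(LBINT x. phi x * (LBINT t. orient t (u x) * divergence (\<lambda>y. bk y t) x))
  - (1 / (1 + dlt)) * (\<Sum>i<Suc (Suc m). LBINT x. LBINT t. orient t (u x) * (phi x * div_part i t x))\<bar> \<le> 2 * M * (c * dlt)"
  (is "\<bar>integral\<^sup>L lborel ?f - _ * (\<Sum>i<_. ?P i)\<bar> \<le> _")
  and main_term_integrable: "Lint (\<lambda>x. phi x * (LBINT t. orient t (u x) * divergence (\<lambda>y. bk y t) x))"
proof -
 let ?p = "\<lambda>i x t. orient t (u x) * (phi x * div_part i t x)" and ?r = "\<lambda>i x t. orient t (u x) * (phi x * err i t x)"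
 let ?Lp = "\<lambda>i x. LBINT t. ?p i x t" and ?Lr = "\<lambda>i x. LBINT t. ?r i x t"
 define n where "n = Suc (Suc m)"
 have [measurable]: "phi \<in> Borel" by (rule C1c_on_measurable[OF phi(1)])
 have K: "C m \<in> sets borel" "evol (C m) < \<infinity>"
  using borel_compact[OF C_compact] emeasure_bounded_finite[OF compact_imp_bounded[OF C_compact]] by (auto simp: less_top)
 have c0: "c \<ge> 0" using phi(2)[of undefined] by linarith
 have z: "phi x = 0" if "x \<notin> C m" for x using that interior_subset C1c_on_outside(1)[OF phi(1)] by blast
 have bd: "\<bar>phi x * g\<bar> \<le> c * d" if "\<bar>g\<bar> \<le> d" for x g d
  unfolding abs_mult by (intro mult_mono phi(2) that c0 abs_ge_zero)
 have i1: "Lint (?p i x)"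
  "Lint (?Lp i)" for i x
 proof -
  obtain d where d: "\<And>t x. \<bar>div_part i t x\<bar> \<le> d" using div_part_bounded[of i] by blast
  from slice_integrable(1,3)[OF u u_le K, of "\<lambda>x t. phi x * div_part i t x", OF _ bd[OF d]] z show "Lint (?p i x)"
   "Lint (?Lp i)" by simp_all
 qed
 have i2: "Lint (?r i x)"
  "Lint (?Lr i)" for i x
 proof -
  obtain d where d: "\<And>t x. \<bar>err i t x\<bar> \<le> d" using err_bounded[of i] by blast
  from slice_integrable(1,3)[OF u u_le K, of "\<lambda>x t. phi x * err i t x", OF _ bd[OF d]] z show "Lint (?r i x)"
   "Lint (?Lr i)" by simp_all
 qed
 let ?R = "\<lambda>i. integral\<^sup>L lborel (?Lr i)"
 have pt: "?f x
  = (1 / (1 + dlt)) * (\<Sum>i<n. ?Lp i x + ?Lr i x)" for x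
 proof (cases "x \<in> interior (C m)")
  case True
  have "?f x
   = (LBINT t. phi x * (orient t (u x) * divergence (\<lambda>y. bk y t) x))" by simp
  also have "\<dots> = (LBINT t. (1 / (1 + dlt)) * (\<Sum>i<n. ?p i x t + ?r i x t))"
   unfolding divergence_bk[OF True] n_def[symmetric]
   by (intro Bintegral_cong refl) (simp add: sum_distrib_left algebra_simps)
  also have "\<dots> = (1 / (1 + dlt)) * (\<Sum>i<n. LBINT t. (?p i x t + ?r i x t))"
   by (subst integral_mult_right_zero, subst Bintegral_sum) (use i1(1) i2(1) in auto)
  also have "\<dots> = (1 / (1 + dlt)) * (\<Sum>i<n. ?Lp i x + ?Lr i x)"
   by (simp only: Bintegral_add[OF i1(1) i2(1)])
  finally show ?thesis .
 qed (simp add: C1c_on_outside(1)[OF phi(1)])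
 show "Lint ?f"
  unfolding pt by (intro integrable_mult_right Bintegrable_sum Bintegrable_add i1(2) i2(2))
 have "integral\<^sup>L lborel ?f = (1 / (1 + dlt)) * (\<Sum>i<n. ?P i + ?R i)"
  unfolding pt using i1(2) i2(2) by (simp only: integral_mult_right_zero Bintegral_sum Bintegral_add Bintegrable_add)
 hence "\<bar>integral\<^sup>L lborel ?f - (1 / (1 + dlt)) * (\<Sum>i<n. ?P i)\<bar>
  = (1 / (1 + dlt)) * \<bar>\<Sum>i<n. ?R i\<bar>"
  using dlt by (simp add: sum.distrib distrib_left abs_mult add_divide_distrib)
 also have "\<dots> \<le> 1 * \<bar>\<Sum>i<n. ?R i\<bar>" using dlt by (intro mult_right_mono) auto
 also have "\<dots> \<le> (\<Sum>i<n. 2 * M * c * (dlt * (1/2) ^ Suc i))"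
  unfolding mult_1
 proof (rule order_trans[OF sum_abs], rule sum_mono)
  fix i
  have "\<bar>?R i\<bar> \<le> 2 * M * (c * (dlt * (1/2) ^ Suc i))"
  proof (rule slice_bound[OF u u_le K])
   fix t assume t: "t \<in> {-M..M}"
   have "(NBINT x. ennreal \<bar>phi x * err i t x\<bar>) \<le> (NBINT x. ennreal c * ennreal \<bar>err i t x\<bar>)"
    using phi(2) c0 by (intro nn_integral_mono) (auto simp: abs_mult ennreal_mult[symmetric] intro!: ennreal_leI mult_right_mono)
   also have "\<dots> = ennreal c * (NBINT x. ennreal \<bar>err i t x\<bar>)" by (rule nn_integral_cmult) measurable
   also have "\<dots> \<le> ennreal c * ennreal (dlt * (1/2) ^ Suc i)" by (intro mult_left_mono nn_integral_err_le[OF t]) simp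
   also have "\<dots> = ennreal (c * (dlt * (1/2) ^ Suc i))" using c0 dlt by (subst ennreal_mult[symmetric]) auto
   finally show "(NBINT x. ennreal \<bar>phi x * err i t x\<bar>) \<le> ennreal (c * (dlt * (1/2) ^ Suc i))" .
  qed (use c0 dlt in auto)
  thus "\<bar>?R i\<bar> \<le> 2 * M * c * (dlt * (1/2) ^ Suc i)" by (simp add: mult.assoc)
 qed
 also have "\<dots> = 2 * M * c * (\<Sum>i<n. dlt * (1/2) ^ Suc i)" by (simp only: sum_distrib_left)
 also have "\<dots> \<le> 2 * M * c * dlt" using M_pos c0 dlt by (intro mult_left_mono sum_half_powers_le) auto
 finally show "\<bar>integral\<^sup>L lborel ?f
  - (1 / (1 + dlt)) * (\<Sum>i<Suc (Suc m). ?P i)\<bar> \<le> 2 * M * (c * dlt)" by (simp only: n_def mult.assoc)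
qed

lemma
 fixes phi u :: "'a => real"
 assumes u[measurable]: "u \<in> Borel" and u_le: "\<And>x. \<bar>u x\<bar> \<le> M"
  and phi: "C1c_on (interior (C m)) phi" "\<And>x. norm (grad phi x) \<le> c"
 shows gradient_term_error: "\<bar>(LBINT x. LBINT t. orient t (u x) * (bk x t \<bullet> grad phi x)) - (LBINT x. LBINT t. orient t (u x) * (b x t \<bullet> grad phi x))\<bar>
  \<le> 2 * M * (c * (dlt * (1 + B * vol (C m))))"
  (is "\<bar>?A - ?B\<bar> \<le> ?r")
  and gradient_term_integrable: "Lint (\<lambda>x. LBINT t. orient t (u x) * (bk x t \<bullet> grad phi x))"
proof -
 define n where "n = Suc (Suc m)"
 have K[measurable]: "C m \<in> sets borel" and Kfin: "evol (C m) < \<infinity>"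
  using borel_compact[OF C_compact] emeasure_bounded_finite[OF compact_imp_bounded[OF C_compact]] by (auto simp: less_top)
 have [measurable]: "grad phi \<in> Borel"
  using grad_continuous[OF phi(1)] by (rule borel_measurable_continuous_onI)
 have c0: "c \<ge> 0" using phi(2)[of undefined] norm_ge_zero order_trans by blast
 have z: "grad phi x = 0" if "x \<notin> interior (C m)" for x using that grad_outside[OF phi(1)] by blast
 have z': "v \<bullet> grad phi x = 0" if "x \<notin> C m" for v x
 proof -
  have "x \<notin> interior (C m)" using that interior_subset by blast
  thus ?thesis by (simp add: z)
 qed
 have bkn: "bk x t = (1 / (1 + dlt)) *\<^sub>R (\<Sum>i<n. T i t x)" if "x \<in> interior (C m)" for x t
  unfolding n_def by (rule bk_eq[OF subsetD[OF interior_subset that] order_refl])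
 have eq: "bk x t \<bullet> grad phi x = ((1 / (1 + dlt)) *\<^sub>R (\<Sum>i<n. T i t x)) \<bullet> grad phi x" for x t
  using bkn[of x t] z[of x] by (cases "x \<in> interior (C m)") auto
 have m1[measurable]: "(\<lambda>p. bk (fst p) (snd p) \<bullet> grad phi (fst p)) \<in> borel_measurable (borel \<Otimes>\<^sub>M borel)"
  unfolding eq by measurable
 have m2[measurable]: "(\<lambda>p. b (fst p) (snd p) \<bullet> grad phi (fst p)) \<in> borel_measurable (borel \<Otimes>\<^sub>M borel)" by measurable
 have le1: "\<bar>bk x t \<bullet> grad phi x\<bar> \<le> B * c" for x t
 proof (cases "x \<in> interior (C m)")
  case True
  hence "norm (bk x t) \<le> B" using C_subset interior_subset b_le B_nonneg by (intro norm_bk_le) auto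
  thus ?thesis by (intro order_trans[OF Cauchy_Schwarz_ineq2] mult_mono phi(2) B_nonneg norm_ge_zero)
 qed (use z[of x] B_nonneg c0 in simp)
 have le2: "\<bar>b x t \<bullet> grad phi x\<bar> \<le> B * c" for x t
  by (rule order_trans[OF Cauchy_Schwarz_ineq2]) (intro mult_mono phi(2) b_le B_nonneg norm_ge_zero)
 have i1: "Lint (\<lambda>t. orient t (u x) * (bk x t \<bullet> grad phi x))"
  "Lint (\<lambda>x. LBINT t. orient t (u x) * (bk x t \<bullet> grad phi x))" for x
  by (rule slice_integrable(1,3)[OF u u_le K Kfin m1 le1 z'], assumption)+
 have i2: "Lint (\<lambda>t. orient t (u x) * (b x t \<bullet> grad phi x))"
  "Lint (\<lambda>x. LBINT t. orient t (u x) * (b x t \<bullet> grad phi x))" for x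
  by (rule slice_integrable(1,3)[OF u u_le K Kfin m2 le2 z'], assumption)+
 have "?A - ?B
  = (LBINT x. LBINT t. orient t (u x) * (bk x t \<bullet> grad phi x - b x t \<bullet> grad phi x))"
  unfolding Bintegral_diff[OF i1(2) i2(2), symmetric]
  by (intro Bintegral_cong refl) (simp add: Bintegral_diff[OF i1(1) i2(1)] right_diff_distrib)
 also have "\<bar>\<dots>\<bar> \<le> ?r"
 proof (rule slice_bound[OF u u_le K Kfin])
  fix t assume t: "t \<in> {-M..M}"
  let ?g = "\<lambda>i x. norm (T i t x - zeta i x *\<^sub>R b x t)"
  have pt: "\<bar>bk x t \<bullet> grad phi x - b x t \<bullet> grad phi x\<bar> \<le> c * ((\<Sum>i<n. ?g i x) + dlt * B * ind (C m) x)" for x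
  proof (cases "x \<in> interior (C m)")
   case True
   hence xC: "x \<in> C m" "x \<in> C (Suc m)" using interior_subset C_mono[of m "Suc m"] by auto
   \<comment> \<open>The partition sums to 1 here, so the difference splits into the gaps of the
     single pieces and the part of b lost by dividing by 1 + dlt; the latter brings in the volume of
     \<open>C m\<close>.\<close>
   have "b x t = (\<Sum>i<n. zeta i x *\<^sub>R b x t)" using zeta_sum[OF xC(2)] by (simp only: n_def scaleR_sum_left[symmetric] scaleR_one)
   hence "bk x t - b x t = (1 / (1 + dlt)) *\<^sub>R ((\<Sum>i<n. T i t x - zeta i x *\<^sub>R b x t) + b x t) - b x t"
    using bkn[OF True] by (simp add: sum_subtractf)
   also have "\<dots> = (1 / (1 + dlt)) *\<^sub>R (\<Sum>i<n. T i t x - zeta i x *\<^sub>R b x t) - (dlt / (1 + dlt)) *\<^sub>R b x t"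
   proof -
    have "1 / (1 + dlt) - 1 = - (dlt / (1 + dlt))" using dlt by (simp add: field_simps)
    hence "(1 / (1 + dlt)) *\<^sub>R b x t - b x t = - ((dlt / (1 + dlt)) *\<^sub>R b x t)"
     by (metis scaleR_left_diff_distrib scaleR_minus_left scaleR_one)
    thus ?thesis by (simp add: scaleR_add_right)
   qed
   also have "norm \<dots> \<le> 1 * (\<Sum>i<n. ?g i x) + dlt * B"
   proof (rule order_trans[OF norm_triangle_ineq4], rule add_mono)
    show "norm ((1 / (1 + dlt)) *\<^sub>R (\<Sum>i<n. T i t x - zeta i x *\<^sub>R b x t)) \<le> 1 * (\<Sum>i<n. ?g i x)"
     unfolding norm_scaleR using dlt by (intro mult_mono norm_sum) (auto intro: sum_nonneg)
    have "dlt / (1 + dlt) \<le> dlt" using dlt by (simp add: divide_le_eq)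
    thus "norm ((dlt / (1 + dlt)) *\<^sub>R b x t) \<le> dlt * B"
     unfolding norm_scaleR using dlt by (intro mult_mono b_le) auto
   qed
   finally have "norm (bk x t - b x t) \<le> (\<Sum>i<n. ?g i x) + dlt * B * ind (C m) x" using xC by simp
   hence "norm (bk x t - b x t) * norm (grad phi x) \<le> ((\<Sum>i<n. ?g i x) + dlt * B * ind (C m) x) * c"
    using phi(2)[of x] order_trans[OF norm_ge_zero] by (intro mult_mono) auto
   thus ?thesis unfolding inner_diff_left[symmetric]
    by (intro order_trans[OF Cauchy_Schwarz_ineq2]) (simp add: mult.commute)
  next
   case False
   have "0 \<le> c * ((\<Sum>i<n. ?g i x) + dlt * B * ind (C m) x)"
    using c0 dlt B_nonneg by (intro mult_nonneg_nonneg add_nonneg_nonneg sum_nonneg) auto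
   thus ?thesis using z[OF False] by simp
  qed
  have [measurable]: "T i t \<in> Borel" for i using T_measurable_comp[of "\<lambda>x. x" borel "\<lambda>x. t" i] by simp
  have "(NBINT x. ennreal \<bar>bk x t \<bullet> grad phi x - b x t \<bullet> grad phi x\<bar>)
   \<le> (NBINT x. ennreal c * ((\<Sum>i<n. ennreal (?g i x)) + ennreal (dlt * B) * ind (C m) x))"
  proof (rule nn_integral_mono)
   fix x
   have "ennreal (c * ((\<Sum>i<n. ?g i x) + dlt * B * ind (C m) x)) = ennreal c * ((\<Sum>i<n. ennreal (?g i x)) + ennreal (dlt * B) * ind (C m) x)"
   proof -
    have S: "0 \<le> (\<Sum>i<n. ?g i x)" by (intro sum_nonneg) simp
    have I: "0 \<le> dlt * B * ind (C m) x" using dlt B_nonneg by simp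
    have "ennreal (c * ((\<Sum>i<n. ?g i x) + dlt * B * ind (C m) x)) = ennreal c * ennreal ((\<Sum>i<n. ?g i x) + dlt * B * ind (C m) x)"
     using c0 S I by (intro ennreal_mult) auto
    also have "ennreal ((\<Sum>i<n. ?g i x) + dlt * B * ind (C m) x) = ennreal (\<Sum>i<n. ?g i x) + ennreal (dlt * B * ind (C m) x)"
     by (rule ennreal_plus[OF S I])
    finally show ?thesis using dlt B_nonneg by (simp add: sum_ennreal ennreal_mult' ennreal_indicator)
   qed
   thus "ennreal \<bar>bk x t \<bullet> grad phi x - b x t \<bullet> grad phi x\<bar> \<le> ennreal c * ((\<Sum>i<n. ennreal (?g i x)) + ennreal (dlt * B) * ind (C m) x)"
    using ennreal_leI[OF pt[of x]] by simp
  qed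
  also have "\<dots> = ennreal c * ((\<Sum>i<n. NBINT x. ennreal (?g i x)) + ennreal (dlt * B) * evol (C m))"
   by (simp add: nn_integral_cmult nn_integral_add nn_integral_sum nn_integral_cmult_indicator del: sum_ennreal)
  also have "\<dots> \<le> ennreal c * (ennreal dlt + ennreal (dlt * B) * ennreal (vol (C m)))"
  proof (intro mult_left_mono add_mono)
   have "(\<Sum>i<n. NBINT x. ennreal (?g i x)) \<le> (\<Sum>i<n. ennreal (dlt * (1/2) ^ Suc i))"
    by (rule sum_mono) (rule nn_integral_gap_le[OF t])
   also have "\<dots> \<le> ennreal dlt" using dlt sum_half_powers_le[of dlt n] by (subst sum_ennreal) (auto intro: ennreal_leI)
   finally show "(\<Sum>i<n. NBINT x. ennreal (?g i x)) \<le> ennreal dlt" .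
   show "evol (C m) \<le> ennreal (vol (C m))" using Kfin by (simp add: emeasure_eq_ennreal_measure)
  qed auto
  also have "\<dots> = ennreal (c * (dlt * (1 + B * vol (C m))))"
   using c0 dlt B_nonneg by (simp add: ennreal_mult[symmetric] ennreal_plus[symmetric] distrib_left mult.assoc del: ennreal_plus)
  finally show "(NBINT x. ennreal \<bar>bk x t \<bullet> grad phi x - b x t \<bullet> grad phi x\<bar>) \<le> ennreal (c * (dlt * (1 + B * vol (C m))))" .
 qed (use c0 dlt B_nonneg m1 m2 in auto)
 finally show "\<bar>?A - ?B\<bar>
  \<le> ?r" .
 show "Lint (\<lambda>x. LBINT t. orient t (u x) * (bk x t \<bullet> grad phi x))" by (rule i1(2))
qed

end


section \<open>Approximate limits of Borel functions\<close>

text \<open>Rational radii suffice: between r and 2r there is a rational q, and replacing r by q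
  costs a factor 2^N.\<close>

lemma null_density_measurable:
 fixes S :: "'a::euclidean_space set"
 assumes S[measurable]: "S \<in> sets borel"
 shows "{x. null_density S x} \<in> sets borel"
proof -
 have [measurable]: "(\<lambda>x. vol (S \<inter> ball x r)) \<in> Borel" for r
 proof -
  have "(\<lambda>(x, y). ind S y * (if dist x y < r then 1 else 0 :: real)) \<in> borel_measurable (borel \<Otimes>\<^sub>M lborel)"
   by measurable
  hence "(\<lambda>x. LBINT y. ind S y * (if dist x y < r then 1 else 0 :: real)) \<in> Borel"
   by (rule lborel.borel_measurable_lebesgue_integral)
  moreover have "vol (S \<inter> ball x r) = (LBINT y. ind S y * (if dist x y < r then 1 else 0 :: real))" for x
  proof -
   have "(\<lambda>y. ind S y * (if dist x y < r then 1 else 0 :: real)) = ind (S \<inter> ball x r)" by (auto simp: indicator_def)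
   thus ?thesis by simp
  qed
  ultimately show ?thesis by simp
 qed
 have "null_density S x \<longleftrightarrow> (\<forall>n. \<exists>m. \<forall>q::rat. 0 < real_of_rat q \<and> real_of_rat q < 1 / real (Suc m) \<longrightarrow>
   vol (S \<inter> ball x (real_of_rat q)) \<le> (1 / real (Suc n)) * real_of_rat q ^ DIM('a))" (is "_ \<longleftrightarrow> ?R") for x
 proof
  assume nd: "null_density S x"
  show ?R
  proof
   fix n
   have "1 / real (Suc n) > 0" by simp
   then obtain d where d: "d > 0" "\<And>r. 0 < r ==> r < d ==> vol (S \<inter> ball x r) \<le> (1 / real (Suc n)) * r ^ DIM('a)"
    using nd unfolding null_density_def by blast
   obtain m where "1 / real (Suc m) < d" using d(1) by (metis nat_approx_posE)
   thus "\<exists>m. \<forall>q::rat. 0 < real_of_rat q \<and> real_of_rat q < 1 / real (Suc m) \<longrightarrow>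
    vol (S \<inter> ball x (real_of_rat q)) \<le> (1 / real (Suc n)) * real_of_rat q ^ DIM('a)"
    using d(2) by (intro exI[of _ m]) auto
  qed
 next
  assume R: ?R
  show "null_density S x" unfolding null_density_def
  proof (intro allI impI)
   fix e :: real assume "e > 0"
   hence "e / 2 ^ DIM('a) > 0" by simp
   then obtain n where n: "1 / real (Suc n) < e / 2 ^ DIM('a)" by (metis nat_approx_posE)
   obtain m where m: "\<And>q::rat. 0 < real_of_rat q ==> real_of_rat q < 1 / real (Suc m) ==>
    vol (S \<inter> ball x (real_of_rat q)) \<le> (1 / real (Suc n)) * real_of_rat q ^ DIM('a)" using R by blast
   have "vol (S \<inter> ball x r) \<le> e * r ^ DIM('a)" if r: "0 < r" "r < 1 / real (Suc m)" for r
   proof -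
    obtain q where q: "r < real_of_rat q" "real_of_rat q < min (2 * r) (1 / real (Suc m))"
     using of_rat_dense[of r "min (2 * r) (1 / real (Suc m))"] r by auto
    have "vol (S \<inter> ball x r) \<le> vol (S \<inter> ball x (real_of_rat q))"
     using q by (intro measure_mono_fmeasurable fmeasurable_subset_ball) auto
    also have "\<dots> \<le> (1 / real (Suc n)) * real_of_rat q ^ DIM('a)" by (rule m) (use q r in linarith)+
    also have "\<dots> \<le> (e / 2 ^ DIM('a)) * (2 * r) ^ DIM('a)" 
    proof (intro mult_mono power_mono)
     have "0 \<le> real_of_rat q" using q(1) r(1) by linarith
     thus "0 \<le> real_of_rat q" "0 \<le> real_of_rat q ^ DIM('a)" by simp_all
    qed (use n q \<open>e > 0\<close> in auto)
    finally show ?thesis by (simp add: power_mult_distrib)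
   qed
   thus "\<exists>d>0. \<forall>r. 0 < r \<and> r < d \<longrightarrow> vol (S \<inter> ball x r) \<le> e * r ^ DIM('a)"
    by (intro exI[of _ "1 / real (Suc m)"]) auto
  qed
 qed
 thus ?thesis by simp
qed

lemma density_zero_iff_null_density:
 fixes S :: "'a::euclidean_space set"
 assumes S: "S \<in> sets borel"
 shows "density_zero S x \<longleftrightarrow> null_density S x"
proof -
 define w where "w = unit_ball_vol (real DIM('a))"
 have w: "w > 0" by (simp add: w_def)
 have q: "measure lebesgue (S \<inter> ball x r) / measure lebesgue (ball x r) = vol (S \<inter> ball x r) / (w * r ^ DIM('a))" if "r > 0" for r
  using that S content_ball[of r x] by (simp add: w_def measure_completion)
 have "density_zero S x \<longleftrightarrow> (\<forall>e>0. eventually (\<lambda>r. vol (S \<inter> ball x r) < e * (w * r ^ DIM('a))) (at_right 0))"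
  unfolding density_zero_def tendsto_iff
  by (intro arg_cong[of _ _ All] ext imp_cong refl eventually_cong[OF eventually_at_right_less[of 0]])
   (use q w in \<open>auto simp: pos_divide_less_eq\<close>)
 also have "\<dots> \<longleftrightarrow> null_density S x"
 proof
  assume L: "\<forall>e>0. eventually (\<lambda>r. vol (S \<inter> ball x r) < e * (w * r ^ DIM('a))) (at_right 0)"
  show "null_density S x" unfolding null_density_def
  proof (intro allI impI)
   fix e :: real assume "e > 0"
   hence "e / w > 0" using w by simp
   with L have "eventually (\<lambda>r. vol (S \<inter> ball x r) < e * r ^ DIM('a)) (at_right 0)" using w by fastforce
   thus "\<exists>d>0. \<forall>r. 0 < r \<and> r < d \<longrightarrow> vol (S \<inter> ball x r) \<le> e * r ^ DIM('a)"
    unfolding eventually_at_right_field by (meson less_imp_le)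
  qed
 next
  assume nd: "null_density S x"
  show "\<forall>e>0. eventually (\<lambda>r. vol (S \<inter> ball x r) < e * (w * r ^ DIM('a))) (at_right 0)"
  proof (intro allI impI)
   fix e :: real assume e: "e > 0"
   hence "e * w / 2 > 0" using w by simp
   then obtain d where d: "d > 0" "\<And>r. 0 < r ==> r < d ==> vol (S \<inter> ball x r) \<le> (e * w / 2) * r ^ DIM('a)"
    using nd unfolding null_density_def by blast
   have "vol (S \<inter> ball x r) < e * (w * r ^ DIM('a))" if "0 < r" "r < d" for r
   proof -
    have "(e * w / 2) * r ^ DIM('a) < e * (w * r ^ DIM('a))" using e w that by simp
    with d(2)[OF that] show ?thesis by linarith
   qed
   thus "eventually (\<lambda>r. vol (S \<inter> ball x r) < e * (w * r ^ DIM('a))) (at_right 0)"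
    unfolding eventually_at_right_field using d(1) by blast
  qed
 qed
 finally show ?thesis .
qed

lemma null_density_local:
 assumes "null_density S x" "e > 0" "S \<inter> ball x e = S' \<inter> ball x e"
 shows "null_density S' x"
 unfolding null_density_def
proof (intro allI impI)
 fix c :: real assume "c > 0"
 then obtain d where d: "d > 0" "\<And>r. 0 < r ==> r < d ==> vol (S \<inter> ball x r) \<le> c * r ^ DIM('a)"
  using assms(1) unfolding null_density_def by blast
 have "S' \<inter> ball x r = S \<inter> ball x r" if "r < e" for r
  using assms(3) subset_ball[of r e x] that by (smt (verit, best) Int_commute Int_assoc inf.absorb_iff2 less_imp_le)
 thus "\<exists>d>0. \<forall>r. 0 < r \<and> r < d \<longrightarrow> vol (S' \<inter> ball x r) \<le> c * r ^ DIM('a)"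
  using d assms(2) by (intro exI[of _ "min d e"]) auto
qed

lemma moll_avg_local:
 assumes "eps > 0" "eps \<le> e" "S \<inter> ball x e = S' \<inter> ball x e"
 shows "moll_avg eps S x = moll_avg eps S' x"
proof -
 have "moll eps (x - y) * ind S y = moll eps (x - y) * ind S' y" for y
 proof (cases "y \<in> ball x e")
  case True
  hence "y \<in> S \<longleftrightarrow> y \<in> S'" using assms(3) by blast
  thus ?thesis by (simp add: indicator_def)
 next
  case False
  hence "norm (x - y) \<ge> eps" using assms(2) by (simp add: dist_norm)
  hence "moll eps (x - y) = 0" by (rule moll_outside[OF assms(1)])
  thus ?thesis by simp
 qed
 thus ?thesis unfolding moll_avg_def by presburger
qed

text \<open>The averages of a set and of its complement add up to 1, so they cannot both tend to
  0.\<close>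

lemma not_null_density_compl:
 assumes S: "S \<in> sets borel" and "null_density S x" shows "\<not> null_density (- S) x"
proof
 assume "null_density (- S) x"
 from moll_avg_null_density[OF this] have "((\<lambda>eps. moll_avg eps (- S) x) \<longlongrightarrow> 0) (at_right 0)" using S by simp
 from tendsto_add[OF moll_avg_null_density[OF assms(2,1)] this]
 have "((\<lambda>eps. moll_avg eps S x + moll_avg eps (- S) x) \<longlongrightarrow> 0) (at_right 0)" by simp
 moreover have "eventually (\<lambda>eps. moll_avg eps S x + moll_avg eps (- S) x = 1) (at_right 0)"
  using eventually_at_right_less[of 0] by eventually_elim (simp add: moll_avg_compl S)
 ultimately have "((\<lambda>eps. 1 :: real) \<longlongrightarrow> 0) (at_right (0 :: real))" by (rule Lim_transform_eventually)
 thus False by (simp add: tendsto_const_iff)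
qed

lemma ap_lower_eq: "ap_lower \<Omega> u x = - ap_upper \<Omega> (\<lambda>x. - u x) x"
proof -
 have "uminus ` {t. density_zero {y \<in> \<Omega>. t < - u y} x} = {t. density_zero {y \<in> \<Omega>. u y < t} x}"
 proof safe
  fix t assume "density_zero {y \<in> \<Omega>. u y < t} x"
  thus "t \<in> uminus ` {t. density_zero {y \<in> \<Omega>. t < - u y} x}" by (intro image_eqI[of _ _ "- t"]) auto
 next
  fix t assume "density_zero {y \<in> \<Omega>. t < - u y} x"
  moreover have "{y \<in> \<Omega>. t < - u y} = {y \<in> \<Omega>. u y < - t}" by auto
  ultimately show "density_zero {y \<in> \<Omega>. u y < - t} x" by simp
 qed
 thus ?thesis unfolding ap_lower_def ap_upper_def Inf_real_def by simp
qed

lemma superlevel_measurable: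
 assumes "open \<Omega>" and [measurable]: "u \<in> Borel"
 shows "{x \<in> \<Omega>. t < (u x :: real)} \<in> sets borel"
proof -
 have "\<Omega> \<inter> {x \<in> space borel. t < u x} \<in> sets borel" using assms(1) by (intro sets.Int) auto
 thus ?thesis by (simp add: Int_def)
qed

context
 fixes \<Omega> :: "'a::euclidean_space set" and u :: "'a => real" and M :: real
 assumes \<Omega>: "open \<Omega>" and u[measurable]: "u \<in> Borel" and u_le: "\<And>x. \<bar>u x\<bar> \<le> M"
begin

lemma ap_upper_bounds:
 assumes y: "y \<in> \<Omega>"
 shows "\<bar>ap_upper \<Omega> u y\<bar> \<le> M"
  and null_density_above_ap_upper: "ap_upper \<Omega> u y < t \<longleftrightarrow> (\<exists>s<t. null_density {x \<in> \<Omega>. s < u x} y)"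
proof -
 define A where "A = {t. null_density {x \<in> \<Omega>. t < u x} y}"
 have U: "ap_upper \<Omega> u y = Inf A"
  unfolding ap_upper_def A_def by (simp only: density_zero_iff_null_density[OF superlevel_measurable[OF \<Omega> u]])
 have e: "null_density {} y" by (auto simp: null_density_def)
 have "{x \<in> \<Omega>. M < u x} = {}" using u_le by (auto simp: not_less abs_le_iff)
 with e have M: "M \<in> A" unfolding A_def by (simp only: mem_Collect_eq)
 \<comment> \<open>Below -M the superlevel set is all of the open set Omega, which has density 1 at
   y; so no such level enters the infimum.\<close>
 have lb: "- M \<le> t" if "t \<in> A" for t
 proof (rule ccontr)
  assume t: "\<not> - M \<le> t"
  have "t < u x" for x using t u_le[of x] by (simp add: abs_le_iff)
  hence "null_density \<Omega> y" using that by (simp add: A_def)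
  moreover obtain e where "e > 0" "ball y e \<subseteq> \<Omega>" using \<Omega> y open_contains_ball by blast
  hence "null_density (- \<Omega>) y" by (intro null_density_local[OF e]) auto
  ultimately show False using not_null_density_compl[OF borel_open[OF \<Omega>]] by blast
 qed
 have "- M \<le> Inf A" using M lb by (intro cInf_greatest) auto
 moreover have bb: "bdd_below A" using lb by (auto simp: bdd_below_def)
 hence "Inf A \<le> M" using M by (intro cInf_lower)
 ultimately show "\<bar>ap_upper \<Omega> u y\<bar> \<le> M" by (simp add: U)
 show "ap_upper \<Omega> u y < t \<longleftrightarrow> (\<exists>s<t. null_density {x \<in> \<Omega>. s < u x} y)"
  unfolding U using cInf_less_iff[of A t] M bb by (auto simp: A_def)
qed

lemma ap_upper_measurable: "(\<lambda>y. if y \<in> \<Omega> then ap_upper \<Omega> u y else 0) \<in> Borel"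
 unfolding borel_measurable_iff_less
proof
 fix t
 have "ap_upper \<Omega> u y < t \<longleftrightarrow> (\<exists>q::rat. real_of_rat q < t \<and> null_density {x \<in> \<Omega>. real_of_rat q < u x} y)" if y: "y \<in> \<Omega>" for y
 proof
  assume "ap_upper \<Omega> u y < t"
  then obtain s where s: "s < t" "null_density {x \<in> \<Omega>. s < u x} y" using null_density_above_ap_upper[OF y] by blast
  obtain q where q: "s < real_of_rat q" "real_of_rat q < t" using of_rat_dense[OF s(1)] by blast
  have "null_density {x \<in> \<Omega>. real_of_rat q < u x} y"
   by (rule null_density_mono[OF s(2)]) (use q superlevel_measurable[OF \<Omega> u] in auto)
  thus "\<exists>q::rat. real_of_rat q < t \<and> null_density {x \<in> \<Omega>. real_of_rat q < u x} y" using q by blast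
 qed (use null_density_above_ap_upper[OF y] in blast)
 hence "{y \<in> space borel. (if y \<in> \<Omega> then ap_upper \<Omega> u y else 0) < t}
  = (\<Omega> \<inter> (\<Union>q\<in>{q::rat. real_of_rat q < t}. {y. null_density {x \<in> \<Omega>. real_of_rat q < u x} y})) \<union> (if 0 < t then - \<Omega> else {})"
  by auto
 also have "\<dots> \<in> sets borel"
  using \<Omega> by (intro sets.Un sets.Int sets.countable_UN') (auto intro!: null_density_measurable[OF superlevel_measurable[OF \<Omega> u]])
 finally show "{y \<in> space borel. (if y \<in> \<Omega> then ap_upper \<Omega> u y else 0) < t} \<in> sets borel" .
qed

end

lemma ap_lower_measurable:
 assumes "open \<Omega>" "u \<in> Borel" "\<And>x. \<bar>u x\<bar> \<le> M"
 shows "(\<lambda>y. if y \<in> \<Omega> then ap_lower \<Omega> u y else 0) \<in> Borel"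
proof -
 have "(\<lambda>y. - (if y \<in> \<Omega> then ap_upper \<Omega> (\<lambda>x. - u x) y else 0)) \<in> Borel"
  by (rule borel_measurable_uminus, rule ap_upper_measurable[where M = M]) (use assms in auto)
 also have "(\<lambda>y. - (if y \<in> \<Omega> then ap_upper \<Omega> (\<lambda>x. - u x) y else 0)) = (\<lambda>y. if y \<in> \<Omega> then ap_lower \<Omega> u y else 0)"
  by (auto simp: ap_lower_eq)
 finally show ?thesis .
qed

lemma ap_lower_bounds:
 assumes "open \<Omega>" "u \<in> Borel" "\<And>x. \<bar>u x\<bar> \<le> M" "y \<in> \<Omega>"
 shows "\<bar>ap_lower \<Omega> u y\<bar> \<le> M"
 using ap_upper_bounds[of \<Omega> "\<lambda>x. - u x" M y] assms by (simp add: ap_lower_eq)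


section \<open>Averages of superlevel sets\<close>

definition fine_at :: "'a::euclidean_space set => 'a => bool" where
 "fine_at E y \<longleftrightarrow> null_density E y \<or> null_density (- E) y \<or> ((\<lambda>eps. moll_avg eps E y) \<longlongrightarrow> 1/2) (at_right 0)"

text \<open>Almost every level is good on every compact \<open>C n\<close>, but each with its own
  exceptional set; a countable dense set \<open>D\<close> of good levels keeps the union of these
  sets null. Intersecting with \<open>C n\<close> gives finite volume and does not change the
  behaviour at interior points.\<close>

lemma (in partitioned_family) superlevel_fine_structure:
 fixes u :: "'a => real"
 assumes ui: "Lint u" and um[measurable]: "u \<in> Borel"
  and BV: "\<And>Phi. C1c_on \<Omega> Phi ==> (\<And>x. norm (Phi x) \<le> 1) ==> (LBINT x. u x * divergence Phi x) \<le> V"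
 obtains N D where "hnull N" "\<And>a b :: real. a < b ==> \<exists>t\<in>D. a < t \<and> t < b"
  "\<And>t y. t \<in> D ==> y \<in> \<Omega> - N ==> fine_at {x \<in> \<Omega>. t < u x} y"
proof -
 define P where "P t \<longleftrightarrow> (\<forall>n. \<exists>V. \<forall>Phi. C1c_on (C n) Phi \<and> (\<forall>x. norm (Phi x) \<le> 1) \<longrightarrow> dist_grad {x. t < u x} Phi \<le> V)" for t
 have AE: "AE t in lborel. P t"
  unfolding P_def AE_all_countable using superlevel_sets_finite_perimeter[OF ui open_\<Omega> C_compact C_subset BV] by blast
 have ex: "\<exists>t. a < t \<and> t < b \<and> P t" if "a < b" for a b
 proof (rule ccontr)
  assume no: "\<nexists>t. a < t \<and> t < b \<and> P t"
  have "AE t in lborel. \<not> (a < t \<and> t < b)" using AE by eventually_elim (use no in auto)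
  from emeasure_eq_0_AE[OF this] have "evol {a<..<b} = 0" by (simp add: greaterThanLessThan_def greaterThan_def lessThan_def Collect_conj_eq)
  thus False using that by simp
 qed
 have "\<exists>t. p < q \<longrightarrow> real_of_rat p < t \<and> t < real_of_rat q \<and> P t" for p q
  using ex[of "real_of_rat p" "real_of_rat q"] by (cases "p < q") (auto simp: of_rat_less)
 \<comment> \<open>A good level in every interval with rational endpoints makes \<open>D\<close>
   both dense and countable.\<close>
 then obtain t0 where t0: "\<And>p q::rat. p < q ==> real_of_rat p < t0 p q \<and> t0 p q < real_of_rat q \<and> P (t0 p q)" by metis
 define D where "D = (\<lambda>(p, q). t0 p q) ` {(p, q). p < q}"
 have D: "countable D" "\<And>t. t \<in> D ==> P t" using t0 by (auto simp: D_def)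
 let ?E = "\<lambda>t. {x \<in> \<Omega>. t < u x}"
 have ex_null: "\<exists>N. hnull N \<and> (\<forall>y\<in>interior (C n) - N. fine_at (?E t \<inter> C n) y)" if t: "t \<in> D" for t n
 proof -
  obtain V where V: "\<And>Phi. C1c_on (C n) Phi ==> (\<And>x. norm (Phi x) \<le> 1) ==> dist_grad {x. t < u x} Phi \<le> V"
   using D(2)[OF t] unfolding P_def by blast
  have Cb: "C n \<in> sets borel" using borel_compact[OF C_compact] .
  have E: "{x \<in> space borel. t < u x} \<in> sets borel" by measurable
  have eq: "?E t \<inter> C n = {x. t < u x} \<inter> C n" using C_subset by blast
  interpret finite_perimeter "?E t \<inter> C n" "interior (C n)" V
  proof
   show "?E t \<inter> C n \<in> sets borel" unfolding eq using E Cb by simp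
   have "evol (?E t \<inter> C n) \<le> evol (C n)" using Cb by (intro emeasure_mono) auto
   thus "evol (?E t \<inter> C n) < \<infinity>"
    using emeasure_bounded_finite[OF compact_imp_bounded[OF C_compact]] by (metis infinity_ennreal_def le_less_trans)
   fix Phi :: "'a => 'a" assume Phi: "C1c_on (interior (C n)) Phi" "\<And>x. norm (Phi x) \<le> 1"
   have "ind (?E t \<inter> C n) x * divergence Phi x = ind {x. t < u x} x * divergence Phi x" for x
    using divergence_outside[OF Phi(1), of x] interior_subset[of "C n"] eq by (cases "x \<in> C n") (auto simp: indicator_def)
   hence "dist_grad (?E t \<inter> C n) Phi = dist_grad {x. t < u x} Phi" unfolding dist_grad_def by presburger
   also have "\<dots> \<le> V" by (rule V[OF C1c_on_mono[OF Phi(1) interior_subset] Phi(2)])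
   finally show "dist_grad (?E t \<inter> C n) Phi \<le> V" .
  qed (auto simp: dim)
  show ?thesis using fine_structure unfolding fine_at_def .
 qed
 define N0 where "N0 t n = (SOME N. hnull N \<and> (\<forall>y\<in>interior (C n) - N. fine_at (?E t \<inter> C n) y))" for t n
 have N0: "hnull (N0 t n)" "\<And>y. y \<in> interior (C n) - N0 t n ==> fine_at (?E t \<inter> C n) y" if "t \<in> D" for t n
  using someI_ex[OF ex_null[OF that]] unfolding N0_def by blast+
 define N where "N = (\<Union>(t, n)\<in>D \<times> UNIV. N0 t n)"
 show thesis
 proof
  show "hnull N" unfolding N_def
   by (rule hnull_countable_Union[OF dim]) (use D(1) N0(1) in auto)
  show "\<exists>t\<in>D. a < t \<and> t < b" if ab: "a < b" for a b :: real
  proof -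
   obtain p where p: "a < real_of_rat p" "real_of_rat p < b" using of_rat_dense[OF ab] by blast
   obtain q where q: "real_of_rat p < real_of_rat q" "real_of_rat q < b" using of_rat_dense[OF p(2)] by blast
   hence "p < q" by (simp add: of_rat_less)
   hence "t0 p q \<in> D" unfolding D_def by auto
   with t0[OF \<open>p < q\<close>] p q show ?thesis by (intro bexI[of _ "t0 p q"]) auto
  qed
  fix t y assume t: "t \<in> D" and y: "y \<in> \<Omega> - N"
  obtain n where n: "y \<in> interior (C n)" using y in_interior_C by blast
  obtain e where e: "e > 0" "ball y e \<subseteq> C n" using n by (meson mem_interior)
  have l: "?E t \<inter> C n \<inter> ball y e = ?E t \<inter> ball y e" "- (?E t \<inter> C n) \<inter> ball y e = - ?E t \<inter> ball y e" using e(2) by auto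
  have "y \<notin> N0 t n" using y t by (auto simp: N_def)
  hence R: "fine_at (?E t \<inter> C n) y" by (intro N0(2)[OF t]) (use n in blast)
  have ev: "eventually (\<lambda>eps. moll_avg eps (?E t \<inter> C n) y = moll_avg eps (?E t) y) (at_right 0)"
   unfolding eventually_at_right_field using e(1) moll_avg_local[OF _ _ l(1)] by (meson less_imp_le)
  from R show "fine_at (?E t) y"
   unfolding fine_at_def tendsto_cong[OF ev] by (elim disj_forward null_density_local[OF _ e(1) l(1)] null_density_local[OF _ e(1) l(2)])
 qed
qed

text \<open>Strictly between the approximate limits neither the superlevel set nor its complement
  has density 0, so the levels in \<open>D\<close> have limit 1/2. Superlevel sets shrink as t
  grows, and two levels of \<open>D\<close> around t sandwich its averages.\<close>

lemma moll_avg_superlevel_tendsto: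
 fixes u :: "'a::euclidean_space => real"
 assumes \<Omega>: "open \<Omega>" and u[measurable]: "u \<in> Borel" and u_le: "\<And>x. \<bar>u x\<bar> \<le> M" and y: "y \<in> \<Omega>"
  and D: "\<And>a b :: real. a < b ==> \<exists>t\<in>D. a < t \<and> t < b"
  and tri: "\<And>t. t \<in> D ==> fine_at {x \<in> \<Omega>. t < u x} y"
  and t: "t \<noteq> ap_upper \<Omega> u y" "t \<noteq> ap_lower \<Omega> u y"
 shows "((\<lambda>eps. moll_avg eps {x \<in> \<Omega>. t < u x} y) \<longlongrightarrow>
  (1/2) * ((if t < ap_upper \<Omega> u y then 1 else 0) + (if t < ap_lower \<Omega> u y then 1 else 0))) (at_right 0)"
proof -
 let ?E = "\<lambda>t. {x \<in> \<Omega>. t < u x}" and ?U = "ap_upper \<Omega> u y" and ?L = "ap_lower \<Omega> u y"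
 have E: "?E t \<in> sets borel" for t by (rule superlevel_measurable[OF \<Omega> u])
 have E': "{x \<in> \<Omega>. u x < t} \<in> sets borel" for t using superlevel_measurable[OF \<Omega>, of "\<lambda>x. - u x" "- t"] by simp
 obtain e where e: "e > 0" "ball y e \<subseteq> \<Omega>" using \<Omega> y open_contains_ball by blast
 have up: "?U < t \<longleftrightarrow> (\<exists>s<t. null_density (?E s) y)" for t
  by (rule null_density_above_ap_upper[OF \<Omega> u u_le y])
 have lo: "t < ?L \<longleftrightarrow> (\<exists>s>t. null_density {x \<in> \<Omega>. u x < s} y)" for t
 proof -
  have "t < ?L \<longleftrightarrow> ap_upper \<Omega> (\<lambda>x. - u x) y < - t" by (auto simp: ap_lower_eq)
  also have "\<dots> \<longleftrightarrow> (\<exists>s. s < - t \<and> null_density {x \<in> \<Omega>. s < - u x} y)"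
   by (rule null_density_above_ap_upper[OF \<Omega> _ _ y]) (use u_le in auto)
  also have "\<dots> \<longleftrightarrow> (\<exists>s>t. null_density {x \<in> \<Omega>. - s < - u x} y)"
   by (rule iffI; elim exE conjE; rule_tac x = "- s" in exI) simp_all
  finally show ?thesis by simp
 qed
 have loc: "null_density (- ?E t) y" if "null_density {x \<in> \<Omega>. u x < s} y" "t < s" for s t
 proof (rule null_density_local[OF _ e(1)])
  show "null_density (\<Omega> - ?E t) y"
   by (rule null_density_mono[OF that(1)]) (use that(2) E E' \<Omega> in auto)
  show "(\<Omega> - ?E t) \<inter> ball y e = - ?E t \<inter> ball y e" using e(2) by auto
 qed
 consider "?U < t" | "t < ?L" | "?L < t" "t < ?U" using t by linarith
 thus ?thesis
 proof cases
  case 1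
  then obtain s where s: "s < t" "null_density (?E s) y" using up by blast
  have nd: "null_density (?E t) y" by (rule null_density_mono[OF s(2)]) (use s(1) E in auto)
  have "\<not> t < ?L"
   using loc[of _ t] lo[of t] not_null_density_compl[OF E nd] by blast
  with 1 moll_avg_null_density[OF nd E] show ?thesis by simp
 next
  case 2
  then obtain s where s: "t < s" "null_density {x \<in> \<Omega>. u x < s} y" using lo by blast
  have nd: "null_density (- ?E t) y" by (rule loc[OF s(2,1)])
  have "\<not> ?U < t"
  proof
   assume "?U < t"
   then obtain r where r: "r < t" "null_density (?E r) y" using up by blast
   have "null_density (?E t) y" by (rule null_density_mono[OF r(2)]) (use r(1) E in auto)
   thus False using not_null_density_compl[OF E] nd by blast
  qed
  hence U: "t < ?U" using t by linarith
  have "((\<lambda>eps. 1 - moll_avg eps (- ?E t) y) \<longlongrightarrow> 1 - 0) (at_right 0)"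
   by (intro tendsto_diff tendsto_const moll_avg_null_density nd) (use E in auto)
  moreover have "eventually (\<lambda>eps. 1 - moll_avg eps (- ?E t) y = moll_avg eps (?E t) y) (at_right 0)"
   using eventually_at_right_less[of 0] by eventually_elim (simp add: moll_avg_compl E)
  ultimately have "((\<lambda>eps. moll_avg eps (?E t) y) \<longlongrightarrow> 1 - 0) (at_right 0)" by (rule Lim_transform_eventually)
  with U 2 show ?thesis by simp
 next
  case 3
  have half: "((\<lambda>eps. moll_avg eps (?E r) y) \<longlongrightarrow> 1/2) (at_right 0)" if r: "r \<in> D" "?L < r" "r < ?U" for r
  proof -
   obtain s where s: "r < s" "s < ?U" using dense[OF r(3)] by blast
   have "\<not> null_density (?E r) y" using up[of s] s by auto
   moreover have "\<not> null_density (- ?E r) y"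
   proof
    assume nd: "null_density (- ?E r) y"
    have "null_density {x \<in> \<Omega>. u x < r} y" by (rule null_density_mono[OF nd]) (use E E' in auto)
    moreover obtain p where "?L < p" "p < r" using dense[OF r(2)] by blast
    ultimately show False using lo[of p] by auto
   qed
   ultimately show ?thesis using tri[OF r(1)] unfolding fine_at_def by blast
  qed
  obtain r where r: "r \<in> D" "?L < r" "r < t" using D[OF 3(1)] by blast
  obtain s where s: "s \<in> D" "t < s" "s < ?U" using D[OF 3(2)] by blast
  have "((\<lambda>eps. moll_avg eps (?E t) y) \<longlongrightarrow> 1/2) (at_right 0)"
  proof (rule tendsto_sandwich[OF _ _ half half])
   show "eventually (\<lambda>eps. moll_avg eps (?E s) y \<le> moll_avg eps (?E t) y) (at_right 0)"
    using eventually_at_right_less[of 0] by eventually_elim (rule moll_avg_mono, use s E in auto)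
   show "eventually (\<lambda>eps. moll_avg eps (?E t) y \<le> moll_avg eps (?E r) y) (at_right 0)"
    using eventually_at_right_less[of 0] by eventually_elim (rule moll_avg_mono, use r E in auto)
  qed (use r s 3 in auto)
  with 3 show ?thesis by simp
 qed
qed

text \<open>The mollification at y of the function \<open>orient t (u x) * phi x\<close> of x; it is
  what remains of u and \<open>phi\<close> once the integral against \<open>sig\<close> has been
  moved outside.\<close>

definition smear :: "('a::euclidean_space => real) => ('a => real) => real => 'a => real => real" where
 "smear u phi eps y t = (LBINT x. orient t (u x) * (phi x * moll eps (x - y)))"

text \<open>Freezing \<open>phi\<close> at y costs at most L eps, with L a Lipschitz constant; what
  is left is the average of the superlevel set.\<close>

lemma smear_tendsto:
 fixes phi u :: "'a::euclidean_space => real"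
 assumes phi: "C1c_on \<Omega> phi" and \<Omega>: "open \<Omega>" and u[measurable]: "u \<in> Borel"
  and lim: "((\<lambda>eps. moll_avg eps {x \<in> \<Omega>. t < u x} y) \<longlongrightarrow> l) (at_right 0)"
 shows "((\<lambda>eps. smear u phi eps y t) \<longlongrightarrow> phi y * (l - (if t < 0 then 1 else 0))) (at_right 0)"
proof -
 let ?E = "{x \<in> \<Omega>. t < u x}" and ?z = "if t < 0 then 1 else 0 :: real"
 have E[measurable]: "?E \<in> sets borel" by (rule superlevel_measurable[OF \<Omega> u])
 obtain L where L: "L \<ge> 0" "\<And>x y. norm (phi x - phi y) \<le> L * norm (x - y)" using C1c_on_lipschitz[OF phi] by blast
 have [measurable]: "phi \<in> Borel" by (rule C1c_on_measurable[OF phi])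
 have "norm (smear u phi eps y t - phi y * (moll_avg eps ?E y - ?z)) \<le> L * eps" if eps: "eps > 0" for eps
 proof -
  note [measurable] = moll_measurable[OF eps]
  have mi: "Lint (\<lambda>x. moll eps (y - x))" by (rule moll_integrable_reflect[OF eps])
  let ?o = "\<lambda>x. ind ?E x - ?z"
  have o: "\<bar>?o x\<bar> \<le> 1" for x by (auto simp: indicator_def)
  have oi: "Lint (\<lambda>x. h x * moll eps (y - x))" if [measurable]: "h \<in> Borel" and "\<And>x. \<bar>h x\<bar> \<le> c" for h c
   using integrable_scaleR_bounded[OF mi, of h c] that(2) by simp
  obtain c where c: "\<And>x. \<bar>phi x\<bar> \<le> c" using C1c_on_bounded[OF phi] by (metis real_norm_def)
  have i1: "Lint (\<lambda>x. (phi x * ?o x) * moll eps (y - x))"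
   by (rule oi[of _ "c * 1"]) (measurable, unfold abs_mult, intro mult_mono c o, use c[of 0] in auto)
  have i2: "Lint (\<lambda>x. (phi y * ?o x) * moll eps (y - x))"
   by (rule oi[of _ "c * 1"]) (measurable, unfold abs_mult, intro mult_mono c o, use c[of 0] in auto)
  have "smear u phi eps y t = (LBINT x. (phi x * ?o x) * moll eps (y - x))"
   unfolding smear_def using C1c_on_outside(1)[OF phi]
   by (intro Bintegral_cong refl) (auto simp: orient_def indicator_def moll_commute[OF eps, of _ y])
  moreover have "phi y * (moll_avg eps ?E y - ?z) = (LBINT x. (phi y * ?o x) * moll eps (y - x))"
  proof -
   have "(LBINT x. ?o x * moll eps (y - x)) = (LBINT x. ind ?E x * moll eps (y - x) - ?z * moll eps (y - x))"
    by (simp add: left_diff_distrib)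
   also have "\<dots> = moll_avg eps ?E y - ?z"
    using mi oi[of "ind ?E" 1] by (subst Bintegral_diff) (auto simp: moll_avg_def mult.commute moll_integral_reflect[OF eps] indicator_def)
   finally show ?thesis by (simp add: mult.assoc)
  qed
  ultimately have "norm (smear u phi eps y t - phi y * (moll_avg eps ?E y - ?z))
   = norm (LBINT x. (phi x * ?o x) * moll eps (y - x) - (phi y * ?o x) * moll eps (y - x))"
   by (simp only: Bintegral_diff[OF i1 i2])
  also have "\<dots> \<le> (LBINT x. norm ((phi x * ?o x) * moll eps (y - x) - (phi y * ?o x) * moll eps (y - x)))" by (rule integral_norm_bound)
  also have "\<dots> \<le> (LBINT x. (L * eps) * moll eps (y - x))"
  proof (rule integral_mono')
   show "Lint (\<lambda>x. (L * eps) * moll eps (y - x))" using mi by simp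
   fix x
   show "norm ((phi x * ?o x) * moll eps (y - x) - (phi y * ?o x) * moll eps (y - x)) \<le> (L * eps) * moll eps (y - x)"
   proof (cases "norm (y - x) < eps")
    case True
    have "\<bar>phi x - phi y\<bar> * \<bar>?o x\<bar> \<le> (L * eps) * 1"
    proof (intro mult_mono o)
     have "L * norm (x - y) \<le> L * eps" using True L(1) by (intro mult_left_mono) (auto simp: norm_minus_commute)
     thus "\<bar>phi x - phi y\<bar> \<le> L * eps" using L(2)[of x y] by simp
    qed (use L eps in auto)
    hence "(\<bar>phi x - phi y\<bar> * \<bar>?o x\<bar>) * moll eps (y - x) \<le> (L * eps) * moll eps (y - x)"
     by (intro mult_right_mono moll_nonneg[OF eps]) simp
    thus ?thesis by (simp only: left_diff_distrib[symmetric] real_norm_def abs_mult abs_of_nonneg[OF moll_nonneg[OF eps]])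
   qed (simp add: moll_outside[OF eps])
   show "0 \<le> (L * eps) * moll eps (y - x)" using L eps by (simp add: moll_nonneg)
  qed
  finally show ?thesis by (simp add: moll_integral_reflect[OF eps])
 qed
 hence "eventually (\<lambda>eps. norm (smear u phi eps y t - phi y * (moll_avg eps ?E y - ?z)) \<le> L * eps) (at_right 0)"
  using eventually_at_right_less[of 0] by (auto elim: eventually_mono)
 moreover have "((\<lambda>eps. L * eps) \<longlongrightarrow> 0) (at_right 0)" by (rule tendsto_eq_intros) (auto intro!: tendsto_eq_intros)
 ultimately have "((\<lambda>eps. smear u phi eps y t - phi y * (moll_avg eps ?E y - ?z)) \<longlongrightarrow> 0) (at_right 0)"
  by (rule Lim_null_comparison)
 from tendsto_add[OF this tendsto_mult[OF tendsto_const[of "phi y"] tendsto_diff[OF lim tendsto_const[of ?z]]]]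
 show ?thesis by simp
qed


section \<open>Convergence of the pairings\<close>

context field_family
begin

text \<open>\<open>f\<close> is bounded by 1 only almost everywhere and level by level. The
  truncation is bounded everywhere, so dominated convergence can be used in t at each fixed
  y.\<close>

definition fc :: "'a => real => real" where "fc y t = max (-1) (min 1 (f y t))"

lemma fc_measurable_comp[measurable]:
 assumes [measurable]: "g \<in> borel_measurable N" "h \<in> borel_measurable N"
 shows "(\<lambda>x. fc (g x) (h x)) \<in> borel_measurable N"
 unfolding fc_def by measurable

lemma abs_fc_le: "\<bar>fc y t\<bar> \<le> 1"
 by (auto simp: fc_def)

text \<open>Fubini exchanges the quantifiers: from a null set of points for each t to a null set of
  levels for almost every y.\<close>

lemma AE_eq_fc: "AE y in sig. AE t in lborel. f y t = fc y t"
proof -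
 interpret s: finite_measure sig by (rule sig_fin)
 interpret pair_sigma_finite sig lborel ..
 have "AE y in sig. f y t = fc y t" for t
  using f_le_1[of t] by eventually_elim (auto simp: fc_def)
 hence "AE t in lborel. AE y in sig. f y t = fc y t" by simp
 moreover have "{p \<in> space (sig \<Otimes>\<^sub>M lborel). f (fst p) (snd p) = fc (fst p) (snd p)} \<in> sets (sig \<Otimes>\<^sub>M lborel)"
  by measurable
 ultimately show ?thesis using AE_commute[of "\<lambda>y t. f y t = fc y t"] by blast
qed

definition primitive :: "'a => real => real" where
 "primitive y w = (LBINT t. orient t w * fc y t)"

lemma orient_fc_integrable: "Lint (\<lambda>t. orient t w * fc y t)"
proof (rule integrableI_bounded_set[where A = "{-\<bar>w\<bar>..\<bar>w\<bar>}" and B = 1])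
 have bd: "\<bar>orient t w * fc y t\<bar> \<le> ind {-\<bar>w\<bar>..\<bar>w\<bar>} t * 1" for t
  unfolding abs_mult by (intro mult_mono abs_orient_le abs_fc_le) auto
 show "AE t in lborel. t \<in> {-\<bar>w\<bar>..\<bar>w\<bar>} \<longrightarrow> norm (orient t w * fc y t) \<le> 1"
  using order_trans[OF bd, of _ 1] by (intro AE_I2 impI) (simp add: indicator_le_1 del: atLeastAtMost_iff)
 have "orient t w * fc y t = 0" if "t \<notin> {-\<bar>w\<bar>..\<bar>w\<bar>}" for t
  using bd[of t] that by (simp del: atLeastAtMost_iff)
 thus "AE t in lborel. t \<notin> {-\<bar>w\<bar>..\<bar>w\<bar>} \<longrightarrow> orient t w * fc y t = 0" by (intro AE_I2 impI)
qed (auto simp: emeasure_lborel_Icc_eq)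

lemma primitive_measurable:
 assumes [measurable]: "h \<in> Borel"
 shows "(\<lambda>y. primitive y (h y)) \<in> Borel"
 unfolding primitive_def by (rule lborel.borel_measurable_lebesgue_integral) measurable

text \<open>The average of F at the two approximate limits; these are set to 0 off Omega to keep the
  function Borel.\<close>

definition half_trace :: "('a => real) => 'a => real" where
 "half_trace u y = (1/2) * (primitive y (if y \<in> \<Omega> then ap_upper \<Omega> u y else 0) + primitive y (if y \<in> \<Omega> then ap_lower \<Omega> u y else 0))"

lemma half_trace_measurable:
 assumes "u \<in> Borel" "\<And>x. \<bar>u x\<bar> \<le> M" shows "half_trace u \<in> Borel"
 unfolding half_trace_def[abs_def]
 using primitive_measurable[OF ap_upper_measurable[OF open_\<Omega> assms]] primitive_measurable[OF ap_lower_measurable[OF open_\<Omega> assms]]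
 by measurable

end

text \<open>Fubini in the three variables x, t and y. All dependence on the radius is collected in
  \<open>smear\<close>, whose limit is known.\<close>

lemma (in mollified_family) div_part_pairing:
 fixes u phi :: "'a => real"
 assumes u[measurable]: "u \<in> Borel" and u_le: "\<And>x. \<bar>u x\<bar> \<le> M" and phi: "C1c_on (interior (C m)) phi"
 shows "(LBINT x. LBINT t. orient t (u x) * (phi x * div_part i t x))
  = (\<integral>y. zeta i y * (LBINT t. fc y t * smear u phi (eps i) y t) \<partial>sig)"
proof -
 interpret s: finite_measure sig by (rule sig_fin)
 interpret P: pair_sigma_finite "lborel \<Otimes>\<^sub>M lborel :: ('a \<times> real) measure" sig
  using lborel_pair.sigma_finite_measure_axioms s.sigma_finite_measure_axioms by (simp add: pair_sigma_finite_def)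
 have [measurable]: "phi \<in> Borel" by (rule C1c_on_measurable[OF phi])
 have K[measurable]: "C m \<in> sets borel" and Kfin: "evol (C m) < \<infinity>"
  using borel_compact[OF C_compact] emeasure_bounded_finite[OF compact_imp_bounded[OF C_compact]] by (auto simp: less_top)
 obtain c where c: "\<And>x. \<bar>phi x\<bar> \<le> c" using bounded_C1c[OF phi] by blast
 obtain d where d: "\<And>z. \<bar>moll (eps i) (z :: 'a)\<bar> \<le> d" using bounded_C1c[OF moll_C1c[OF eps_pos]] by blast
 have c0: "c \<ge> 0" "d \<ge> 0" using c[of 0] d[of 0] by auto
 have z: "phi x = 0" if "x \<notin> C m" for x using that interior_subset C1c_on_outside(1)[OF phi] by blast
 have z': "orient t (u x) = 0" if "t \<notin> {-M..M}" for t x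
  using abs_orient_le[OF u_le, of t x] that by (auto simp: indicator_def)
 define h where "h x t y = phi x * ((moll (eps i) (x - y) * zeta i y) * fc y t)" for x t y
 have h_le: "\<bar>h x t y\<bar> \<le> c * ((d * 1) * 1)" for x t y
  unfolding h_def abs_mult using zeta_nonneg zeta_le_1 c0 by (intro mult_mono c d abs_fc_le) auto
 have o_le: "\<bar>orient t (u x)\<bar> \<le> 1" for t x by (auto simp: orient_def)
 have hm: "(\<lambda>p. h (fst (fst p)) (snd (fst p)) (snd p)) \<in> borel_measurable ((borel \<Otimes>\<^sub>M borel) \<Otimes>\<^sub>M borel)"
  unfolding h_def by measurable
 let ?F = "\<lambda>p y. orient (snd p) (u (fst p)) * h (fst p) (snd p) y"
 have int: "integrable ((lborel \<Otimes>\<^sub>M lborel) \<Otimes>\<^sub>M sig) (case_prod ?F)"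
 proof (rule integrableI_bounded_set[where A = "(C m \<times> {-M..M}) \<times> UNIV" and B = "1 * (c * ((d * 1) * 1))"])
  have "case_prod ?F \<in> borel_measurable ((borel \<Otimes>\<^sub>M borel) \<Otimes>\<^sub>M borel)" using hm by measurable
  thus "case_prod ?F \<in> borel_measurable ((lborel \<Otimes>\<^sub>M lborel) \<Otimes>\<^sub>M sig)"
   by (simp only: measurable_cong_sets[OF sets_pair_measure_cong[OF sets_pair_measure_cong[OF sets_lborel sets_lborel] sig_sets] refl])
  show "(C m \<times> {-M..M}) \<times> UNIV \<in> sets ((lborel \<Otimes>\<^sub>M lborel) \<Otimes>\<^sub>M sig)"
   by (intro pair_measureI) (auto simp: sig_sets)
  show "emeasure ((lborel \<Otimes>\<^sub>M lborel) \<Otimes>\<^sub>M sig) ((C m \<times> {-M..M}) \<times> UNIV) < \<infinity>"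
   using Kfin by (subst s.emeasure_pair_measure_Times; (subst lborel.emeasure_pair_measure_Times)?)
    (auto simp: sig_sets ennreal_mult_less_top emeasure_lborel_Icc_eq s.emeasure_eq_measure)
  show "AE q in (lborel \<Otimes>\<^sub>M lborel) \<Otimes>\<^sub>M sig. q \<in> (C m \<times> {-M..M}) \<times> UNIV \<longrightarrow> norm (case_prod ?F q) \<le> 1 * (c * ((d * 1) * 1))"
   by (intro AE_I2 impI) (simp only: split_beta real_norm_def abs_mult[of "orient _ _"] mult_mono[OF o_le h_le] zero_le_one abs_ge_zero)
  have F0: "?F p y = 0" if "p \<notin> C m \<times> {-M..M}" for p y
  proof (cases "fst p \<in> C m")
   case True
   hence "snd p \<notin> {-M..M}" using that by (auto simp: mem_Times_iff)
   thus ?thesis by (simp add: z' del: atLeastAtMost_iff)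
  qed (simp add: z h_def)
  show "AE q in (lborel \<Otimes>\<^sub>M lborel) \<Otimes>\<^sub>M sig. q \<notin> (C m \<times> {-M..M}) \<times> UNIV \<longrightarrow> case_prod ?F q = 0"
   using F0[of "fst _" "snd _"] by (intro AE_I2 impI) (simp only: split_beta mem_Times_iff[of _ "C m \<times> {-M..M}" UNIV] UNIV_I simp_thms)
 qed
 have dp: "phi x * div_part i t x = (\<integral>y. h x t y \<partial>sig)" for x t
 proof -
  have [measurable]: "(\<lambda>y. moll (eps i) (x - y) * zeta i y) \<in> Borel" by measurable
  have "div_part i t x = (\<integral>y. (moll (eps i) (x - y) * zeta i y) * fc y t \<partial>sig)"
   unfolding div_part_def
   by (rule integral_cong_AE, measurable) (use f_le_1[of t] in \<open>eventually_elim, auto simp: fc_def\<close>)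
  thus ?thesis by (simp add: h_def)
 qed
 obtain e where e: "\<And>t x. \<bar>div_part i t x\<bar> \<le> e" using div_part_bounded[of i] by blast
 have "integrable (lborel \<Otimes>\<^sub>M lborel) (\<lambda>(x, t). orient t (u x) * (phi x * div_part i t x))"
 proof (rule slice_integrable(2)[OF u u_le K Kfin])
  show "\<bar>phi x * div_part i t x\<bar> \<le> c * e" for x t unfolding abs_mult by (intro mult_mono c e c0 abs_ge_zero)
 qed (use z in auto)
 from lborel_pair.integral_fst'[OF this]
 have "(LBINT x. LBINT t. orient t (u x) * (phi x * div_part i t x)) = (\<integral>p. \<integral>y. ?F p y \<partial>sig \<partial>(lborel \<Otimes>\<^sub>M lborel))"
  by (simp add: case_prod_beta' dp)
 also have "\<dots> = (\<integral>y. \<integral>p. ?F p y \<partial>(lborel \<Otimes>\<^sub>M lborel) \<partial>sig)" by (rule P.Fubini_integral[OF int, symmetric])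
 also have "\<dots> = (\<integral>y. zeta i y * (LBINT t. fc y t * smear u phi (eps i) y t) \<partial>sig)"
 proof (intro Bintegral_cong refl)
  fix y
  have "integrable (lborel \<Otimes>\<^sub>M lborel) (\<lambda>(x, t). orient t (u x) * h x t y)"
   by (rule slice_integrable(2)[OF u u_le K Kfin _ h_le]) (use z in \<open>auto simp: h_def\<close>)
  from lborel_pair.integral_snd[OF this]
  have "(\<integral>p. ?F p y \<partial>(lborel \<Otimes>\<^sub>M lborel)) = (LBINT t. LBINT x. orient t (u x) * h x t y)" by (simp add: case_prod_beta')
  also have "\<dots> = (LBINT t. zeta i y * (fc y t * smear u phi (eps i) y t))"
  proof (intro Bintegral_cong refl)
   fix t
   have "(LBINT x. orient t (u x) * h x t y) = (LBINT x. (zeta i y * fc y t) * (orient t (u x) * (phi x * moll (eps i) (x - y))))"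
    by (simp add: h_def mult_ac)
   thus "(LBINT x. orient t (u x) * h x t y) = zeta i y * (fc y t * smear u phi (eps i) y t)" by (simp add: smear_def)
  qed
  finally show "(\<integral>p. ?F p y \<partial>(lborel \<Otimes>\<^sub>M lborel)) = zeta i y * (LBINT t. fc y t * smear u phi (eps i) y t)" by simp
 qed
 finally show ?thesis .
qed

text \<open>Dominated convergence twice: in t for each good y, where only the two levels equal to
  the approximate limits are excluded, then in y against the finite measure
  \<open>sig\<close>.\<close>

lemma (in partitioned_family) pairing_limit:
 fixes u phi :: "'a => real"
 assumes u[measurable]: "u \<in> Borel" and u_le: "\<And>x. \<bar>u x\<bar> \<le> M" and phi: "C1c_on \<Omega> phi"
  and e: "\<And>k. e k > 0" "e \<longlonglongrightarrow> 0"
  and fine: "AE y in sig. y \<in> \<Omega> \<and> (\<forall>t. t \<noteq> ap_upper \<Omega> u y \<and> t \<noteq> ap_lower \<Omega> u y \<longrightarrow>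
   ((\<lambda>eps. moll_avg eps {x \<in> \<Omega>. t < u x} y) \<longlongrightarrow>
    (1/2) * ((if t < ap_upper \<Omega> u y then 1 else 0) + (if t < ap_lower \<Omega> u y then 1 else 0))) (at_right 0))"
 shows "(\<lambda>k. \<integral>y. zeta i y * (LBINT t. fc y t * smear u phi (e k) y t) \<partial>sig)
  \<longlonglongrightarrow> (\<integral>y. zeta i y * (phi y * half_trace u y) \<partial>sig)"
proof -
 interpret s: finite_measure sig by (rule sig_fin)
 let ?U = "\<lambda>y. if y \<in> \<Omega> then ap_upper \<Omega> u y else 0" and ?L = "\<lambda>y. if y \<in> \<Omega> then ap_lower \<Omega> u y else 0"
 have [measurable]: "phi \<in> Borel" by (rule C1c_on_measurable[OF phi])
 obtain c where c: "\<And>x. \<bar>phi x\<bar> \<le> c" using C1c_on_bounded[OF phi] by (metis real_norm_def)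
 have c0: "c \<ge> 0" using c[of 0] by simp
 let ?H = "\<lambda>k. smear u phi (e k)"
 note [measurable] = moll_measurable[OF e(1)]
 note moll_measurable[measurable del]
 have Hm: "(\<lambda>p. ?H k (fst p) (snd p)) \<in> borel_measurable (borel \<Otimes>\<^sub>M borel)" for k
  unfolding smear_def by (rule lborel.borel_measurable_lebesgue_integral) measurable
 have Hm'[measurable]: "(\<lambda>t. ?H k y t) \<in> Borel" for k y
  using measurable_compose[OF measurable_Pair1' Hm[of k], of y] by simp
 have H_le: "\<bar>?H k y t\<bar> \<le> c * ind {-M..M} t" for k y t
 proof -
  have "\<bar>?H k y t\<bar> \<le> (LBINT x. \<bar>orient t (u x) * (phi x * moll (e k) (x - y))\<bar>)" unfolding smear_def using integral_norm_bound[of lborel "\<lambda>x. orient t (u x) * (phi x * moll (e k) (x - y))"] by simp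
  also have "\<dots> \<le> (LBINT x. (c * ind {-M..M} t) * moll (e k) (y - x))"
  proof (rule integral_mono')
   show "Lint (\<lambda>x. (c * ind {-M..M} t) * moll (e k) (y - x))" by (intro integrable_mult_right moll_integrable_reflect e(1))
   fix x
   have "\<bar>orient t (u x)\<bar> * \<bar>phi x\<bar> \<le> ind {-M..M} t * c" by (intro mult_mono abs_orient_le u_le c) auto
   hence "(\<bar>orient t (u x)\<bar> * \<bar>phi x\<bar>) * moll (e k) (y - x) \<le> (ind {-M..M} t * c) * moll (e k) (y - x)"
    by (rule mult_right_mono) (rule moll_nonneg[OF e(1)])
   thus "\<bar>orient t (u x) * (phi x * moll (e k) (x - y))\<bar> \<le> (c * ind {-M..M} t) * moll (e k) (y - x)"
    by (simp add: abs_mult moll_nonneg[OF e(1)] moll_commute[OF e(1), where x = x and y = y] mult_ac)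
   show "0 \<le> (c * ind {-M..M} t) * moll (e k) (y - x)" using c0 by (simp add: moll_nonneg[OF e(1)])
  qed
  also have "\<dots> = c * ind {-M..M} t" by (simp add: moll_integral_reflect[OF e(1)])
  finally show ?thesis .
 qed
 have fcH_le: "\<bar>fc y t * ?H k y t\<bar> \<le> c * ind {-M..M} t" for k y t
  using mult_mono[OF abs_fc_le[of y t] H_le[of k y t]] by (simp add: abs_mult)
 have wi: "Lint (\<lambda>t. c * ind {-M..M} t)" by (simp add: emeasure_lborel_Icc_eq)
 have e_right: "filterlim e (at_right 0) sequentially"
  using e by (intro tendsto_imp_filterlim_at_right) auto
 have inner: "(\<lambda>k. LBINT t. fc y t * ?H k y t) \<longlonglongrightarrow> phi y * half_trace u y"
  if y: "y \<in> \<Omega>" and lim: "\<And>t. t \<noteq> ?U y ==> t \<noteq> ?L y ==> ((\<lambda>eps. moll_avg eps {x \<in> \<Omega>. t < u x} y) \<longlongrightarrow>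
    (1/2) * ((if t < ?U y then 1 else 0) + (if t < ?L y then 1 else 0))) (at_right 0)" for y
 proof -
  let ?l = "\<lambda>t. (1/2) * ((orient t (?U y) * fc y t) + (orient t (?L y) * fc y t))"
  have "(\<lambda>k. LBINT t. fc y t * ?H k y t) \<longlonglongrightarrow> (LBINT t. phi y * ?l t)"
  proof (rule integral_dominated_convergence[where w = "\<lambda>t. c * ind {-M..M} t", OF _ _ wi])
   have "(\<lambda>k. fc y t * ?H k y t) \<longlonglongrightarrow> phi y * ?l t" if t: "t \<noteq> ?U y" "t \<noteq> ?L y" for t
   proof -
    have "(\<lambda>k. ?H k y t) \<longlonglongrightarrow> phi y * ((1/2) * ((if t < ?U y then 1 else 0) + (if t < ?L y then 1 else 0)) - (if t < 0 then 1 else 0))"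
     by (rule filterlim_compose[OF smear_tendsto[OF phi open_\<Omega> u lim[OF t]] e_right])
    hence "(\<lambda>k. fc y t * ?H k y t) \<longlonglongrightarrow> fc y t * (phi y * ((1/2) * ((if t < ?U y then 1 else 0) + (if t < ?L y then 1 else 0)) - (if t < 0 then 1 else 0)))"
     by (intro tendsto_mult tendsto_const)
    moreover have "fc y t * (phi y * ((1/2) * ((if t < ?U y then 1 else 0) + (if t < ?L y then 1 else 0)) - (if t < 0 then 1 else 0))) = phi y * ?l t"
     by (simp add: orient_def algebra_simps)
    ultimately show ?thesis by (simp only:)
   qed
   thus "AE t in lborel. (\<lambda>k. fc y t * ?H k y t) \<longlonglongrightarrow> phi y * ?l t"
    using AE_lborel_singleton[of "?U y"] AE_lborel_singleton[of "?L y"] by (auto elim: eventually_elim2)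
  qed (use fcH_le in auto)
  also have "(LBINT t. phi y * ?l t) = phi y * half_trace u y"
   unfolding half_trace_def primitive_def by (simp add: orient_fc_integrable)
  finally show ?thesis .
 qed
 show ?thesis
 proof (rule integral_dominated_convergence[where w = "\<lambda>y. 1 * (c * (2 * M))"])
  show "AE y in sig. (\<lambda>k. zeta i y * (LBINT t. fc y t * ?H k y t)) \<longlonglongrightarrow> zeta i y * (phi y * half_trace u y)"
   using fine by eventually_elim (intro tendsto_mult tendsto_const inner, auto)
  have [measurable]: "(\<lambda>y. LBINT t. fc y t * ?H k y t) \<in> Borel" for k
   using Hm[of k] by (intro lborel.borel_measurable_lebesgue_integral) (simp add: split_beta)
  show "(\<lambda>y. zeta i y * (LBINT t. fc y t * ?H k y t)) \<in> borel_measurable sig" for k by measurable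
  show "(\<lambda>y. zeta i y * (phi y * half_trace u y)) \<in> borel_measurable sig"
   using half_trace_measurable[OF u u_le] by measurable
  have "\<bar>zeta i y * (LBINT t. fc y t * ?H k y t)\<bar> \<le> 1 * (c * (2 * M))" for k y
   unfolding abs_mult
  proof (intro mult_mono)
   have "\<bar>LBINT t. fc y t * ?H k y t\<bar> \<le> (LBINT t. c * ind {-M..M} t)"
    by (rule order_trans[OF integral_norm_bound[of lborel "\<lambda>t. fc y t * ?H k y t", unfolded real_norm_def] integral_mono'[OF wi fcH_le]])
     (use c0 in simp)
   thus "\<bar>LBINT t. fc y t * ?H k y t\<bar> \<le> c * (2 * M)" using M_pos by (simp add: measure_def emeasure_lborel_Icc_eq)
  qed (use zeta_nonneg zeta_le_1 in auto)
  thus "AE y in sig. norm (zeta i y * (LBINT t. fc y t * ?H k y t)) \<le> 1 * (c * (2 * M))" for k by simp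
 qed simp
qed

context partitioned_family
begin

lemma C1c_on_interior_C: assumes "C1c_on \<Omega> phi" obtains m where "C1c_on (interior (C m)) phi"
proof -
 obtain K where K: "compact K" "K \<subseteq> \<Omega>" "\<And>x. x \<notin> K ==> phi x = 0" using assms unfolding C1c_on_def by blast
 have "K \<subseteq> (\<Union>n\<in>UNIV. interior (C n))"
 proof
  fix x assume "x \<in> K"
  hence "x \<in> \<Omega>" using K(2) by blast
  then obtain n where "x \<in> interior (C n)" by (rule in_interior_C)
  thus "x \<in> (\<Union>n\<in>UNIV. interior (C n))" by blast
 qed
 then obtain I where I: "finite I" "K \<subseteq> (\<Union>n\<in>I. interior (C n))"
  using compactE_image[OF K(1), of UNIV "\<lambda>n. interior (C n)"] by auto
 have "interior (C n) \<subseteq> interior (C (Max I))" if "n \<in> I" for n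
  using that I(1) by (intro interior_mono C_mono Max_ge)
 hence "K \<subseteq> interior (C (Max I))" using I(2) by blast
 hence "C1c_on (interior (C (Max I))) phi"
  using assms K(1,3) unfolding C1c_on_def by (intro conjI exI[of _ K]) simp_all
 thus thesis by (rule that)
qed

lemma AE_in_\<Omega>: "AE y in sig. y \<in> \<Omega>"
proof -
 have "emeasure sig (- \<Omega>) = 0" using mpn_outside open_\<Omega> by (intro sig_null) auto
 hence "- \<Omega> \<in> null_sets sig" using open_\<Omega> by (auto simp: null_sets_def sig_sets)
 from AE_not_in[OF this] show ?thesis by simp
qed

lemma abs_primitive_le: assumes "\<bar>w\<bar> \<le> M" shows "\<bar>primitive y w\<bar> \<le> 2 * M"
proof -
 have "\<bar>primitive y w\<bar> \<le> (LBINT t. ind {-M..M} t)"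
  unfolding primitive_def
 proof (rule order_trans[OF integral_norm_bound[of lborel "\<lambda>t. orient t w * fc y t", unfolded real_norm_def]], rule integral_mono')
  show "\<bar>orient t w * fc y t\<bar> \<le> ind {-M..M} t" for t
   using mult_mono[OF abs_orient_le[OF assms, of t] abs_fc_le[of y t]] by (simp add: abs_mult)
 qed (auto simp: emeasure_lborel_Icc_eq)
 thus ?thesis using M_pos by (simp add: measure_def emeasure_lborel_Icc_eq)
qed

text \<open>Both error estimates are of order \<open>dlt k\<close>, so the limit is decided by
  finitely many mollified pieces, with radii \<open>eps k i\<close> at most
  \<open>dlt k\<close>.\<close>

lemma pairing_converges:
 fixes u phi :: "'a => real"
 assumes dlt: "\<And>k. dlt k > 0" "dlt \<longlonglongrightarrow> 0" and adm: "\<And>k. admissible (dlt k) (eps k)"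
  and ui: "Lint u" and u[measurable]: "u \<in> Borel" and u_le: "\<And>x. \<bar>u x\<bar> \<le> M"
  and BV: "\<And>Phi. C1c_on \<Omega> Phi ==> (\<And>x. norm (Phi x) \<le> 1) ==> (LBINT x. u x * divergence Phi x) \<le> V"
  and phi: "C1c_on \<Omega> phi"
 shows "(\<lambda>k. LBINT x. phi x * (LBINT t. orient t (u x) * divergence (\<lambda>y. mollified_family.bk b zeta (dlt k) (eps k) y t) x))
   \<longlonglongrightarrow> (\<integral>y. phi y * half_trace u y \<partial>sig)" (is "?A \<longlonglongrightarrow> ?a")
  and "(\<lambda>k. LBINT x. LBINT t. orient t (u x) * (mollified_family.bk b zeta (dlt k) (eps k) x t \<bullet> grad phi x))
   \<longlonglongrightarrow> (LBINT x. LBINT t. orient t (u x) * (b x t \<bullet> grad phi x))" (is "?B \<longlonglongrightarrow> ?b")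
proof -
 interpret K: mollified_family \<Omega> b B mp mn sig f C zeta M "dlt k" "eps k" for k
  by unfold_locales (rule dlt(1) adm)+
 interpret s: finite_measure sig by (rule sig_fin)
 obtain m where m: "C1c_on (interior (C m)) phi" using C1c_on_interior_C[OF phi] .
 obtain c where c: "\<And>x. \<bar>phi x\<bar> \<le> c" using C1c_on_bounded[OF phi] by (metis real_norm_def)
 obtain c' where c': "\<And>x. norm (grad phi x) \<le> c'" using grad_bounded[OF phi] by blast
 have lim0: "(\<lambda>k. r * dlt k) \<longlonglongrightarrow> 0" for r using tendsto_mult[OF tendsto_const[of r] dlt(2)] by simp
 show "?B \<longlonglongrightarrow> ?b"
 proof (rule LIM_zero_cancel, rule Lim_null_comparison[OF always_eventually[OF allI]])
  show "norm (?B k - ?b) \<le> (2 * M * c' * (1 + B * vol (C m))) * dlt k" for k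
   using K.gradient_term_error[OF u u_le m c', of k] by (simp add: mult_ac)
 qed (rule lim0)
 obtain N D where N: "hnull N" and D: "\<And>a b :: real. a < b ==> \<exists>t\<in>D. a < t \<and> t < b"
  and tri: "\<And>t y. t \<in> D ==> y \<in> \<Omega> - N ==> fine_at {x \<in> \<Omega>. t < u x} y"
  using superlevel_fine_structure[OF ui u BV] by blast
 have fine: "AE y in sig. y \<in> \<Omega> \<and> (\<forall>t. t \<noteq> ap_upper \<Omega> u y \<and> t \<noteq> ap_lower \<Omega> u y \<longrightarrow>
   ((\<lambda>eps. moll_avg eps {x \<in> \<Omega>. t < u x} y) \<longlongrightarrow>
    (1/2) * ((if t < ap_upper \<Omega> u y then 1 else 0) + (if t < ap_lower \<Omega> u y then 1 else 0))) (at_right 0))"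
  using hnull_AE_sig[OF N] AE_in_\<Omega>
 proof eventually_elim
  case (elim y)
  thus ?case using moll_avg_superlevel_tendsto[OF open_\<Omega> u u_le _ D tri] by blast
 qed
 let ?n = "Suc (Suc m)"
 let ?D = "\<lambda>k i. LBINT x. LBINT t. orient t (u x) * (phi x * K.div_part k i t x)"
 let ?S = "\<lambda>k. \<Sum>i<?n. ?D k i"
 have part: "(\<lambda>k. ?D k i) \<longlonglongrightarrow> (\<integral>y. zeta i y * (phi y * half_trace u y) \<partial>sig)" for i
  unfolding K.div_part_pairing[OF u u_le m]
 proof (rule pairing_limit[OF u u_le phi _ _ fine])
  show "eps k i > 0" for k by (rule K.eps_pos)
  show "(\<lambda>k. eps k i) \<longlonglongrightarrow> 0"
   by (rule tendsto_sandwich[OF _ _ tendsto_const dlt(2)]) (auto intro!: always_eventually less_imp_le K.eps_pos K.eps_le)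
 qed
 \<comment> \<open>On the support of \<open>phi\<close> the cutoffs with index below m + 2 sum to 1,
   so the limits of the pieces add up to the full integral.\<close>
 have "(\<Sum>i<?n. \<integral>y. zeta i y * (phi y * half_trace u y) \<partial>sig) = (\<integral>y. (\<Sum>i<?n. zeta i y * (phi y * half_trace u y)) \<partial>sig)"
 proof (rule Bintegral_sum[symmetric])
  fix i
  have [measurable]: "phi \<in> Borel" by (rule C1c_on_measurable[OF phi])
  note [measurable] = half_trace_measurable[OF u u_le]
  have R: "\<bar>half_trace u y\<bar> \<le> 2 * M" for y
  proof -
   have half: "\<bar>(1/2) * (p + q)\<bar> \<le> r" if "\<bar>p\<bar> \<le> r" "\<bar>q\<bar> \<le> r" for p q r :: real
    using abs_triangle_ineq[of p q] that by (simp add: abs_mult)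
   show ?thesis unfolding half_trace_def
    using ap_upper_bounds[OF open_\<Omega> u u_le] ap_lower_bounds[OF open_\<Omega> u u_le] M_pos by (intro half abs_primitive_le) auto
  qed
  have "\<bar>zeta i y * (phi y * half_trace u y)\<bar> \<le> 1 * (c * (2 * M))" for y
   unfolding abs_mult[of "zeta i y"] abs_mult[of "phi y"] using zeta_nonneg zeta_le_1 c[of y] by (intro mult_mono c R) auto
  hence b: "norm (zeta i y * (phi y * half_trace u y)) \<le> 1 * (c * (2 * M))" for y by simp
  have "(\<lambda>y. zeta i y * (phi y * half_trace u y)) \<in> borel_measurable sig"
   by measurable
  from s.integrable_const_bound[OF AE_I2[OF b] this] show "integrable sig (\<lambda>y. zeta i y * (phi y * half_trace u y))" .
 qed
 also have "\<dots> = ?a"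
 proof (intro Bintegral_cong refl)
  fix y
  show "(\<Sum>i<?n. zeta i y * (phi y * half_trace u y)) = phi y * half_trace u y"
  proof (cases "y \<in> interior (C m)")
   case True
   hence "y \<in> C (Suc m)" using interior_subset C_mono[of m "Suc m"] by auto
   from zeta_sum[OF this] show ?thesis by (simp only: sum_distrib_right[symmetric] mult_1)
  qed (simp add: C1c_on_outside(1)[OF m])
 qed
 finally have sum: "(\<Sum>i<?n. \<integral>y. zeta i y * (phi y * half_trace u y) \<partial>sig) = ?a" .
 have S: "?S \<longlonglongrightarrow> ?a" unfolding sum[symmetric] by (rule tendsto_sum) (rule part)
 have "(\<lambda>k. (1 / (1 + dlt k)) * ?S k) \<longlonglongrightarrow> (1 / (1 + 0)) * ?a"
  by (intro tendsto_mult tendsto_divide tendsto_add tendsto_const dlt(2) S) simp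
 moreover have "(\<lambda>k. ?A k - (1 / (1 + dlt k)) * ?S k) \<longlonglongrightarrow> 0"
 proof (rule Lim_null_comparison[OF always_eventually[OF allI]])
  show "norm (?A k - (1 / (1 + dlt k)) * ?S k) \<le> (2 * M * c) * dlt k" for k
   using K.main_term_error[OF u u_le m c, of k] by (simp only: real_norm_def mult.assoc)
 qed (rule lim0)
 ultimately show "?A \<longlonglongrightarrow> ?a"
  by (auto dest: Lim_transform)
qed

end


section \<open>Reduction to Borel data on the whole space\<close>

text \<open>Measurability of \<open>h\<close> comes for free: it differs from \<open>g\<close> only
  inside a Borel null set, all of whose subsets are Lebesgue measurable.\<close>

lemma integral_lebesgue_cong_AE:
 fixes g h :: "'a::euclidean_space => 'b::{banach, second_countable_topology}"
 assumes g: "g \<in> Borel" and ae: "AE x in lborel. h x = g x"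
 shows "integral\<^sup>L lebesgue h = integral\<^sup>L lborel g"
proof -
 have gl: "g \<in> borel_measurable lebesgue" using g by (simp add: measurable_completion)
 obtain N where N: "N \<in> null_sets lborel" "{x. h x \<noteq> g x} \<subseteq> N"
  using ae by (auto elim!: AE_E simp: null_sets_def)
 have "h \<in> borel_measurable lebesgue"
 proof (rule measurableI)
  fix A :: "'b set" assume A: "A \<in> sets borel"
  have "h -` A \<inter> space lebesgue = (g -` A - N) \<union> (h -` A \<inter> N)"
  proof (intro set_eqI)
   fix x show "x \<in> h -` A \<inter> space lebesgue \<longleftrightarrow> x \<in> (g -` A - N) \<union> (h -` A \<inter> N)"
   proof (cases "x \<in> N")
    case False
    hence "h x = g x" using N(2) by blast
    with False show ?thesis by simp
   qed simp
  qed
  moreover have "h -` A \<inter> N \<in> sets lebesgue" by (rule null_sets_completion[OF N(1)]) auto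
  moreover have "N \<in> sets lebesgue" by (rule null_sets_completion[OF N(1)]) auto
  moreover have "g -` A \<in> sets lebesgue" using measurable_sets[OF gl A] by simp
  ultimately show "h -` A \<inter> space lebesgue \<in> sets lebesgue" by (simp only: sets.Un sets.Diff)
 qed simp
 hence "integral\<^sup>L lebesgue h = integral\<^sup>L lebesgue g" by (rule integral_cong_AE[OF _ gl AE_completion[OF ae]])
 also have "\<dots> = integral\<^sup>L lborel g" by (rule integral_completion) (use g in simp)
 finally show ?thesis .
qed

lemma set_integral_oriented:
 fixes u v c :: "'a::euclidean_space => real" and G :: "'a => real => real"
 assumes uv: "AE x in lborel. x \<in> \<Omega> \<longrightarrow> u x = v x"
  and G: "\<And>x. x \<in> \<Omega> ==> G x \<in> Borel"
  and m: "(\<lambda>x. c x * (LBINT t. orient t (v x) * G x t)) \<in> Borel"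
  and z: "\<And>x. x \<notin> \<Omega> ==> c x * (LBINT t. orient t (v x) * G x t) = 0"
 shows "(LINT x:\<Omega>|lebesgue. c x * (LBINT t=0..u x. G x t)) = (LBINT x. c x * (LBINT t. orient t (v x) * G x t))"
 unfolding set_lebesgue_integral_def
proof (rule integral_lebesgue_cong_AE[OF m])
 show "AE x in lborel. ind \<Omega> x *\<^sub>R (c x * (LBINT t=0..u x. G x t)) = c x * (LBINT t. orient t (v x) * G x t)"
  using uv
 proof eventually_elim
  case (elim x)
  thus ?case using z[of x] interval_integral_eq_orient[OF G, of x "u x"] by (cases "x \<in> \<Omega>") (simp_all add: zero_ereal_def)
 qed
qed

lemma id_measurable_restrict_space:
 assumes "sets M = sets (restrict_space borel \<Omega>)" shows "(\<lambda>x. x) \<in> measurable M borel"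
 by (simp only: measurable_cong_sets[OF assms refl]) (rule measurable_restrict_space1, simp)

abbreviation ext_measure :: "'a::topological_space measure => 'a measure" where
 "ext_measure M \<equiv> distr M borel (\<lambda>x. x)"

lemma emeasure_ext_measure:
 assumes "sets M = sets (restrict_space borel \<Omega>)" "E \<in> sets borel"
 shows "emeasure (ext_measure M) E = emeasure M (E \<inter> \<Omega>)"
 using assms(2) sets_eq_imp_space_eq[OF assms(1)] id_measurable_restrict_space[OF assms(1)]
 by (simp add: emeasure_distr space_restrict_space)

text \<open>The approximate limits depend only on volumes of superlevel sets, hence only on the
  class of u; they may be computed from a Borel representative.\<close>

lemma ap_upper_cong_AE:
 fixes u v :: "'a::euclidean_space => real"
 assumes \<Omega>: "open \<Omega>" and u: "(\<lambda>x. ind \<Omega> x * u x) \<in> borel_measurable lebesgue" and v: "v \<in> Borel"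
  and uv: "AE x in lborel. x \<in> \<Omega> \<longrightarrow> u x = v x"
 shows "ap_upper \<Omega> u y = ap_upper \<Omega> v y"
proof -
 have "measure lebesgue ({x \<in> \<Omega>. t < u x} \<inter> ball y r) = measure lebesgue ({x \<in> \<Omega>. t < v x} \<inter> ball y r)" for t r
 proof (rule measure_eq_AE)
  show "AE x in lebesgue. x \<in> {x \<in> \<Omega>. t < u x} \<inter> ball y r \<longleftrightarrow> x \<in> {x \<in> \<Omega>. t < v x} \<inter> ball y r"
   by (rule AE_completion) (use uv in \<open>eventually_elim, auto\<close>)
  have "{x \<in> space lebesgue. t < ind \<Omega> x * u x} \<in> sets lebesgue" using u by measurable
  hence "\<Omega> \<inter> {x \<in> space lebesgue. t < ind \<Omega> x * u x} \<inter> ball y r \<in> sets lebesgue" using \<Omega> by (intro sets.Int) auto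
  moreover have "\<Omega> \<inter> {x \<in> space lebesgue. t < ind \<Omega> x * u x} \<inter> ball y r = {x \<in> \<Omega>. t < u x} \<inter> ball y r" by auto
  ultimately show "{x \<in> \<Omega>. t < u x} \<inter> ball y r \<in> sets lebesgue" by simp
  show "{x \<in> \<Omega>. t < v x} \<inter> ball y r \<in> sets lebesgue"
   using superlevel_measurable[OF \<Omega> v] by (intro sets.Int) auto
 qed
 thus ?thesis unfolding ap_upper_def density_zero_def by presburger
qed

lemma ap_lower_cong_AE:
 fixes u v :: "'a::euclidean_space => real"
 assumes \<Omega>: "open \<Omega>" and u: "(\<lambda>x. ind \<Omega> x * u x) \<in> borel_measurable lebesgue" and v: "v \<in> Borel"
  and uv: "AE x in lborel. x \<in> \<Omega> \<longrightarrow> u x = v x"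
 shows "ap_lower \<Omega> u y = ap_lower \<Omega> v y"
 unfolding ap_lower_eq
proof (rule arg_cong[where f = uminus], rule ap_upper_cong_AE[OF \<Omega>])
 show "(\<lambda>x. ind \<Omega> x * - u x) \<in> borel_measurable lebesgue" using u by simp
 show "AE x in lborel. x \<in> \<Omega> \<longrightarrow> - u x = - v x" using uv by eventually_elim simp
qed (use v in simp)

lemma is_BV_bounded_Borel_representative:
 fixes \<Omega> :: "'a::euclidean_space set"
 assumes \<Omega>: "open \<Omega>" and M: "M > 0" and BV: "is_BV \<Omega> u" and le: "AE x in lebesgue_on \<Omega>. \<bar>u x\<bar> \<le> M"
 obtains v V where "v \<in> Borel" "\<And>x. \<bar>v x\<bar> \<le> M" "Lint v" "AE x in lborel. x \<in> \<Omega> \<longrightarrow> u x = v x"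
  "\<And>Phi. C1c_on \<Omega> Phi ==> (\<And>x. norm (Phi x) \<le> 1) ==> (LBINT x. v x * divergence Phi x) \<le> V"
  "(\<lambda>x. ind \<Omega> x * u x) \<in> borel_measurable lebesgue"
proof -
 have [measurable]: "\<Omega> \<in> sets borel" using \<Omega> by simp
 have ui: "integrable lebesgue (\<lambda>x. ind \<Omega> x * u x)" using BV by (simp add: is_BV_def set_integrable_def)
 hence um: "(\<lambda>x. ind \<Omega> x * u x) \<in> borel_measurable lebesgue" by (rule borel_measurable_integrable)
 obtain V where V: "\<And>Phi. C1c_on \<Omega> Phi ==> (\<And>x. norm (Phi x) \<le> 1) ==> (LINT x:\<Omega>|lebesgue. u x * divergence Phi x) \<le> V"
  using BV unfolding is_BV_def by blast
 obtain w where w: "w \<in> borel_measurable lborel" "AE x in lborel. ind \<Omega> x * u x = w x"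
  using completion_ex_borel_measurable_real[OF um] by blast
 \<comment> \<open>Truncation at M and extension by zero turn the almost everywhere bound into one
   that holds everywhere.\<close>
 define v where "v x = ind \<Omega> x * max (- M) (min M (w x))" for x
 have v[measurable]: "v \<in> Borel" using w(1) unfolding v_def by simp
 have "AE x in lborel. x \<in> \<Omega> \<longrightarrow> \<bar>u x\<bar> \<le> M"
  using le by (subst (asm) AE_restrict_space_iff) (auto simp: AE_completion_iff)
 with w(2) have uv0: "AE x in lborel. ind \<Omega> x * u x = v x"
  by eventually_elim (auto simp: v_def indicator_def abs_le_iff max_def min_def split: if_splits)
 hence uv: "AE x in lborel. x \<in> \<Omega> \<longrightarrow> u x = v x" by eventually_elim auto
 have "integrable lebesgue v"
  by (rule Bochner_Integration.integrable_cong_AE_imp[OF ui _ AE_completion]) (use uv0 v in \<open>auto simp: measurable_completion\<close>)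
 hence vi: "Lint v" by (subst (asm) integrable_completion) auto
 show thesis
 proof (rule that[OF v _ vi uv _ um])
  show "\<bar>v x\<bar> \<le> M" for x using M by (auto simp: v_def indicator_def)
  fix Phi :: "'a => 'a" assume Phi: "C1c_on \<Omega> Phi" "\<And>x. norm (Phi x) \<le> 1"
  have "divergence Phi \<in> Borel" using divergence_continuous[OF Phi(1)] by (rule borel_measurable_continuous_onI)
  hence "(\<lambda>x. v x * divergence Phi x) \<in> Borel" by measurable
  hence "(LINT x:\<Omega>|lebesgue. u x * divergence Phi x) = (LBINT x. v x * divergence Phi x)"
   unfolding set_lebesgue_integral_def
   by (rule integral_lebesgue_cong_AE) (use uv0 in \<open>eventually_elim, auto simp: mult.assoc[symmetric]\<close>)
  thus "(LBINT x. v x * divergence Phi x) \<le> V" using V[OF Phi] by simp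
 qed
qed

lemma (in mollified_family) pairing_smooth_eq:
 assumes v[measurable]: "v \<in> Borel" and v_le: "\<And>x. \<bar>v x\<bar> \<le> M"
  and uv: "AE x in lborel. x \<in> \<Omega> \<longrightarrow> u x = v x" and phi: "C1c_on \<Omega> phi"
 shows "pairing_smooth \<Omega> bk u phi = - (LBINT x. phi x * (LBINT t. orient t (v x) * divergence (\<lambda>y. bk y t) x))
  - (LBINT x. LBINT t. orient t (v x) * (bk x t \<bullet> grad phi x))"
proof -
 obtain m where m: "C1c_on (interior (C m)) phi" using C1c_on_interior_C[OF phi] .
 obtain c where c: "\<And>x. \<bar>phi x\<bar> \<le> c" using bounded_C1c[OF phi] by blast
 obtain c' where c': "\<And>x. norm (grad phi x) \<le> c'" using grad_bounded[OF phi] by blast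
 have z: "phi x = 0" "grad phi x = 0" if "x \<notin> \<Omega>" for x
  using that C1c_on_outside(1)[OF phi] grad_outside[OF phi] by auto
 have "(LINT x:\<Omega>|lebesgue. phi x * (LBINT t=0..u x. divergence (\<lambda>y. bk y t) x)) = (LBINT x. phi x * (LBINT t. orient t (v x) * divergence (\<lambda>y. bk y t) x))"
 proof (rule set_integral_oriented[OF uv])
  fix x assume "x \<in> \<Omega>"
  hence "continuous_on UNIV (\<lambda>t. divergence (\<lambda>y. bk y t) x)"
   using divergence_bk_tendsto by (auto simp: continuous_on_sequentially o_def)
  thus "(\<lambda>t. divergence (\<lambda>y. bk y t) x) \<in> Borel" by (rule borel_measurable_continuous_onI)
 qed (use borel_measurable_integrable[OF main_term_integrable[OF v v_le m c]] z in auto)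
 moreover have "(LINT x:\<Omega>|lebesgue. 1 * (LBINT t=0..u x. bk x t \<bullet> grad phi x)) = (LBINT x. 1 * (LBINT t. orient t (v x) * (bk x t \<bullet> grad phi x)))"
 proof (rule set_integral_oriented[OF uv])
  fix x assume x: "x \<in> \<Omega>"
  have "continuous_on UNIV (\<lambda>t. bk x t)"
   using continuous_on_compose2[OF bk_continuous continuous_on_Pair[OF continuous_on_const[of UNIV x] continuous_on_id]] x by auto
  thus "(\<lambda>t. bk x t \<bullet> grad phi x) \<in> Borel"
   by (intro borel_measurable_continuous_onI continuous_intros)
 qed (use borel_measurable_integrable[OF gradient_term_integrable[OF v v_le m c']] z in auto)
 ultimately show ?thesis by (simp add: pairing_smooth_def)
qed

text \<open>For \<open>sig\<close>-almost every y the density and its truncation agree at almost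
  every level, hence have the same primitive. The rest passes from the data on Omega to their
  extensions.\<close>

lemma (in partitioned_family) pairing_half_eq:
 assumes b0: "\<And>x t. x \<in> \<Omega> ==> b x t = b0 x t" and f0: "\<And>x t. x \<in> \<Omega> ==> f x t = f0 x t"
  and sig0: "sets sig0 = sets (restrict_space borel \<Omega>)" "sig = ext_measure sig0"
  and um: "(\<lambda>x. ind \<Omega> x * u x) \<in> borel_measurable lebesgue"
  and v[measurable]: "v \<in> Borel" and v_le: "\<And>x. \<bar>v x\<bar> \<le> M"
  and uv: "AE x in lborel. x \<in> \<Omega> \<longrightarrow> u x = v x" and phi: "C1c_on \<Omega> phi"
 shows "pairing_half \<Omega> sig0 f0 b0 u phi =
  - (\<integral>y. phi y * half_trace v y \<partial>sig)
  - (LBINT x. LBINT t. orient t (v x) * (b x t \<bullet> grad phi x))"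
proof -
 have [measurable]: "phi \<in> Borel" by (rule C1c_on_measurable[OF phi])
 have [measurable]: "grad phi \<in> Borel" using grad_continuous[OF phi] by (rule borel_measurable_continuous_onI)
 have sp: "space sig0 = \<Omega>" using sets_eq_imp_space_eq[OF sig0(1)] by (simp add: space_restrict_space)
 let ?U = "\<lambda>y. if y \<in> \<Omega> then ap_upper \<Omega> v y else 0" and ?L = "\<lambda>y. if y \<in> \<Omega> then ap_lower \<Omega> v y else 0"
 note Um[measurable] = ap_upper_measurable[OF open_\<Omega> v v_le] ap_lower_measurable[OF open_\<Omega> v v_le]
 define P where "P y w = (LBINT t. orient t w * f y t)" for y w
 have Pm: "(\<lambda>y. P y (h y)) \<in> Borel" if [measurable]: "h \<in> Borel" for h
  unfolding P_def by (rule lborel.borel_measurable_lebesgue_integral) measurable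
 have Pf: "prim_f f0 x w = P x w" if "x \<in> \<Omega>" for x w
 proof -
  have "f0 x = f x" using f0 that by auto
  thus ?thesis unfolding prim_f_def P_def by (subst interval_integral_eq_orient) auto
 qed
 have "(\<integral>x. (1/2) * (prim_f f0 x (ap_upper \<Omega> u x) + prim_f f0 x (ap_lower \<Omega> u x)) * phi x \<partial>sig0)
  = (\<integral>y. phi y * ((1/2) * (P y (?U y) + P y (?L y))) \<partial>sig0)"
  by (intro Bintegral_cong refl)
   (simp add: sp Pf ap_upper_cong_AE[OF open_\<Omega> um v uv] ap_lower_cong_AE[OF open_\<Omega> um v uv])
 also have "\<dots> = (\<integral>y. phi y * ((1/2) * (P y (?U y) + P y (?L y))) \<partial>sig)"
  unfolding sig0(2) by (rule integral_distr[symmetric, OF id_measurable_restrict_space[OF sig0(1)]]) (use Pm[OF Um(1)] Pm[OF Um(2)] in measurable)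
 also have "\<dots> = (\<integral>y. phi y * half_trace v y \<partial>sig)"
 proof (rule integral_cong_AE)
  show "(\<lambda>y. phi y * ((1/2) * (P y (?U y) + P y (?L y)))) \<in> borel_measurable sig"
   using Pm[OF Um(1)] Pm[OF Um(2)] by measurable
  show "(\<lambda>y. phi y * half_trace v y) \<in> borel_measurable sig"
   using half_trace_measurable[OF v v_le] by measurable
  show "AE y in sig. phi y * ((1/2) * (P y (?U y) + P y (?L y))) = phi y * half_trace v y"
   using AE_eq_fc
  proof eventually_elim
   case (elim y)
   have "P y w = primitive y w" for w
    unfolding P_def primitive_def by (rule integral_cong_AE, measurable, use elim in eventually_elim, simp)
   thus ?case by (simp add: half_trace_def)
  qed
 qed
 finally have 1: "(\<integral>x. (1/2) * (prim_f f0 x (ap_upper \<Omega> u x) + prim_f f0 x (ap_lower \<Omega> u x)) * phi x \<partial>sig0)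
  = (\<integral>y. phi y * half_trace v y \<partial>sig)" .
 have "(LINT x:\<Omega>|lebesgue. prim_b b0 x (u x) \<bullet> grad phi x) = (LBINT x. LBINT t. orient t (v x) * (b x t \<bullet> grad phi x))"
  unfolding set_lebesgue_integral_def
 proof (rule integral_lebesgue_cong_AE)
  show "(\<lambda>x. LBINT t. orient t (v x) * (b x t \<bullet> grad phi x)) \<in> Borel"
   by (rule lborel.borel_measurable_lebesgue_integral) measurable
  show "AE x in lborel. ind \<Omega> x *\<^sub>R (prim_b b0 x (u x) \<bullet> grad phi x) = (LBINT t. orient t (v x) * (b x t \<bullet> grad phi x))"
   using uv
  proof eventually_elim
   case (elim x)
   show ?case
   proof (cases "x \<in> \<Omega>")
    case True
    have i: "Lint (\<lambda>t. orient t (v x) *\<^sub>R b x t)"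
    proof (rule Bintegrable_bound[of _ "\<lambda>t. B * ind {-M..M} t"])
     show "AE t in lborel. norm (orient t (v x) *\<^sub>R b x t) \<le> norm (B * ind {-M..M} t)"
      using mult_mono[OF abs_orient_le[OF v_le] b_le] B_nonneg by (simp add: abs_mult mult.commute)
    qed (auto simp: emeasure_lborel_Icc_eq)
    have "b0 x = b x" using b0 True by auto
    hence "prim_b b0 x (u x) = (LBINT t. orient t (v x) *\<^sub>R b x t)"
     unfolding prim_b_def using elim True by (subst interval_integral_eq_orient) auto
    thus ?thesis using True by (simp add: integral_inner_left[OF i, symmetric])
   qed (simp add: grad_outside[OF phi])
  qed
 qed
 thus ?thesis unfolding pairing_half_def 1 by simp
qed

theorem theorem5p4:
  fixes \<Omega> :: "'a::euclidean_space set"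
    and b :: "'a \<Rightarrow> real \<Rightarrow> 'a"
    and mp mn :: "real \<Rightarrow> 'a measure"
    and \<sigma> :: "'a measure"
    and f :: "'a \<Rightarrow> real \<Rightarrow> real"
    and M :: real
  assumes dim: "DIM('a) \<ge> 2"
    and open_\<Omega>: "open \<Omega>"
    and b1_borel: "(\<lambda>p. b (fst p) (snd p)) \<in> borel_measurable (restrict_space borel (\<Omega> \<times> UNIV))"
    and b1_bdd: "\<exists>C. \<forall>x\<in>\<Omega>. \<forall>t. norm (b x t) \<le> C"
    and b2: "AE x in lebesgue_on \<Omega>. continuous_on UNIV (b x)"
    and b3: "\<forall>t. DM_inf \<Omega> (\<lambda>x. b x t) (mp t) (mn t)"
    and b4_sets: "sets \<sigma> = sets (restrict_space borel \<Omega>)"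
    and b4_fin: "emeasure \<sigma> \<Omega> < \<infinity>"
    and b4_lub: "\<forall>E\<in>sets \<sigma>. emeasure \<sigma> E =
                   lub_meas \<Omega> (\<lambda>t E. emeasure (mp t) E + emeasure (mn t) E) UNIV E"
    and f_borel: "(\<lambda>p. f (fst p) (snd p)) \<in> borel_measurable (restrict_space borel (\<Omega> \<times> UNIV))"
    and f_dens: "\<forall>t. set_integrable \<sigma> \<Omega> (\<lambda>x. f x t) \<and>
                   (\<forall>E\<in>sets \<sigma>. measure (mp t) E - measure (mn t) E = set_lebesgue_integral \<sigma> E (\<lambda>x. f x t))"
    and M_pos: "M > 0"
  shows "\<exists>bk :: nat \<Rightarrow> 'a \<Rightarrow> real \<Rightarrow> 'a.
     (\<forall>k.
       \<comment> \<open>(c1)\<close>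
       continuous_on (\<Omega> \<times> UNIV) (\<lambda>p. bk k (fst p) (snd p)) \<and>
       bounded ((\<lambda>p. bk k (fst p) (snd p)) ` (\<Omega> \<times> UNIV)) \<and>
       (\<forall>L. (AE p in lebesgue_on \<Omega> \<Otimes>\<^sub>M lborel. norm (b (fst p) (snd p)) \<le> L) \<longrightarrow>
             (\<forall>x\<in>\<Omega>. \<forall>t. norm (bk k x t) \<le> L)) \<and>
       \<comment> \<open>(c2)\<close>
       (\<forall>t. smooth_on \<Omega> (\<lambda>x. bk k x t) \<and>
          (t \<in> {-M..M} \<longrightarrow>
             (\<integral>\<^sup>+x\<in>\<Omega>. ennreal \<bar>divergence (\<lambda>y. bk k y t) x\<bar> \<partial>lebesgue)
               \<le> emeasure (mp t) \<Omega> + emeasure (mn t) \<Omega> + ennreal (1 / real (Suc k)))) \<and>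
       \<comment> \<open>(c3)\<close>
       (\<exists>\<rho>. sets \<rho> = sets (restrict_space borel \<Omega>) \<and>
          (\<forall>E\<in>sets \<rho>. emeasure \<rho> E =
              lub_meas \<Omega> (\<lambda>t E. \<integral>\<^sup>+x\<in>E. ennreal \<bar>divergence (\<lambda>y. bk k y t) x\<bar> \<partial>lebesgue) {-M..M} E) \<and>
          emeasure \<rho> \<Omega> \<le> emeasure \<sigma> \<Omega> + ennreal (1 / real (Suc k)))) \<and>
     \<comment> \<open>(c4)\<close>
     (\<forall>u. is_BV \<Omega> u \<and> (AE x in lebesgue_on \<Omega>. \<bar>u x\<bar> \<le> M) \<longrightarrow>
        (\<forall>\<phi>::'a \<Rightarrow> real. C1c_on \<Omega> \<phi> \<longrightarrow>
           (\<lambda>k. pairing_smooth \<Omega> (bk k) u \<phi>) \<longlonglongrightarrow> pairing_half \<Omega> \<sigma> f b u \<phi>))"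
proof -
 obtain B0 where B0: "\<And>x t. x \<in> \<Omega> ==> norm (b x t) \<le> B0" using b1_bdd by blast
 \<comment> \<open>If Omega is empty the given bound may be negative, whereas the extension by zero
   asks for a nonnegative one.\<close>
 define B where "B = max B0 0"
 have B: "\<And>x t. x \<in> \<Omega> ==> norm (b x t) \<le> B" "B \<ge> 0" using B0 by (auto simp: B_def max.coboundedI1)
 let ?b = "\<lambda>x t. ind \<Omega> x *\<^sub>R b x t" and ?f = "\<lambda>x t. ind \<Omega> x * f x t"
 let ?mp = "\<lambda>t. ext_measure (mp t)" and ?mn = "\<lambda>t. ext_measure (mn t)" and ?\<sigma> = "ext_measure \<sigma>"
 have \<Omega>[measurable]: "\<Omega> \<in> sets borel" using open_\<Omega> by simp
 have \<Omega>U: "\<Omega> \<times> (UNIV :: real set) \<inter> space borel \<in> sets borel" using open_\<Omega> by (simp add: open_Times)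
 have dm: "is_div_measure \<Omega> (\<lambda>x. b x t) (mp t) (mn t)" for t using b3 by (simp add: DM_inf_def)
 have ms: "sets (mp t) = sets (restrict_space borel \<Omega>)" "sets (mn t) = sets (restrict_space borel \<Omega>)"
  "finite_measure (mp t)" "finite_measure (mn t)" for t
  using dm[of t] by (auto simp: is_div_measure_def)
 have set: "A \<in> sets (restrict_space borel \<Omega>) \<longleftrightarrow> A \<in> sets borel \<and> A \<subseteq> \<Omega>" for A :: "'a set"
  using \<Omega> by (subst sets_restrict_space_iff) auto
 note em = emeasure_ext_measure[OF ms(1)] emeasure_ext_measure[OF ms(2)] emeasure_ext_measure[OF b4_sets]
 note idm = id_measurable_restrict_space[OF ms(1)] id_measurable_restrict_space[OF ms(2)] id_measurable_restrict_space[OF b4_sets]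
 have sp: "space \<sigma> = \<Omega>" using sets_eq_imp_space_eq[OF b4_sets] by (simp add: space_restrict_space)
 have sf: "finite_measure \<sigma>" using b4_fin by (intro finite_measureI) (simp add: sp)
 have b': "(\<lambda>p. ind \<Omega> (fst p) *\<^sub>R b (fst p) (snd p)) \<in> Borel"
  using b1_borel unfolding borel_measurable_restrict_space_iff[OF \<Omega>U]
  by (rule measurable_cong[THEN iffD1, rotated]) (auto simp: indicator_def)
 have bt: "(\<lambda>x. ind \<Omega> x *\<^sub>R b x t) \<in> Borel" for t
  using measurable_compose[OF _ b', of "\<lambda>x. (x, t)" borel] by simp
 have f': "(\<lambda>p. ind \<Omega> (fst p) * f (fst p) (snd p)) \<in> Borel"
  using f_borel unfolding borel_measurable_restrict_space_iff[OF \<Omega>U]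
  by (rule measurable_cong[THEN iffD1, rotated]) (auto simp: indicator_def)
 have ft[measurable]: "(\<lambda>x. ind \<Omega> x * f x t) \<in> Borel" for t
  using measurable_compose[OF _ f', of "\<lambda>x. (x, t)" borel] by simp
 have F: "field_family \<Omega> ?b B ?mp ?mn ?\<sigma> ?f"
 proof (rule field_family.intro)
  show "norm (ind \<Omega> x *\<^sub>R b x t) \<le> B" for x t using B by (auto simp: indicator_def)
  show "AE x in lborel. continuous_on UNIV (\<lambda>t. ind \<Omega> x *\<^sub>R b x t)"
  proof -
   have "AE x in lborel. x \<in> \<Omega> \<longrightarrow> continuous_on UNIV (b x)"
    using b2 \<Omega> by (subst (asm) AE_restrict_space_iff) (auto simp: AE_completion_iff)
   thus ?thesis
   proof eventually_elim
    case (elim x) thus ?case by (cases "x \<in> \<Omega>") (auto intro: continuous_intros)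
   qed
  qed
  show "finite_measure (ext_measure (mp t))" "finite_measure (ext_measure (mn t))" for t
   by (intro finite_measure.finite_measure_distr ms idm)+
  show "finite_measure (ext_measure \<sigma>)" by (intro finite_measure.finite_measure_distr sf idm)
  show "\<exists>P\<in>sets borel. emeasure (ext_measure (mn t)) P = 0 \<and> emeasure (ext_measure (mp t)) (- P) = 0" for t
  proof -
   obtain P where P: "P \<in> sets (restrict_space borel \<Omega>)" "emeasure (mn t) P = 0" "emeasure (mp t) (\<Omega> - P) = 0"
    using dm[of t] unfolding is_div_measure_def by blast
   have "- P \<inter> \<Omega> = \<Omega> - P" "P \<inter> \<Omega> = P" using P(1) set by auto
   thus ?thesis using P set by (intro bexI[of _ P]) (auto simp: em)
  qed
  show "emeasure (ext_measure (mp t)) (- \<Omega>) = 0" "emeasure (ext_measure (mn t)) (- \<Omega>) = 0" for t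
   using open_\<Omega> by (auto simp: em)
  show "(LBINT x. (ind \<Omega> x *\<^sub>R b x t) \<bullet> grad phi x) = - (integral\<^sup>L (ext_measure (mp t)) phi - integral\<^sup>L (ext_measure (mn t)) phi)"
   if phi: "C1c_on \<Omega> phi" for t and phi :: "'a => real"
  proof -
   have [measurable]: "phi \<in> Borel" by (rule C1c_on_measurable[OF phi])
   have [measurable]: "grad phi \<in> Borel" using grad_continuous[OF phi] by (rule borel_measurable_continuous_onI)
   have "(LBINT x. (ind \<Omega> x *\<^sub>R b x t) \<bullet> grad phi x) = (LINT x:\<Omega>|lebesgue. b x t \<bullet> grad phi x)"
    unfolding set_lebesgue_integral_def
    by (rule integral_lebesgue_cong_AE[OF borel_measurable_inner[OF bt], symmetric]) auto
   also have "\<dots> = - (integral\<^sup>L (mp t) phi - integral\<^sup>L (mn t) phi)" using dm[of t] phi unfolding is_div_measure_def by blast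
   finally show ?thesis using idm(1)[of t] idm(2)[of t] by (simp add: integral_distr)
  qed
  show "integrable (ext_measure \<sigma>) (\<lambda>x. ind \<Omega> x * f x t)" for t
   using f_dens ft[of t] idm(3) by (subst integrable_distr_eq) (auto simp: set_integrable_def)
  show "measure (ext_measure (mp t)) E - measure (ext_measure (mn t)) E
    = (\<integral>x. ind E x * (ind \<Omega> x * f x t) \<partial>ext_measure \<sigma>)" if E: "E \<in> sets borel" for t E
  proof -
   have "E \<inter> \<Omega> \<in> sets \<sigma>" using E by (simp add: b4_sets set)
   hence "measure (mp t) (E \<inter> \<Omega>) - measure (mn t) (E \<inter> \<Omega>) = (\<integral>x. ind (E \<inter> \<Omega>) x *\<^sub>R f x t \<partial>\<sigma>)"
    using f_dens unfolding set_lebesgue_integral_def by blast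
   also have "\<dots> = (\<integral>x. ind E x * (ind \<Omega> x * f x t) \<partial>\<sigma>)"
    by (intro Bintegral_cong) (auto simp: indicator_def)
   also have "\<dots> = (\<integral>x. ind E x * (ind \<Omega> x * f x t) \<partial>ext_measure \<sigma>)"
    by (rule integral_distr[symmetric, OF idm(3)]) (use E ft in auto)
   finally show ?thesis using E by (simp add: measure_def em)
  qed
  \<comment> \<open>The family with the single index t and the single piece E \<inter> \<Omega>
    competes in the supremum.\<close>
  show "emeasure (ext_measure (mp t)) E + emeasure (ext_measure (mn t)) E \<le> emeasure (ext_measure \<sigma>) E"
   if E: "E \<in> sets borel" for t E
  proof -
   have E': "E \<inter> \<Omega> \<in> sets (restrict_space borel \<Omega>)" using E by (simp add: set)
   have "(\<integral>\<^sup>+s. emeasure (mp s) (E \<inter> \<Omega>) + emeasure (mn s) (E \<inter> \<Omega>) \<partial>count_space {t}) = emeasure (mp t) (E \<inter> \<Omega>) + emeasure (mn t) (E \<inter> \<Omega>)"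
    by (simp add: nn_integral_count_space_finite)
   hence "emeasure (mp t) (E \<inter> \<Omega>) + emeasure (mn t) (E \<inter> \<Omega>)
    \<le> lub_meas \<Omega> (\<lambda>t E. emeasure (mp t) E + emeasure (mn t) E) UNIV (E \<inter> \<Omega>)"
    unfolding lub_meas_def using E' by (intro SUP_upper2[of "({t}, \<lambda>_. E \<inter> \<Omega>)"]) (auto simp: disjoint_family_on_def)
   thus ?thesis using E E' b4_lub b4_sets by (simp add: em)
  qed
  show "emeasure (ext_measure \<sigma>) E = 0"
   if E: "E \<in> sets borel" and n: "\<And>t. emeasure (ext_measure (mp t)) E = 0 \<and> emeasure (ext_measure (mn t)) E = 0" for E
  proof -
   have E': "E \<inter> \<Omega> \<in> sets (restrict_space borel \<Omega>)" using E by (simp add: set)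
   have n': "emeasure (mp t) (E \<inter> \<Omega>) = 0" "emeasure (mn t) (E \<inter> \<Omega>) = 0" for t using n[of t] E by (simp_all add: em)
   \<comment> \<open>Every piece of a partition lies in the partitioned set, so all sums in the
     supremum vanish.\<close>
   have sub: "emeasure (mp t) A = 0" "emeasure (mn t) A = 0" if "A \<subseteq> E \<inter> \<Omega>" for t A
    using emeasure_mono[OF that, of "mp t"] emeasure_mono[OF that, of "mn t"] E' n' by (auto simp: ms)
   have "lub_meas \<Omega> (\<lambda>t E. emeasure (mp t) E + emeasure (mn t) E) UNIV (E \<inter> \<Omega>) \<le> 0"
    unfolding lub_meas_def
   proof (rule SUP_least)
    fix p assume "p \<in> {(T' :: real set, P). countable T' \<and> T' \<subseteq> UNIV \<and> (\<forall>t\<in>T'. P t \<in> sets (restrict_space borel \<Omega>)) \<and> disjoint_family_on P T' \<and> (\<Union>t\<in>T'. P t) = E \<inter> \<Omega>}"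
    then obtain T P where p: "p = (T, P)" "(\<Union>t\<in>T. P t) = E \<inter> \<Omega>" by auto
    hence "P t \<subseteq> E \<inter> \<Omega>" if "t \<in> T" for t using that by blast
    hence "(\<integral>\<^sup>+t. emeasure (mp t) (P t) + emeasure (mn t) (P t) \<partial>count_space T) = (\<integral>\<^sup>+t. 0 \<partial>count_space T)"
     by (intro nn_integral_cong) (simp add: sub)
    thus "(case p of (T', P) => \<integral>\<^sup>+t. emeasure (mp t) (P t) + emeasure (mn t) (P t) \<partial>count_space T') \<le> 0" by (simp add: p(1))
   qed
   thus ?thesis using E E' b4_lub b4_sets by (simp add: em)
  qed
 qed (use dim open_\<Omega> b' f' in auto)
 have emU: "emeasure (?mp t) UNIV = emeasure (mp t) \<Omega>" "emeasure (?mn t) UNIV = emeasure (mn t) \<Omega>"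
  "emeasure ?\<sigma> UNIV = emeasure \<sigma> \<Omega>" for t
  by (simp_all add: em)
 obtain C and zeta :: "nat => 'a => real" where part: "\<And>n. compact (C n)" "\<And>n. C n \<subseteq> interior (C (Suc n))" "(\<Union>n. C n) = \<Omega>"
  "\<And>i. C1c_on (interior (C (Suc i))) (zeta i)" "\<And>i x. 0 \<le> zeta i x" "\<And>i x. x \<in> C i ==> zeta (Suc i) x = 0"
  "\<And>n x. x \<in> C n ==> (\<Sum>i<Suc n. zeta i x) = 1" "\<And>n x. (\<Sum>i<n. zeta i x) \<le> 1"
  by (rule smooth_partition_of_unity[OF open_\<Omega>]) (rule that)
 interpret P: partitioned_family \<Omega> ?b B ?mp ?mn ?\<sigma> ?f C zeta M
  by (intro partitioned_family.intro F partitioned_family_axioms.intro part M_pos)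
 \<comment> \<open>\<open>k\<close> starts at 0, so 1/(k + 1) stands for the 1/k of a sequence
   indexed from 1.\<close>
 define dlt where "dlt k = 1 / real (Suc k)" for k
 have dlt: "dlt k > 0" "dlt \<longlonglongrightarrow> 0" for k
  using LIMSEQ_inverse_real_of_nat by (auto simp: dlt_def[abs_def] inverse_eq_divide)
 have "\<exists>eps. \<forall>k. P.admissible (dlt k) (eps k)" using P.ex_admissible[OF dlt(1)] by metis
 then obtain eps where adm: "\<And>k. P.admissible (dlt k) (eps k)" by blast
 interpret K: mollified_family \<Omega> ?b B ?mp ?mn ?\<sigma> ?f C zeta M "dlt k" "eps k" for k
  by unfold_locales (rule dlt(1) adm)+
 have bk_le: "norm (K.bk k x t) \<le> B" if "x \<in> \<Omega>" for k x t
  by (rule K.norm_bk_le[OF _ B(2) that]) (use B(1) in auto)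
 have bk_le_ess: "norm (K.bk k x t) \<le> L" if L: "AE p in lebesgue_on \<Omega> \<Otimes>\<^sub>M lborel. norm (b (fst p) (snd p)) \<le> L" and x: "x \<in> \<Omega>" for k x t L
 proof -
  have "sigma_finite_measure (lebesgue :: 'a measure)"
  proof
   obtain A :: "'a set set" where "countable A" "A \<subseteq> sets lborel" "\<Union>A = space lborel" "\<forall>a\<in>A. evol a \<noteq> \<infinity>"
    using lborel.sigma_finite_countable by blast
   thus "\<exists>A::'a set set. countable A \<and> A \<subseteq> sets lebesgue \<and> \<Union>A = space lebesgue \<and> (\<forall>a\<in>A. emeasure lebesgue a \<noteq> \<infinity>)"
    by (intro exI[of _ A]) auto
  qed
  then interpret S: sigma_finite_measure "lebesgue_on \<Omega>"
   by (rule sigma_finite_measure_restrict_space) simp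
  interpret SP: pair_sigma_finite "lebesgue_on \<Omega>" lborel ..
  \<comment> \<open>Fubini gives the bound for almost every y and almost every t. Continuity in t
    makes the set of good t closed, and a closed set of full measure is everything, so the fixed t
    is good.\<close>
  have "AE y in lebesgue_on \<Omega>. norm (b y t) \<le> L"
   using SP.AE_pair[OF L] b2
  proof eventually_elim
   case (elim y)
   have "closed {t. norm (b y t) \<le> L}" using elim(2) by (intro closed_Collect_le continuous_intros) simp
   moreover have "AE t in lebesgue. t \<in> {t. norm (b y t) \<le> L}" using elim(1) by (simp add: AE_completion_iff)
   ultimately show ?case using mem_closed_if_AE_lebesgue by blast
  qed
  hence ae: "AE y in lborel. y \<in> \<Omega> \<longrightarrow> norm (b y t) \<le> L"
   by (subst (asm) AE_restrict_space_iff) (auto simp: AE_completion_iff)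
  \<comment> \<open>A negative \<open>L\<close> would make Omega a null set, but it is open and
    contains x.\<close>
  have "L \<ge> 0"
  proof (rule ccontr)
   assume "\<not> L \<ge> 0"
   hence "\<not> norm (b y t) \<le> L" for y using norm_ge_zero[of "b y t"] by linarith
   hence "AE y in lebesgue. y \<in> - \<Omega>" using ae by (simp add: AE_completion_iff)
   thus False using mem_closed_if_AE_lebesgue[of "- \<Omega>" x] open_\<Omega> x by auto
  qed
  thus ?thesis using ae by (intro K.norm_bk_le[OF _ _ x]) (auto elim: eventually_mono)
 qed
 have c4: "(\<lambda>k. pairing_smooth \<Omega> (K.bk k) u phi) \<longlonglongrightarrow> pairing_half \<Omega> \<sigma> f b u phi"
  if u: "is_BV \<Omega> u" "AE x in lebesgue_on \<Omega>. \<bar>u x\<bar> \<le> M" and phi: "C1c_on \<Omega> phi" for u and phi :: "'a => real"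
 proof -
  obtain v V where v: "v \<in> Borel" "\<And>x. \<bar>v x\<bar> \<le> M" "Lint v" "AE x in lborel. x \<in> \<Omega> \<longrightarrow> u x = v x"
   "\<And>Phi. C1c_on \<Omega> Phi ==> (\<And>x. norm (Phi x) \<le> 1) ==> (LBINT x. v x * divergence Phi x) \<le> V"
   "(\<lambda>x. ind \<Omega> x * u x) \<in> borel_measurable lebesgue"
   using is_BV_bounded_Borel_representative[OF open_\<Omega> M_pos u] by blast
  note lim = P.pairing_converges[OF dlt adm v(3,1,2,5) phi]
  have ext: "?b x t = b x t" "?f x t = f x t" if "x \<in> \<Omega>" for x t using that by simp_all
  show ?thesis
   unfolding K.pairing_smooth_eq[OF v(1,2,4) phi]
   by (subst P.pairing_half_eq[OF ext b4_sets refl v(6,1,2,4) phi]) (assumption | intro tendsto_diff tendsto_minus lim)+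
 qed
 show ?thesis
 proof (rule exI[of _ "\<lambda>k. K.bk k"], intro conjI allI impI)
  fix k
  show "continuous_on (\<Omega> \<times> UNIV) (\<lambda>p. K.bk k (fst p) (snd p))" by (rule K.bk_continuous)
  show "bounded ((\<lambda>p. K.bk k (fst p) (snd p)) ` (\<Omega> \<times> UNIV))" using bk_le by (auto simp: bounded_iff)
  show "\<forall>x\<in>\<Omega>. \<forall>t. norm (K.bk k x t) \<le> L" if "AE p in lebesgue_on \<Omega> \<Otimes>\<^sub>M lborel. norm (b (fst p) (snd p)) \<le> L" for L
   using bk_le_ess[OF that] by blast
  show "smooth_on \<Omega> (\<lambda>x. K.bk k x t)" for t by (rule K.bk_smooth)
  show "(\<integral>\<^sup>+x\<in>\<Omega>. ennreal \<bar>divergence (\<lambda>y. K.bk k y t) x\<bar> \<partial>lebesgue) \<le> emeasure (mp t) \<Omega> + emeasure (mn t) \<Omega> + ennreal (1 / real (Suc k))"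
   if "t \<in> {-M..M}" for t
   using K.divergence_bk_L1[OF that, of k] by (simp add: nn_integral_completion emU dlt_def)
  show "\<exists>\<rho>. sets \<rho> = sets (restrict_space borel \<Omega>) \<and>
     (\<forall>E\<in>sets \<rho>. emeasure \<rho> E =
       lub_meas \<Omega> (\<lambda>t E. \<integral>\<^sup>+x\<in>E. ennreal \<bar>divergence (\<lambda>y. K.bk k y t) x\<bar> \<partial>lebesgue) {-M..M} E) \<and>
     emeasure \<rho> \<Omega> \<le> emeasure \<sigma> \<Omega> + ennreal (1 / real (Suc k))"
   using K.ex_lub_meas_divergence_bk[of k] by (simp only: emU dlt_def)
 next
  fix u and phi :: "'a => real"
  assume "is_BV \<Omega> u \<and> (AE x in lebesgue_on \<Omega>. \<bar>u x\<bar> \<le> M)" "C1c_on \<Omega> phi"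
  thus "(\<lambda>k. pairing_smooth \<Omega> (K.bk k) u phi) \<longlonglongrightarrow> pairing_half \<Omega> \<sigma> f b u phi" using c4 by blast
 qed
qed

end
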